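(* Let $X$ be a uniformly locally finite metric space. (i) If $X$ has cohomological property (T), then $X$ has geometric property (T). (ii) If the coarse structure of $X$ is induced by a property (T) group $G$, i.e. a group $G=\langle S\rangle$ with Kazhdan's property (T), generated by a finite set $S$, acts on $X$ in such a way that $\{(x,gx): x\in X,\ g\in S\}$ is a generating controlled subset of $X\times X$, then $X$ has cohomological property (T). (iii) If $X$ is a disjoint union $\bigsqcup_{m}\mathrm{Cay}(G^{(m)},s_1^{(m)},\ldots,s_k^{(m)})$ of the Cayley graphs of finite $k$-marked groups ($k$ fixed), then $X$ has cohomological property (T) if and only if it has geometric property (T).
   Context: Metrics may take the value $\infty$. $X$ is uniformly locally finite if $\sup_x\sharp B(x,R)<\infty$ for every $R>0$. A subset $E\subset X\times X$ is controlled if $\sup_{(x,y)\in E}d(x,y)<\infty$; it is generating if the smallest coarse structure containing $E$ is the collection of all controlled sets, i.e. for every $R>0$ there is $n$ such that whenever $d(x,y)\le R$ one can go from $x$ to $y$ by a chain of at most $n$ steps, each of the form $(z,z')$ with $(z,z')\in E$ or $(z',z)\in E$. $\mathbb{C}_{\mathrm u}[X]$ is the $*$-algebra of complex matrices $a=[a_{x,y}]_{x,y\in X}$ with $\sup|a_{x,y}|<\infty$ and finite propagation $\mathrm{prop}(a)=\sup\{d(x,y):a_{x,y}\neq0\}$; its diagonal is $\ell_\infty(X)$. Let $\omega\colon\mathbb{C}_{\mathrm u}[X]\to\ell_\infty(X)$, $\omega(a)(x)=\sum_ya_{x,y}$, and $\mathcal{L}_{\mathrm u}[X]=\ker\omega$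 (a left ideal). Cohomological property (T): for every (unital) $*$-representation $\pi\colon\mathbb{C}_{\mathrm u}[X]\to\mathbb{B}(\mathcal{H})$ on a Hilbert space, every linear map $\theta\colon\mathcal{L}_{\mathrm u}[X]\to\mathcal{H}$ with $\theta(ab)=\pi(a)\theta(b)$ for $a\in\mathbb{C}_{\mathrm u}[X]$, $b\in\mathcal{L}_{\mathrm u}[X]$ (a $1$-cocycle) is of the form $\theta(a)=\pi(a)v$ for some $v\in\mathcal{H}$ (a $1$-coboundary). Geometric property (T) (Willett--Yu): for a unital $*$-representation $(\pi,\mathcal{H})$ of $\mathbb{C}_{\mathrm u}[X]$ let $\mathcal{H}_c=\{v\in\mathcal{H}:\pi(a)v=0\ \forall a\in\mathcal{L}_{\mathrm u}[X]\}$ be the space of constant vectors. $X$ has geometric property (T) if there exist $R>0$ and $c>0$ such that for every unital $*$-representation $(\pi,\mathcal{H})$ and every $v\in\mathcal{H}_c^\perp$ there is a nonzero $a\in\mathbb{C}_{\mathrm u}[X]$ with $\mathrm{prop}(a)\le R$ and $\|\pi(a-\omega(a))v\|\ge c\,\|v\|\sup_{x,y}|a_{x,y}|$. (When $X$ is a disjoint union of finite connected graphs of uniformly bounded degree, this is equivalent to the graph Laplacian having spectrum contained in $\{0\}\cup[\nu,\infty)$ for some $\nu>0$ in the maximal uniform Roe algebra, the completion of $\mathbb{C}_{\mathrm u}[X]$ in the norm $\sup_\pi\|\pi(\cdot)\|$.) A $k$-marked group $(G,s_1,\ldots,s_k)$ is a group with an ordered generating $k$-tuple; $\mathrm{Cay}(G,s_1,\ldots,s_k)$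 is $G$ with $d(g,h)$ the word length of $gh^{-1}$ in the $s_j^{\pm1}$. In a disjoint union, points of distinct components are at distance $\infty$. *)

theory Defs
  imports
    "HOL-Analysis.Abstract_Metric_Spaces"
    "HOL-Library.Extended_Nonnegative_Real"
    "HOL-Algebra.Module"
    "HOL-Algebra.Generated_Groups"
    "HOL-Algebra.Group_Action"
begin

section \<open>Complex Hilbert spaces with explicit carriers\<close>

definition complex_ring :: "complex ring" where
  "complex_ring = \<lparr>carrier = UNIV, mult = (*), one = 1, zero = 0, add = (+)\<rparr>"

text \<open>The fields \<open>mult\<close> and \<open>one\<close> inherited from the record of modules are not used.\<close>

record 'h inner_module = "(complex, 'h) module" +
  cinner :: "'h \<Rightarrow> 'h \<Rightarrow> complex"

definition hnorm :: "'h inner_module \<Rightarrow> 'h \<Rightarrow> real" where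
  "hnorm H v = sqrt (Re (cinner H v v))"

text \<open>The locale \<open>Metric_space\<close> requires nonnegativity and symmetry on the whole type, hence the
  default value off the carrier.\<close>

definition hdist :: "'h inner_module \<Rightarrow> 'h \<Rightarrow> 'h \<Rightarrow> real" where
  "hdist H v w =
     (if v \<in> carrier H \<and> w \<in> carrier H then hnorm H (v \<ominus>\<^bsub>H\<^esub> w) else 0)"

locale inner_product_space = module complex_ring H for H :: "'h inner_module" (structure) +
  assumes cinner_add_left:
      "\<lbrakk>u \<in> carrier H; v \<in> carrier H; w \<in> carrier H\<rbrakk> \<Longrightarrow>
         cinner H (u \<oplus> v) w = cinner H u w + cinner H v w"
    and cinner_smult_left:
      "\<lbrakk>v \<in> carrier H; w \<in> carrier H\<rbrakk> \<Longrightarrow> cinner H (c \<odot> v) w = c * cinner H v w"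
    and cinner_commute:
      "\<lbrakk>v \<in> carrier H; w \<in> carrier H\<rbrakk> \<Longrightarrow> cinner H w v = cnj (cinner H v w)"
    and cinner_pos:
      "\<lbrakk>v \<in> carrier H; v \<noteq> \<zero>\<rbrakk> \<Longrightarrow> 0 < Re (cinner H v v)"

lemma complex_ring_simps [simp]:
  "carrier complex_ring = UNIV" "mult complex_ring = (*)" "one complex_ring = 1"
  "zero complex_ring = 0" "add complex_ring = (+)"
  by (simp_all add: complex_ring_def)

lemma cring_complex_ring: "cring complex_ring"
proof (rule cringI)
  show "abelian_group complex_ring"
    by (rule abelian_groupI) (auto simp: algebra_simps intro: exI[of _ "- x" for x])
  show "comm_monoid complex_ring"
    by (rule comm_monoidI) (auto simp: algebra_simps)
qed (auto simp: algebra_simps)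

context inner_product_space
begin

lemma cinner_add_right:
  assumes "u \<in> carrier H" "v \<in> carrier H" "w \<in> carrier H"
  shows "cinner H w (u \<oplus> v) = cinner H w u + cinner H w v"
  using assms cinner_add_left[of u v w] cinner_commute[of "u \<oplus> v" w]
    cinner_commute[of u w] cinner_commute[of v w] by simp

lemma cinner_smult_right:
  assumes "v \<in> carrier H" "w \<in> carrier H"
  shows "cinner H w (c \<odot> v) = cnj c * cinner H w v"
  using assms cinner_smult_left[of v w c] cinner_commute[of "c \<odot> v" w]
    cinner_commute[of v w] smult_closed[of c v] by simp

lemma smult_zero: "v \<in> carrier H \<Longrightarrow> 0 \<odot> v = \<zero>"
  using smult_l_null[of v] by simp

lemma minus_eq_smult: "v \<in> carrier H \<Longrightarrow> \<ominus> v = (- 1) \<odot> v"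
proof -
  assume v: "v \<in> carrier H"
  have "(- 1) \<odot> v \<oplus> v = ((-1) + 1) \<odot> v"
    using smult_l_distr[of "-1" 1 v] v smult_one[OF v] by simp
  also have "\<dots> = \<zero>" using smult_zero[OF v] by simp
  finally show ?thesis
    using v smult_closed[of "-1" v] by (metis M.minus_equality complex_ring_simps(1) UNIV_I)
qed

lemma cinner_zero_left: "v \<in> carrier H \<Longrightarrow> cinner H \<zero> v = 0"
  using cinner_smult_left[of \<zero> v 0] smult_zero[of \<zero>] by simp

lemma cinner_nonneg: "v \<in> carrier H \<Longrightarrow> 0 \<le> Re (cinner H v v)"
  using cinner_pos[of v] cinner_zero_left[of v] by (cases "v = \<zero>") auto

lemma hnorm_sq: "v \<in> carrier H \<Longrightarrow> (hnorm H v)\<^sup>2 = Re (cinner H v v)"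
  by (simp add: hnorm_def cinner_nonneg)

lemma hnorm_nonneg [simp]: "v \<in> carrier H \<Longrightarrow> 0 \<le> hnorm H v"
  by (simp add: hnorm_def cinner_nonneg)

lemma hnorm_eq_0: "v \<in> carrier H \<Longrightarrow> hnorm H v = 0 \<longleftrightarrow> v = \<zero>"
  using cinner_pos[of v] cinner_zero_left[of v] by (cases "v = \<zero>") (auto simp: hnorm_def)

lemma hnorm_smult: "v \<in> carrier H \<Longrightarrow> hnorm H (c \<odot> v) = cmod c * hnorm H v"
proof -
  assume v: "v \<in> carrier H"
  have "cinner H (c \<odot> v) (c \<odot> v) = (c * cnj c) * cinner H v v"
    using v smult_closed[of c v] by (simp add: cinner_smult_left cinner_smult_right)
  also have "\<dots> = complex_of_real ((cmod c)\<^sup>2) * cinner H v v"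
    by (simp only: complex_norm_square)
  finally have "Re (cinner H (c \<odot> v) (c \<odot> v)) = (cmod c)\<^sup>2 * Re (cinner H v v)"
    by (simp only: Re_complex_of_real times_complex.sel Im_complex_of_real mult_zero_left diff_zero)
  then show ?thesis
    by (simp add: hnorm_def real_sqrt_mult)
qed

lemma cinner_sum_sq:
  assumes "v \<in> carrier H" "w \<in> carrier H"
  shows "(hnorm H (v \<oplus> w))\<^sup>2 = (hnorm H v)\<^sup>2 + 2 * Re (cinner H v w) + (hnorm H w)\<^sup>2"
  using assms cinner_commute[of v w]
  by (simp add: hnorm_sq cinner_add_left cinner_add_right)

lemma Cauchy_Schwarz_Re:
  assumes v: "v \<in> carrier H" and w: "w \<in> carrier H"
  shows "Re (cinner H v w) \<le> hnorm H v * hnorm H w"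
proof (cases "w = \<zero>")
  case True
  then show ?thesis
    using v cinner_commute[of w v] w cinner_zero_left[of v] hnorm_eq_0[of \<zero>] by simp
next
  case False
  define r where "r = Re (cinner H v w)"
  define q where "q = (hnorm H w)\<^sup>2"
  have q: "q > 0" using False w by (simp add: q_def hnorm_eq_0)
  define t where "t = - r / q"
  have "0 \<le> (hnorm H (v \<oplus> complex_of_real t \<odot> w))\<^sup>2" by simp
  also have "\<dots> = (hnorm H v)\<^sup>2 + 2 * (t * r) + t\<^sup>2 * q"
    using v w smult_closed[of "complex_of_real t" w]
    by (simp add: cinner_sum_sq cinner_smult_right hnorm_smult r_def q_def power_mult_distrib)
  also have "\<dots> = (hnorm H v)\<^sup>2 - r\<^sup>2 / q"
    using q by (simp add: t_def field_simps power2_eq_square)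
  finally have "r\<^sup>2 \<le> (hnorm H v * hnorm H w)\<^sup>2"
    using q by (simp add: field_simps q_def)
  then show ?thesis
    unfolding r_def using v w by (meson abs_le_square_iff abs_ge_self order_trans
      power2_le_imp_le mult_nonneg_nonneg hnorm_nonneg)
qed

lemma hnorm_triangle:
  assumes v: "v \<in> carrier H" and w: "w \<in> carrier H"
  shows "hnorm H (v \<oplus> w) \<le> hnorm H v + hnorm H w"
proof (rule power2_le_imp_le)
  show "(hnorm H (v \<oplus> w))\<^sup>2 \<le> (hnorm H v + hnorm H w)\<^sup>2"
    using Cauchy_Schwarz_Re[OF v w] by (simp add: cinner_sum_sq v w power2_sum)
qed (simp add: v w)

lemma hnorm_minus: "v \<in> carrier H \<Longrightarrow> hnorm H (\<ominus> v) = hnorm H v"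
  by (simp add: minus_eq_smult hnorm_smult)

lemma minus_diff: "\<lbrakk>v \<in> carrier H; w \<in> carrier H\<rbrakk> \<Longrightarrow> \<ominus> (v \<ominus> w) = w \<ominus> v"
  by (simp add: a_minus_def M.minus_add M.a_comm)

lemma diff_eq_zero: "\<lbrakk>v \<in> carrier H; w \<in> carrier H\<rbrakk> \<Longrightarrow> v \<ominus> w = \<zero> \<longleftrightarrow> v = w"
  by (metis M.minus_equality M.minus_minus M.r_neg a_minus_def M.a_inv_closed M.a_comm)

lemma diff_add_diff:
  "\<lbrakk>u \<in> carrier H; v \<in> carrier H; w \<in> carrier H\<rbrakk> \<Longrightarrow> (u \<ominus> v) \<oplus> (v \<ominus> w) = u \<ominus> w"
  by (simp add: a_minus_def M.a_assoc M.l_neg) (metis M.a_assoc M.a_inv_closed M.l_neg M.l_zero M.a_closed)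

sublocale Metric_space "carrier H" "hdist H"
proof
  show "0 \<le> hdist H v w" for v w
    by (simp add: hdist_def)
  show "hdist H v w = hdist H w v" for v w
    using hnorm_minus[of "v \<ominus> w"] by (auto simp: hdist_def minus_diff)
  show "hdist H v w = 0 \<longleftrightarrow> v = w" if "v \<in> carrier H" "w \<in> carrier H" for v w
    using that by (simp add: hdist_def hnorm_eq_0 diff_eq_zero)
  show "hdist H u w \<le> hdist H u v + hdist H v w"
    if "u \<in> carrier H" "v \<in> carrier H" "w \<in> carrier H" for u v w
    using that hnorm_triangle[of "u \<ominus> v" "v \<ominus> w"] by (simp add: hdist_def diff_add_diff)
qed

end


locale hilbert_space = inner_product_space +
  assumes complete: mcomplete

definition clinear_map ::
    "(complex, 'a, 'm) module_scheme \<Rightarrow> (complex, 'b, 'n) module_scheme \<Rightarrow> ('a \<Rightarrow> 'b) \<Rightarrow> bool" where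
  "clinear_map M N f \<longleftrightarrow>
     f \<in> carrier M \<rightarrow> carrier N \<and>
     (\<forall>x\<in>carrier M. \<forall>y\<in>carrier M. f (x \<oplus>\<^bsub>M\<^esub> y) = f x \<oplus>\<^bsub>N\<^esub> f y) \<and>
     (\<forall>c. \<forall>x\<in>carrier M. f (c \<odot>\<^bsub>M\<^esub> x) = c \<odot>\<^bsub>N\<^esub> f x)"

definition bounded_operator :: "'h inner_module \<Rightarrow> ('h \<Rightarrow> 'h) \<Rightarrow> bool" where
  "bounded_operator H T \<longleftrightarrow>
     clinear_map H H T \<and> (\<exists>C. \<forall>v\<in>carrier H. hnorm H (T v) \<le> C * hnorm H v)"

definition unitary_operator :: "'h inner_module \<Rightarrow> ('h \<Rightarrow> 'h) \<Rightarrow> bool" where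
  "unitary_operator H T \<longleftrightarrow>
     clinear_map H H T \<and> T ` carrier H = carrier H \<and>
     (\<forall>v\<in>carrier H. \<forall>w\<in>carrier H. cinner H (T v) (T w) = cinner H v w)"

context inner_product_space
begin

lemma inner_diff_add:
  assumes "a \<in> carrier H" "b \<in> carrier H" "c \<in> carrier H" "d \<in> carrier H"
  shows "(a \<oplus> b) \<ominus> (c \<oplus> d) = (a \<ominus> c) \<oplus> (b \<ominus> d)"
  using assms by (simp add: a_minus_def M.minus_add) (simp add: M.a_ac)

lemma smult_minus: "v \<in> carrier H \<Longrightarrow> c \<odot> (\<ominus> v) = \<ominus> (c \<odot> v)"
  using smult_assoc1[of c "-1" v] smult_assoc1[of "-1" c v] smult_closed[of c v]
  by (simp add: minus_eq_smult)

lemma smult_diff: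
  "\<lbrakk>v \<in> carrier H; w \<in> carrier H\<rbrakk> \<Longrightarrow> c \<odot> v \<ominus> c \<odot> w = c \<odot> (v \<ominus> w)"
  using smult_r_distr[of c v "\<ominus> w"] by (simp add: a_minus_def smult_minus)

lemma hdist_add:
  assumes "a \<in> carrier H" "b \<in> carrier H" "c \<in> carrier H" "d \<in> carrier H"
  shows "hdist H (a \<oplus> b) (c \<oplus> d) \<le> hdist H a c + hdist H b d"
  using assms hnorm_triangle[of "a \<ominus> c" "b \<ominus> d"] by (simp add: hdist_def inner_diff_add)

lemma hdist_smult:
  assumes "v \<in> carrier H" "w \<in> carrier H"
  shows "hdist H (c \<odot> v) (c \<odot> w) = cmod c * hdist H v w"
  using assms smult_closed[of c v] smult_closed[of c w]
  by (simp add: hdist_def smult_diff hnorm_smult)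

lemma clinear_map_diff:
  assumes "clinear_map H H T" "v \<in> carrier H" "w \<in> carrier H"
  shows "T v \<ominus> T w = T (v \<ominus> w)"
proof -
  have cl: "T u \<in> carrier H" if "u \<in> carrier H" for u
    using assms(1) that by (auto simp: clinear_map_def)
  have "T (v \<ominus> w) = T v \<oplus> T (\<ominus> w)"
    using assms by (simp add: a_minus_def clinear_map_def)
  also have "T (\<ominus> w) = (-1) \<odot> T w"
    using assms by (simp add: minus_eq_smult clinear_map_def)
  finally show ?thesis using assms cl by (simp add: a_minus_def minus_eq_smult)
qed

lemma bounded_operator_dist:
  assumes "bounded_operator H T"
  obtains C where "C > 0"
    "\<And>v w. \<lbrakk>v \<in> carrier H; w \<in> carrier H\<rbrakk> \<Longrightarrow> hdist H (T v) (T w) \<le> C * hdist H v w"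
proof -
  obtain C where C: "\<And>v. v \<in> carrier H \<Longrightarrow> hnorm H (T v) \<le> C * hnorm H v"
    and lin: "clinear_map H H T"
    using assms by (auto simp: bounded_operator_def)
  have "hdist H (T v) (T w) \<le> (\<bar>C\<bar> + 1) * hdist H v w"
    if "v \<in> carrier H" "w \<in> carrier H" for v w
  proof -
    have "hnorm H (T (v \<ominus> w)) \<le> C * hnorm H (v \<ominus> w)" using C that by simp
    also have "\<dots> \<le> (\<bar>C\<bar> + 1) * hnorm H (v \<ominus> w)"
      using that by (intro mult_right_mono) auto
    finally show ?thesis
      using that clinear_map_diff[OF lin that] lin by (auto simp: hdist_def clinear_map_def)
  qed
  then show thesis using that[of "\<bar>C\<bar> + 1"] by simp
qed

end

section \<open>Uniformly locally finite metric spaces, with distances in \<open>[0, \<infinity>]\<close>\<close>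

locale ulf_metric_space =
  fixes X :: "'a set" and d :: "'a \<Rightarrow> 'a \<Rightarrow> ennreal"
  assumes dist_eq_0: "\<lbrakk>x \<in> X; y \<in> X\<rbrakk> \<Longrightarrow> d x y = 0 \<longleftrightarrow> x = y"
    and dist_commute: "\<lbrakk>x \<in> X; y \<in> X\<rbrakk> \<Longrightarrow> d x y = d y x"
    and dist_triangle: "\<lbrakk>x \<in> X; y \<in> X; z \<in> X\<rbrakk> \<Longrightarrow> d x z \<le> d x y + d y z"
    and uniformly_locally_finite:
      "0 < R \<Longrightarrow> \<exists>N. \<forall>x\<in>X. finite {y \<in> X. d x y \<le> ennreal R} \<and>
                          card {y \<in> X. d x y \<le> ennreal R} \<le> N"

definition controlled :: "('a \<Rightarrow> 'a \<Rightarrow> ennreal) \<Rightarrow> ('a \<times> 'a) set \<Rightarrow> bool" where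
  "controlled d E \<longleftrightarrow> (SUP (x, y)\<in>E. d x y) < \<infinity>"

definition generating :: "'a set \<Rightarrow> ('a \<Rightarrow> 'a \<Rightarrow> ennreal) \<Rightarrow> ('a \<times> 'a) set \<Rightarrow> bool" where
  "generating X d E \<longleftrightarrow>
     (\<forall>R>0. \<exists>n. \<forall>x\<in>X. \<forall>y\<in>X. d x y \<le> ennreal R \<longrightarrow> (\<exists>i\<le>n. (x, y) \<in> (E \<union> E\<inverse>) ^^ i))"

section \<open>The algebra of bounded matrices of finite propagation\<close>

text \<open>Matrices over \<open>X\<close> are functions on the whole type that vanish off \<open>X \<times> X\<close>.\<close>

type_synonym 'a cmatrix = "'a \<Rightarrow> 'a \<Rightarrow> complex"

definition propagation :: "('a \<Rightarrow> 'a \<Rightarrow> ennreal) \<Rightarrow> 'a cmatrix \<Rightarrow> ennreal" where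
  "propagation d a = Sup {d x y |x y. a x y \<noteq> 0}"

definition diagonal :: "('a \<Rightarrow> complex) \<Rightarrow> 'a cmatrix" where
  "diagonal f = (\<lambda>x y. if x = y then f x else 0)"

definition adjoint_matrix :: "'a cmatrix \<Rightarrow> 'a cmatrix" where
  "adjoint_matrix a = (\<lambda>x y. cnj (a y x))"

text \<open>The sums below run over the support of a row, which is finite for a matrix of finite
  propagation over a uniformly locally finite space.\<close>

definition uniform_roe ::
    "'a set \<Rightarrow> ('a \<Rightarrow> 'a \<Rightarrow> ennreal) \<Rightarrow> (complex, 'a cmatrix) module" where
  "uniform_roe X d = \<lparr>
     carrier = {a. (\<forall>x y. a x y \<noteq> 0 \<longrightarrow> x \<in> X \<and> y \<in> X) \<and>
                   (\<exists>C. \<forall>x y. cmod (a x y) \<le> C) \<and> propagation d a < \<infinity>},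
     mult = (\<lambda>a b x z. \<Sum>y | a x y \<noteq> 0. a x y * b y z),
     one = diagonal (\<lambda>x. if x \<in> X then 1 else 0),
     zero = (\<lambda>x y. 0),
     add = (\<lambda>a b x y. a x y + b x y),
     smult = (\<lambda>c a x y. c * a x y)\<rparr>"

definition omega :: "'a cmatrix \<Rightarrow> 'a \<Rightarrow> complex" where
  "omega a x = (\<Sum>y | a x y \<noteq> 0. a x y)"

definition ker_omega :: "'a set \<Rightarrow> ('a \<Rightarrow> 'a \<Rightarrow> ennreal) \<Rightarrow> 'a cmatrix set" where
  "ker_omega X d = {a \<in> carrier (uniform_roe X d). omega a = (\<lambda>x. 0)}"

section \<open>Cohomological and geometric property (T)\<close>

definition star_representation ::
    "'a set \<Rightarrow> ('a \<Rightarrow> 'a \<Rightarrow> ennreal) \<Rightarrow> 'h inner_module \<Rightarrow> ('a cmatrix \<Rightarrow> 'h \<Rightarrow> 'h) \<Rightarrow> bool" where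
  "star_representation X d H \<pi> \<longleftrightarrow>
     hilbert_space H \<and>
     (\<forall>a\<in>carrier (uniform_roe X d). bounded_operator H (\<pi> a)) \<and>
     (\<forall>a\<in>carrier (uniform_roe X d). \<forall>b\<in>carrier (uniform_roe X d). \<forall>v\<in>carrier H.
        \<pi> (a \<oplus>\<^bsub>uniform_roe X d\<^esub> b) v = \<pi> a v \<oplus>\<^bsub>H\<^esub> \<pi> b v \<and>
        \<pi> (a \<otimes>\<^bsub>uniform_roe X d\<^esub> b) v = \<pi> a (\<pi> b v)) \<and>
     (\<forall>c. \<forall>a\<in>carrier (uniform_roe X d). \<forall>v\<in>carrier H.
        \<pi> (c \<odot>\<^bsub>uniform_roe X d\<^esub> a) v = c \<odot>\<^bsub>H\<^esub> \<pi> a v) \<and>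
     (\<forall>v\<in>carrier H. \<pi> \<one>\<^bsub>uniform_roe X d\<^esub> v = v) \<and>
     (\<forall>a\<in>carrier (uniform_roe X d). \<forall>v\<in>carrier H. \<forall>w\<in>carrier H.
        cinner H (\<pi> (adjoint_matrix a) v) w = cinner H v (\<pi> a w))"

definition cocycle ::
    "'a set \<Rightarrow> ('a \<Rightarrow> 'a \<Rightarrow> ennreal) \<Rightarrow> 'h inner_module \<Rightarrow> ('a cmatrix \<Rightarrow> 'h \<Rightarrow> 'h) \<Rightarrow>
      ('a cmatrix \<Rightarrow> 'h) \<Rightarrow> bool" where
  "cocycle X d H \<pi> \<theta> \<longleftrightarrow>
     clinear_map (uniform_roe X d\<lparr>carrier := ker_omega X d\<rparr>) H \<theta> \<and>
     (\<forall>a\<in>carrier (uniform_roe X d). \<forall>b\<in>ker_omega X d.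
        \<theta> (a \<otimes>\<^bsub>uniform_roe X d\<^esub> b) = \<pi> a (\<theta> b))"

definition coboundary ::
    "'a set \<Rightarrow> ('a \<Rightarrow> 'a \<Rightarrow> ennreal) \<Rightarrow> 'h inner_module \<Rightarrow> ('a cmatrix \<Rightarrow> 'h \<Rightarrow> 'h) \<Rightarrow>
      ('a cmatrix \<Rightarrow> 'h) \<Rightarrow> bool" where
  "coboundary X d H \<pi> \<theta> \<longleftrightarrow> (\<exists>v\<in>carrier H. \<forall>a\<in>ker_omega X d. \<theta> a = \<pi> a v)"

definition constant_vectors ::
    "'a set \<Rightarrow> ('a \<Rightarrow> 'a \<Rightarrow> ennreal) \<Rightarrow> 'h inner_module \<Rightarrow> ('a cmatrix \<Rightarrow> 'h \<Rightarrow> 'h) \<Rightarrow> 'h set" where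
  "constant_vectors X d H \<pi> = {v \<in> carrier H. \<forall>a\<in>ker_omega X d. \<pi> a v = \<zero>\<^bsub>H\<^esub>}"

definition orthogonal_complement :: "'h inner_module \<Rightarrow> 'h set \<Rightarrow> 'h set" where
  "orthogonal_complement H S = {v \<in> carrier H. \<forall>w\<in>S. cinner H v w = 0}"

definition sup_entry :: "'a set \<Rightarrow> 'a cmatrix \<Rightarrow> real" where
  "sup_entry X a = (SUP (x, y)\<in>X \<times> X. cmod (a x y))"

definition constant_gap ::
    "'a set \<Rightarrow> ('a \<Rightarrow> 'a \<Rightarrow> ennreal) \<Rightarrow> real \<Rightarrow> real \<Rightarrow> 'h inner_module \<Rightarrow>
      ('a cmatrix \<Rightarrow> 'h \<Rightarrow> 'h) \<Rightarrow> bool" where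
  "constant_gap X d R c H \<pi> \<longleftrightarrow>
     (\<forall>v\<in>orthogonal_complement H (constant_vectors X d H \<pi>).
        \<exists>a\<in>carrier (uniform_roe X d). a \<noteq> \<zero>\<^bsub>uniform_roe X d\<^esub> \<and> propagation d a \<le> ennreal R \<and>
          hnorm H (\<pi> (a \<ominus>\<^bsub>uniform_roe X d\<^esub> diagonal (omega a)) v)
            \<ge> c * hnorm H v * sup_entry X a)"

text \<open>HOL does not allow a formula to quantify over types, so the Hilbert spaces in the next three
  definitions are carried by subsets of one fixed type. It is large enough to contain a copy of the
  closure of every subspace that is indexed by matrices (respectively by formal linear
  combinations of group elements), and therefore the definitions imply the same properties for
  Hilbert spaces carried by an arbitrary type: see the lemmas \<open>cohomological_T_D\<close>,
  \<open>geometric_T_D\<close> and \<open>property_T_D\<close> at the end of this theory.\<close>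

definition cohomological_T :: "'a set \<Rightarrow> ('a \<Rightarrow> 'a \<Rightarrow> ennreal) \<Rightarrow> bool" where
  "cohomological_T X d \<longleftrightarrow>
     (\<forall>(H :: (nat \<Rightarrow> 'a cmatrix) inner_module) \<pi> \<theta>.
        star_representation X d H \<pi> \<and> cocycle X d H \<pi> \<theta> \<longrightarrow> coboundary X d H \<pi> \<theta>)"

definition geometric_T :: "'a set \<Rightarrow> ('a \<Rightarrow> 'a \<Rightarrow> ennreal) \<Rightarrow> bool" where
  "geometric_T X d \<longleftrightarrow>
     (\<exists>R>0. \<exists>c>0. \<forall>(H :: (nat \<Rightarrow> 'a cmatrix) inner_module) \<pi>.
        star_representation X d H \<pi> \<longrightarrow> constant_gap X d R c H \<pi>)"

section \<open>Kazhdan's property (T)\<close>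

definition unitary_representation ::
    "('g, 'm) monoid_scheme \<Rightarrow> 'h inner_module \<Rightarrow> ('g \<Rightarrow> 'h \<Rightarrow> 'h) \<Rightarrow> bool" where
  "unitary_representation G H \<pi> \<longleftrightarrow>
     hilbert_space H \<and>
     (\<forall>g\<in>carrier G. unitary_operator H (\<pi> g)) \<and>
     (\<forall>v\<in>carrier H. \<pi> \<one>\<^bsub>G\<^esub> v = v) \<and>
     (\<forall>g\<in>carrier G. \<forall>h\<in>carrier G. \<forall>v\<in>carrier H. \<pi> (g \<otimes>\<^bsub>G\<^esub> h) v = \<pi> g (\<pi> h v))"

definition almost_invariant_vector ::
    "'h inner_module \<Rightarrow> ('g \<Rightarrow> 'h \<Rightarrow> 'h) \<Rightarrow> 'g set \<Rightarrow> real \<Rightarrow> 'h \<Rightarrow> bool" where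
  "almost_invariant_vector H \<pi> Q \<epsilon> v \<longleftrightarrow>
     v \<in> carrier H \<and> v \<noteq> \<zero>\<^bsub>H\<^esub> \<and> (\<forall>g\<in>Q. hnorm H (\<pi> g v \<ominus>\<^bsub>H\<^esub> v) < \<epsilon> * hnorm H v)"

definition has_invariant_vector ::
    "('g, 'm) monoid_scheme \<Rightarrow> 'h inner_module \<Rightarrow> ('g \<Rightarrow> 'h \<Rightarrow> 'h) \<Rightarrow> bool" where
  "has_invariant_vector G H \<pi> \<longleftrightarrow>
     (\<exists>v\<in>carrier H. v \<noteq> \<zero>\<^bsub>H\<^esub> \<and> (\<forall>g\<in>carrier G. \<pi> g v = v))"

definition property_T :: "('g, 'm) monoid_scheme \<Rightarrow> bool" where
  "property_T G \<longleftrightarrow>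
     (\<exists>Q \<epsilon>. finite Q \<and> Q \<subseteq> carrier G \<and> 0 < \<epsilon> \<and>
        (\<forall>(H :: (nat \<Rightarrow> (complex \<times> 'g) list) inner_module) \<pi>.
           unitary_representation G H \<pi> \<and> (\<exists>v. almost_invariant_vector H \<pi> Q \<epsilon> v) \<longrightarrow>
           has_invariant_vector G H \<pi>))"

section \<open>Disjoint unions of Cayley graphs\<close>

definition marked_group :: "nat \<Rightarrow> ('g, 'm) monoid_scheme \<Rightarrow> 'g list \<Rightarrow> bool" where
  "marked_group k G s \<longleftrightarrow>
     group G \<and> length s = k \<and> set s \<subseteq> carrier G \<and> generate G (set s) = carrier G"

definition word_length :: "('g, 'm) monoid_scheme \<Rightarrow> 'g list \<Rightarrow> 'g \<Rightarrow> nat" where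
  "word_length G s g =
     (LEAST n. \<exists>w. length w = n \<and> set w \<subseteq> set s \<union> m_inv G ` set s \<and>
                   foldr (\<otimes>\<^bsub>G\<^esub>) w \<one>\<^bsub>G\<^esub> = g)"

definition Cayley_union_dist ::
    "('i \<Rightarrow> 'g monoid) \<Rightarrow> ('i \<Rightarrow> 'g list) \<Rightarrow> 'i \<times> 'g \<Rightarrow> 'i \<times> 'g \<Rightarrow> ennreal" where
  "Cayley_union_dist G s = (\<lambda>(m, g) (n, h).
     if m = n then of_nat (word_length (G m) (s m) (g \<otimes>\<^bsub>G m\<^esub> inv\<^bsub>G m\<^esub> h)) else \<infinity>)"

text \<open>The isometry \<open>f\<close> identifies \<open>X\<close> with the disjoint union of the Cayley graphs.\<close>

definition Cayley_union ::
    "'a set \<Rightarrow> ('a \<Rightarrow> 'a \<Rightarrow> ennreal) \<Rightarrow> 'i set \<Rightarrow> ('i \<Rightarrow> 'g monoid) \<Rightarrow> ('i \<Rightarrow> 'g list) \<Rightarrow> bool" where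
  "Cayley_union X d I G s \<longleftrightarrow>
     (\<exists>f. bij_betw f X (SIGMA m:I. carrier (G m)) \<and>
          (\<forall>x\<in>X. \<forall>y\<in>X. d x y = Cayley_union_dist G s (f x) (f y)))"

section \<open>Passing to Hilbert spaces carried by arbitrary types\<close>

lemma (in hilbert_space) hilbert_subspace_code:
  fixes p :: "'c \<Rightarrow> 'a" and L :: "'c set"
  assumes sub: "p ` L \<subseteq> carrier H" and zero: "\<zero> \<in> p ` L"
    and add: "\<And>v w. \<lbrakk>v \<in> p ` L; w \<in> p ` L\<rbrakk> \<Longrightarrow> v \<oplus> w \<in> p ` L"
    and smult: "\<And>c v. v \<in> p ` L \<Longrightarrow> c \<odot> v \<in> p ` L"
  obtains H' :: "(nat \<Rightarrow> 'c) inner_module" and j where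
    "hilbert_space H'" "clinear_map H' H j"
    "\<And>v w. \<lbrakk>v \<in> carrier H'; w \<in> carrier H'\<rbrakk> \<Longrightarrow> cinner H (j v) (j w) = cinner H' v w"
    "p ` L \<subseteq> j ` carrier H'"
    "\<And>T. \<lbrakk>bounded_operator H T; T ` (p ` L) \<subseteq> p ` L\<rbrakk> \<Longrightarrow>
       T ` (j ` carrier H') \<subseteq> j ` carrier H'"
proof -
  define D where "D = p ` L"
  define K where "K = {v \<in> carrier H. \<forall>e>0. \<exists>u\<in>D. hdist H u v < e}"
  have DH: "u \<in> carrier H" if "u \<in> D" for u using sub that by (auto simp: D_def)
  have KH: "v \<in> carrier H" if "v \<in> K" for v using that by (simp add: K_def)
  have DK: "D \<subseteq> K"
  proof
    fix u assume "u \<in> D"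
    then show "u \<in> K" using DH[of u] mdist_zero by (force simp: K_def)
  qed
  have K_add: "v \<oplus> w \<in> K" if v: "v \<in> K" and w: "w \<in> K" for v w
  proof -
    have "\<exists>u\<in>D. hdist H u (v \<oplus> w) < e" if "e > 0" for e
    proof -
      have "e / 2 > 0" using that by simp
      obtain u1 where u1: "u1 \<in> D" "hdist H u1 v < e / 2"
        using v \<open>e / 2 > 0\<close> unfolding K_def by blast
      obtain u2 where u2: "u2 \<in> D" "hdist H u2 w < e / 2"
        using w \<open>e / 2 > 0\<close> unfolding K_def by blast
      have "hdist H (u1 \<oplus> u2) (v \<oplus> w) < e"
        using hdist_add[of u1 u2 v w] u1 u2 DH KH v w by fastforce
      then show ?thesis using add[of u1 u2] u1 u2 by (auto simp: D_def)
    qed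
    then show ?thesis using v w by (simp add: K_def)
  qed
  have K_smult: "c \<odot> v \<in> K" if v: "v \<in> K" for c v
  proof -
    have "\<exists>u\<in>D. hdist H u (c \<odot> v) < e" if "e > 0" for e
    proof -
      have "e / (cmod c + 1) > 0" using that by (simp add: add_nonneg_pos)
      then obtain u where u: "u \<in> D" "hdist H u v < e / (cmod c + 1)"
        using v unfolding K_def by blast
      have "hdist H (c \<odot> u) (c \<odot> v) \<le> (cmod c + 1) * hdist H u v"
        using u v DH KH by (simp add: hdist_smult mult_right_mono)
      also have "\<dots> < e"
        using u(2) by (simp add: pos_less_divide_eq add_nonneg_pos mult.commute)
      finally show ?thesis using smult[of u c] u by (auto simp: D_def)
    qed
    then show ?thesis using v smult_closed[of c v] by (simp add: K_def)
  qed
  have K_zero: "\<zero> \<in> K" using DK zero by (auto simp: D_def)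
  have K_minus: "\<ominus> v \<in> K" if "v \<in> K" for v
    using K_smult[OF that, of "-1"] KH[OF that] by (simp add: minus_eq_smult)
  define code where
    "code v = (SOME s. range s \<subseteq> L \<and> (\<forall>n. hdist H (p (s n)) v < 1 / real (Suc n)))" for v
  have code: "hdist H (p (code v n)) v < 1 / real (Suc n)" "code v n \<in> L"
    if "v \<in> K" for v n
  proof -
    have "\<forall>n. \<exists>a. a \<in> L \<and> hdist H (p a) v < 1 / real (Suc n)"
      using that by (force simp: K_def D_def)
    then obtain s where "\<forall>n. s n \<in> L \<and> hdist H (p (s n)) v < 1 / real (Suc n)"
      by metis
    then have "\<exists>s. range s \<subseteq> L \<and> (\<forall>n. hdist H (p (s n)) v < 1 / real (Suc n))"
      by (intro exI[of _ s]) auto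
    from someI_ex[OF this, folded code_def]
    show "hdist H (p (code v n)) v < 1 / real (Suc n)" "code v n \<in> L" by auto
  qed
  have inj: "inj_on code K"
  proof (rule inj_onI)
    fix v w assume v: "v \<in> K" and w: "w \<in> K" and eq: "code v = code w"
    have le: "hdist H v w < 2 / real (Suc n)" for n
    proof -
      have "p (code v n) \<in> carrier H" using code(2)[OF v] sub by auto
      then have "hdist H v w \<le> hdist H (p (code v n)) v + hdist H (p (code v n)) w"
        using triangle[of v "p (code v n)" w] KH v w commute[of v] by simp
      then show ?thesis using code(1)[OF v, of n] code(1)[OF w, of n] eq by simp
    qed
    have "hdist H v w \<le> 0"
    proof (rule ccontr)
      assume "\<not> hdist H v w \<le> 0"
      then have pos: "hdist H v w / 2 > 0" by simp
      obtain n where "1 / real (Suc n) < hdist H v w / 2"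
        using nat_approx_posE[OF pos] by auto
      then show False using le[of n] by simp
    qed
    then show "v = w" using KH v w nonneg[of v w] zero by (metis antisym Metric_space.zero Metric_space_axioms)
  qed
  define g where "g = inv_into K code"
  have gK: "g x \<in> K" "code (g x) = x" if "x \<in> code ` K" for x
    using that by (auto simp: g_def inv_into_into f_inv_into_f)
  have gc [simp]: "g (code v) = v" if "v \<in> K" for v
    using that inj by (simp add: g_def)
  have gH: "g x \<in> carrier H" if "x \<in> code ` K" for x using gK(1) KH that by blast
  define H' :: "(nat \<Rightarrow> 'c) inner_module" where
    "H' = \<lparr>carrier = code ` K, mult = undefined, one = undefined, zero = code \<zero>,
       add = (\<lambda>x y. code (g x \<oplus> g y)), smult = (\<lambda>c x. code (c \<odot> g x)),
       cinner = (\<lambda>x y. cinner H (g x) (g y))\<rparr>"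
  have H'_simps: "carrier H' = code ` K" "zero H' = code \<zero>"
    "\<And>x y. add H' x y = code (g x \<oplus> g y)" "\<And>c x. module.smult H' c x = code (c \<odot> g x)"
    "\<And>x y. cinner H' x y = cinner H (g x) (g y)"
    by (simp_all add: H'_def)
  have ab: "abelian_group H'"
  proof (rule abelian_groupI)
    show "\<exists>y\<in>carrier H'. y \<oplus>\<^bsub>H'\<^esub> x = \<zero>\<^bsub>H'\<^esub>" if "x \<in> carrier H'" for x
      using that KH by (auto simp: H'_simps K_minus M.l_neg intro!: bexI[of _ "\<ominus> (g x)"])
  qed (auto simp: H'_simps K_add K_zero KH M.a_ac)
  have "inner_product_space H'"
  proof (intro inner_product_space.intro moduleI inner_product_space_axioms.intro cring_complex_ring ab)
    fix v assume v: "v \<in> carrier H'" "v \<noteq> \<zero>\<^bsub>H'\<^esub>"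
    then have "g v \<noteq> \<zero>" using gK(2)[of v] by (auto simp: H'_simps)
    then show "0 < Re (cinner H' v v)" using v cinner_pos[of "g v"] gH by (simp add: H'_simps)
  next
    fix v w assume "v \<in> carrier H'" "w \<in> carrier H'"
    then show "cinner H' w v = cnj (cinner H' v w)"
      using cinner_commute[of "g v" "g w"] gH by (simp add: H'_simps)
  qed (auto simp: H'_simps K_add K_smult KH cinner_add_left cinner_smult_left
      smult_l_distr[simplified] smult_r_distr[simplified] smult_assoc1[simplified] smult_one[simplified])
  then interpret H': inner_product_space H' .
  have dist: "hdist H' x y = hdist H (g x) (g y)" if "x \<in> carrier H'" "y \<in> carrier H'" for x y
  proof -
    have "x \<ominus>\<^bsub>H'\<^esub> y = code (g x \<ominus> g y)"
      using that KH by (simp add: a_minus_def H'.minus_eq_smult minus_eq_smult)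
       (auto simp: H'_simps K_smult minus_eq_smult)
    moreover have "g x \<ominus> g y \<in> K" using that by (auto simp: a_minus_def H'_simps K_add K_minus)
    ultimately show ?thesis
      using that gH by (simp add: hdist_def hnorm_def) (simp add: H'_simps)
  qed
  have "H'.mcomplete"
    unfolding H'.mcomplete_def
  proof (intro allI impI)
    fix \<sigma> assume C: "H'.MCauchy \<sigma>"
    have \<sigma>: "\<sigma> n \<in> carrier H'" for n using C by (auto simp: H'.MCauchy_def)
    have "MCauchy (g \<circ> \<sigma>)"
      unfolding MCauchy_def
    proof (intro conjI)
      show "range (g \<circ> \<sigma>) \<subseteq> carrier H" using \<sigma> gH by (auto simp: H'_simps)
      show "\<forall>\<epsilon>>0. \<exists>N. \<forall>n n'. N \<le> n \<longrightarrow> N \<le> n' \<longrightarrow> hdist H ((g \<circ> \<sigma>) n) ((g \<circ> \<sigma>) n') < \<epsilon>"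
        using C \<sigma> by (simp add: H'.MCauchy_def dist)
    qed
    then obtain l where "limitin mtopology (g \<circ> \<sigma>) l sequentially"
      using complete unfolding mcomplete_def by blast
    then have l: "l \<in> carrier H" "\<And>e. e > 0 \<Longrightarrow> \<exists>N. \<forall>n\<ge>N. hdist H (g (\<sigma> n)) l < e"
      unfolding limit_metric_sequentially o_def by blast+
    have "\<exists>u\<in>D. hdist H u l < e" if "e > 0" for e
    proof -
      have e2: "e / 2 > 0" using that by simp
      obtain N where N: "hdist H (g (\<sigma> N)) l < e / 2" using l(2)[OF e2] by blast
      have gN: "g (\<sigma> N) \<in> K" using \<sigma>[of N] gK(1) by (simp add: H'_simps)
      then obtain u where u: "u \<in> D" "hdist H u (g (\<sigma> N)) < e / 2"
        using e2 unfolding K_def by blast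
      have "hdist H u l < e"
        using triangle[of u "g (\<sigma> N)" l] u N DH KH gN l(1) by fastforce
      then show ?thesis using u(1) by blast
    qed
    then have lK: "l \<in> K" using l(1) by (simp add: K_def)
    then have cl: "code l \<in> carrier H'" by (simp add: H'_simps)
    have "limitin H'.mtopology \<sigma> (code l) sequentially"
      unfolding H'.limit_metric_sequentially
      using l(2) \<sigma> cl lK by (simp add: dist)
    then show "\<exists>x. limitin H'.mtopology \<sigma> x sequentially" by blast
  qed
  then have "hilbert_space H'"
    by unfold_locales
  moreover have "clinear_map H' H g"
    using gH by (auto simp: clinear_map_def H'_simps K_add K_smult)
  moreover have gim: "g ` carrier H' = K"
    by (force simp: H'_simps image_image)
  moreover have "T ` K \<subseteq> K" if T: "bounded_operator H T" and TD: "T ` D \<subseteq> D" for T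
  proof
    fix w assume "w \<in> T ` K"
    then obtain v where v: "v \<in> K" "w = T v" by blast
    obtain C where C: "C > 0"
      "\<And>v w. \<lbrakk>v \<in> carrier H; w \<in> carrier H\<rbrakk> \<Longrightarrow> hdist H (T v) (T w) \<le> C * hdist H v w"
      using bounded_operator_dist[OF T] by blast
    have "\<exists>u\<in>D. hdist H u w < e" if "e > 0" for e
    proof -
      have "e / C > 0" using that C by simp
      then obtain u where u: "u \<in> D" "hdist H u v < e / C"
        using v unfolding K_def by blast
      have "hdist H (T u) (T v) \<le> C * hdist H u v" using C u v DH KH by blast
      also have "\<dots> < e" using u C by (simp add: pos_less_divide_eq mult.commute)
      finally show ?thesis using u v TD by blast
    qed
    moreover have "w \<in> carrier H"
      using T v KH by (auto simp: bounded_operator_def clinear_map_def)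
    ultimately show "w \<in> K" by (simp add: K_def)
  qed
  ultimately show thesis
    using that[of H' g] DK by (simp add: D_def H'_simps(5))
qed


lemma clinear_mapD:
  assumes "clinear_map M N f"
  shows "x \<in> carrier M \<Longrightarrow> f x \<in> carrier N"
    "\<lbrakk>x \<in> carrier M; y \<in> carrier M\<rbrakk> \<Longrightarrow> f (x \<oplus>\<^bsub>M\<^esub> y) = f x \<oplus>\<^bsub>N\<^esub> f y"
    "x \<in> carrier M \<Longrightarrow> f (c \<odot>\<^bsub>M\<^esub> x) = c \<odot>\<^bsub>N\<^esub> f x"
  using assms by (auto simp: clinear_map_def)

locale isometric_embedding = H: inner_product_space H + K: inner_product_space K
  for H :: "'h inner_module" and K :: "'k inner_module" +
  fixes j :: "'k \<Rightarrow> 'h"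
  assumes linear: "clinear_map K H j"
    and isometric: "\<lbrakk>v \<in> carrier K; w \<in> carrier K\<rbrakk> \<Longrightarrow> cinner H (j v) (j w) = cinner K v w"
begin

lemmas j_simps = clinear_mapD[OF linear]

lemma j_diff:
  assumes "v \<in> carrier K" "w \<in> carrier K"
  shows "j (v \<ominus>\<^bsub>K\<^esub> w) = j v \<ominus>\<^bsub>H\<^esub> j w"
  using assms K.smult_closed[of "-1" w]
  by (simp add: a_minus_def K.minus_eq_smult H.minus_eq_smult j_simps)

lemma j_hnorm: "v \<in> carrier K \<Longrightarrow> hnorm H (j v) = hnorm K v"
  by (simp add: hnorm_def isometric)

lemma j_zero: "j \<zero>\<^bsub>K\<^esub> = \<zero>\<^bsub>H\<^esub>"
  using j_hnorm[of "\<zero>\<^bsub>K\<^esub>"] K.hnorm_eq_0[of "\<zero>\<^bsub>K\<^esub>"] H.hnorm_eq_0[of "j \<zero>\<^bsub>K\<^esub>"] j_simps(1) by simp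

lemma j_inj: "inj_on j (carrier K)"
proof (rule inj_onI)
  fix v w assume vw: "v \<in> carrier K" "w \<in> carrier K" "j v = j w"
  then have "j (v \<ominus>\<^bsub>K\<^esub> w) = \<zero>\<^bsub>H\<^esub>" using j_simps(1) by (simp add: j_diff H.diff_eq_zero)
  then have "hnorm K (v \<ominus>\<^bsub>K\<^esub> w) = 0"
    using j_hnorm[of "v \<ominus>\<^bsub>K\<^esub> w"] vw H.hnorm_eq_0[of "\<zero>\<^bsub>H\<^esub>"] by simp
  then show "v = w" using vw by (simp add: K.hnorm_eq_0 K.diff_eq_zero)
qed

definition pull :: "('h \<Rightarrow> 'h) \<Rightarrow> 'k \<Rightarrow> 'k" where
  "pull T v = inv_into (carrier K) j (T (j v))"

lemma j_pull:
  assumes "T ` (j ` carrier K) \<subseteq> j ` carrier K" "v \<in> carrier K"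
  shows "pull T v \<in> carrier K" "j (pull T v) = T (j v)"
  using assms by (auto simp: pull_def inv_into_into f_inv_into_f image_subset_iff)

lemma clinear_map_pull:
  assumes T: "T ` (j ` carrier K) \<subseteq> j ` carrier K" and lin: "clinear_map H H T"
  shows "clinear_map K K (pull T)"
  unfolding clinear_map_def
proof (intro conjI ballI allI)
  show "pull T \<in> carrier K \<rightarrow> carrier K" using j_pull[OF T] by blast
next
  fix v w assume v: "v \<in> carrier K" and w: "w \<in> carrier K"
  show "pull T (v \<oplus>\<^bsub>K\<^esub> w) = pull T v \<oplus>\<^bsub>K\<^esub> pull T w"
    by (rule inj_onD[OF j_inj]) (simp_all add: j_pull[OF T] v w j_simps clinear_mapD[OF lin])
next
  fix c v assume v: "v \<in> carrier K"
  have "c \<odot>\<^bsub>K\<^esub> v \<in> carrier K" using K.smult_closed[of c v] v by simp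
  moreover have "c \<odot>\<^bsub>K\<^esub> pull T v \<in> carrier K"
    using K.smult_closed[of c "pull T v"] v j_pull[OF T v] by simp
  ultimately show "pull T (c \<odot>\<^bsub>K\<^esub> v) = c \<odot>\<^bsub>K\<^esub> pull T v"
    by (intro inj_onD[OF j_inj]) (simp_all add: j_pull[OF T] v j_simps clinear_mapD[OF lin])
qed

lemma bounded_operator_pull:
  assumes T: "T ` (j ` carrier K) \<subseteq> j ` carrier K" and bdd: "bounded_operator H T"
  shows "bounded_operator K (pull T)"
proof -
  have lin: "clinear_map H H T" using bdd by (simp add: bounded_operator_def)
  obtain C where C: "\<And>v. v \<in> carrier H \<Longrightarrow> hnorm H (T v) \<le> C * hnorm H v"
    using bdd by (auto simp: bounded_operator_def)
  have "hnorm K (pull T v) \<le> C * hnorm K v" if "v \<in> carrier K" for v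
    using C[of "j v"] that j_pull[OF T that] j_simps(1) j_hnorm[of v] j_hnorm[of "pull T v"] by simp
  then show ?thesis using clinear_map_pull[OF T lin] by (auto simp: bounded_operator_def)
qed

lemma star_representation_pull:
  assumes rep: "star_representation X d H \<pi>" and K: "hilbert_space K"
    and inv: "\<And>a. a \<in> carrier (uniform_roe X d) \<Longrightarrow> \<pi> a ` (j ` carrier K) \<subseteq> j ` carrier K"
    and closed: "\<one>\<^bsub>uniform_roe X d\<^esub> \<in> carrier (uniform_roe X d)"
      "\<And>a b. \<lbrakk>a \<in> carrier (uniform_roe X d); b \<in> carrier (uniform_roe X d)\<rbrakk> \<Longrightarrow>
         a \<oplus>\<^bsub>uniform_roe X d\<^esub> b \<in> carrier (uniform_roe X d)"
      "\<And>a b. \<lbrakk>a \<in> carrier (uniform_roe X d); b \<in> carrier (uniform_roe X d)\<rbrakk> \<Longrightarrow>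
         a \<otimes>\<^bsub>uniform_roe X d\<^esub> b \<in> carrier (uniform_roe X d)"
      "\<And>c a. a \<in> carrier (uniform_roe X d) \<Longrightarrow>
         c \<odot>\<^bsub>uniform_roe X d\<^esub> a \<in> carrier (uniform_roe X d)"
      "\<And>a. a \<in> carrier (uniform_roe X d) \<Longrightarrow> adjoint_matrix a \<in> carrier (uniform_roe X d)"
  shows "star_representation X d K (\<lambda>a. pull (\<pi> a))"
proof -
  note r = rep[unfolded star_representation_def]
  note jp = j_pull[OF inv]
  have sm: "c \<odot>\<^bsub>K\<^esub> v \<in> carrier K" if "v \<in> carrier K" for c v
    using K.smult_closed[of c v] that by simp
  show ?thesis
    unfolding star_representation_def
  proof (intro conjI ballI allI)
    show "hilbert_space K" by fact
  next
    fix a assume "a \<in> carrier (uniform_roe X d)"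
    then show "bounded_operator K (pull (\<pi> a))" using bounded_operator_pull[OF inv] r by blast
  next
    fix a b v assume a: "a \<in> carrier (uniform_roe X d)" and b: "b \<in> carrier (uniform_roe X d)"
      and v: "v \<in> carrier K"
    show "pull (\<pi> (a \<oplus>\<^bsub>uniform_roe X d\<^esub> b)) v = pull (\<pi> a) v \<oplus>\<^bsub>K\<^esub> pull (\<pi> b) v"
      by (rule inj_onD[OF j_inj]) (use r in \<open>simp_all add: jp closed a b v j_simps\<close>)
    show "pull (\<pi> (a \<otimes>\<^bsub>uniform_roe X d\<^esub> b)) v = pull (\<pi> a) (pull (\<pi> b) v)"
      by (rule inj_onD[OF j_inj]) (use r in \<open>simp_all add: jp closed a b v j_simps\<close>)
  next
    fix c a v assume a: "a \<in> carrier (uniform_roe X d)" and v: "v \<in> carrier K"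
    show "pull (\<pi> (c \<odot>\<^bsub>uniform_roe X d\<^esub> a)) v = c \<odot>\<^bsub>K\<^esub> pull (\<pi> a) v"
      by (rule inj_onD[OF j_inj]) (use r in \<open>simp_all add: jp closed a v j_simps sm\<close>)
  next
    fix v assume v: "v \<in> carrier K"
    show "pull (\<pi> \<one>\<^bsub>uniform_roe X d\<^esub>) v = v"
      by (rule inj_onD[OF j_inj]) (use r in \<open>simp_all add: jp closed v j_simps\<close>)
  next
    fix a v w assume a: "a \<in> carrier (uniform_roe X d)" and v: "v \<in> carrier K" and w: "w \<in> carrier K"
    have "cinner K (pull (\<pi> (adjoint_matrix a)) v) w = cinner H (\<pi> (adjoint_matrix a) (j v)) (j w)"
      using isometric[of "pull (\<pi> (adjoint_matrix a)) v" w] by (simp add: jp closed a v w)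
    also have "\<dots> = cinner H (j v) (\<pi> a (j w))" using r a v w j_simps(1) by blast
    also have "\<dots> = cinner K v (pull (\<pi> a) w)"
      using isometric[of v "pull (\<pi> a) w"] by (simp add: jp a v w)
    finally show "cinner K (pull (\<pi> (adjoint_matrix a)) v) w = cinner K v (pull (\<pi> a) w)" .
  qed
qed

end

context ulf_metric_space
begin

abbreviation Cu where "Cu \<equiv> uniform_roe X d"

lemma roe_simps:
  "mult Cu = (\<lambda>a b x z. \<Sum>y | a x y \<noteq> 0. a x y * b y z)"
  "one Cu = diagonal (\<lambda>x. if x \<in> X then 1 else 0)"
  "zero Cu = (\<lambda>x y. 0)" "add Cu = (\<lambda>a b x y. a x y + b x y)"
  "smult Cu = (\<lambda>c a x y. c * a x y)"
  by (simp_all add: uniform_roe_def)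

lemma in_roe_iff:
  "a \<in> carrier Cu \<longleftrightarrow>
     (\<forall>x y. a x y \<noteq> 0 \<longrightarrow> x \<in> X \<and> y \<in> X) \<and> (\<exists>C. \<forall>x y. cmod (a x y) \<le> C) \<and>
     (\<exists>R>0. \<forall>x y. a x y \<noteq> 0 \<longrightarrow> d x y \<le> ennreal R)"
proof -
  have "propagation d a < \<infinity> \<longleftrightarrow> (\<exists>R>0. \<forall>x y. a x y \<noteq> 0 \<longrightarrow> d x y \<le> ennreal R)"
  proof
    assume "propagation d a < \<infinity>"
    then obtain r where r: "r \<ge> 0" "propagation d a = ennreal r"
      by (cases "propagation d a") auto
    have "d x y \<le> ennreal (r + 1)" if "a x y \<noteq> 0" for x y
    proof -
      have "d x y \<le> propagation d a"
        unfolding propagation_def by (rule Sup_upper) (use that in blast)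
      also have "\<dots> \<le> ennreal (r + 1)" using r by (simp add: ennreal_leI)
      finally show ?thesis .
    qed
    then show "\<exists>R>0. \<forall>x y. a x y \<noteq> 0 \<longrightarrow> d x y \<le> ennreal R"
      using r(1) by (intro exI[of _ "r + 1"]) auto
  next
    assume "\<exists>R>0. \<forall>x y. a x y \<noteq> 0 \<longrightarrow> d x y \<le> ennreal R"
    then obtain R where "\<forall>x y. a x y \<noteq> 0 \<longrightarrow> d x y \<le> ennreal R" by blast
    then have "propagation d a \<le> ennreal R"
      unfolding propagation_def by (auto intro!: Sup_least)
    also have "\<dots> < \<infinity>" by simp
    finally show "propagation d a < \<infinity>" .
  qed
  then show ?thesis by (simp add: uniform_roe_def)
qed

lemma finite_rows:
  assumes "a \<in> carrier Cu"
  obtains N where "\<And>x. finite {y. a x y \<noteq> 0}" "\<And>x. card {y. a x y \<noteq> 0} \<le> N"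
proof -
  obtain R where R: "R > 0" "\<And>x y. a x y \<noteq> 0 \<Longrightarrow> d x y \<le> ennreal R \<and> x \<in> X \<and> y \<in> X"
    using assms unfolding in_roe_iff by blast
  obtain N where N: "\<And>x. x \<in> X \<Longrightarrow> finite {y \<in> X. d x y \<le> ennreal R} \<and>
      card {y \<in> X. d x y \<le> ennreal R} \<le> N"
    using uniformly_locally_finite[OF R(1)] by blast
  have sub: "{y. a x y \<noteq> 0} \<subseteq> {y \<in> X. d x y \<le> ennreal R}" for x using R(2) by blast
  have "finite {y. a x y \<noteq> 0} \<and> card {y. a x y \<noteq> 0} \<le> N" for x
  proof (cases "x \<in> X")
    case True
    then show ?thesis
      using N[of x] sub[of x] finite_subset card_mono[OF _ sub[of x]] by (meson order_trans)
  next
    case False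
    then have "{y. a x y \<noteq> 0} = {}" using R(2) by blast
    then show ?thesis by simp
  qed
  then show thesis using that by blast
qed

lemma dist_self: "x \<in> X \<Longrightarrow> d x x = 0"
  by (simp add: dist_eq_0)

lemma one_in_roe: "\<one>\<^bsub>Cu\<^esub> \<in> carrier Cu"
  unfolding in_roe_iff roe_simps diagonal_def
proof (intro conjI)
  show "\<exists>R>0. \<forall>x y. (if x = y then if x \<in> X then 1 else 0 else 0) \<noteq> (0::complex) \<longrightarrow> d x y \<le> ennreal R"
    using dist_self by (intro exI[of _ 1]) auto
  show "\<exists>C. \<forall>x y. cmod (if x = y then if x \<in> X then 1 else 0 else 0) \<le> C"
    by (intro exI[of _ 1]) auto
qed auto

lemma add_in_roe:
  assumes a: "a \<in> carrier Cu" and b: "b \<in> carrier Cu"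
  shows "a \<oplus>\<^bsub>Cu\<^esub> b \<in> carrier Cu"
proof -
  obtain C R where a': "\<And>x y. a x y \<noteq> 0 \<Longrightarrow> x \<in> X \<and> y \<in> X \<and> d x y \<le> ennreal R"
    "\<And>x y. cmod (a x y) \<le> C" "R > 0" using a unfolding in_roe_iff by blast
  obtain C' R' where b': "\<And>x y. b x y \<noteq> 0 \<Longrightarrow> x \<in> X \<and> y \<in> X \<and> d x y \<le> ennreal R'"
    "\<And>x y. cmod (b x y) \<le> C'" "R' > 0" using b unfolding in_roe_iff by blast
  have nz: "a x y \<noteq> 0 \<or> b x y \<noteq> 0" if "a x y + b x y \<noteq> 0" for x y using that by auto
  have "ennreal R \<le> ennreal (max R R')" "ennreal R' \<le> ennreal (max R R')"
    by (auto intro!: ennreal_leI)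
  then have "d x y \<le> ennreal (max R R')" if "a x y + b x y \<noteq> 0" for x y
    using nz[OF that] a'(1) b'(1) by (meson order_trans)
  then have 1: "\<exists>R>0. \<forall>x y. a x y + b x y \<noteq> 0 \<longrightarrow> d x y \<le> ennreal R"
    using a'(3) by (intro exI[of _ "max R R'"]) auto
  have 2: "\<forall>x y. cmod (a x y + b x y) \<le> C + C'"
    using a'(2) b'(2) by (meson add_mono norm_triangle_le)
  show ?thesis unfolding in_roe_iff roe_simps using 1 2 nz a'(1) b'(1) by blast
qed

lemma smult_in_roe:
  assumes a: "a \<in> carrier Cu"
  shows "c \<odot>\<^bsub>Cu\<^esub> a \<in> carrier Cu"
proof -
  obtain C R where a': "\<And>x y. a x y \<noteq> 0 \<Longrightarrow> x \<in> X \<and> y \<in> X \<and> d x y \<le> ennreal R"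
    "\<And>x y. cmod (a x y) \<le> C" "R > 0" using a unfolding in_roe_iff by blast
  have "\<forall>x y. cmod (c * a x y) \<le> cmod c * C"
    using a'(2) by (simp add: norm_mult mult_left_mono)
  then show ?thesis unfolding in_roe_iff roe_simps using a' by (metis mult_eq_0_iff)
qed

lemma adjoint_in_roe:
  assumes a: "a \<in> carrier Cu"
  shows "adjoint_matrix a \<in> carrier Cu"
proof -
  obtain C R where a': "\<And>x y. a x y \<noteq> 0 \<Longrightarrow> x \<in> X \<and> y \<in> X \<and> d x y \<le> ennreal R"
    "\<And>x y. cmod (a x y) \<le> C" "R > 0" using a unfolding in_roe_iff by blast
  then show ?thesis
    unfolding in_roe_iff adjoint_matrix_def using dist_commute
    by (metis complex_cnj_zero_iff complex_mod_cnj)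
qed

lemma mult_in_roe:
  assumes a: "a \<in> carrier Cu" and b: "b \<in> carrier Cu"
  shows "a \<otimes>\<^bsub>Cu\<^esub> b \<in> carrier Cu"
proof -
  obtain C R where a': "\<And>x y. a x y \<noteq> 0 \<Longrightarrow> x \<in> X \<and> y \<in> X \<and> d x y \<le> ennreal R"
    "\<And>x y. cmod (a x y) \<le> C" "R > 0" using a unfolding in_roe_iff by blast
  obtain C' R' where b': "\<And>x y. b x y \<noteq> 0 \<Longrightarrow> x \<in> X \<and> y \<in> X \<and> d x y \<le> ennreal R'"
    "\<And>x y. cmod (b x y) \<le> C'" "R' > 0" using b unfolding in_roe_iff by blast
  obtain N where N: "\<And>x. finite {y. a x y \<noteq> 0}" "\<And>x. card {y. a x y \<noteq> 0} \<le> N"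
    using finite_rows[OF a] by blast
  let ?p = "\<lambda>x z. \<Sum>y | a x y \<noteq> 0. a x y * b y z"
  have C: "C \<ge> 0" "C' \<ge> 0" using a'(2) b'(2) norm_ge_zero order_trans by blast+
  have nz: "\<exists>y. a x y \<noteq> 0 \<and> b y z \<noteq> 0" if "?p x z \<noteq> 0" for x z
    using sum.not_neutral_contains_not_neutral[OF that] by auto
  have 1: "x \<in> X \<and> z \<in> X \<and> d x z \<le> ennreal (R + R')" if nzp: "?p x z \<noteq> 0" for x z
  proof -
    obtain y where y: "a x y \<noteq> 0" "b y z \<noteq> 0" using nz[OF nzp] by blast
    have "d x z \<le> d x y + d y z" using dist_triangle a'(1)[OF y(1)] b'(1)[OF y(2)] by blast
    also have "\<dots> \<le> ennreal R + ennreal R'"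
      using a'(1)[OF y(1)] b'(1)[OF y(2)] by (intro add_mono) auto
    also have "\<dots> = ennreal (R + R')" using a'(3) b'(3) by (simp add: ennreal_plus)
    finally show ?thesis using a'(1)[OF y(1)] b'(1)[OF y(2)] by blast
  qed
  have 2: "cmod (?p x z) \<le> real N * (C * C')" for x z
  proof -
    have "cmod (?p x z) \<le> (\<Sum>y | a x y \<noteq> 0. C * C')"
      using a'(2) b'(2) C by (intro sum_norm_le) (simp add: norm_mult mult_mono)
    also have "\<dots> \<le> real N * (C * C')"
      using N(2)[of x] C by (simp add: mult_right_mono)
    finally show ?thesis .
  qed
  have "R + R' > 0" using a'(3) b'(3) by simp
  then show ?thesis unfolding in_roe_iff roe_simps using 1 2 by blast
qed

lemma omega_eq_sum:
  assumes "finite F" "{y. a x y \<noteq> 0} \<subseteq> F"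
  shows "omega a x = sum (a x) F"
  unfolding omega_def using assms by (intro sum.mono_neutral_left) auto

lemma ker_omega_add:
  assumes "a \<in> ker_omega X d" "b \<in> ker_omega X d"
  shows "a \<oplus>\<^bsub>Cu\<^esub> b \<in> ker_omega X d"
proof -
  have ab: "a \<in> carrier Cu" "b \<in> carrier Cu" "omega a = (\<lambda>x. 0)" "omega b = (\<lambda>x. 0)"
    using assms by (auto simp: ker_omega_def)
  have "omega (\<lambda>x y. a x y + b x y) x = omega a x + omega b x" for x
  proof -
    let ?F = "{y. a x y \<noteq> 0} \<union> {y. b x y \<noteq> 0}"
    have F: "finite ?F" using finite_rows[OF ab(1)] finite_rows[OF ab(2)] by (metis finite_Un)
    have "omega (\<lambda>x y. a x y + b x y) x = (\<Sum>y\<in>?F. a x y + b x y)"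
      by (rule omega_eq_sum[OF F]) auto
    also have "\<dots> = sum (a x) ?F + sum (b x) ?F" by (rule sum.distrib)
    also have "sum (a x) ?F = omega a x" by (rule omega_eq_sum[OF F, symmetric]) auto
    also have "sum (b x) ?F = omega b x" by (rule omega_eq_sum[OF F, symmetric]) auto
    finally show ?thesis .
  qed
  then show ?thesis using add_in_roe[OF ab(1,2)] ab by (auto simp: ker_omega_def roe_simps)
qed

lemma ker_omega_smult:
  assumes "a \<in> ker_omega X d"
  shows "c \<odot>\<^bsub>Cu\<^esub> a \<in> ker_omega X d"
proof -
  have a: "a \<in> carrier Cu" "omega a = (\<lambda>x. 0)" using assms by (auto simp: ker_omega_def)
  have "omega (\<lambda>x y. c * a x y) x = c * omega a x" for x
    by (cases "c = 0") (auto simp: omega_def sum_distrib_left)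
  then show ?thesis using smult_in_roe[OF a(1)] a by (auto simp: ker_omega_def roe_simps)
qed

lemma ker_omega_mult:
  assumes a: "a \<in> carrier Cu" and b: "b \<in> ker_omega X d"
  shows "a \<otimes>\<^bsub>Cu\<^esub> b \<in> ker_omega X d"
proof -
  have b': "b \<in> carrier Cu" "omega b = (\<lambda>x. 0)" using b by (auto simp: ker_omega_def)
  have fa: "finite {y. a x y \<noteq> 0}" for x using finite_rows[OF a] by metis
  have fb: "finite {y. b x y \<noteq> 0}" for x using finite_rows[OF b'(1)] by metis
  have "omega (a \<otimes>\<^bsub>Cu\<^esub> b) x = 0" for x
  proof -
    let ?Z = "\<Union>y\<in>{y. a x y \<noteq> 0}. {z. b y z \<noteq> 0}"
    have Z: "finite ?Z" using fa fb by blast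
    have "omega (a \<otimes>\<^bsub>Cu\<^esub> b) x = (\<Sum>z\<in>?Z. \<Sum>y | a x y \<noteq> 0. a x y * b y z)"
      unfolding roe_simps
    proof (rule omega_eq_sum[OF Z], rule subsetI)
      fix z assume "z \<in> {z. (\<Sum>y | a x y \<noteq> 0. a x y * b y z) \<noteq> 0}"
      then have "(\<Sum>y | a x y \<noteq> 0. a x y * b y z) \<noteq> 0" by simp
      from sum.not_neutral_contains_not_neutral[OF this] show "z \<in> ?Z" by auto
    qed
    also have "\<dots> = (\<Sum>y | a x y \<noteq> 0. a x y * sum (b y) ?Z)"
      by (subst sum.swap) (simp add: sum_distrib_left)
    also have "\<dots> = (\<Sum>y | a x y \<noteq> 0. a x y * omega b y)"
      by (rule sum.cong[OF refl]) (subst omega_eq_sum[OF Z], auto)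
    finally show ?thesis using b' by simp
  qed
  then show ?thesis using mult_in_roe[OF a b'(1)] by (auto simp: ker_omega_def)
qed

lemma ker_omega_zero: "(\<lambda>x y. 0) \<in> ker_omega X d"
  by (auto simp: ker_omega_def in_roe_iff omega_def intro!: exI[of _ 1])

lemma diagonal_omega_in_roe:
  assumes a: "a \<in> carrier Cu"
  shows "diagonal (omega a) \<in> carrier Cu"
proof -
  obtain C R where a': "\<And>x y. a x y \<noteq> 0 \<Longrightarrow> x \<in> X \<and> y \<in> X \<and> d x y \<le> ennreal R"
    "\<And>x y. cmod (a x y) \<le> C" "R > 0" using a unfolding in_roe_iff by blast
  obtain N where N: "\<And>x. finite {y. a x y \<noteq> 0}" "\<And>x. card {y. a x y \<noteq> 0} \<le> N"
    using finite_rows[OF a] by blast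
  have C: "C \<ge> 0" using a'(2) norm_ge_zero order_trans by blast
  have nz: "x \<in> X" if "omega a x \<noteq> 0" for x
    using sum.not_neutral_contains_not_neutral[OF that[unfolded omega_def]] a'(1) by auto
  have bd: "cmod (omega a x) \<le> real N * C" for x
  proof -
    have "cmod (omega a x) \<le> (\<Sum>y | a x y \<noteq> 0. C)"
      unfolding omega_def using a'(2) by (intro sum_norm_le) simp
    also have "\<dots> \<le> real N * C" using N(2)[of x] C by (simp add: mult_right_mono)
    finally show ?thesis .
  qed
  have "\<forall>x y. cmod (diagonal (omega a) x y) \<le> real N * C"
    using bd C by (simp add: diagonal_def)
  moreover have "\<forall>x y. diagonal (omega a) x y \<noteq> 0 \<longrightarrow> x \<in> X \<and> y \<in> X \<and> d x y \<le> ennreal 1"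
    using nz dist_self by (auto simp: diagonal_def)
  ultimately show ?thesis unfolding in_roe_iff by (metis zero_less_one)
qed

lemma abelian_group_roe: "abelian_group Cu"
proof (rule abelian_groupI)
  fix a assume a: "a \<in> carrier Cu"
  show "\<exists>b\<in>carrier Cu. b \<oplus>\<^bsub>Cu\<^esub> a = \<zero>\<^bsub>Cu\<^esub>"
    using smult_in_roe[OF a, of "-1"]
    by (intro bexI[of _ "(-1) \<odot>\<^bsub>Cu\<^esub> a"]) (auto simp: roe_simps)
qed (use add_in_roe ker_omega_zero in \<open>auto simp: roe_simps ker_omega_def algebra_simps\<close>)

lemma cohomological_T_D:
  fixes H :: "'h inner_module"
  assumes T: "cohomological_T X d"
    and rep: "star_representation X d H \<pi>" and coc: "cocycle X d H \<pi> \<theta>"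
  shows "coboundary X d H \<pi> \<theta>"
proof -
  interpret H: hilbert_space H using rep by (simp add: star_representation_def)
  let ?L = "ker_omega X d"
  have L: "a \<in> carrier Cu" if "a \<in> ?L" for a using that by (simp add: ker_omega_def)
  have \<theta>: "\<theta> a \<in> carrier H" "\<theta> (a \<oplus>\<^bsub>Cu\<^esub> b) = \<theta> a \<oplus>\<^bsub>H\<^esub> \<theta> b" "\<theta> (c \<odot>\<^bsub>Cu\<^esub> a) = c \<odot>\<^bsub>H\<^esub> \<theta> a"
    if "a \<in> ?L" "b \<in> ?L" for a b c
    using coc that by (auto simp: cocycle_def clinear_map_def)
  have \<pi>\<theta>: "\<pi> a (\<theta> b) = \<theta> (a \<otimes>\<^bsub>Cu\<^esub> b)" if "a \<in> carrier Cu" "b \<in> ?L" for a b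
    using coc that by (simp add: cocycle_def)
  have z: "\<theta> (\<lambda>x y. 0) = \<zero>\<^bsub>H\<^esub>"
  proof -
    have "\<theta> (0 \<odot>\<^bsub>Cu\<^esub> (\<lambda>x y. 0)) = 0 \<odot>\<^bsub>H\<^esub> \<theta> (\<lambda>x y. 0)"
      using \<theta>(3) ker_omega_zero by blast
    then show ?thesis using \<theta>(1) ker_omega_zero by (simp add: roe_simps H.smult_zero)
  qed
  obtain K :: "(nat \<Rightarrow> 'a cmatrix) inner_module" and j where
    K: "hilbert_space K" and lin: "clinear_map K H j"
    and iso: "\<And>v w. \<lbrakk>v \<in> carrier K; w \<in> carrier K\<rbrakk> \<Longrightarrow> cinner H (j v) (j w) = cinner K v w"
    and im: "\<theta> ` ?L \<subseteq> j ` carrier K"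
    and inv: "\<And>T. \<lbrakk>bounded_operator H T; T ` (\<theta> ` ?L) \<subseteq> \<theta> ` ?L\<rbrakk> \<Longrightarrow>
       T ` (j ` carrier K) \<subseteq> j ` carrier K"
  proof (rule H.hilbert_subspace_code[of \<theta> ?L])
    show "\<theta> ` ?L \<subseteq> carrier H" using \<theta>(1) by blast
    show "\<zero>\<^bsub>H\<^esub> \<in> \<theta> ` ?L" using z ker_omega_zero by (metis imageI)
    show "v \<oplus>\<^bsub>H\<^esub> w \<in> \<theta> ` ?L" if vw: "v \<in> \<theta> ` ?L" "w \<in> \<theta> ` ?L" for v w
    proof -
      obtain a b where ab: "a \<in> ?L" "b \<in> ?L" "v = \<theta> a" "w = \<theta> b" using vw by blast
      show ?thesis unfolding ab(3,4) \<theta>(2)[OF ab(1,2), symmetric]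
        by (rule imageI[OF ker_omega_add[OF ab(1,2)]])
    qed
    show "c \<odot>\<^bsub>H\<^esub> v \<in> \<theta> ` ?L" if v: "v \<in> \<theta> ` ?L" for c v
    proof -
      obtain a where a: "a \<in> ?L" "v = \<theta> a" using v by blast
      show ?thesis unfolding a(2) \<theta>(3)[OF a(1) a(1), symmetric]
        by (rule imageI[OF ker_omega_smult[OF a(1)]])
    qed
  qed blast
  interpret K: hilbert_space K by fact
  interpret J: isometric_embedding H K j
    by unfold_locales (use lin iso in auto)
  have inv': "\<pi> a ` (j ` carrier K) \<subseteq> j ` carrier K" if "a \<in> carrier Cu" for a
  proof (rule inv)
    show "bounded_operator H (\<pi> a)" using rep that by (simp add: star_representation_def)
    show "\<pi> a ` \<theta> ` ?L \<subseteq> \<theta> ` ?L" using that \<pi>\<theta> ker_omega_mult by auto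
  qed
  have rep': "star_representation X d K (\<lambda>a. J.pull (\<pi> a))"
    by (rule J.star_representation_pull[OF rep K inv'])
      (auto intro: one_in_roe add_in_roe mult_in_roe smult_in_roe adjoint_in_roe)
  define \<theta>' where "\<theta>' a = inv_into (carrier K) j (\<theta> a)" for a
  have \<theta>': "\<theta>' a \<in> carrier K" "j (\<theta>' a) = \<theta> a" if "a \<in> ?L" for a
    using im that by (auto simp: \<theta>'_def image_subset_iff inv_into_into f_inv_into_f)
  have smK: "c \<odot>\<^bsub>K\<^esub> v \<in> carrier K" if "v \<in> carrier K" for c v
    using K.smult_closed[of c v] that by simp
  have "cocycle X d K (\<lambda>a. J.pull (\<pi> a)) \<theta>'"
    unfolding cocycle_def clinear_map_def
  proof (intro conjI ballI allI)
    show "\<theta>' \<in> carrier (Cu\<lparr>carrier := ?L\<rparr>) \<rightarrow> carrier K" using \<theta>' by simp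
  next
    fix a b assume "a \<in> carrier (Cu\<lparr>carrier := ?L\<rparr>)" "b \<in> carrier (Cu\<lparr>carrier := ?L\<rparr>)"
    then have ab: "a \<in> ?L" "b \<in> ?L" by simp_all
    have "\<theta>' (a \<oplus>\<^bsub>Cu\<^esub> b) = \<theta>' a \<oplus>\<^bsub>K\<^esub> \<theta>' b"
      by (rule inj_onD[OF J.j_inj]) (simp_all add: \<theta>' \<theta> ab ker_omega_add J.j_simps)
    then show "\<theta>' (a \<oplus>\<^bsub>Cu\<lparr>carrier := ?L\<rparr>\<^esub> b) = \<theta>' a \<oplus>\<^bsub>K\<^esub> \<theta>' b" by simp
  next
    fix c a assume "a \<in> carrier (Cu\<lparr>carrier := ?L\<rparr>)"
    then have a: "a \<in> ?L" by simp
    have "\<theta>' (c \<odot>\<^bsub>Cu\<^esub> a) = c \<odot>\<^bsub>K\<^esub> \<theta>' a"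
      by (rule inj_onD[OF J.j_inj]) (simp_all add: \<theta>' \<theta>[OF a a] a ker_omega_smult J.j_simps smK)
    then show "\<theta>' (c \<odot>\<^bsub>Cu\<lparr>carrier := ?L\<rparr>\<^esub> a) = c \<odot>\<^bsub>K\<^esub> \<theta>' a" by simp
  next
    fix a b assume a: "a \<in> carrier Cu" and b: "b \<in> ?L"
    show "\<theta>' (a \<otimes>\<^bsub>Cu\<^esub> b) = J.pull (\<pi> a) (\<theta>' b)"
      by (rule inj_onD[OF J.j_inj])
        (simp_all add: \<theta>' \<pi>\<theta> a b ker_omega_mult J.j_pull[OF inv'])
  qed
  then have "coboundary X d K (\<lambda>a. J.pull (\<pi> a)) \<theta>'"
    using T[unfolded cohomological_T_def, rule_format, OF conjI, OF rep'] by simp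
  then obtain v where v: "v \<in> carrier K" "\<And>a. a \<in> ?L \<Longrightarrow> \<theta>' a = J.pull (\<pi> a) v"
    unfolding coboundary_def by blast
  have "\<theta> a = \<pi> a (j v)" if a: "a \<in> ?L" for a
    using v(2)[OF a] \<theta>'(2)[OF a] J.j_pull(2)[OF inv'[OF L[OF a]] v(1)] by simp
  then show ?thesis unfolding coboundary_def using v(1) J.j_simps(1) by blast
qed

lemma constant_gap_D:
  fixes H :: "'h inner_module"
  assumes T: "\<And>(K :: (nat \<Rightarrow> 'a cmatrix) inner_module) \<rho>.
      star_representation X d K \<rho> \<Longrightarrow> constant_gap X d R c K \<rho>"
    and rep: "star_representation X d H \<pi>"
  shows "constant_gap X d R c H \<pi>"
  unfolding constant_gap_def
proof
  fix v assume v: "v \<in> orthogonal_complement H (constant_vectors X d H \<pi>)"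
  then have vH: "v \<in> carrier H" by (simp add: orthogonal_complement_def)
  interpret H: hilbert_space H using rep by (simp add: star_representation_def)
  note r = rep[unfolded star_representation_def]
  have \<pi>H: "\<pi> a w \<in> carrier H" if "a \<in> carrier Cu" "w \<in> carrier H" for a w
    using r that by (auto simp: bounded_operator_def clinear_map_def)
  let ?p = "\<lambda>a. \<pi> a v"
  let ?D = "?p ` carrier Cu"
  have zA: "(\<lambda>x y. 0) \<in> carrier Cu" using ker_omega_zero by (simp add: ker_omega_def)
  have z: "\<pi> (\<lambda>x y. 0) v = \<zero>\<^bsub>H\<^esub>"
  proof -
    have "\<pi> (0 \<odot>\<^bsub>Cu\<^esub> (\<lambda>x y. 0)) v = 0 \<odot>\<^bsub>H\<^esub> \<pi> (\<lambda>x y. 0) v"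
      using r zA vH by blast
    then show ?thesis using \<pi>H[OF zA vH] by (simp add: roe_simps H.smult_zero)
  qed
  obtain K :: "(nat \<Rightarrow> 'a cmatrix) inner_module" and j where
    K: "hilbert_space K" and lin: "clinear_map K H j"
    and iso: "\<And>v w. \<lbrakk>v \<in> carrier K; w \<in> carrier K\<rbrakk> \<Longrightarrow> cinner H (j v) (j w) = cinner K v w"
    and im: "?D \<subseteq> j ` carrier K"
    and inv: "\<And>T. \<lbrakk>bounded_operator H T; T ` ?D \<subseteq> ?D\<rbrakk> \<Longrightarrow> T ` (j ` carrier K) \<subseteq> j ` carrier K"
  proof (rule H.hilbert_subspace_code[of ?p "carrier Cu"])
    show "?D \<subseteq> carrier H" using \<pi>H vH by blast
    show "\<zero>\<^bsub>H\<^esub> \<in> ?D" using z zA by (metis (no_types, lifting) imageI)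
    show "u \<oplus>\<^bsub>H\<^esub> w \<in> ?D" if uw: "u \<in> ?D" "w \<in> ?D" for u w
    proof -
      obtain a b where ab: "a \<in> carrier Cu" "b \<in> carrier Cu" "u = \<pi> a v" "w = \<pi> b v" using uw by blast
      then have "u \<oplus>\<^bsub>H\<^esub> w = \<pi> (a \<oplus>\<^bsub>Cu\<^esub> b) v" using r vH by simp
      then show ?thesis using add_in_roe ab by blast
    qed
    show "c \<odot>\<^bsub>H\<^esub> u \<in> ?D" if u: "u \<in> ?D" for c u
    proof -
      obtain a where a: "a \<in> carrier Cu" "u = \<pi> a v" using u by blast
      then have "c \<odot>\<^bsub>H\<^esub> u = \<pi> (c \<odot>\<^bsub>Cu\<^esub> a) v" using r vH by simp
      then show ?thesis using smult_in_roe a by blast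
    qed
  qed blast
  interpret K: hilbert_space K by fact
  interpret J: isometric_embedding H K j
    by unfold_locales (use lin iso in auto)
  have inv': "\<pi> a ` (j ` carrier K) \<subseteq> j ` carrier K" if a: "a \<in> carrier Cu" for a
  proof (rule inv)
    show "bounded_operator H (\<pi> a)" using r a by simp
    show "\<pi> a ` ?D \<subseteq> ?D"
    proof clarify
      fix b assume b: "b \<in> carrier Cu"
      have "\<pi> a (\<pi> b v) = \<pi> (a \<otimes>\<^bsub>Cu\<^esub> b) v" using r a b vH by simp
      then show "\<pi> a (\<pi> b v) \<in> ?D" using mult_in_roe a b by blast
    qed
  qed
  have rep': "star_representation X d K (\<lambda>a. J.pull (\<pi> a))"
    by (rule J.star_representation_pull[OF rep K inv'])
      (auto intro: one_in_roe add_in_roe mult_in_roe smult_in_roe adjoint_in_roe)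
  have "\<pi> \<one>\<^bsub>Cu\<^esub> v = v" using r vH by blast
  then have "v \<in> j ` carrier K" using im one_in_roe by (metis (no_types, lifting) image_eqI subsetD)
  then obtain v' where v': "v' \<in> carrier K" "j v' = v" by blast
  have "v' \<in> orthogonal_complement K (constant_vectors X d K (\<lambda>a. J.pull (\<pi> a)))"
    unfolding orthogonal_complement_def
  proof (intro CollectI conjI ballI)
    fix w assume "w \<in> constant_vectors X d K (\<lambda>a. J.pull (\<pi> a))"
    then have w: "w \<in> carrier K" "\<And>a. a \<in> ker_omega X d \<Longrightarrow> J.pull (\<pi> a) w = \<zero>\<^bsub>K\<^esub>"
      by (auto simp: constant_vectors_def)
    have "\<pi> a (j w) = \<zero>\<^bsub>H\<^esub>" if a: "a \<in> ker_omega X d" for a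
    proof -
      have "a \<in> carrier Cu" using a by (simp add: ker_omega_def)
      from J.j_pull(2)[OF inv'[OF this] w(1)] show ?thesis using w(2)[OF a] J.j_zero by simp
    qed
    then have "j w \<in> constant_vectors X d H \<pi>"
      using w(1) J.j_simps(1) by (simp add: constant_vectors_def)
    then have "cinner H v (j w) = 0" using v by (simp add: orthogonal_complement_def)
    then show "cinner K v' w = 0" using iso[OF v'(1) w(1)] v'(2) by simp
  qed (fact v')
  then obtain a where a: "a \<in> carrier Cu" "a \<noteq> \<zero>\<^bsub>Cu\<^esub>" "propagation d a \<le> ennreal R"
    "hnorm K (J.pull (\<pi> (a \<ominus>\<^bsub>Cu\<^esub> diagonal (omega a))) v') \<ge> c * hnorm K v' * sup_entry X a"
    using T[OF rep'] unfolding constant_gap_def by blast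
  have m: "a \<ominus>\<^bsub>Cu\<^esub> diagonal (omega a) \<in> carrier Cu"
    using abelian_group.minus_closed[OF abelian_group_roe a(1) diagonal_omega_in_roe[OF a(1)]] .
  note jp = J.j_pull[OF inv'[OF m] v'(1)]
  have "hnorm H (\<pi> (a \<ominus>\<^bsub>Cu\<^esub> diagonal (omega a)) v) = hnorm K (J.pull (\<pi> (a \<ominus>\<^bsub>Cu\<^esub> diagonal (omega a))) v')"
    using J.j_hnorm[OF jp(1)] jp(2) v'(2) by simp
  moreover have "hnorm H v = hnorm K v'" using J.j_hnorm[OF v'(1)] v'(2) by simp
  ultimately show "\<exists>a\<in>carrier Cu. a \<noteq> \<zero>\<^bsub>Cu\<^esub> \<and> propagation d a \<le> ennreal R \<and>
      hnorm H (\<pi> (a \<ominus>\<^bsub>Cu\<^esub> diagonal (omega a)) v) \<ge> c * hnorm H v * sup_entry X a"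
    using a by auto
qed

lemma geometric_T_D:
  assumes "geometric_T X d"
  obtains R c where "R > 0" "c > 0"
    "\<And>(H :: 'h inner_module) \<pi>. star_representation X d H \<pi> \<Longrightarrow> constant_gap X d R c H \<pi>"
proof -
  obtain R c where Rc: "R > 0" "c > 0"
    "\<And>(H :: (nat \<Rightarrow> 'a cmatrix) inner_module) \<pi>. star_representation X d H \<pi> \<Longrightarrow> constant_gap X d R c H \<pi>"
    using assms unfolding geometric_T_def by blast
  show thesis using that[OF Rc(1,2)] constant_gap_D[OF Rc(3)] by blast
qed

end

primrec orbit_combination ::
    "'h inner_module \<Rightarrow> ('g \<Rightarrow> 'h \<Rightarrow> 'h) \<Rightarrow> 'h \<Rightarrow> (complex \<times> 'g) list \<Rightarrow> 'h" where
  "orbit_combination H \<pi> v [] = \<zero>\<^bsub>H\<^esub>"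
| "orbit_combination H \<pi> v (cg # l) =
     fst cg \<odot>\<^bsub>H\<^esub> \<pi> (snd cg) v \<oplus>\<^bsub>H\<^esub> orbit_combination H \<pi> v l"

lemma property_T_D:
  fixes G :: "('g, 'm) monoid_scheme"
  assumes G: "group G" and T: "property_T G"
  obtains Q \<epsilon> where "finite Q" "Q \<subseteq> carrier G" "0 < \<epsilon>"
    "\<And>(H :: 'h inner_module) \<pi> v. \<lbrakk>unitary_representation G H \<pi>; almost_invariant_vector H \<pi> Q \<epsilon> v\<rbrakk> \<Longrightarrow>
       has_invariant_vector G H \<pi>"
proof -
  interpret G: group G by fact
  obtain Q \<epsilon> where Q: "finite Q" "Q \<subseteq> carrier G" "0 < \<epsilon>"
    and QT: "\<And>(H :: (nat \<Rightarrow> (complex \<times> 'g) list) inner_module) \<pi> v.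
      \<lbrakk>unitary_representation G H \<pi>; almost_invariant_vector H \<pi> Q \<epsilon> v\<rbrakk> \<Longrightarrow> has_invariant_vector G H \<pi>"
    using T unfolding property_T_def by blast
  have "has_invariant_vector G H \<pi>"
    if rep: "unitary_representation G H \<pi>" and v: "almost_invariant_vector H \<pi> Q \<epsilon> v"
    for H :: "'h inner_module" and \<pi> v
  proof -
    interpret H: hilbert_space H using rep by (simp add: unitary_representation_def)
    note r = rep[unfolded unitary_representation_def]
    have lin\<pi>: "clinear_map H H (\<pi> g)" if "g \<in> carrier G" for g
      using r that by (auto simp: unitary_operator_def)
    note \<pi>s = clinear_mapD[OF lin\<pi>]
    have vH: "v \<in> carrier H" using v by (simp add: almost_invariant_vector_def)
    have sm: "c \<odot>\<^bsub>H\<^esub> w \<in> carrier H" if "w \<in> carrier H" for c w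
      using H.smult_closed[of c w] that by simp
    have bdd: "bounded_operator H (\<pi> g)" if g: "g \<in> carrier G" for g
      unfolding bounded_operator_def
    proof (intro conjI exI ballI)
      fix w assume "w \<in> carrier H"
      then have "cinner H (\<pi> g w) (\<pi> g w) = cinner H w w" using r g unfolding unitary_operator_def by blast
      then show "hnorm H (\<pi> g w) \<le> 1 * hnorm H w" by (simp add: hnorm_def)
    qed (rule lin\<pi>[OF g])
    let ?p = "orbit_combination H \<pi> v"
    let ?L = "{l :: (complex \<times> 'g) list. snd ` set l \<subseteq> carrier G}"
    have pH: "?p l \<in> carrier H" if "l \<in> ?L" for l
      using that by (induction l) (auto simp: \<pi>s vH sm)
    have p_app: "?p (l @ l') = ?p l \<oplus>\<^bsub>H\<^esub> ?p l'" if "l \<in> ?L" "l' \<in> ?L" for l l'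
      using that pH[OF that(2)]
    proof (induction l)
      case (Cons a l)
      then show ?case using pH[of l] by (auto simp: \<pi>s vH sm H.M.a_assoc)
    qed simp
    have p_sm: "?p (map (\<lambda>(b, g). (c * b, g)) l) = c \<odot>\<^bsub>H\<^esub> ?p l" if "l \<in> ?L" for c l
      using that
    proof (induction l)
      case Nil
      then show ?case using H.smult_r_null[of c] by simp
    next
      case (Cons a l)
      then show ?case
        using pH[of l] H.smult_r_distr[of c "fst a \<odot>\<^bsub>H\<^esub> \<pi> (snd a) v" "?p l"]
          H.smult_assoc1[of c "fst a" "\<pi> (snd a) v"]
        by (auto simp: \<pi>s vH sm split: prod.split)
    qed
    have p_\<pi>: "?p (map (\<lambda>(b, h). (b, g \<otimes>\<^bsub>G\<^esub> h)) l) = \<pi> g (?p l)"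
      if "l \<in> ?L" and g: "g \<in> carrier G" for g l
      using that(1)
    proof (induction l)
      case Nil
      have "\<pi> g (0 \<odot>\<^bsub>H\<^esub> \<zero>\<^bsub>H\<^esub>) = 0 \<odot>\<^bsub>H\<^esub> \<pi> g \<zero>\<^bsub>H\<^esub>"
        using g by (intro \<pi>s(3)) simp_all
      then show ?case using \<pi>s(1)[OF g, of "\<zero>\<^bsub>H\<^esub>"] by (simp add: H.smult_zero)
    next
      case (Cons a l)
      then show ?case
        using pH[of l] g r by (auto simp: \<pi>s vH sm split: prod.split)
    qed
    obtain K :: "(nat \<Rightarrow> (complex \<times> 'g) list) inner_module" and j where
      K: "hilbert_space K" and lin: "clinear_map K H j"
      and iso: "\<And>v w. \<lbrakk>v \<in> carrier K; w \<in> carrier K\<rbrakk> \<Longrightarrow> cinner H (j v) (j w) = cinner K v w"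
      and im: "?p ` ?L \<subseteq> j ` carrier K"
      and inv: "\<And>T. \<lbrakk>bounded_operator H T; T ` (?p ` ?L) \<subseteq> ?p ` ?L\<rbrakk> \<Longrightarrow>
         T ` (j ` carrier K) \<subseteq> j ` carrier K"
    proof (rule H.hilbert_subspace_code[of ?p ?L])
      show "?p ` ?L \<subseteq> carrier H" using pH by blast
      show "\<zero>\<^bsub>H\<^esub> \<in> ?p ` ?L" by (rule image_eqI[of _ _ "[]"]) auto
      show "u \<oplus>\<^bsub>H\<^esub> w \<in> ?p ` ?L" if uw: "u \<in> ?p ` ?L" "w \<in> ?p ` ?L" for u w
      proof -
        obtain l l' where l: "l \<in> ?L" "l' \<in> ?L" "u = ?p l" "w = ?p l'" using uw by blast
        then show ?thesis using p_app[of l l'] by (intro image_eqI[of _ _ "l @ l'"]) auto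
      qed
      show "c \<odot>\<^bsub>H\<^esub> u \<in> ?p ` ?L" if u: "u \<in> ?p ` ?L" for c u
      proof -
        obtain l where l: "l \<in> ?L" "u = ?p l" using u by blast
        then show ?thesis using p_sm[of l c]
          by (intro image_eqI[of _ _ "map (\<lambda>(b, g). (c * b, g)) l"]) force+
      qed
    qed blast
    interpret K: hilbert_space K by fact
    interpret J: isometric_embedding H K j
      by unfold_locales (use lin iso in auto)
    have inv': "\<pi> g ` (j ` carrier K) \<subseteq> j ` carrier K" if g: "g \<in> carrier G" for g
    proof (rule inv[OF bdd[OF g]])
      show "\<pi> g ` ?p ` ?L \<subseteq> ?p ` ?L"
      proof clarify
        fix l :: "(complex \<times> 'g) list" assume l: "snd ` set l \<subseteq> carrier G"
        have "map (\<lambda>(b, h). (b, g \<otimes>\<^bsub>G\<^esub> h)) l \<in> ?L" using l g by force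
        moreover have "?p (map (\<lambda>(b, h). (b, g \<otimes>\<^bsub>G\<^esub> h)) l) = \<pi> g (?p l)" using p_\<pi> l g by blast
        ultimately show "\<pi> g (?p l) \<in> ?p ` ?L" by (metis (no_types, lifting) imageI)
      qed
    qed
    note jp = J.j_pull[OF inv']
    have one: "J.pull (\<pi> \<one>\<^bsub>G\<^esub>) w = w" if w: "w \<in> carrier K" for w
      by (rule inj_onD[OF J.j_inj]) (use r in \<open>simp_all add: jp w J.j_simps\<close>)
    have mult: "J.pull (\<pi> (g \<otimes>\<^bsub>G\<^esub> h)) w = J.pull (\<pi> g) (J.pull (\<pi> h) w)"
      if g: "g \<in> carrier G" and h: "h \<in> carrier G" and w: "w \<in> carrier K" for g h w
      by (rule inj_onD[OF J.j_inj]) (use r in \<open>simp_all add: jp w g h J.j_simps\<close>)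
    have "unitary_representation G K (\<lambda>g. J.pull (\<pi> g))"
      unfolding unitary_representation_def
    proof (intro conjI ballI)
      fix g assume g: "g \<in> carrier G"
      show "unitary_operator K (J.pull (\<pi> g))"
        unfolding unitary_operator_def
      proof (intro conjI ballI)
        show "clinear_map K K (J.pull (\<pi> g))" by (rule J.clinear_map_pull[OF inv'[OF g] lin\<pi>[OF g]])
        show "J.pull (\<pi> g) ` carrier K = carrier K"
        proof
          show "J.pull (\<pi> g) ` carrier K \<subseteq> carrier K" using jp(1)[OF g] by blast
          show "carrier K \<subseteq> J.pull (\<pi> g) ` carrier K"
          proof
            fix w assume w: "w \<in> carrier K"
            have "w = J.pull (\<pi> g) (J.pull (\<pi> (inv\<^bsub>G\<^esub> g)) w)"
              using mult[of g "inv\<^bsub>G\<^esub> g" w] one[OF w] g w by simp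
            then show "w \<in> J.pull (\<pi> g) ` carrier K" using jp(1)[of "inv\<^bsub>G\<^esub> g" w] g w by blast
          qed
        qed
        fix u w assume u: "u \<in> carrier K" and w: "w \<in> carrier K"
        have "cinner K (J.pull (\<pi> g) u) (J.pull (\<pi> g) w) = cinner H (\<pi> g (j u)) (\<pi> g (j w))"
          using iso[of "J.pull (\<pi> g) u" "J.pull (\<pi> g) w"] by (simp add: jp g u w)
        also have "\<dots> = cinner H (j u) (j w)"
          using r g u w J.j_simps(1) unfolding unitary_operator_def by blast
        finally show "cinner K (J.pull (\<pi> g) u) (J.pull (\<pi> g) w) = cinner K u w"
          using iso[OF u w] by simp
      qed
    qed (use K one mult in auto)
    moreover have "?p [(1, \<one>\<^bsub>G\<^esub>)] = v"
      using r vH H.smult_one[OF vH] by simp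
    then have "v \<in> ?p ` ?L" by (intro image_eqI[of _ _ "[(1, \<one>\<^bsub>G\<^esub>)]"]) auto
    then obtain v' where v': "v' \<in> carrier K" "j v' = v" using im by blast
    have "almost_invariant_vector K (\<lambda>g. J.pull (\<pi> g)) Q \<epsilon> v'"
      unfolding almost_invariant_vector_def
    proof (intro conjI ballI)
      show "v' \<noteq> \<zero>\<^bsub>K\<^esub>" using v v'(2) J.j_zero by (auto simp: almost_invariant_vector_def)
      fix g assume "g \<in> Q"
      then have g: "g \<in> carrier G" "hnorm H (\<pi> g v \<ominus>\<^bsub>H\<^esub> v) < \<epsilon> * hnorm H v"
        using Q(2) v by (auto simp: almost_invariant_vector_def)
      have "hnorm K (J.pull (\<pi> g) v' \<ominus>\<^bsub>K\<^esub> v') = hnorm H (\<pi> g v \<ominus>\<^bsub>H\<^esub> v)"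
        using J.j_hnorm[of "J.pull (\<pi> g) v' \<ominus>\<^bsub>K\<^esub> v'"] jp[OF g(1) v'(1)] v' by (simp add: J.j_diff)
      then show "hnorm K (J.pull (\<pi> g) v' \<ominus>\<^bsub>K\<^esub> v') < \<epsilon> * hnorm K v'"
        using g(2) J.j_hnorm[OF v'(1)] v'(2) by simp
    qed (fact v')
    ultimately have "has_invariant_vector G K (\<lambda>g. J.pull (\<pi> g))" by (rule QT)
    then obtain w where w: "w \<in> carrier K" "w \<noteq> \<zero>\<^bsub>K\<^esub>" "\<And>g. g \<in> carrier G \<Longrightarrow> J.pull (\<pi> g) w = w"
      unfolding has_invariant_vector_def by blast
    have "j w \<noteq> \<zero>\<^bsub>H\<^esub>" using w J.j_zero inj_onD[OF J.j_inj, of w "\<zero>\<^bsub>K\<^esub>"] by auto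
    moreover have "\<pi> g (j w) = j w" if "g \<in> carrier G" for g
      using jp(2)[OF that w(1)] w(3)[OF that] by simp
    ultimately show ?thesis unfolding has_invariant_vector_def using J.j_simps(1) w(1) by blast
  qed
  then show thesis using that Q by blast
qed

end

theory Submission
  imports Defs "HOL-Analysis.Function_Topology" "HOL-Algebra.Product_Groups"
begin

text \<open>(i) If geometric property (T) fails, there are representations with unit vectors orthogonal to the
  constant vectors that are almost constant at any prescribed rate. Rescaling these vectors yields a
  cocycle with values in the direct sum of the representations which is not a coboundary.

  (ii) The ideal \<open>ker_omega X d\<close> is generated by the elements \<open>u s - 1\<close> for \<open>s \<in> S\<close>, so a cocycle is
  determined by the group cocycle \<open>b g = \<theta> (u g - 1)\<close>, which is inner by Delorme's theorem: the
  spectral gap allows one to subtract a coboundary and make \<open>b\<close> harmonic; by Schoenberg's theorem the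
  kernels \<open>exp (- t N)\<close> with \<open>N g h = \<parallel>b g - b h\<parallel>\<^sup>2\<close> are positive definite; the spectral gap of
  the associated representations, differentiated at \<open>t = 0\<close>, forces the harmonic \<open>b\<close> to vanish.

  (iii) The same argument applies to the group generated by the tuples of corresponding generators,
  except that the gap is only available for representations of the algebra. The Cayley graphs are
  finite, and the diagonal projections onto sets of components allow one to localise \<open>b\<close>. A limit of
  normalised localisations produces a kernel for which \<open>exp (- t N)\<close> gives such a representation.\<close>

section \<open>Semi-inner products and their completion\<close>

text \<open>A gap \<nu> bounds \<nu> times the energy of a vector by the squared norm of its
  Laplacian. For the vector with kernel \<open>exp (- t * N)\<close> the energy has slope
  \<open>2 * (\<Sum>s\<leftarrow>S. N s \<one>)\<close> at t = 0, while the slope of the other side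
  is twice the squared norm of the Laplacian of b, which is zero for harmonic b.

  The obstacle in (iii) is that the kernel of a cocycle need not define a representation of the
  algebra: \<open>N g h\<close> may distinguish elements that act alike on a component. On a finite
  component, an invariant kernel that depends on the action alone does define one, because averaging
  over the component makes left multiplication adjointable. Hence b is cut down to decreasing sets
  of components such that two elements from a growing finite list act alike on all of these
  components or on none of them. In the limit the kernel depends, at each fixed radius, on the
  action alone. The energy of b can tend to zero along these sets even if each of them carries some
  of it, which forces the normalisation.\<close>

locale semi_inner_product =
  fixes V :: "'v inner_module" (structure)
  assumes nonempty: "carrier V \<noteq> {}"
    and add_closed: "\<lbrakk>u \<in> carrier V; v \<in> carrier V\<rbrakk> \<Longrightarrow> u \<oplus> v \<in> carrier V"
    and scale_closed: "v \<in> carrier V \<Longrightarrow> c \<odot> v \<in> carrier V"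
    and form_add: "\<lbrakk>u \<in> carrier V; v \<in> carrier V; w \<in> carrier V\<rbrakk> \<Longrightarrow>
         cinner V (u \<oplus> v) w = cinner V u w + cinner V v w"
    and form_scale: "\<lbrakk>v \<in> carrier V; w \<in> carrier V\<rbrakk> \<Longrightarrow>
         cinner V (c \<odot> v) w = c * cinner V v w"
    and form_commute: "\<lbrakk>v \<in> carrier V; w \<in> carrier V\<rbrakk> \<Longrightarrow> cinner V w v = cnj (cinner V v w)"
    and form_nonneg: "v \<in> carrier V \<Longrightarrow> 0 \<le> Re (cinner V v v)"
begin

lemma form_add_right:
  "\<lbrakk>u \<in> carrier V; v \<in> carrier V; w \<in> carrier V\<rbrakk> \<Longrightarrow>
     cinner V w (u \<oplus> v) = cinner V w u + cinner V w v"
  using form_add[of u v w] form_commute[of "u \<oplus> v" w] form_commute[of u w] form_commute[of v w]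
  by (simp add: add_closed)

lemma form_scale_right:
  "\<lbrakk>v \<in> carrier V; w \<in> carrier V\<rbrakk> \<Longrightarrow> cinner V w (c \<odot> v) = cnj c * cinner V w v"
  using form_scale[of v w c] form_commute[of "c \<odot> v" w] form_commute[of v w]
  by (simp add: scale_closed)

lemma form_self: "v \<in> carrier V \<Longrightarrow> cinner V v v = complex_of_real ((hnorm V v)\<^sup>2)"
  using form_commute[of v v] form_nonneg[of v] by (simp add: hnorm_def complex_eq_iff)

lemma cmod_form_self: "v \<in> carrier V \<Longrightarrow> cmod (cinner V v v) = (hnorm V v)\<^sup>2"
  by (subst form_self) (simp_all only: norm_of_real abs_power2)

lemma seminorm_nonneg: "v \<in> carrier V \<Longrightarrow> 0 \<le> hnorm V v"
  by (simp add: hnorm_def form_nonneg)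

lemma seminorm_add_sq:
  assumes "v \<in> carrier V" "w \<in> carrier V"
  shows "(hnorm V (v \<oplus> w))\<^sup>2 = (hnorm V v)\<^sup>2 + 2 * Re (cinner V v w) + (hnorm V w)\<^sup>2"
  using assms form_commute[of v w] form_nonneg[of v] form_nonneg[of w] form_nonneg[of "v \<oplus> w"]
  by (simp add: hnorm_def form_add form_add_right add_closed)

lemma seminorm_scale: "v \<in> carrier V \<Longrightarrow> hnorm V (c \<odot> v) = cmod c * hnorm V v"
proof -
  assume v: "v \<in> carrier V"
  have "cinner V (c \<odot> v) (c \<odot> v) = (c * cnj c) * cinner V v v"
    using v by (simp add: form_scale form_scale_right scale_closed)
  also have "\<dots> = complex_of_real ((cmod c)\<^sup>2) * cinner V v v"
    by (simp only: complex_norm_square)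
  finally have "Re (cinner V (c \<odot> v) (c \<odot> v)) = (cmod c)\<^sup>2 * Re (cinner V v v)"
    by (simp only: Re_complex_of_real times_complex.sel Im_complex_of_real mult_zero_left diff_zero)
  then show ?thesis by (simp add: hnorm_def real_sqrt_mult)
qed

text \<open>The usual quadratic in \<open>t\<close> is nonnegative. When \<open>w\<close> is a null
  vector it degenerates to an affine function, whose slope must then vanish.\<close>

lemma Re_form_le:
  assumes v: "v \<in> carrier V" and w: "w \<in> carrier V"
  shows "Re (cinner V v w) \<le> hnorm V v * hnorm V w"
proof -
  define r p q where "r = Re (cinner V v w)" and "p = hnorm V v" and "q = hnorm V w"
  have pq: "p \<ge> 0" "q \<ge> 0" using seminorm_nonneg v w by (auto simp: p_def q_def)
  have quad: "0 \<le> p\<^sup>2 + 2 * t * r + t\<^sup>2 * q\<^sup>2" for t :: real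
  proof -
    have "0 \<le> (hnorm V (v \<oplus> complex_of_real t \<odot> w))\<^sup>2" by simp
    also have "\<dots> = p\<^sup>2 + 2 * t * r + t\<^sup>2 * q\<^sup>2"
      using v w by (simp add: seminorm_add_sq form_scale_right seminorm_scale scale_closed
          r_def p_def q_def power_mult_distrib)
    finally show ?thesis .
  qed
  have "r \<le> p * q"
  proof (cases "q = 0")
    case True
    \<comment> \<open>At this \<open>t\<close> the affine function would equal -1.\<close>
    then show ?thesis using quad[of "- (p\<^sup>2 + 1) / (2 * r)"] pq
      by (cases "r = 0") (auto simp: field_simps)
  next
    case False
    then have q: "q\<^sup>2 > 0" by simp
    have "0 \<le> p\<^sup>2 - r\<^sup>2 / q\<^sup>2"
      using quad[of "- r / q\<^sup>2"] q False by (simp add: power2_eq_square field_simps)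
    then have "r\<^sup>2 \<le> (p * q)\<^sup>2" using q by (simp add: field_simps)
    then show ?thesis using pq by (meson abs_le_square_iff abs_ge_self order_trans
      power2_le_imp_le mult_nonneg_nonneg)
  qed
  then show ?thesis by (simp add: r_def p_def q_def)
qed

lemma norm_form_le:
  assumes v: "v \<in> carrier V" and w: "w \<in> carrier V"
  shows "cmod (cinner V v w) \<le> hnorm V v * hnorm V w"
proof (cases "cinner V v w = 0")
  case True
  then show ?thesis using seminorm_nonneg v w by simp
next
  case False
  define z where "z = cinner V v w"
  define c where "c = cnj z / cmod z"
  have z: "z \<noteq> 0" using False by (simp add: z_def)
  then have c: "cmod c = 1" by (simp add: c_def norm_divide)
  have "c * z = complex_of_real (cmod z)"
    using z by (simp add: c_def field_simps complex_norm_square[symmetric] power2_eq_square)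
  then have "cmod z = Re (cinner V (c \<odot> v) w)"
    using v w by (simp add: form_scale z_def)
  also have "\<dots> \<le> hnorm V (c \<odot> v) * hnorm V w"
    using v w by (intro Re_form_le scale_closed)
  finally show ?thesis using v c by (simp add: seminorm_scale z_def)
qed

lemma seminorm_triangle:
  assumes v: "v \<in> carrier V" and w: "w \<in> carrier V"
  shows "hnorm V (v \<oplus> w) \<le> hnorm V v + hnorm V w"
proof (rule power2_le_imp_le)
  show "(hnorm V (v \<oplus> w))\<^sup>2 \<le> (hnorm V v + hnorm V w)\<^sup>2"
    using Re_form_le[OF v w] by (simp add: seminorm_add_sq v w power2_sum)
qed (simp add: v w seminorm_nonneg)

text \<open>The locale has no vector space axioms: sums and multiples only have to be right inside
  the form. Lists under concatenation qualify, and there a difference has to be formed in this way,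
  since a nonempty list has no additive inverse.\<close>

abbreviation sdiff where "sdiff u v \<equiv> u \<oplus> (-1) \<odot> v"

lemma sdiff_closed: "\<lbrakk>u \<in> carrier V; v \<in> carrier V\<rbrakk> \<Longrightarrow> sdiff u v \<in> carrier V"
  by (simp add: add_closed scale_closed)

lemma form_sdiff:
  "\<lbrakk>u \<in> carrier V; v \<in> carrier V; w \<in> carrier V\<rbrakk> \<Longrightarrow>
     cinner V (sdiff u v) w = cinner V u w - cinner V v w"
  "\<lbrakk>u \<in> carrier V; v \<in> carrier V; w \<in> carrier V\<rbrakk> \<Longrightarrow>
     cinner V w (sdiff u v) = cinner V w u - cinner V w v"
  by (simp_all add: form_add form_scale form_add_right form_scale_right scale_closed)

text \<open>The completion consists of conjugate linear functionals. The vector \<open>a\<close> stands for the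
  functional \<open>cinner V a\<close>, and the completion is the closure of these in the dual norm.\<close>

definition approximates :: "'v \<Rightarrow> real \<Rightarrow> ('v \<Rightarrow> complex) \<Rightarrow> bool" where
  "approximates a e l \<longleftrightarrow>
     a \<in> carrier V \<and> (\<forall>x\<in>carrier V. cmod (l x - cinner V a x) \<le> e * hnorm V x)"

definition completion_set :: "('v \<Rightarrow> complex) set" where
  "completion_set = {l. (\<forall>x. x \<notin> carrier V \<longrightarrow> l x = 0) \<and> (\<forall>e>0. \<exists>a. approximates a e l)}"

definition approximant :: "('v \<Rightarrow> complex) \<Rightarrow> nat \<Rightarrow> 'v" where
  "approximant l n = (SOME a. approximates a (1 / Suc n) l)"

text \<open>Functionals identify vectors that differ by a null vector, so no quotient is formed, and
  the pointwise operations satisfy the module laws by computation. The inner product refers to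
  chosen approximants; \<open>completion_form_tendsto\<close> shows that the choice is
  immaterial.\<close>

definition completion :: "('v \<Rightarrow> complex) inner_module" where
  "completion = \<lparr>carrier = completion_set, mult = undefined, one = undefined,
     zero = (\<lambda>_. 0), add = (\<lambda>l k x. l x + k x), smult = (\<lambda>c l x. c * l x),
     cinner = (\<lambda>l k. lim (\<lambda>n. cinner V (approximant l n) (approximant k n)))\<rparr>"

definition embed :: "'v \<Rightarrow> 'v \<Rightarrow> complex" where
  "embed a x = (if x \<in> carrier V then cinner V a x else 0)"

lemma completion_simps:
  "carrier completion = completion_set" "zero completion = (\<lambda>_. 0)"
  "add completion = (\<lambda>l k x. l x + k x)" "smult completion = (\<lambda>c l x. c * l x)"
  "cinner completion = (\<lambda>l k. lim (\<lambda>n. cinner V (approximant l n) (approximant k n)))"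
  by (simp_all add: completion_def)

lemma approximant:
  assumes "l \<in> completion_set" shows "approximates (approximant l n) (1 / Suc n) l"
proof -
  have "\<exists>a. approximates a (1 / Suc n) l" using assms by (simp add: completion_set_def)
  then show ?thesis unfolding approximant_def by (rule someI_ex)
qed

definition converges_to :: "(nat \<Rightarrow> 'v) \<Rightarrow> ('v \<Rightarrow> complex) \<Rightarrow> bool" where
  "converges_to a l \<longleftrightarrow> (\<exists>e. e \<longlonglongrightarrow> 0 \<and> (\<forall>n. approximates (a n) (e n) l))"

lemma converges_to_approximant: "l \<in> completion_set \<Longrightarrow> converges_to (approximant l) l"
  unfolding converges_to_def using approximant LIMSEQ_inverse_real_of_nat
  by (intro exI[of _ "\<lambda>n. 1 / Suc n"]) (auto simp: inverse_eq_divide)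

text \<open>Testing both approximations on the difference \<open>sdiff a b\<close> itself writes its
  squared norm as a difference of two errors; one factor of the norm cancels.\<close>

lemma approximates_dist:
  assumes a: "approximates a e l" and b: "approximates b e' l" and e: "0 \<le> e + e'"
  shows "hnorm V (sdiff a b) \<le> e + e'"
proof -
  let ?c = "sdiff a b"
  have ab: "a \<in> carrier V" "b \<in> carrier V" using a b by (auto simp: approximates_def)
  note c = sdiff_closed[OF ab]
  have "(hnorm V ?c)\<^sup>2 = cmod (cinner V ?c ?c)" by (rule cmod_form_self[OF c, symmetric])
  also have "cinner V ?c ?c = (l ?c - cinner V b ?c) - (l ?c - cinner V a ?c)"
    using form_sdiff(1)[OF ab c] by simp
  also have "cmod \<dots> \<le> e' * hnorm V ?c + e * hnorm V ?c"
    using a b c by (intro order_trans[OF norm_triangle_ineq4 add_mono]) (auto simp: approximates_def)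
  finally have "hnorm V ?c * hnorm V ?c \<le> (e + e') * hnorm V ?c"
    by (simp add: power2_eq_square algebra_simps)
  then show ?thesis using seminorm_nonneg[OF c] e by (cases "hnorm V ?c = 0") auto
qed

text \<open>A tolerance can be negative when the seminorm vanishes identically, so estimates that
  depend on its sign pass to the absolute value.\<close>

lemma approximates_nonneg_or:
  assumes "approximates a e l" shows "approximates a \<bar>e\<bar> l"
  using assms seminorm_nonneg unfolding approximates_def
  by (meson abs_ge_self mult_right_mono order_trans)

lemma seminorm_bounded:
  assumes "converges_to a l"
  obtains M where "\<And>n. hnorm V (a n) \<le> M"
proof -
  obtain e where e: "e \<longlonglongrightarrow> 0" "\<And>n. approximates (a n) (e n) l"
    using assms by (auto simp: converges_to_def)
  obtain E where E: "\<And>n. \<bar>e n\<bar> \<le> E"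
    using convergent_imp_Bseq[OF convergentI[OF e(1)]] by (auto simp: Bseq_def)
  have aV: "a n \<in> carrier V" for n using e(2)[of n] by (simp add: approximates_def)
  have "hnorm V (a n) \<le> hnorm V (a 0) + 2 * E" for n
  proof -
    \<comment> \<open>The two vectors can be different elements of the carrier; it is the form that
      identifies them.\<close>
    have "hnorm V (a n) = hnorm V (sdiff (a n) (a 0) \<oplus> a 0)"
      using form_self[of "a n"] form_self[of "sdiff (a n) (a 0) \<oplus> a 0"]
      using aV by (simp add: hnorm_def form_add form_add_right form_scale form_scale_right
          add_closed scale_closed)
    also have "\<dots> \<le> hnorm V (sdiff (a n) (a 0)) + hnorm V (a 0)"
      using aV by (intro seminorm_triangle sdiff_closed)
    also have "hnorm V (sdiff (a n) (a 0)) \<le> \<bar>e n\<bar> + \<bar>e 0\<bar>"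
      by (rule approximates_dist) (auto intro: approximates_nonneg_or e(2))
    finally show ?thesis using E[of n] E[of 0] by simp
  qed
  then show thesis using that by blast
qed

lemma converges_to_diff:
  assumes a: "converges_to a l" and b: "converges_to b l"
  shows "(\<lambda>n. hnorm V (sdiff (a n) (b n))) \<longlonglongrightarrow> 0"
proof -
  obtain e where e: "e \<longlonglongrightarrow> 0" "\<And>n. approximates (a n) (e n) l"
    using a by (auto simp: converges_to_def)
  obtain e' where e': "e' \<longlonglongrightarrow> 0" "\<And>n. approximates (b n) (e' n) l"
    using b by (auto simp: converges_to_def)
  have aV: "a n \<in> carrier V" "b n \<in> carrier V" for n
    using e(2)[of n] e'(2)[of n] by (simp_all add: approximates_def)
  show ?thesis
  proof (rule tendsto_sandwich)
    show "\<forall>\<^sub>F n in sequentially. 0 \<le> hnorm V (sdiff (a n) (b n))"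
      using aV by (simp add: seminorm_nonneg sdiff_closed)
    show "\<forall>\<^sub>F n in sequentially. hnorm V (sdiff (a n) (b n)) \<le> \<bar>e n\<bar> + \<bar>e' n\<bar>"
      by (intro always_eventually allI approximates_dist)
        (auto intro: approximates_nonneg_or e(2) e'(2))
    show "(\<lambda>n. \<bar>e n\<bar> + \<bar>e' n\<bar>) \<longlonglongrightarrow> 0"
      using tendsto_add[OF tendsto_rabs_zero[OF e(1)] tendsto_rabs_zero[OF e'(1)]] by simp
  qed auto
qed

lemma form_diff_le:
  assumes V: "u \<in> carrier V" "v \<in> carrier V" "w \<in> carrier V" "z \<in> carrier V"
    and le: "hnorm V (sdiff u v) \<le> p" "hnorm V w \<le> M" "hnorm V v \<le> M'" "hnorm V (sdiff w z) \<le> q"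
  shows "cmod (cinner V u w - cinner V v z) \<le> p * M + M' * q"
proof -
  note n = seminorm_nonneg[OF sdiff_closed[OF V(1,2)]] seminorm_nonneg[OF V(3)]
    seminorm_nonneg[OF V(2)] seminorm_nonneg[OF sdiff_closed[OF V(3,4)]]
  have "cinner V u w - cinner V v z = cinner V (sdiff u v) w + cinner V v (sdiff w z)"
    using V by (simp add: form_sdiff)
  then have "cmod (cinner V u w - cinner V v z) \<le> cmod (cinner V (sdiff u v) w) + cmod (cinner V v (sdiff w z))"
    by (simp only: norm_triangle_ineq)
  also have "\<dots> \<le> hnorm V (sdiff u v) * hnorm V w + hnorm V v * hnorm V (sdiff w z)"
    using norm_form_le[OF sdiff_closed[OF V(1,2)] V(3)] norm_form_le[OF V(2) sdiff_closed[OF V(3,4)]]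
    by (rule add_mono)
  also have "\<dots> \<le> p * M + M' * q"
    using mult_mono[OF le(1,2) order_trans[OF n(1) le(1)] n(2)]
      mult_mono[OF le(3,4) order_trans[OF n(3) le(3)] n(4)] by (rule add_mono)
  finally show ?thesis .
qed

text \<open>Approximating sequences of the same functional get arbitrarily close in norm and stay
  bounded, so the limit of the form depends on the functionals alone.\<close>

lemma form_diff_tendsto:
  assumes a: "converges_to a l" and b: "converges_to b l"
    and c: "converges_to c k" and d: "converges_to d k"
  shows "(\<lambda>n. cinner V (a n) (c n) - cinner V (b n) (d n)) \<longlonglongrightarrow> 0"
proof -
  have V: "a n \<in> carrier V" "b n \<in> carrier V" "c n \<in> carrier V" "d n \<in> carrier V" for n
    using a b c d by (auto simp: converges_to_def approximates_def)
  obtain M where M: "\<And>n. hnorm V (c n) \<le> M" using seminorm_bounded[OF c] by blast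
  obtain M' where M': "\<And>n. hnorm V (b n) \<le> M'" using seminorm_bounded[OF b] by blast
  have le: "cmod (cinner V (a n) (c n) - cinner V (b n) (d n))
     \<le> hnorm V (sdiff (a n) (b n)) * M + M' * hnorm V (sdiff (c n) (d n))" for n
    by (rule form_diff_le[OF V order_refl M M' order_refl])
  have "(\<lambda>n. hnorm V (sdiff (a n) (b n)) * M + M' * hnorm V (sdiff (c n) (d n))) \<longlonglongrightarrow> 0 * M + M' * 0"
    by (intro tendsto_intros converges_to_diff[OF a b] converges_to_diff[OF c d])
  then show ?thesis
    using Lim_null_comparison[OF always_eventually[OF allI[OF le]]] by simp
qed

lemma approximant_convergent:
  assumes l: "l \<in> completion_set" and k: "k \<in> completion_set"
  shows "convergent (\<lambda>n. cinner V (approximant l n) (approximant k n))"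
proof -
  let ?a = "approximant l" and ?c = "approximant k"
  have V: "?a n \<in> carrier V" "?c n \<in> carrier V" for n
    using approximant[OF l] approximant[OF k] by (auto simp: approximates_def)
  obtain M where M: "\<And>n. hnorm V (?c n) \<le> M"
    using seminorm_bounded[OF converges_to_approximant[OF k]] by blast
  obtain M' where M': "\<And>n. hnorm V (?a n) \<le> M'"
    using seminorm_bounded[OF converges_to_approximant[OF l]] by blast
  have M0: "M \<ge> 0" "M' \<ge> 0" using M M' V seminorm_nonneg order_trans by blast+
  have le: "cmod (cinner V (?a m) (?c m) - cinner V (?a n) (?c n))
     \<le> (1 / Suc m + 1 / Suc n) * (M + M')" for m n
  proof -
    have "cmod (cinner V (?a m) (?c m) - cinner V (?a n) (?c n))
        \<le> (1 / Suc m + 1 / Suc n) * M + M' * (1 / Suc m + 1 / Suc n)"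
      by (rule form_diff_le[OF V(1) V(1) V(2) V(2) approximates_dist[OF approximant[OF l] approximant[OF l]] M M'
        approximates_dist[OF approximant[OF k] approximant[OF k]]]) simp_all
    then show ?thesis by (simp only: distrib_left[of _ M M'] mult.commute[of M'])
  qed
  have "Cauchy (\<lambda>n. cinner V (?a n) (?c n))"
  proof (rule metric_CauchyI)
    fix e :: real assume e: "e > 0"
    define D where "D = M + M' + 1"
    have D: "D > 0" using M0 by (simp add: D_def)
    obtain n0 where n0: "1 / real (Suc n0) < e / (2 * D)"
      using nat_approx_posE[of "e / (2 * D)"] e D by auto
    have "dist (cinner V (?a m) (?c m)) (cinner V (?a n) (?c n)) < e" if "m \<ge> n0" "n \<ge> n0" for m n
    proof -
      have mn: "1 / real (Suc m) < e / (2 * D)" "1 / real (Suc n) < e / (2 * D)"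
        using that n0 by (smt (verit) frac_le of_nat_mono Suc_le_mono of_nat_0_less_iff zero_less_Suc)+
      have "(1 / Suc m + 1 / Suc n) * (M + M') \<le> (1 / Suc m + 1 / Suc n) * D"
        by (intro mult_left_mono) (auto simp: D_def)
      also have "\<dots> < (e / (2 * D) + e / (2 * D)) * D"
        using mn D by (intro mult_strict_right_mono add_strict_mono)
      also have "\<dots> = e" using D by (simp add: field_simps)
      finally show ?thesis using le[of m n] by (simp add: dist_norm)
    qed
    then show "\<exists>M. \<forall>m\<ge>M. \<forall>n\<ge>M. dist (cinner V (?a m) (?c m)) (cinner V (?a n) (?c n)) < e" by blast
  qed
  then show ?thesis by (simp add: Cauchy_convergent)
qed

lemma completion_form_tendsto:
  assumes l: "l \<in> completion_set" and k: "k \<in> completion_set"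
    and a: "converges_to a l" and c: "converges_to c k"
  shows "(\<lambda>n. cinner V (a n) (c n)) \<longlonglongrightarrow> cinner completion l k"
proof -
  have 1: "(\<lambda>n. cinner V (approximant l n) (approximant k n)) \<longlonglongrightarrow> cinner completion l k"
    using approximant_convergent[OF l k] by (simp add: completion_simps convergent_LIMSEQ_iff)
  show ?thesis
    using tendsto_add[OF form_diff_tendsto[OF a converges_to_approximant[OF l] c
        converges_to_approximant[OF k]] 1] by simp
qed

lemma approximates_embed: "a \<in> carrier V \<Longrightarrow> approximates a 0 (embed a)"
  by (simp add: approximates_def embed_def)

lemma embed_in_completion: "a \<in> carrier V \<Longrightarrow> embed a \<in> completion_set"
proof -
  assume a: "a \<in> carrier V"
  have "approximates a e (embed a)" if "e > 0" for e
    using that seminorm_nonneg a by (simp add: approximates_def embed_def)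
  then show ?thesis by (auto simp: completion_set_def embed_def)
qed

lemma converges_to_embed: "a \<in> carrier V \<Longrightarrow> converges_to (\<lambda>_. a) (embed a)"
  unfolding converges_to_def using approximates_embed by (intro exI[of _ "\<lambda>_. 0"]) simp

lemma cinner_embed:
  assumes "a \<in> carrier V" "b \<in> carrier V"
  shows "cinner completion (embed a) (embed b) = cinner V a b"
  using completion_form_tendsto[OF embed_in_completion embed_in_completion
      converges_to_embed converges_to_embed, OF assms assms]
  by (simp add: LIMSEQ_const_iff)

lemma embed_add:
  "\<lbrakk>a \<in> carrier V; b \<in> carrier V\<rbrakk> \<Longrightarrow> embed (a \<oplus> b) = embed a \<oplus>\<^bsub>completion\<^esub> embed b"
  by (auto simp: embed_def completion_simps form_add)

lemma embed_scale: "a \<in> carrier V \<Longrightarrow> embed (c \<odot> a) = c \<odot>\<^bsub>completion\<^esub> embed a"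
  by (auto simp: embed_def completion_simps form_scale)

lemma converges_to_map:
  assumes a: "converges_to a l"
    and T: "\<And>b e. approximates b e l \<Longrightarrow> approximates (f b) (C * \<bar>e\<bar>) k"
  shows "converges_to (\<lambda>n. f (a n)) k"
proof -
  obtain e where e: "e \<longlonglongrightarrow> 0" "\<And>n. approximates (a n) (e n) l"
    using a by (auto simp: converges_to_def)
  have "(\<lambda>n. C * \<bar>e n\<bar>) \<longlonglongrightarrow> 0" using tendsto_mult[OF tendsto_const tendsto_rabs_zero[OF e(1)]] by simp
  then show ?thesis unfolding converges_to_def using T[OF e(2)] by blast
qed

lemma in_completion_converges:
  "l \<in> completion_set \<longleftrightarrow> (\<forall>x. x \<notin> carrier V \<longrightarrow> l x = 0) \<and> (\<exists>a. converges_to a l)"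
proof
  assume "(\<forall>x. x \<notin> carrier V \<longrightarrow> l x = 0) \<and> (\<exists>a. converges_to a l)"
  then obtain a e where l: "\<And>x. x \<notin> carrier V \<Longrightarrow> l x = 0"
    and e: "e \<longlonglongrightarrow> 0" "\<And>n. approximates (a n) (e n) l" by (auto simp: converges_to_def)
  have "\<exists>b. approximates b \<epsilon> l" if eps: "\<epsilon> > 0" for \<epsilon> :: real
  proof -
    obtain n where "e n < \<epsilon>"
      using order_tendstoD(2)[OF e(1) eps] by (auto simp: eventually_sequentially)
    then have "approximates (a n) \<epsilon> l"
      using e(2)[of n] seminorm_nonneg unfolding approximates_def
      by (meson mult_right_mono order_trans less_imp_le)
    then show ?thesis by blast
  qed
  then show "l \<in> completion_set" using l by (simp add: completion_set_def)
qed (use converges_to_approximant in \<open>auto simp: completion_set_def\<close>)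

lemma converges_to_add:
  assumes "converges_to a l" "converges_to b k"
  shows "converges_to (\<lambda>n. a n \<oplus> b n) (l \<oplus>\<^bsub>completion\<^esub> k)"
proof -
  obtain e where e: "e \<longlonglongrightarrow> 0" "\<And>n. approximates (a n) (e n) l"
    using assms by (auto simp: converges_to_def)
  obtain e' where e': "e' \<longlonglongrightarrow> 0" "\<And>n. approximates (b n) (e' n) k"
    using assms by (auto simp: converges_to_def)
  have "approximates (a n \<oplus> b n) (e n + e' n) (l \<oplus>\<^bsub>completion\<^esub> k)" for n
    unfolding approximates_def
  proof (intro conjI ballI)
    have ab: "a n \<in> carrier V" "b n \<in> carrier V" using e(2)[of n] e'(2)[of n]
      by (auto simp: approximates_def)
    then show "a n \<oplus> b n \<in> carrier V" by (rule add_closed)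
    fix x assume x: "x \<in> carrier V"
    have "cmod ((l x - cinner V (a n) x) + (k x - cinner V (b n) x)) \<le> e n * hnorm V x + e' n * hnorm V x"
      using e(2)[of n] e'(2)[of n] x by (intro order_trans[OF norm_triangle_ineq add_mono]) (auto simp: approximates_def)
    then show "cmod ((l \<oplus>\<^bsub>completion\<^esub> k) x - cinner V (a n \<oplus> b n) x) \<le> (e n + e' n) * hnorm V x"
      using ab x by (simp add: completion_simps form_add algebra_simps)
  qed
  then show ?thesis unfolding converges_to_def using tendsto_add[OF e(1) e'(1)] by auto
qed

lemma converges_to_scale:
  assumes "converges_to a l"
  shows "converges_to (\<lambda>n. c \<odot> a n) (c \<odot>\<^bsub>completion\<^esub> l)"
proof (rule converges_to_map[OF assms, where C = "cmod c"])
  fix b e assume "approximates b e l"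
  then have b: "b \<in> carrier V" "\<And>x. x \<in> carrier V \<Longrightarrow> cmod (l x - cinner V b x) \<le> \<bar>e\<bar> * hnorm V x"
    using approximates_nonneg_or[of b e l] by (auto simp: approximates_def)
  show "approximates (c \<odot> b) (cmod c * \<bar>e\<bar>) (c \<odot>\<^bsub>completion\<^esub> l)"
    unfolding approximates_def
  proof (intro conjI ballI scale_closed b)
    fix x assume x: "x \<in> carrier V"
    have "cmod (c * (l x - cinner V b x)) \<le> cmod c * (\<bar>e\<bar> * hnorm V x)"
      using b(2)[OF x] by (simp add: norm_mult mult_left_mono)
    then show "cmod ((c \<odot>\<^bsub>completion\<^esub> l) x - cinner V (c \<odot> b) x) \<le> cmod c * \<bar>e\<bar> * hnorm V x"
      using b(1) x by (simp add: completion_simps form_scale algebra_simps)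
  qed
qed

section \<open>Hilbert space structure of the completion\<close>

lemma completion_closed:
  assumes "l \<in> completion_set"
  shows "k \<in> completion_set \<Longrightarrow> l \<oplus>\<^bsub>completion\<^esub> k \<in> completion_set" "c \<odot>\<^bsub>completion\<^esub> l \<in> completion_set"
proof -
  obtain a where a: "converges_to a l" using assms in_completion_converges by blast
  show "c \<odot>\<^bsub>completion\<^esub> l \<in> completion_set"
    unfolding in_completion_converges using assms converges_to_scale[OF a, of c]
    by (auto simp: completion_set_def completion_simps)
  assume k: "k \<in> completion_set"
  then obtain b where b: "converges_to b k" using in_completion_converges by blast
  show "l \<oplus>\<^bsub>completion\<^esub> k \<in> completion_set"
    unfolding in_completion_converges using assms k converges_to_add[OF a b]
    by (auto simp: completion_set_def completion_simps)
qed

text \<open>Evaluation at \<open>x\<close> is the inner product with \<open>embed x\<close>, as in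
  the Riesz representation. Together with \<open>dual_norm_le\<close> this makes the norm of the
  completion the dual norm of functionals.\<close>

lemma norm_completion_ge:
  assumes l: "l \<in> completion_set" and x: "x \<in> carrier V"
  shows "cmod (l x) \<le> hnorm completion l * hnorm V x"
    and "0 \<le> Re (cinner completion l l)" and "cinner completion l (embed x) = l x"
proof -
  let ?a = "approximant l"
  note c = converges_to_approximant[OF l]
  have V: "?a n \<in> carrier V" for n using approximant[OF l] by (auto simp: approximates_def)
  note t = completion_form_tendsto[OF l l c c]
  show n: "0 \<le> Re (cinner completion l l)"
    by (rule tendsto_lowerbound[OF tendsto_Re[OF t]]) (auto simp: form_nonneg V)
  have t': "(\<lambda>n. hnorm V (?a n)) \<longlonglongrightarrow> hnorm completion l"
    unfolding hnorm_def by (intro tendsto_real_sqrt tendsto_Re t)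
  have e0: "(\<lambda>n. 1 / real (Suc n) * hnorm V x) \<longlonglongrightarrow> 0"
    using tendsto_mult_right_zero[OF LIMSEQ_inverse_real_of_nat, of "hnorm V x"]
    by (simp add: inverse_eq_divide)
  have "(\<lambda>n. l x - cinner V (?a n) x) \<longlonglongrightarrow> 0"
    by (rule Lim_null_comparison[OF always_eventually e0])
      (use approximant[OF l] x in \<open>auto simp: approximates_def\<close>)
  then have lim: "(\<lambda>n. cinner V (?a n) x) \<longlonglongrightarrow> l x"
    using tendsto_diff[OF tendsto_const[of "l x"]] by fastforce
  show "cinner completion l (embed x) = l x"
    using LIMSEQ_unique[OF completion_form_tendsto[OF l embed_in_completion[OF x] c
      converges_to_embed[OF x]] lim] .
  show "cmod (l x) \<le> hnorm completion l * hnorm V x"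
    by (rule LIMSEQ_le[OF tendsto_norm[OF lim] tendsto_mult_right[OF t']])
      (use norm_form_le V x in blast)
qed

lemma inner_product_space_completion: "inner_product_space completion"
proof (intro inner_product_space.intro moduleI inner_product_space_axioms.intro cring_complex_ring)
  show "abelian_group completion"
  proof (rule abelian_groupI)
    obtain z where z: "z \<in> carrier V" using nonempty by blast
    have "(\<lambda>x. 0 * embed z x) \<in> completion_set"
      using completion_closed(2)[OF embed_in_completion[OF z], of 0] by (simp add: completion_simps)
    then show "\<zero>\<^bsub>completion\<^esub> \<in> carrier completion" by (simp add: completion_simps)
    fix l assume l: "l \<in> carrier completion"
    show "\<exists>k\<in>carrier completion. k \<oplus>\<^bsub>completion\<^esub> l = \<zero>\<^bsub>completion\<^esub>"
      using completion_closed(2)[of l "-1"] l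
      by (intro bexI[of _ "(-1) \<odot>\<^bsub>completion\<^esub> l"]) (auto simp: completion_simps)
  qed (use completion_closed in \<open>auto simp: completion_simps algebra_simps\<close>)
  fix u v w assume u: "u \<in> carrier completion" and v: "v \<in> carrier completion" and w: "w \<in> carrier completion"
  then have s: "u \<in> completion_set" "v \<in> completion_set" "w \<in> completion_set" by (simp_all add: completion_simps)
  note cu = converges_to_approximant[OF s(1)] and cv = converges_to_approximant[OF s(2)]
    and cw = converges_to_approximant[OF s(3)]
  have V: "approximant u n \<in> carrier V" "approximant v n \<in> carrier V" "approximant w n \<in> carrier V" for n
    using s approximant by (auto simp: approximates_def)
  show "cinner completion (u \<oplus>\<^bsub>completion\<^esub> v) w = cinner completion u w + cinner completion v w"
  proof (rule LIMSEQ_unique)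
    show "(\<lambda>n. cinner V (approximant u n \<oplus> approximant v n) (approximant w n)) \<longlonglongrightarrow>
        cinner completion (u \<oplus>\<^bsub>completion\<^esub> v) w"
      by (intro completion_form_tendsto completion_closed s converges_to_add cu cv cw)
    show "(\<lambda>n. cinner V (approximant u n \<oplus> approximant v n) (approximant w n)) \<longlonglongrightarrow>
        cinner completion u w + cinner completion v w"
      using tendsto_add[OF completion_form_tendsto[OF s(1,3) cu cw] completion_form_tendsto[OF s(2,3) cv cw]]
      by (simp add: form_add V)
  qed
next
  fix v w c assume v: "v \<in> carrier completion" and w: "w \<in> carrier completion"
  then have s: "v \<in> completion_set" "w \<in> completion_set" by (simp_all add: completion_simps)
  note cv = converges_to_approximant[OF s(1)] and cw = converges_to_approximant[OF s(2)]
  have V: "approximant v n \<in> carrier V" "approximant w n \<in> carrier V" for n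
    using s approximant by (auto simp: approximates_def)
  show "cinner completion w v = cnj (cinner completion v w)"
  proof (rule LIMSEQ_unique)
    show "(\<lambda>n. cinner V (approximant w n) (approximant v n)) \<longlonglongrightarrow> cinner completion w v"
      by (intro completion_form_tendsto s cv cw)
    have "(\<lambda>n. cnj (cinner V (approximant v n) (approximant w n))) \<longlonglongrightarrow> cnj (cinner completion v w)"
      by (intro tendsto_cnj completion_form_tendsto s cv cw)
    then show "(\<lambda>n. cinner V (approximant w n) (approximant v n)) \<longlonglongrightarrow> cnj (cinner completion v w)"
      using form_commute[OF V] by simp
  qed
  show "cinner completion (c \<odot>\<^bsub>completion\<^esub> v) w = c * cinner completion v w"
  proof (rule LIMSEQ_unique)
    show "(\<lambda>n. cinner V (c \<odot> approximant v n) (approximant w n)) \<longlonglongrightarrow> cinner completion (c \<odot>\<^bsub>completion\<^esub> v) w"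
      by (intro completion_form_tendsto completion_closed s converges_to_scale cv cw)
    show "(\<lambda>n. cinner V (c \<odot> approximant v n) (approximant w n)) \<longlonglongrightarrow> c * cinner completion v w"
      using tendsto_mult_left[OF completion_form_tendsto[OF s cv cw], of c] by (simp add: form_scale V)
  qed
next
  fix v assume v: "v \<in> carrier completion" "v \<noteq> \<zero>\<^bsub>completion\<^esub>"
  then obtain x where x: "v x \<noteq> 0" by (auto simp: completion_simps)
  then have xV: "x \<in> carrier V" using v by (auto simp: completion_simps completion_set_def)
  show "0 < Re (cinner completion v v)"
  \<comment> \<open>Definiteness: by the dual norm estimate, a functional of norm zero vanishes at
    every vector.\<close>
  proof (rule ccontr)
    assume "\<not> 0 < Re (cinner completion v v)"
    then have "hnorm completion v = 0"
      using norm_completion_ge(2)[of v x] v xV by (simp add: completion_simps(1) hnorm_def)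
    then show False using norm_completion_ge(1)[of v x] v xV x by (simp add: completion_simps(1))
  qed
qed (auto simp: completion_simps(1) completion_closed, auto simp: completion_simps algebra_simps)

text \<open>The approximants are themselves test vectors: at its n-th approximant, \<open>l\<close>
  equals the squared norm of that approximant up to 1/(n+1) times the norm. So the approximants have
  norm at most \<open>e\<close> + 1/(n+1).\<close>

lemma dual_norm_le:
  assumes l: "l \<in> completion_set" and e: "0 \<le> e"
    and le: "\<And>x. x \<in> carrier V \<Longrightarrow> cmod (l x) \<le> e * hnorm V x"
  shows "hnorm completion l \<le> e"
proof -
  let ?a = "approximant l"
  note c = converges_to_approximant[OF l]
  have V: "?a n \<in> carrier V" for n using approximant[OF l] by (auto simp: approximates_def)
  have t: "(\<lambda>n. hnorm V (?a n)) \<longlonglongrightarrow> hnorm completion l"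
    unfolding hnorm_def by (intro tendsto_real_sqrt tendsto_Re completion_form_tendsto[OF l l c c])
  have b: "hnorm V (?a n) \<le> 1 / Suc n + e" for n
  proof -
    have "(hnorm V (?a n))\<^sup>2 = cmod (cinner V (?a n) (?a n))" by (rule cmod_form_self[OF V, symmetric])
    also have "\<dots> = cmod (l (?a n) - (l (?a n) - cinner V (?a n) (?a n)))" by simp
    also have "\<dots> \<le> e * hnorm V (?a n) + 1 / Suc n * hnorm V (?a n)"
      using le[OF V[of n]] approximant[OF l, of n] V[of n]
      by (intro order_trans[OF norm_triangle_ineq4 add_mono]) (auto simp: approximates_def)
    finally have "hnorm V (?a n) * hnorm V (?a n) \<le> (1 / Suc n + e) * hnorm V (?a n)"
      by (simp add: power2_eq_square algebra_simps)
    then show ?thesis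
      using seminorm_nonneg[OF V[of n]] e by (cases "hnorm V (?a n) = 0") auto
  qed
  have "(\<lambda>n. 1 / real (Suc n) + e) \<longlonglongrightarrow> 0 + e"
    using LIMSEQ_inverse_real_of_nat by (intro tendsto_add) (auto simp: inverse_eq_divide)
  from LIMSEQ_le[OF t this] b show ?thesis by simp
qed

text \<open>A Cauchy sequence of functionals converges pointwise, uniformly relative to the
  seminorm. This uniformity puts the limit into the closure of the embedded vectors, and
  \<open>dual_norm_le\<close> turns it back into convergence in norm.\<close>

lemma hilbert_space_completion: "hilbert_space completion"
proof -
  interpret K: inner_product_space completion by (rule inner_product_space_completion)
  have minus: "l \<ominus>\<^bsub>completion\<^esub> k = (\<lambda>x. l x - k x)"
    if "l \<in> carrier completion" "k \<in> carrier completion" for l k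
    using that by (simp add: a_minus_def K.minus_eq_smult) (simp add: completion_simps)
  have "K.mcomplete"
    unfolding K.mcomplete_def
  proof (intro allI impI)
    fix \<sigma> assume C: "K.MCauchy \<sigma>"
    have \<sigma>: "\<sigma> n \<in> carrier completion" for n using C by (auto simp: K.MCauchy_def)
    then have s: "\<sigma> n \<in> completion_set" for n by (simp add: completion_simps)
    have Ce: "\<exists>N. \<forall>m n x. N \<le> m \<longrightarrow> N \<le> n \<longrightarrow> x \<in> carrier V \<longrightarrow> cmod (\<sigma> m x - \<sigma> n x) \<le> e * hnorm V x"
      if e: "e > 0" for e
    proof -
      obtain N where N: "\<And>m n. \<lbrakk>N \<le> m; N \<le> n\<rbrakk> \<Longrightarrow> hdist completion (\<sigma> m) (\<sigma> n) < e"
        using C e unfolding K.MCauchy_def by blast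
      have "cmod (\<sigma> m x - \<sigma> n x) \<le> e * hnorm V x" if "N \<le> m" "N \<le> n" "x \<in> carrier V" for m n x
      proof -
        have "cmod (\<sigma> m x - \<sigma> n x) \<le> hnorm completion (\<sigma> m \<ominus>\<^bsub>completion\<^esub> \<sigma> n) * hnorm V x"
          using norm_completion_ge(1)[of "\<sigma> m \<ominus>\<^bsub>completion\<^esub> \<sigma> n" x] that \<sigma> K.M.minus_closed[of "\<sigma> m" "\<sigma> n"]
          by (simp add: minus completion_simps(1))
        also have "\<dots> \<le> e * hnorm V x"
          using N[OF that(1,2)] \<sigma> seminorm_nonneg[OF that(3)]
          by (intro mult_right_mono) (auto simp: hdist_def)
        finally show ?thesis .
      qed
      then show ?thesis by blast
    qed
    have conv: "convergent (\<lambda>n. \<sigma> n x)" if x: "x \<in> carrier V" for x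
    proof -
      have "Cauchy (\<lambda>n. \<sigma> n x)"
      proof (rule metric_CauchyI)
        fix e :: real assume e: "e > 0"
        define h where "h = hnorm V x + 1"
        have h: "h > 0" using seminorm_nonneg[OF x] by (simp add: h_def)
        obtain N where N: "\<And>m n x. \<lbrakk>N \<le> m; N \<le> n; x \<in> carrier V\<rbrakk> \<Longrightarrow> cmod (\<sigma> m x - \<sigma> n x) \<le> e / h * hnorm V x"
          using Ce[of "e / h"] e h by (meson divide_pos_pos)
        have "e / h * hnorm V x < e"
          using e h seminorm_nonneg[OF x] by (simp add: h_def pos_divide_less_eq)
        then show "\<exists>M. \<forall>m\<ge>M. \<forall>n\<ge>M. dist (\<sigma> m x) (\<sigma> n x) < e"
          using le_less_trans[OF N[OF _ _ x]] unfolding dist_norm by blast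
      qed
      then show ?thesis by (simp add: Cauchy_convergent)
    qed
    define l where "l x = (if x \<in> carrier V then lim (\<lambda>n. \<sigma> n x) else 0)" for x
    have lim: "(\<lambda>n. \<sigma> n x) \<longlonglongrightarrow> l x" if "x \<in> carrier V" for x
      using conv[OF that] that by (simp add: l_def convergent_LIMSEQ_iff)
    have close: "\<exists>N. \<forall>m x. N \<le> m \<longrightarrow> x \<in> carrier V \<longrightarrow> cmod (\<sigma> m x - l x) \<le> e * hnorm V x" if e: "e > 0" for e
    proof -
      obtain N where N: "\<And>m n x. \<lbrakk>N \<le> m; N \<le> n; x \<in> carrier V\<rbrakk> \<Longrightarrow> cmod (\<sigma> m x - \<sigma> n x) \<le> e * hnorm V x"
        using Ce[OF e] by blast
      have "cmod (\<sigma> m x - l x) \<le> e * hnorm V x" if "N \<le> m" "x \<in> carrier V" for m x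
        by (rule tendsto_upperbound[OF tendsto_norm[OF tendsto_diff[OF tendsto_const lim[OF that(2)]]]])
          (use N that in \<open>auto simp: eventually_sequentially\<close>)
      then show ?thesis by blast
    qed
    have "l \<in> completion_set"
      unfolding completion_set_def
    proof (intro CollectI conjI allI impI)
      fix e :: real assume e: "e > 0"
      obtain N where N: "\<And>m x. \<lbrakk>N \<le> m; x \<in> carrier V\<rbrakk> \<Longrightarrow> cmod (\<sigma> m x - l x) \<le> e / 2 * hnorm V x"
        using close[of "e / 2"] e by auto
      obtain a where a: "approximates a (e / 2) (\<sigma> N)"
        using s[of N] half_gt_zero[OF e] unfolding completion_set_def by blast
      have "approximates a e l"
        unfolding approximates_def
      proof (intro conjI ballI)
        show "a \<in> carrier V" using a by (simp add: approximates_def)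
        fix x assume x: "x \<in> carrier V"
        have "cmod ((\<sigma> N x - cinner V a x) - (\<sigma> N x - l x)) \<le> e / 2 * hnorm V x + e / 2 * hnorm V x"
          using a N[OF _ x, of N] x by (intro order_trans[OF norm_triangle_ineq4 add_mono]) (auto simp: approximates_def)
        then show "cmod (l x - cinner V a x) \<le> e * hnorm V x" by simp
      qed
      then show "\<exists>a. approximates a e l" by blast
    qed (simp add: l_def)
    then have l: "l \<in> carrier completion" by (simp add: completion_simps)
    have "limitin K.mtopology \<sigma> l sequentially"
      unfolding K.limit_metric_sequentially
    proof (intro conjI allI impI l)
      fix e :: real assume e: "e > 0"
      then have e2: "e / 2 > 0" by simp
      obtain N where N: "\<And>m x. \<lbrakk>N \<le> m; x \<in> carrier V\<rbrakk> \<Longrightarrow> cmod (\<sigma> m x - l x) \<le> e / 2 * hnorm V x"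
        using close[OF e2] by blast
      have "hdist completion (\<sigma> n) l < e" if "n \<ge> N" for n
      proof -
        have "hnorm completion (\<sigma> n \<ominus>\<^bsub>completion\<^esub> l) \<le> e / 2"
          by (rule dual_norm_le)
            (use N that \<sigma> l e K.M.minus_closed[of "\<sigma> n" l] in \<open>auto simp: minus completion_simps(1)\<close>)
        then show ?thesis using e \<sigma> l by (simp add: hdist_def)
      qed
      then show "\<exists>N. \<forall>n\<ge>N. \<sigma> n \<in> carrier completion \<and> hdist completion (\<sigma> n) l < e" using \<sigma> by blast
    qed
    then show "\<exists>x. limitin K.mtopology \<sigma> x sequentially" by blast
  qed
  then show ?thesis by unfold_locales
qed

text \<open>The argument \<open>T'\<close> is the adjoint of the operator that is extended.\<close>

definition lift :: "('v \<Rightarrow> 'v) \<Rightarrow> ('v \<Rightarrow> complex) \<Rightarrow> 'v \<Rightarrow> complex" where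
  "lift T' l x = (if x \<in> carrier V then l (T' x) else 0)"

text \<open>Both bounds enter: that of \<open>T'\<close> keeps approximations under control, that of
  \<open>T\<close> bounds the lifted operator. The lift is linear in any case, since it evaluates
  functionals at \<open>T' x\<close>.\<close>

definition adjoint_pair :: "('v \<Rightarrow> 'v) \<Rightarrow> ('v \<Rightarrow> 'v) \<Rightarrow> bool" where
  "adjoint_pair T T' \<longleftrightarrow> T \<in> carrier V \<rightarrow> carrier V \<and> T' \<in> carrier V \<rightarrow> carrier V \<and>
     (\<forall>u\<in>carrier V. \<forall>v\<in>carrier V. cinner V (T u) v = cinner V u (T' v)) \<and>
     (\<exists>C. \<forall>u\<in>carrier V. hnorm V (T u) \<le> C * hnorm V u) \<and>
     (\<exists>C. \<forall>u\<in>carrier V. hnorm V (T' u) \<le> C * hnorm V u)"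

lemma adjoint_pair_commute: "adjoint_pair T T' \<Longrightarrow> adjoint_pair T' T"
proof -
  assume T: "adjoint_pair T T'"
  have "cinner V (T' u) v = cinner V u (T v)" if uv: "u \<in> carrier V" "v \<in> carrier V" for u v
  proof -
    have V: "T v \<in> carrier V" "T' u \<in> carrier V" using T uv by (auto simp: adjoint_pair_def)
    have "cinner V (T v) u = cinner V v (T' u)" using T uv by (simp add: adjoint_pair_def)
    then show ?thesis using form_commute[OF V(1) uv(1)] form_commute[OF uv(2) V(2)] by simp
  qed
  then show ?thesis using T by (simp add: adjoint_pair_def)
qed

lemma converges_to_lift:
  assumes T: "adjoint_pair T T'" and a: "converges_to a l"
  shows "converges_to (\<lambda>n. T (a n)) (lift T' l)"
proof -
  obtain C where C: "\<And>u. u \<in> carrier V \<Longrightarrow> hnorm V (T' u) \<le> C * hnorm V u"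
    using T unfolding adjoint_pair_def by blast
  show ?thesis
  proof (rule converges_to_map[OF a, of T C])
    fix b e assume b: "approximates b e l"
    have bV: "b \<in> carrier V" using b by (simp add: approximates_def)
    show "approximates (T b) (C * \<bar>e\<bar>) (lift T' l)"
      unfolding approximates_def
    proof (intro conjI ballI)
      show "T b \<in> carrier V" using T bV by (auto simp: adjoint_pair_def)
      fix x assume x: "x \<in> carrier V"
      then have T'x: "T' x \<in> carrier V" using T by (auto simp: adjoint_pair_def)
      have "cmod (l (T' x) - cinner V b (T' x)) \<le> \<bar>e\<bar> * hnorm V (T' x)"
        using approximates_nonneg_or[OF b] T'x by (simp add: approximates_def)
      also have "\<dots> \<le> \<bar>e\<bar> * (C * hnorm V x)" using C[OF x] by (intro mult_left_mono) auto
      also have "cinner V b (T' x) = cinner V (T b) x" using T bV x by (simp add: adjoint_pair_def)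
      finally show "cmod (lift T' l x - cinner V (T b) x) \<le> C * \<bar>e\<bar> * hnorm V x"
        using x by (simp add: lift_def algebra_simps)
    qed
  qed
qed

lemma lift_in_completion:
  assumes T: "adjoint_pair T T'" and l: "l \<in> carrier completion"
  shows "lift T' l \<in> carrier completion"
  unfolding completion_simps(1) in_completion_converges
  using converges_to_lift[OF T converges_to_approximant] l by (auto simp: completion_simps(1) lift_def)

lemma clinear_map_lift:
  assumes T: "adjoint_pair T T'"
  shows "clinear_map completion completion (lift T')"
  unfolding clinear_map_def
proof (intro conjI ballI allI)
  show "lift T' \<in> carrier completion \<rightarrow> carrier completion" using lift_in_completion[OF T] by blast
qed (simp_all add: completion_simps(2-4) lift_def fun_eq_iff)

lemma bounded_operator_lift:
  assumes T: "adjoint_pair T T'"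
  shows "bounded_operator completion (lift T')"
proof -
  obtain C where C: "\<And>u. u \<in> carrier V \<Longrightarrow> hnorm V (T u) \<le> C * hnorm V u"
    using T unfolding adjoint_pair_def by blast
  have "hnorm completion (lift T' l) \<le> C * hnorm completion l" if l: "l \<in> carrier completion" for l
  proof -
    have s: "l \<in> completion_set" "lift T' l \<in> completion_set"
      using l lift_in_completion[OF T l] by (simp_all add: completion_simps(1))
    note c = converges_to_approximant[OF s(1)] 
    note c' = converges_to_lift[OF T c]
    have V: "approximant l n \<in> carrier V" for n using approximant[OF s(1)] by (auto simp: approximates_def)
    have 1: "(\<lambda>n. hnorm V (approximant l n)) \<longlonglongrightarrow> hnorm completion l"
      unfolding hnorm_def by (intro tendsto_real_sqrt tendsto_Re completion_form_tendsto[OF s(1) s(1) c c])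
    have 2: "(\<lambda>n. hnorm V (T (approximant l n))) \<longlonglongrightarrow> hnorm completion (lift T' l)"
      unfolding hnorm_def by (intro tendsto_real_sqrt tendsto_Re completion_form_tendsto[OF s(2) s(2) c' c'])
    show ?thesis by (rule LIMSEQ_le[OF 2 tendsto_mult_left[OF 1]]) (use C V in blast)
  qed
  then show ?thesis using clinear_map_lift[OF T] by (auto simp: bounded_operator_def)
qed

lemma cinner_lift:
  assumes T: "adjoint_pair T T'" and l: "l \<in> carrier completion" and k: "k \<in> carrier completion"
  shows "cinner completion (lift T' l) k = cinner completion l (lift T k)"
proof (rule LIMSEQ_unique)
  have s: "l \<in> completion_set" "k \<in> completion_set" "lift T' l \<in> completion_set" "lift T k \<in> completion_set"
    using l k lift_in_completion[OF T l] lift_in_completion[OF adjoint_pair_commute[OF T] k]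
    by (simp_all add: completion_simps(1))
  note cl = converges_to_approximant[OF s(1)] and ck = converges_to_approximant[OF s(2)]
  have V: "approximant l n \<in> carrier V" "approximant k n \<in> carrier V" for n
    using approximant s by (auto simp: approximates_def)
  show "(\<lambda>n. cinner V (T (approximant l n)) (approximant k n)) \<longlonglongrightarrow> cinner completion (lift T' l) k"
    by (intro completion_form_tendsto s ck converges_to_lift[OF T cl])
  have "(\<lambda>n. cinner V (approximant l n) (T' (approximant k n))) \<longlonglongrightarrow> cinner completion l (lift T k)"
    by (intro completion_form_tendsto s cl converges_to_lift[OF adjoint_pair_commute[OF T] ck])
  then show "(\<lambda>n. cinner V (T (approximant l n)) (approximant k n)) \<longlonglongrightarrow> cinner completion l (lift T k)"
    using T V by (simp add: adjoint_pair_def)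
qed

lemma lift_embed:
  assumes T: "adjoint_pair T T'" and a: "a \<in> carrier V"
  shows "lift T' (embed a) = embed (T a)"
  using T a by (auto simp: lift_def embed_def adjoint_pair_def fun_eq_iff)

end

lemma (in inner_product_space) semi_inner_product: "semi_inner_product H"
proof
  show "carrier H \<noteq> {}" using M.zero_closed by blast
  show "c \<odot> v \<in> carrier H" if "v \<in> carrier H" for c v using smult_closed[of c v] that by simp
qed (auto simp: cinner_add_left cinner_smult_left cinner_nonneg intro: cinner_commute)

section \<open>Representations and their uniform bounds\<close>

context ulf_metric_space
begin

lemma roe_entry_in: "a \<in> carrier Cu \<Longrightarrow> a x y \<noteq> 0 \<Longrightarrow> x \<in> X \<and> y \<in> X"
  unfolding in_roe_iff by blast

lemma roe_bounded:
  assumes "a \<in> carrier Cu" obtains C where "C \<ge> 0" "\<And>x y. cmod (a x y) \<le> C"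
proof -
  obtain C where C: "\<And>x y. cmod (a x y) \<le> C" using assms unfolding in_roe_iff by blast
  have "0 \<le> C" using C[of undefined undefined] norm_ge_zero order_trans by blast
  then show thesis using that C by blast
qed

lemma finite_row: "a \<in> carrier Cu \<Longrightarrow> finite {y. a x y \<noteq> 0}"
  using finite_rows by metis

lemma finite_columns:
  assumes "a \<in> carrier Cu"
  obtains N where "\<And>y. finite {x. a x y \<noteq> 0}" "\<And>y. card {x. a x y \<noteq> 0} \<le> N"
  using finite_rows[OF adjoint_in_roe[OF assms]] by (auto simp: adjoint_matrix_def)

lemma finite_column: "a \<in> carrier Cu \<Longrightarrow> finite {x. a x y \<noteq> 0}"
  using finite_columns by metis

lemma mult_eq_sum:
  assumes "finite F" "\<And>y. a x y \<noteq> 0 \<Longrightarrow> b y z \<noteq> 0 \<Longrightarrow> y \<in> F" "a \<in> carrier Cu"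
  shows "(a \<otimes>\<^bsub>Cu\<^esub> b) x z = (\<Sum>y\<in>F. a x y * b y z)"
proof -
  have "(\<Sum>y | a x y \<noteq> 0. a x y * b y z) = (\<Sum>y\<in>{y. a x y \<noteq> 0} \<inter> F. a x y * b y z)"
    using assms finite_row[OF assms(3)] by (intro sum.mono_neutral_right) auto
  also have "\<dots> = (\<Sum>y\<in>F. a x y * b y z)"
    using assms by (intro sum.mono_neutral_left) auto
  finally show ?thesis by (simp add: roe_simps)
qed

lemma adjoint_adjoint [simp]: "adjoint_matrix (adjoint_matrix a) = a"
  by (simp add: adjoint_matrix_def)

lemma adjoint_mult:
  assumes a: "a \<in> carrier Cu" and b: "b \<in> carrier Cu"
  shows "adjoint_matrix (a \<otimes>\<^bsub>Cu\<^esub> b) = adjoint_matrix b \<otimes>\<^bsub>Cu\<^esub> adjoint_matrix a"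
proof (intro ext)
  fix x z
  let ?F = "{y. a z y \<noteq> 0}"
  have "(adjoint_matrix b \<otimes>\<^bsub>Cu\<^esub> adjoint_matrix a) x z = (\<Sum>y\<in>?F. adjoint_matrix b x y * adjoint_matrix a y z)"
    by (rule mult_eq_sum[OF _ _ adjoint_in_roe[OF b]]) (auto simp: finite_row a adjoint_matrix_def)
  moreover have "(a \<otimes>\<^bsub>Cu\<^esub> b) z x = (\<Sum>y\<in>?F. a z y * b y x)"
    by (rule mult_eq_sum) (auto simp: finite_row a)
  ultimately show "adjoint_matrix (a \<otimes>\<^bsub>Cu\<^esub> b) x z = (adjoint_matrix b \<otimes>\<^bsub>Cu\<^esub> adjoint_matrix a) x z"
    by (simp add: adjoint_matrix_def mult.commute)
qed

lemma diagonal_in_roe: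
  assumes "\<And>x. cmod (f x) \<le> C" "\<And>x. x \<notin> X \<Longrightarrow> f x = 0"
  shows "diagonal f \<in> carrier Cu"
proof -
  have "0 \<le> C" using assms(1)[of undefined] norm_ge_zero order_trans by blast
  then have "\<forall>x y. cmod (diagonal f x y) \<le> C" using assms(1) by (simp add: diagonal_def)
  moreover have "\<forall>x y. diagonal f x y \<noteq> 0 \<longrightarrow> x \<in> X \<and> y \<in> X \<and> d x y \<le> ennreal 1"
    using assms(2) dist_self by (metis diagonal_def zero_le)
  ultimately show ?thesis unfolding in_roe_iff by (metis zero_less_one)
qed

lemma diagonal_mult:
  assumes "diagonal f \<in> carrier Cu"
  shows "diagonal f \<otimes>\<^bsub>Cu\<^esub> a = (\<lambda>x y. f x * a x y)"
proof (intro ext)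
  fix x z
  have "(diagonal f \<otimes>\<^bsub>Cu\<^esub> a) x z = (\<Sum>y\<in>{x}. diagonal f x y * a y z)"
    by (rule mult_eq_sum[OF _ _ assms]) (auto simp: diagonal_def split: if_splits)
  then show "(diagonal f \<otimes>\<^bsub>Cu\<^esub> a) x z = f x * a x z" by (simp add: diagonal_def)
qed

end

text \<open>The identities are tested inside the form, so they may fail by null vectors. Boundedness
  of the operators is not assumed: \<open>seminorm_T_le\<close> derives it from the algebra.\<close>

locale pre_representation = ulf_metric_space X d + semi_inner_product V
  for X :: "'a set" and d and V :: "'v inner_module" (structure) +
  fixes T :: "'a cmatrix \<Rightarrow> 'v \<Rightarrow> 'v"
  assumes T_closed: "\<lbrakk>a \<in> carrier Cu; v \<in> carrier V\<rbrakk> \<Longrightarrow> T a v \<in> carrier V"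
    and T_add: "\<lbrakk>a \<in> carrier Cu; b \<in> carrier Cu; v \<in> carrier V; w \<in> carrier V\<rbrakk> \<Longrightarrow>
      cinner V (T (a \<oplus>\<^bsub>Cu\<^esub> b) v) w = cinner V (T a v) w + cinner V (T b v) w"
    and T_scale: "\<lbrakk>a \<in> carrier Cu; v \<in> carrier V; w \<in> carrier V\<rbrakk> \<Longrightarrow>
      cinner V (T (c \<odot>\<^bsub>Cu\<^esub> a) v) w = c * cinner V (T a v) w"
    and T_mult: "\<lbrakk>a \<in> carrier Cu; b \<in> carrier Cu; v \<in> carrier V; w \<in> carrier V\<rbrakk> \<Longrightarrow>
      cinner V (T (a \<otimes>\<^bsub>Cu\<^esub> b) v) w = cinner V (T a (T b v)) w"
    and T_one: "\<lbrakk>v \<in> carrier V; w \<in> carrier V\<rbrakk> \<Longrightarrow> cinner V (T \<one>\<^bsub>Cu\<^esub> v) w = cinner V v w"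
    and T_adjoint: "\<lbrakk>a \<in> carrier Cu; v \<in> carrier V; w \<in> carrier V\<rbrakk> \<Longrightarrow>
      cinner V (T (adjoint_matrix a) v) w = cinner V v (T a w)"
begin

lemma seminorm_cong:
  assumes "u \<in> carrier V" "v \<in> carrier V" "\<And>w. w \<in> carrier V \<Longrightarrow> cinner V u w = cinner V v w"
  shows "hnorm V u = hnorm V v"
proof -
  have "cinner V u u = cnj (cinner V u v)"
    using assms(3)[OF assms(1)] form_commute[OF assms(1,2)] by (rule trans)
  also have "\<dots> = cnj (cinner V v v)" by (simp only: assms(3)[OF assms(2)])
  finally show ?thesis by (simp add: hnorm_def)
qed

lemma seminorm_T_sq:
  assumes a: "a \<in> carrier Cu" and v: "v \<in> carrier V"
  shows "(hnorm V (T a v))\<^sup>2 = Re (cinner V (T (adjoint_matrix a \<otimes>\<^bsub>Cu\<^esub> a) v) v)"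
proof -
  have "cinner V (T (adjoint_matrix a \<otimes>\<^bsub>Cu\<^esub> a) v) v = cinner V (T (adjoint_matrix a) (T a v)) v"
    using a v by (simp add: T_mult adjoint_in_roe)
  also have "\<dots> = cinner V (T a v) (T a v)" using a v by (simp add: T_adjoint T_closed)
  finally show ?thesis using form_self[OF T_closed[OF a v]] by simp
qed

text \<open>The function \<open>D - h\<close> has a pointwise square root \<open>g\<close> on
  \<open>X\<close>, so \<open>D\<close> times the unit minus the diagonal matrix of \<open>h\<close>
  has the form g* g, and such matrices have nonnegative form.\<close>

lemma form_diagonal_le:
  fixes h :: "'a \<Rightarrow> real"
  assumes h: "\<And>x. 0 \<le> h x" "\<And>x. h x \<le> D" "\<And>x. x \<notin> X \<Longrightarrow> h x = 0" and v: "v \<in> carrier V"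
  shows "Re (cinner V (T (diagonal (\<lambda>x. complex_of_real (h x))) v) v) \<le> D * (hnorm V v)\<^sup>2"
proof -
  define g where "g x = (if x \<in> X then sqrt (D - h x) else 0)" for x
  let ?g = "diagonal (\<lambda>x. complex_of_real (g x))" and ?h = "diagonal (\<lambda>x. complex_of_real (h x))"
  have D: "0 \<le> D" using h(1,2) order_trans by blast
  have g: "?g \<in> carrier Cu"
    by (rule diagonal_in_roe[of _ "sqrt D"]) (use h D in \<open>auto simp: g_def\<close>)
  have hC: "?h \<in> carrier Cu"
    by (rule diagonal_in_roe[of _ D]) (use h D in auto)
  have "?h \<oplus>\<^bsub>Cu\<^esub> (adjoint_matrix ?g \<otimes>\<^bsub>Cu\<^esub> ?g) = complex_of_real D \<odot>\<^bsub>Cu\<^esub> \<one>\<^bsub>Cu\<^esub>"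
  proof -
    have "adjoint_matrix ?g = ?g" by (auto simp: adjoint_matrix_def diagonal_def fun_eq_iff)
    then have "adjoint_matrix ?g \<otimes>\<^bsub>Cu\<^esub> ?g = (\<lambda>x y. g x * ?g x y)" using diagonal_mult[OF g] by simp
    moreover have "complex_of_real (g x) * complex_of_real (g x) = complex_of_real (D - h x)" if "x \<in> X" for x
      using that h(2)[of x] unfolding of_real_mult[symmetric] by (simp add: g_def)
    ultimately show ?thesis using h(3) by (auto simp: roe_simps diagonal_def fun_eq_iff g_def)
  qed
  then have "complex_of_real D * cinner V v v = cinner V (T ?h v) v + cinner V (T (adjoint_matrix ?g \<otimes>\<^bsub>Cu\<^esub> ?g) v) v"
    using T_add[OF hC mult_in_roe[OF adjoint_in_roe[OF g] g] v v] T_scale[OF one_in_roe v v] T_one[OF v v]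
    by simp
  then have "D * (hnorm V v)\<^sup>2 = Re (cinner V (T ?h v) v) + (hnorm V (T ?g v))\<^sup>2"
    using seminorm_T_sq[OF g v] form_self[OF v] by (simp add: complex_eq_iff)
  then show ?thesis by (metis add_increasing2 order_refl zero_le_power2)
qed

text \<open>With at most one entry per row, distinct columns have disjoint supports, so a* a is
  diagonal. Its entries are sums of at most \<open>N\<close> squares down a column.\<close>

lemma seminorm_T_monomial:
  assumes a: "a \<in> carrier Cu" and C: "\<And>x y. cmod (a x y) \<le> C"
    and rows: "\<And>x y z. a x y \<noteq> 0 \<Longrightarrow> a x z \<noteq> 0 \<Longrightarrow> y = z"
    and N: "\<And>y. card {x. a x y \<noteq> 0} \<le> N" and v: "v \<in> carrier V"
  shows "hnorm V (T a v) \<le> sqrt N * C * hnorm V v"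
proof (rule power2_le_imp_le)
  have C0: "0 \<le> C" using C[of undefined undefined] norm_ge_zero order_trans by blast
  define h where "h y = (\<Sum>x | a x y \<noteq> 0. (cmod (a x y))\<^sup>2)" for y
  have "adjoint_matrix a \<otimes>\<^bsub>Cu\<^esub> a = diagonal (\<lambda>y. complex_of_real (h y))"
  proof (intro ext)
    fix y z
    have "(adjoint_matrix a \<otimes>\<^bsub>Cu\<^esub> a) y z = (\<Sum>x | a x y \<noteq> 0. cnj (a x y) * a x z)"
      by (simp add: roe_simps adjoint_matrix_def)
    also have "\<dots> = diagonal (\<lambda>y. complex_of_real (h y)) y z"
    proof (cases "y = z")
      case True
      then show ?thesis
        by (simp add: diagonal_def h_def complex_norm_square[symmetric] mult.commute[of "cnj _"])
    next
      case False
      then have "cnj (a x y) * a x z = 0" for x using rows[of x y z] by auto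
      then show ?thesis using False by (simp only: sum.neutral_const) (simp add: diagonal_def)
    qed
    finally show "(adjoint_matrix a \<otimes>\<^bsub>Cu\<^esub> a) y z = diagonal (\<lambda>y. complex_of_real (h y)) y z" .
  qed
  moreover have "h y \<le> N * C\<^sup>2" for y
  proof -
    have "h y \<le> (\<Sum>x | a x y \<noteq> 0. C\<^sup>2)" unfolding h_def
      by (intro sum_mono power_mono C) simp
    also have "\<dots> \<le> N * C\<^sup>2" using N[of y] by (simp add: mult_right_mono)
    finally show ?thesis .
  qed
  moreover have "h y = 0" if "y \<notin> X" for y
    using that roe_entry_in[OF a] by (auto simp: h_def intro!: sum.neutral)
  ultimately have "(hnorm V (T a v))\<^sup>2 \<le> N * C\<^sup>2 * (hnorm V v)\<^sup>2"
    using form_diagonal_le[of h "N * C\<^sup>2" v] v seminorm_T_sq[OF a v] by (simp add: h_def sum_nonneg)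
  then show "(hnorm V (T a v))\<^sup>2 \<le> (sqrt N * C * hnorm V v)\<^sup>2" by (simp add: power_mult_distrib)
  show "0 \<le> sqrt N * C * hnorm V v" using C0 v by (simp add: seminorm_nonneg)
qed

lemma seminorm_T_add:
  assumes a: "a \<in> carrier Cu" and b: "b \<in> carrier Cu" and v: "v \<in> carrier V"
  shows "hnorm V (T (a \<oplus>\<^bsub>Cu\<^esub> b) v) \<le> hnorm V (T a v) + hnorm V (T b v)"
proof -
  have "hnorm V (T (a \<oplus>\<^bsub>Cu\<^esub> b) v) = hnorm V (T a v \<oplus> T b v)"
    using a b v by (intro seminorm_cong) (simp_all add: T_closed add_closed add_in_roe T_add form_add)
  then show ?thesis using seminorm_triangle[OF T_closed[OF a v] T_closed[OF b v]] by simp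
qed

text \<open>A matrix with at most n entries per row is a sum of n matrices with at most one. The
  bound depends on the matrix but not on the form or on \<open>T\<close>.\<close>

lemma seminorm_T_le:
  assumes "a \<in> carrier Cu" "\<And>x y. cmod (a x y) \<le> C" "\<And>x. card {y. a x y \<noteq> 0} \<le> n"
    "\<And>y. card {x. a x y \<noteq> 0} \<le> N" "v \<in> carrier V"
  shows "hnorm V (T a v) \<le> n * (sqrt N * C) * hnorm V v"
  using assms
proof (induction n arbitrary: a)
  case 0
  then have "a x y = 0" for x y
    using finite_row[of a x] by (metis (mono_tags, lifting) card_0_eq empty_iff le_zero_eq mem_Collect_eq)
  then have "a = 0 \<odot>\<^bsub>Cu\<^esub> a" by (simp add: roe_simps fun_eq_iff)
  then have "cinner V (T a v) (T a v) = 0"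
    using T_scale[OF 0(1) 0(5) T_closed[OF 0(1,5)], of 0] by simp
  then show ?case by (simp add: hnorm_def)
next
  case (Suc n)
  note a = Suc.prems(1) and v = Suc.prems(5)
  \<comment> \<open>One nonzero entry of each nonzero row is split off; \<open>a2\<close> keeps the
    others and has one entry less per row.\<close>
  define p where "p x = (SOME y. a x y \<noteq> 0)" for x
  define a1 where "a1 = (\<lambda>x y. if y = p x then a x y else 0)"
  define a2 where "a2 = (\<lambda>x y. if y = p x then 0 else a x y)"
  have C0: "0 \<le> C" using Suc.prems(2)[of undefined undefined] norm_ge_zero order_trans by blast
  have sub: "b \<in> carrier Cu" if "\<And>x y. b x y \<noteq> 0 \<Longrightarrow> b x y = a x y" for b
    using a that C0 unfolding in_roe_iff by (metis norm_zero Suc.prems(2))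
  have a12: "a1 \<in> carrier Cu" "a2 \<in> carrier Cu"
    by (rule sub; simp add: a1_def a2_def split: if_splits)+
  have C12: "cmod (a1 x y) \<le> C" "cmod (a2 x y) \<le> C" for x y
    using Suc.prems(2) C0 by (simp_all add: a1_def a2_def)
  have N12: "card {x. a1 x y \<noteq> 0} \<le> N" "card {x. a2 x y \<noteq> 0} \<le> N" for y
  proof -
    have "{x. a1 x y \<noteq> 0} \<subseteq> {x. a x y \<noteq> 0}" "{x. a2 x y \<noteq> 0} \<subseteq> {x. a x y \<noteq> 0}"
      by (auto simp: a1_def a2_def split: if_splits)
    then show "card {x. a1 x y \<noteq> 0} \<le> N" "card {x. a2 x y \<noteq> 0} \<le> N"
      using card_mono[OF finite_column[OF a, of y]] Suc.prems(4)[of y] by (meson order_trans)+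
  qed
  have rows2: "card {y. a2 x y \<noteq> 0} \<le> n" for x
  proof (cases "{y. a x y \<noteq> 0} = {}")
    case True
    then have "{y. a2 x y \<noteq> 0} = {}" by (auto simp: a2_def split: if_splits)
    then show ?thesis by (simp only: card.empty)
  next
    case False
    then have "p x \<in> {y. a x y \<noteq> 0}" unfolding p_def by (metis (mono_tags) empty_Collect_eq mem_Collect_eq someI_ex)
    moreover have "{y. a2 x y \<noteq> 0} = {y. a x y \<noteq> 0} - {p x}" by (auto simp: a2_def)
    ultimately have "card {y. a2 x y \<noteq> 0} = card {y. a x y \<noteq> 0} - 1" by (simp only: card_Diff_singleton)
    then show ?thesis using Suc.prems(3)[of x] by simp
  qed
  have "a = a1 \<oplus>\<^bsub>Cu\<^esub> a2" by (auto simp: roe_simps a1_def a2_def fun_eq_iff)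
  then have "hnorm V (T a v) \<le> hnorm V (T a1 v) + hnorm V (T a2 v)"
    using seminorm_T_add[OF a12 v] by simp
  also have "\<dots> \<le> sqrt N * C * hnorm V v + n * (sqrt N * C) * hnorm V v"
  proof (rule add_mono)
    show "hnorm V (T a1 v) \<le> sqrt N * C * hnorm V v"
      by (rule seminorm_T_monomial[OF a12(1) C12(1) _ N12(1) v]) (simp add: a1_def split: if_splits)
    show "hnorm V (T a2 v) \<le> n * (sqrt N * C) * hnorm V v"
      by (rule Suc.IH[OF a12(2) C12(2) rows2 N12(2) v])
  qed
  also have "\<dots> = Suc n * (sqrt N * C) * hnorm V v" by (simp add: algebra_simps)
  finally show ?case .
qed

lemma adjoint_pair_T:
  assumes a: "a \<in> carrier Cu"
  shows "adjoint_pair (T a) (T (adjoint_matrix a))"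
proof -
  have bd: "\<exists>C. \<forall>u\<in>carrier V. hnorm V (T b u) \<le> C * hnorm V u" if b: "b \<in> carrier Cu" for b
  proof -
    obtain C where "0 \<le> C" and C: "\<And>x y. cmod (b x y) \<le> C" using roe_bounded[OF b] by blast
    obtain n where "\<And>x. finite {y. b x y \<noteq> 0}" and n: "\<And>x. card {y. b x y \<noteq> 0} \<le> n"
      using finite_rows[OF b] by blast
    obtain N where "\<And>y. finite {x. b x y \<noteq> 0}" and N: "\<And>y. card {x. b x y \<noteq> 0} \<le> N"
      using finite_columns[OF b] by blast
    show ?thesis by (rule exI, rule ballI, rule seminorm_T_le[OF b C n N])
  qed
  show ?thesis
    unfolding adjoint_pair_def
  proof (intro conjI ballI bd a adjoint_in_roe[OF a] funcsetI T_closed)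
    fix u v assume "u \<in> carrier V" "v \<in> carrier V"
    then show "cinner V (T a u) v = cinner V u (T (adjoint_matrix a) v)"
      using T_adjoint[OF adjoint_in_roe[OF a]] by simp
  qed
qed

text \<open>A functional in the completion is the inner product with \<open>embed x\<close>, which
  depends on \<open>x\<close> through the form alone. This turns the weak identities of the locale
  into equalities in the completion.\<close>

lemma completion_eval_cong:
  assumes "l \<in> carrier completion" "x \<in> carrier V" "y \<in> carrier V"
    "\<And>w. w \<in> carrier V \<Longrightarrow> cinner V x w = cinner V y w"
  shows "l x = l y"
proof -
  have "embed x = embed y" using assms by (auto simp: embed_def)
  then show ?thesis
    using norm_completion_ge(3)[of l x] norm_completion_ge(3)[of l y] assms
    by (simp add: completion_simps(1))
qed

lemma completion_eval_linear:
  assumes l: "l \<in> carrier completion" and x: "x \<in> carrier V" 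
  shows "y \<in> carrier V \<Longrightarrow> l (x \<oplus> y) = l x + l y" "l (c \<odot> x) = cnj c * l x"
proof -
  interpret K: hilbert_space completion by (rule hilbert_space_completion)
  have e: "l u = cinner completion l (embed u)" "embed u \<in> carrier completion" if "u \<in> carrier V" for u
    using norm_completion_ge(3)[of l u] embed_in_completion[of u] that l by (simp_all add: completion_simps(1))
  show "l (c \<odot> x) = cnj c * l x"
    using x l by (simp add: e scale_closed embed_scale K.cinner_smult_right)
  assume y: "y \<in> carrier V"
  show "l (x \<oplus> y) = l x + l y"
    using x y l by (simp add: e add_closed embed_add K.cinner_add_right)
qed

text \<open>Evaluated at a vector, the lifted operators act through the adjoint matrix. The adjoint
  reverses products and conjugates scalars; evaluation reverses the order once more, and functionals
  are conjugate linear.\<close>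

lemma star_representation_completion:
  "star_representation X d completion (\<lambda>a. lift (T (adjoint_matrix a)))"
  unfolding star_representation_def
proof (intro conjI ballI allI)
  show "hilbert_space completion" by (rule hilbert_space_completion)
next
  fix a assume a: "a \<in> carrier Cu"
  show "bounded_operator completion (lift (T (adjoint_matrix a)))"
    by (rule bounded_operator_lift[OF adjoint_pair_T[OF a]])
next
  fix a b l assume a: "a \<in> carrier Cu" and b: "b \<in> carrier Cu" and l: "l \<in> carrier completion"
  note a' = adjoint_in_roe[OF a] and b' = adjoint_in_roe[OF b]
  have adj: "adjoint_matrix (a \<oplus>\<^bsub>Cu\<^esub> b) = adjoint_matrix a \<oplus>\<^bsub>Cu\<^esub> adjoint_matrix b"
    by (simp add: adjoint_matrix_def roe_simps)
  have "l (T (adjoint_matrix a \<oplus>\<^bsub>Cu\<^esub> adjoint_matrix b) x) =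
      l (T (adjoint_matrix a) x) + l (T (adjoint_matrix b) x)" if x: "x \<in> carrier V" for x
  proof -
    have "l (T (adjoint_matrix a \<oplus>\<^bsub>Cu\<^esub> adjoint_matrix b) x) = l (T (adjoint_matrix a) x \<oplus> T (adjoint_matrix b) x)"
      by (rule completion_eval_cong[OF l]) (simp_all add: a' b' x T_closed add_closed add_in_roe T_add form_add)
    then show ?thesis using completion_eval_linear(1)[OF l T_closed[OF a' x] T_closed[OF b' x]] by simp
  qed
  then show "lift (T (adjoint_matrix (a \<oplus>\<^bsub>Cu\<^esub> b))) l =
      lift (T (adjoint_matrix a)) l \<oplus>\<^bsub>completion\<^esub> lift (T (adjoint_matrix b)) l"
    by (simp add: adj fun_eq_iff completion_simps(3) lift_def)
  have "l (T (adjoint_matrix b \<otimes>\<^bsub>Cu\<^esub> adjoint_matrix a) x) =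
      l (T (adjoint_matrix b) (T (adjoint_matrix a) x))" if x: "x \<in> carrier V" for x
    by (rule completion_eval_cong[OF l]) (simp_all add: a' b' x T_closed mult_in_roe T_mult)
  then show "lift (T (adjoint_matrix (a \<otimes>\<^bsub>Cu\<^esub> b))) l =
      lift (T (adjoint_matrix a)) (lift (T (adjoint_matrix b)) l)"
    using T_closed[OF a'] by (simp add: adjoint_mult[OF a b] fun_eq_iff lift_def)
next
  fix c a l assume a: "a \<in> carrier Cu" and l: "l \<in> carrier completion"
  note a' = adjoint_in_roe[OF a]
  have adj: "adjoint_matrix (c \<odot>\<^bsub>Cu\<^esub> a) = cnj c \<odot>\<^bsub>Cu\<^esub> adjoint_matrix a"
    by (simp add: adjoint_matrix_def roe_simps)
  have "l (T (cnj c \<odot>\<^bsub>Cu\<^esub> adjoint_matrix a) x) = c * l (T (adjoint_matrix a) x)" if x: "x \<in> carrier V" for x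
  proof -
    have "l (T (cnj c \<odot>\<^bsub>Cu\<^esub> adjoint_matrix a) x) = l (cnj c \<odot> T (adjoint_matrix a) x)"
      by (rule completion_eval_cong[OF l]) (simp_all add: a' x T_closed scale_closed smult_in_roe T_scale form_scale)
    then show ?thesis using completion_eval_linear(2)[OF l T_closed[OF a' x], of "cnj c"] by simp
  qed
  then show "lift (T (adjoint_matrix (c \<odot>\<^bsub>Cu\<^esub> a))) l = c \<odot>\<^bsub>completion\<^esub> lift (T (adjoint_matrix a)) l"
    by (simp add: adj fun_eq_iff completion_simps(4) lift_def)
next
  fix l assume l: "l \<in> carrier completion"
  have adj: "adjoint_matrix \<one>\<^bsub>Cu\<^esub> = \<one>\<^bsub>Cu\<^esub>"
    by (auto simp: adjoint_matrix_def roe_simps diagonal_def fun_eq_iff)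
  have "l (T \<one>\<^bsub>Cu\<^esub> x) = l x" if x: "x \<in> carrier V" for x
    by (rule completion_eval_cong[OF l]) (simp_all add: x T_closed one_in_roe T_one)
  then show "lift (T (adjoint_matrix \<one>\<^bsub>Cu\<^esub>)) l = l"
    using l by (auto simp: adj fun_eq_iff lift_def completion_simps(1) completion_set_def)
next
  fix a l k assume a: "a \<in> carrier Cu" and l: "l \<in> carrier completion" and k: "k \<in> carrier completion"
  show "cinner completion (lift (T (adjoint_matrix (adjoint_matrix a))) l) k =
      cinner completion l (lift (T (adjoint_matrix a)) k)"
    using cinner_lift[OF adjoint_pair_T[OF adjoint_in_roe[OF a]] l k] by simp
qed

end

section \<open>Bounds common to all representations\<close>

lemma (in ulf_metric_space) pre_representation_star:
  assumes rep: "star_representation X d H \<pi>"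
  shows "pre_representation X d H \<pi>"
proof -
  interpret H: hilbert_space H using rep by (simp add: star_representation_def)
  note r = rep[unfolded star_representation_def]
  have c: "\<pi> a v \<in> carrier H" if "a \<in> carrier Cu" "v \<in> carrier H" for a v
    using r that by (auto simp: bounded_operator_def clinear_map_def)
  show ?thesis
  proof (intro pre_representation.intro H.semi_inner_product ulf_metric_space_axioms
        pre_representation_axioms.intro)
    fix a b v w assume *: "a \<in> carrier Cu" "b \<in> carrier Cu" "v \<in> carrier H" "w \<in> carrier H"
    then have "\<pi> (a \<oplus>\<^bsub>Cu\<^esub> b) v = \<pi> a v \<oplus>\<^bsub>H\<^esub> \<pi> b v" using r by blast
    then show "cinner H (\<pi> (a \<oplus>\<^bsub>Cu\<^esub> b) v) w = cinner H (\<pi> a v) w + cinner H (\<pi> b v) w"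
      using * by (simp add: c H.cinner_add_left)
    have "\<pi> (a \<otimes>\<^bsub>Cu\<^esub> b) v = \<pi> a (\<pi> b v)" using r * by blast
    then show "cinner H (\<pi> (a \<otimes>\<^bsub>Cu\<^esub> b) v) w = cinner H (\<pi> a (\<pi> b v)) w" by simp
  next
    fix a v w e assume *: "a \<in> carrier Cu" "v \<in> carrier H" "w \<in> carrier H"
    then have "\<pi> (e \<odot>\<^bsub>Cu\<^esub> a) v = e \<odot>\<^bsub>H\<^esub> \<pi> a v" using r by blast
    then show "cinner H (\<pi> (e \<odot>\<^bsub>Cu\<^esub> a) v) w = e * cinner H (\<pi> a v) w"
      using * by (simp add: c H.cinner_smult_left)
    show "cinner H (\<pi> (adjoint_matrix a) v) w = cinner H v (\<pi> a w)" using r * by blast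
  next
    fix v w assume "v \<in> carrier H" "w \<in> carrier H"
    then have "\<pi> \<one>\<^bsub>Cu\<^esub> v = v" using r by blast
    then show "cinner H (\<pi> \<one>\<^bsub>Cu\<^esub> v) w = cinner H v w" by (simp only:)
  qed (rule c)
qed

text \<open>The constant is quantified before the representation: direct sums of infinitely many
  representations need a common bound.\<close>

lemma (in ulf_metric_space) star_representation_uniform_bound:
  assumes a: "a \<in> carrier Cu"
  obtains C where "0 \<le> C"
    "\<And>(H :: 'h inner_module) \<pi> v. star_representation X d H \<pi> \<Longrightarrow> v \<in> carrier H \<Longrightarrow>
       hnorm H (\<pi> a v) \<le> C * hnorm H v"
proof -
  obtain C where C: "0 \<le> C" "\<And>x y. cmod (a x y) \<le> C" using roe_bounded[OF a] by blast
  obtain n where "\<And>x. finite {y. a x y \<noteq> 0}" and n: "\<And>x. card {y. a x y \<noteq> 0} \<le> n"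
      using finite_rows[OF a] by blast
  obtain N where "\<And>y. finite {x. a x y \<noteq> 0}" and N: "\<And>y. card {x. a x y \<noteq> 0} \<le> N"
      using finite_columns[OF a] by blast
  have "0 \<le> n * (sqrt N * C)" using C by simp
  moreover have "hnorm H (\<pi> a v) \<le> n * (sqrt N * C) * hnorm H v"
    if "star_representation X d H \<pi>" "v \<in> carrier H" for H :: "'h inner_module" and \<pi> v
    using pre_representation.seminorm_T_le[OF pre_representation_star[OF that(1)] a C(2) n N that(2)] .
  ultimately show thesis using that by blast
qed

lemma (in ulf_metric_space) star_representation_diagonal_le:
  assumes rep: "star_representation X d H \<pi>" and v: "v \<in> carrier H"
    and f: "\<And>x. cmod (f x) \<le> C" "\<And>x. x \<notin> X \<Longrightarrow> f x = 0"
  shows "hnorm H (\<pi> (diagonal f) v) \<le> C * hnorm H v"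
proof -
  have C0: "0 \<le> C" using f(1)[of undefined] norm_ge_zero order_trans by blast
  have "card {y. diagonal f x y \<noteq> 0} \<le> 1" "card {y. diagonal f y x \<noteq> 0} \<le> 1" for x
  proof -
    have 1: "{y. diagonal f x y \<noteq> 0} \<subseteq> {x}" and 2: "{y. diagonal f y x \<noteq> 0} \<subseteq> {x}"
      by (auto simp: diagonal_def split: if_splits)
    show "card {y. diagonal f x y \<noteq> 0} \<le> 1" using card_mono[OF _ 1] by simp
    show "card {y. diagonal f y x \<noteq> 0} \<le> 1" using card_mono[OF _ 2] by simp
  qed
  moreover have "cmod (diagonal f x y) \<le> C" for x y using f C0 by (simp add: diagonal_def)
  ultimately show ?thesis
    using pre_representation.seminorm_T_le[OF pre_representation_star[OF rep] diagonal_in_roe[of f C] _ _ _ v, of C 1 1] f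
    by simp
qed

section \<open>Countable direct sums\<close>

lemma (in inner_product_space) norm_cinner_le:
  "\<lbrakk>v \<in> carrier H; w \<in> carrier H\<rbrakk> \<Longrightarrow> cmod (cinner H v w) \<le> hnorm H v * hnorm H w"
  by (rule semi_inner_product.norm_form_le[OF semi_inner_product])

lemma (in inner_product_space) scale_closed: "v \<in> carrier H \<Longrightarrow> c \<odot> v \<in> carrier H"
  using smult_closed[of c v] by simp

lemma (in inner_product_space) cinner_diff_left:
  "\<lbrakk>u \<in> carrier H; v \<in> carrier H; w \<in> carrier H\<rbrakk> \<Longrightarrow> cinner H (u \<ominus> v) w = cinner H u w - cinner H v w"
  by (simp add: a_minus_def minus_eq_smult cinner_add_left cinner_smult_left scale_closed)

lemma (in inner_product_space) cinner_diff_right: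
  "\<lbrakk>u \<in> carrier H; v \<in> carrier H; w \<in> carrier H\<rbrakk> \<Longrightarrow> cinner H w (u \<ominus> v) = cinner H w u - cinner H w v"
  by (simp add: a_minus_def minus_eq_smult cinner_add_right cinner_smult_right scale_closed)

lemma (in inner_product_space) cinner_self:
  "v \<in> carrier H \<Longrightarrow> cinner H v v = complex_of_real ((hnorm H v)\<^sup>2)"
  by (rule semi_inner_product.form_self[OF semi_inner_product])

lemma (in inner_product_space) hnorm_zero: "hnorm H \<zero> = 0"
  by (rule hnorm_eq_0[THEN iffD2]) simp_all

lemma (in hilbert_space) Cauchy_limit:
  assumes "\<And>n. \<sigma> n \<in> carrier H"
    and "\<And>e. e > 0 \<Longrightarrow> \<exists>N. \<forall>m\<ge>N. \<forall>n\<ge>N. hnorm H (\<sigma> m \<ominus> \<sigma> n) < e"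
  obtains v where "v \<in> carrier H" "(\<lambda>n. hnorm H (\<sigma> n \<ominus> v)) \<longlonglongrightarrow> 0"
proof -
  have "MCauchy \<sigma>"
    unfolding MCauchy_def
  proof (intro conjI allI impI)
    show "range \<sigma> \<subseteq> carrier H" using assms(1) by blast
    fix e :: real assume "e > 0"
    then obtain N where "\<forall>m\<ge>N. \<forall>n\<ge>N. hnorm H (\<sigma> m \<ominus> \<sigma> n) < e" using assms(2) by blast
    then show "\<exists>N. \<forall>n n'. N \<le> n \<longrightarrow> N \<le> n' \<longrightarrow> hdist H (\<sigma> n) (\<sigma> n') < e"
      using assms(1) by (auto simp: hdist_def)
  qed
  then obtain v where "limitin mtopology \<sigma> v sequentially" using complete by (auto simp: mcomplete_def)
  then have v: "v \<in> carrier H" "\<And>e. e > 0 \<Longrightarrow> \<exists>N. \<forall>n\<ge>N. hdist H (\<sigma> n) v < e"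
    unfolding limit_metric_sequentially by blast+
  have "(\<lambda>n. hnorm H (\<sigma> n \<ominus> v)) \<longlonglongrightarrow> 0"
    unfolding LIMSEQ_iff
  proof (intro allI impI)
    fix e :: real assume "e > 0"
    then obtain N where "\<forall>n\<ge>N. hdist H (\<sigma> n) v < e" using v(2) by blast
    then show "\<exists>N. \<forall>n\<ge>N. norm (hnorm H (\<sigma> n \<ominus> v) - 0) < e"
      using assms(1) v(1) by (intro exI[of _ N]) (simp add: hdist_def)
  qed
  then show thesis using that v(1) by blast
qed

lemma (in inner_product_space) hilbert_spaceI:
  assumes lim: "\<And>\<sigma> :: nat \<Rightarrow> _. \<lbrakk>\<And>n. \<sigma> n \<in> carrier H;
      \<And>e. e > 0 \<Longrightarrow> \<exists>N. \<forall>m\<ge>N. \<forall>n\<ge>N. hnorm H (\<sigma> m \<ominus> \<sigma> n) < e\<rbrakk> \<Longrightarrow>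
      \<exists>v\<in>carrier H. \<forall>e>0. \<exists>N. \<forall>n\<ge>N. hnorm H (\<sigma> n \<ominus> v) < e"
  shows "hilbert_space H"
proof -
  have "mcomplete"
    unfolding mcomplete_def
  proof (intro allI impI)
    fix \<sigma> assume C: "MCauchy \<sigma>"
    have \<sigma>: "\<sigma> n \<in> carrier H" for n using C by (auto simp: MCauchy_def)
    have "\<exists>N. \<forall>m\<ge>N. \<forall>n\<ge>N. hnorm H (\<sigma> m \<ominus> \<sigma> n) < e" if "e > 0" for e
    proof -
      have "\<exists>N. \<forall>m n. N \<le> m \<longrightarrow> N \<le> n \<longrightarrow> hdist H (\<sigma> m) (\<sigma> n) < e"
        using C that by (simp add: MCauchy_def)
      then show ?thesis using \<sigma> by (auto simp: hdist_def)
    qed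
    then obtain v where v: "v \<in> carrier H" "\<forall>e>0. \<exists>N. \<forall>n\<ge>N. hnorm H (\<sigma> n \<ominus> v) < e"
      using lim[of \<sigma>] \<sigma> by blast
    then have "limitin mtopology \<sigma> v sequentially"
      unfolding limit_metric_sequentially using \<sigma> by (simp add: hdist_def)
    then show "\<exists>v. limitin mtopology \<sigma> v sequentially" by blast
  qed
  then show ?thesis by unfold_locales
qed

definition l2_sum :: "(nat \<Rightarrow> 'h inner_module) \<Rightarrow> (nat \<Rightarrow> 'h) inner_module" where
  "l2_sum H = \<lparr>carrier = {x. (\<forall>n. x n \<in> carrier (H n)) \<and> summable (\<lambda>n. (hnorm (H n) (x n))\<^sup>2)},
     mult = undefined, one = undefined, zero = (\<lambda>n. \<zero>\<^bsub>H n\<^esub>),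
     add = (\<lambda>x y n. x n \<oplus>\<^bsub>H n\<^esub> y n), smult = (\<lambda>c x n. c \<odot>\<^bsub>H n\<^esub> x n),
     cinner = (\<lambda>x y. \<Sum>n. cinner (H n) (x n) (y n))\<rparr>"

locale hilbert_family =
  fixes H :: "nat \<Rightarrow> 'h inner_module"
  assumes hilbert: "hilbert_space (H n)"
begin

sublocale S: hilbert_space "H n" for n by (rule hilbert)

lemma l2_simps:
  "x \<in> carrier (l2_sum H) \<longleftrightarrow> (\<forall>n. x n \<in> carrier (H n)) \<and> summable (\<lambda>n. (hnorm (H n) (x n))\<^sup>2)"
  "zero (l2_sum H) = (\<lambda>n. \<zero>\<^bsub>H n\<^esub>)" "add (l2_sum H) = (\<lambda>x y n. x n \<oplus>\<^bsub>H n\<^esub> y n)"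
  "smult (l2_sum H) = (\<lambda>c x n. c \<odot>\<^bsub>H n\<^esub> x n)"
  "cinner (l2_sum H) = (\<lambda>x y. \<Sum>n. cinner (H n) (x n) (y n))"
  by (simp_all add: l2_sum_def)

lemma l2_summable_cinner:
  assumes x: "x \<in> carrier (l2_sum H)" and y: "y \<in> carrier (l2_sum H)"
  shows "summable (\<lambda>n. cinner (H n) (x n) (y n))"
proof (rule summable_comparison_test')
  show "summable (\<lambda>n. (hnorm (H n) (x n))\<^sup>2 + (hnorm (H n) (y n))\<^sup>2)"
    using x y by (simp add: l2_simps summable_add)
  fix n
  have "cmod (cinner (H n) (x n) (y n)) \<le> hnorm (H n) (x n) * hnorm (H n) (y n)"
    using x y by (intro S.norm_cinner_le) (simp_all add: l2_simps)
  also have "\<dots> \<le> (hnorm (H n) (x n))\<^sup>2 + (hnorm (H n) (y n))\<^sup>2"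
  proof -
    have "0 \<le> hnorm (H n) (x n) * hnorm (H n) (y n)"
      using x y by (intro mult_nonneg_nonneg S.hnorm_nonneg) (simp_all add: l2_simps)
    then show ?thesis using sum_squares_bound[of "hnorm (H n) (x n)" "hnorm (H n) (y n)"] by linarith
  qed
  finally show "norm (cinner (H n) (x n) (y n)) \<le> (hnorm (H n) (x n))\<^sup>2 + (hnorm (H n) (y n))\<^sup>2" .
qed

lemma l2_add_closed:
  assumes x: "x \<in> carrier (l2_sum H)" and y: "y \<in> carrier (l2_sum H)"
  shows "x \<oplus>\<^bsub>l2_sum H\<^esub> y \<in> carrier (l2_sum H)"
proof -
  have "summable (\<lambda>n. (hnorm (H n) (x n \<oplus>\<^bsub>H n\<^esub> y n))\<^sup>2)"
  proof (rule summable_comparison_test')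
    show "summable (\<lambda>n. 2 * (hnorm (H n) (x n))\<^sup>2 + 2 * (hnorm (H n) (y n))\<^sup>2)"
      using x y by (simp add: l2_simps summable_add summable_mult)
    fix n
    have "(hnorm (H n) (x n \<oplus>\<^bsub>H n\<^esub> y n))\<^sup>2 \<le> (hnorm (H n) (x n) + hnorm (H n) (y n))\<^sup>2"
      using x y by (intro power_mono S.hnorm_triangle) (auto simp: l2_simps)
    also have "\<dots> \<le> 2 * (hnorm (H n) (x n))\<^sup>2 + 2 * (hnorm (H n) (y n))\<^sup>2"
      using sum_squares_bound[of "hnorm (H n) (x n)" "hnorm (H n) (y n)"] by (simp add: power2_sum)
    finally show "norm ((hnorm (H n) (x n \<oplus>\<^bsub>H n\<^esub> y n))\<^sup>2) \<le> 2 * (hnorm (H n) (x n))\<^sup>2 + 2 * (hnorm (H n) (y n))\<^sup>2"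
      by simp
  qed
  then show ?thesis using x y by (simp add: l2_simps)
qed

lemma l2_scale_closed:
  assumes x: "x \<in> carrier (l2_sum H)"
  shows "c \<odot>\<^bsub>l2_sum H\<^esub> x \<in> carrier (l2_sum H)"
  using x by (simp add: l2_simps S.scale_closed S.hnorm_smult power_mult_distrib summable_mult)

lemma l2_zero_closed: "\<zero>\<^bsub>l2_sum H\<^esub> \<in> carrier (l2_sum H)"
  by (simp add: l2_simps S.hnorm_zero)

lemma l2_norm_sq:
  assumes x: "x \<in> carrier (l2_sum H)"
  shows "Re (cinner (l2_sum H) x x) = (\<Sum>n. (hnorm (H n) (x n))\<^sup>2)"
proof -
  have "Re (\<Sum>n. cinner (H n) (x n) (x n)) = (\<Sum>n. Re (cinner (H n) (x n) (x n)))"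
    using l2_summable_cinner[OF x x] by (intro bounded_linear.suminf[OF bounded_linear_Re])
  then show ?thesis using x by (simp add: l2_simps S.hnorm_sq)
qed

lemma l2_component_le:
  assumes x: "x \<in> carrier (l2_sum H)"
  shows "(hnorm (H n) (x n))\<^sup>2 \<le> Re (cinner (l2_sum H) x x)"
  using sum_le_suminf[of "\<lambda>n. (hnorm (H n) (x n))\<^sup>2" "{n}"] x
  by (simp add: l2_norm_sq) (simp add: l2_simps)

sublocale L: inner_product_space "l2_sum H"
proof (intro inner_product_space.intro moduleI inner_product_space_axioms.intro cring_complex_ring)
  show "abelian_group (l2_sum H)"
  proof (rule abelian_groupI)
    fix x assume x: "x \<in> carrier (l2_sum H)"
    have "((-1) \<odot>\<^bsub>l2_sum H\<^esub> x) \<oplus>\<^bsub>l2_sum H\<^esub> x = \<zero>\<^bsub>l2_sum H\<^esub>"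
      using x by (auto simp: l2_simps fun_eq_iff S.minus_eq_smult[symmetric] S.M.l_neg)
    then show "\<exists>y\<in>carrier (l2_sum H). y \<oplus>\<^bsub>l2_sum H\<^esub> x = \<zero>\<^bsub>l2_sum H\<^esub>"
      using l2_scale_closed[OF x] by blast
  next
    fix x y z assume "x \<in> carrier (l2_sum H)" "y \<in> carrier (l2_sum H)" "z \<in> carrier (l2_sum H)"
    then show "(x \<oplus>\<^bsub>l2_sum H\<^esub> y) \<oplus>\<^bsub>l2_sum H\<^esub> z = x \<oplus>\<^bsub>l2_sum H\<^esub> (y \<oplus>\<^bsub>l2_sum H\<^esub> z)"
      by (simp add: l2_simps S.M.a_assoc)
  next
    fix x y assume "x \<in> carrier (l2_sum H)" "y \<in> carrier (l2_sum H)"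
    then show "x \<oplus>\<^bsub>l2_sum H\<^esub> y = y \<oplus>\<^bsub>l2_sum H\<^esub> x"
      by (simp add: l2_simps S.M.a_comm)
  next
    fix x assume "x \<in> carrier (l2_sum H)"
    then show "\<zero>\<^bsub>l2_sum H\<^esub> \<oplus>\<^bsub>l2_sum H\<^esub> x = x" by (simp add: l2_simps)
  qed (fact l2_add_closed l2_zero_closed)+
next
  fix x y z assume *: "x \<in> carrier (l2_sum H)" "y \<in> carrier (l2_sum H)" "z \<in> carrier (l2_sum H)"
  show "cinner (l2_sum H) (x \<oplus>\<^bsub>l2_sum H\<^esub> y) z = cinner (l2_sum H) x z + cinner (l2_sum H) y z"
    using suminf_add[OF l2_summable_cinner[OF *(1,3)] l2_summable_cinner[OF *(2,3)]] *
    by (simp add: l2_simps S.cinner_add_left)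
next
  fix c x y assume *: "x \<in> carrier (l2_sum H)" "y \<in> carrier (l2_sum H)"
  show "cinner (l2_sum H) (c \<odot>\<^bsub>l2_sum H\<^esub> x) y = c * cinner (l2_sum H) x y"
    using suminf_mult[OF l2_summable_cinner[OF *], of c] *
    by (simp add: l2_simps S.cinner_smult_left)
  have "(\<lambda>n. cnj (cinner (H n) (x n) (y n))) sums cnj (\<Sum>n. cinner (H n) (x n) (y n))"
    using l2_summable_cinner[OF *] by (intro sums_cnj[THEN iffD2] summable_sums)
  moreover have "cnj (cinner (H n) (x n) (y n)) = cinner (H n) (y n) (x n)" for n
    using * by (simp add: l2_simps S.cinner_commute[of "x n" n "y n"])
  ultimately show "cinner (l2_sum H) y x = cnj (cinner (l2_sum H) x y)"
    by (simp add: l2_simps sums_iff)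
next
  fix x assume x: "x \<in> carrier (l2_sum H)" "x \<noteq> \<zero>\<^bsub>l2_sum H\<^esub>"
  then obtain n where n: "x n \<noteq> \<zero>\<^bsub>H n\<^esub>" by (auto simp: l2_simps)
  have xn: "x n \<in> carrier (H n)" using x(1) by (simp add: l2_simps)
  have "0 < (hnorm (H n) (x n))\<^sup>2" using S.cinner_pos[OF xn n] S.hnorm_sq[OF xn] by simp
  then show "0 < Re (cinner (l2_sum H) x x)" by (rule less_le_trans[OF _ l2_component_le[OF x(1)]])
next
  fix a b :: complex and x y assume x: "x \<in> carrier (l2_sum H)" and y: "y \<in> carrier (l2_sum H)"
  show "(a \<oplus>\<^bsub>complex_ring\<^esub> b) \<odot>\<^bsub>l2_sum H\<^esub> x = a \<odot>\<^bsub>l2_sum H\<^esub> x \<oplus>\<^bsub>l2_sum H\<^esub> b \<odot>\<^bsub>l2_sum H\<^esub> x"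
    using x S.smult_l_distr[of a b] by (simp add: l2_simps)
  show "a \<odot>\<^bsub>l2_sum H\<^esub> (x \<oplus>\<^bsub>l2_sum H\<^esub> y) = a \<odot>\<^bsub>l2_sum H\<^esub> x \<oplus>\<^bsub>l2_sum H\<^esub> a \<odot>\<^bsub>l2_sum H\<^esub> y"
    using x y S.smult_r_distr[of a] by (simp add: l2_simps)
  show "(a \<otimes>\<^bsub>complex_ring\<^esub> b) \<odot>\<^bsub>l2_sum H\<^esub> x = a \<odot>\<^bsub>l2_sum H\<^esub> (b \<odot>\<^bsub>l2_sum H\<^esub> x)"
    using x S.smult_assoc1[of a b] by (simp add: l2_simps)
next
  fix x assume x: "x \<in> carrier (l2_sum H)"
  show "\<one>\<^bsub>complex_ring\<^esub> \<odot>\<^bsub>l2_sum H\<^esub> x = x"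
    using x S.smult_one by (simp add: l2_simps)
qed (auto intro: l2_scale_closed)

lemma l2_minus:
  "\<lbrakk>x \<in> carrier (l2_sum H); y \<in> carrier (l2_sum H)\<rbrakk> \<Longrightarrow> (x \<ominus>\<^bsub>l2_sum H\<^esub> y) n = x n \<ominus>\<^bsub>H n\<^esub> y n"
  unfolding a_minus_def by (simp add: L.minus_eq_smult) (simp add: l2_simps S.minus_eq_smult)

lemma hnorm_component_le:
  "x \<in> carrier (l2_sum H) \<Longrightarrow> hnorm (H n) (x n) \<le> hnorm (l2_sum H) x"
  using l2_component_le[of x n] S.hnorm_sq[of "x n" n]
  by (simp add: hnorm_def l2_simps(1))

lemma hilbert_space_l2_sum: "hilbert_space (l2_sum H)"
proof (rule L.hilbert_spaceI)
  fix \<sigma> :: "nat \<Rightarrow> nat \<Rightarrow> 'h" assume \<sigma>: "\<And>k. \<sigma> k \<in> carrier (l2_sum H)"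
    and C: "\<And>e. e > 0 \<Longrightarrow> \<exists>N. \<forall>m\<ge>N. \<forall>n\<ge>N. hnorm (l2_sum H) (\<sigma> m \<ominus>\<^bsub>l2_sum H\<^esub> \<sigma> n) < e"
  have c: "\<sigma> k n \<in> carrier (H n)" for k n using \<sigma> by (simp add: l2_simps)
  have "\<exists>v. v \<in> carrier (H n) \<and> (\<lambda>k. hnorm (H n) (\<sigma> k n \<ominus>\<^bsub>H n\<^esub> v)) \<longlonglongrightarrow> 0" for n
  proof (rule S.Cauchy_limit[of "\<lambda>k. \<sigma> k n" n])
    fix e :: real assume "e > 0"
    then obtain N where N: "\<And>k l. \<lbrakk>k \<ge> N; l \<ge> N\<rbrakk> \<Longrightarrow> hnorm (l2_sum H) (\<sigma> k \<ominus>\<^bsub>l2_sum H\<^esub> \<sigma> l) < e"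
      using C by blast
    have "hnorm (H n) (\<sigma> k n \<ominus>\<^bsub>H n\<^esub> \<sigma> l n) < e" if "k \<ge> N" "l \<ge> N" for k l
      using hnorm_component_le[of "\<sigma> k \<ominus>\<^bsub>l2_sum H\<^esub> \<sigma> l" n] N[OF that] \<sigma>
      by (simp add: l2_minus)
    then show "\<exists>N. \<forall>k\<ge>N. \<forall>l\<ge>N. hnorm (H n) (\<sigma> k n \<ominus>\<^bsub>H n\<^esub> \<sigma> l n) < e" by blast
  qed (use c in auto)
  then obtain v where v: "\<And>n. v n \<in> carrier (H n)"
    "\<And>n. (\<lambda>k. hnorm (H n) (\<sigma> k n \<ominus>\<^bsub>H n\<^esub> v n)) \<longlonglongrightarrow> 0" by metis
  \<comment> \<open>The estimate is made for finite partial sums, where the limit in the second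
    index can be taken term by term.\<close>
  have part: "\<exists>N. \<forall>k\<ge>N. \<forall>M. (\<Sum>n<M. (hnorm (H n) (\<sigma> k n \<ominus>\<^bsub>H n\<^esub> v n))\<^sup>2) \<le> e\<^sup>2" if e: "e > 0" for e
  proof -
    obtain N where N: "\<And>k l. \<lbrakk>k \<ge> N; l \<ge> N\<rbrakk> \<Longrightarrow> hnorm (l2_sum H) (\<sigma> k \<ominus>\<^bsub>l2_sum H\<^esub> \<sigma> l) < e"
      using C[OF e] by blast
    have "(\<Sum>n<M. (hnorm (H n) (\<sigma> k n \<ominus>\<^bsub>H n\<^esub> v n))\<^sup>2) \<le> e\<^sup>2" if k: "k \<ge> N" for k M
    proof (rule tendsto_upperbound)
      have "(\<lambda>l. hnorm (H n) (\<sigma> k n \<ominus>\<^bsub>H n\<^esub> \<sigma> l n)) \<longlonglongrightarrow> hnorm (H n) (\<sigma> k n \<ominus>\<^bsub>H n\<^esub> v n)" for n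
      proof -
        have "\<bar>hnorm (H n) (\<sigma> k n \<ominus>\<^bsub>H n\<^esub> \<sigma> l n) - hnorm (H n) (\<sigma> k n \<ominus>\<^bsub>H n\<^esub> v n)\<bar>
            \<le> hnorm (H n) (\<sigma> l n \<ominus>\<^bsub>H n\<^esub> v n)" for l
          using S.triangle[of "\<sigma> k n" n "\<sigma> l n" "v n"] S.triangle[of "\<sigma> k n" n "v n" "\<sigma> l n"]
            S.commute[of n "v n" "\<sigma> l n"] c v(1) by (simp add: hdist_def)
        then have "(\<lambda>l. hnorm (H n) (\<sigma> k n \<ominus>\<^bsub>H n\<^esub> \<sigma> l n) - hnorm (H n) (\<sigma> k n \<ominus>\<^bsub>H n\<^esub> v n)) \<longlonglongrightarrow> 0"
          by (intro Lim_null_comparison[OF always_eventually[OF allI] v(2)[of n]]) simp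
        then show ?thesis by (simp add: LIM_zero_iff)
      qed
      then show "(\<lambda>l. \<Sum>n<M. (hnorm (H n) (\<sigma> k n \<ominus>\<^bsub>H n\<^esub> \<sigma> l n))\<^sup>2) \<longlonglongrightarrow>
          (\<Sum>n<M. (hnorm (H n) (\<sigma> k n \<ominus>\<^bsub>H n\<^esub> v n))\<^sup>2)"
        by (intro tendsto_sum tendsto_power)
      have "(\<Sum>n<M. (hnorm (H n) (\<sigma> k n \<ominus>\<^bsub>H n\<^esub> \<sigma> l n))\<^sup>2) \<le> e\<^sup>2" if l: "l \<ge> N" for l
      proof -
        let ?y = "\<sigma> k \<ominus>\<^bsub>l2_sum H\<^esub> \<sigma> l"
        have y: "?y \<in> carrier (l2_sum H)" using \<sigma> by simp
        have "(\<Sum>n<M. (hnorm (H n) (?y n))\<^sup>2) \<le> (\<Sum>n. (hnorm (H n) (?y n))\<^sup>2)"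
          using y by (intro sum_le_suminf) (simp_all add: l2_simps)
        also have "\<dots> = (hnorm (l2_sum H) ?y)\<^sup>2" using y by (simp add: L.hnorm_sq l2_norm_sq)
        also have "\<dots> \<le> e\<^sup>2" using N[OF k l] y by (intro power_mono) auto
        finally show ?thesis using \<sigma> by (simp add: l2_minus)
      qed
      then show "\<forall>\<^sub>F l in sequentially. (\<Sum>n<M. (hnorm (H n) (\<sigma> k n \<ominus>\<^bsub>H n\<^esub> \<sigma> l n))\<^sup>2) \<le> e\<^sup>2"
        by (auto simp: eventually_sequentially)
    qed simp
    then show ?thesis by blast
  qed
  have bs: "summable (\<lambda>n. (hnorm (H n) (\<sigma> k n \<ominus>\<^bsub>H n\<^esub> v n))\<^sup>2)"
    "(\<Sum>n. (hnorm (H n) (\<sigma> k n \<ominus>\<^bsub>H n\<^esub> v n))\<^sup>2) \<le> e\<^sup>2"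
    if "\<forall>M. (\<Sum>n<M. (hnorm (H n) (\<sigma> k n \<ominus>\<^bsub>H n\<^esub> v n))\<^sup>2) \<le> e\<^sup>2" for k e
    using that by (auto intro!: summableI_nonneg_bounded[where x = "e\<^sup>2"] suminf_le_const)
  \<comment> \<open>One index suffices for membership: \<open>v\<close> is \<open>\<sigma> k\<close>
    minus a square summable difference.\<close>
  obtain k where k: "\<forall>M. (\<Sum>n<M. (hnorm (H n) (\<sigma> k n \<ominus>\<^bsub>H n\<^esub> v n))\<^sup>2) \<le> 1\<^sup>2"
    using part[of 1] by auto
  have dk: "(\<lambda>n. \<sigma> k n \<ominus>\<^bsub>H n\<^esub> v n) \<in> carrier (l2_sum H)" 
    using bs(1)[OF k] c v(1) by (simp add: l2_simps)
  have "\<sigma> k n \<ominus>\<^bsub>H n\<^esub> (\<sigma> k n \<ominus>\<^bsub>H n\<^esub> v n) = v n" for n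
    using c[of k n] v(1)[of n]
    by (simp add: a_minus_def S.M.minus_add S.M.r_neg1 S.M.a_assoc[symmetric] S.M.r_neg)
  then have "v = \<sigma> k \<ominus>\<^bsub>l2_sum H\<^esub> (\<lambda>n. \<sigma> k n \<ominus>\<^bsub>H n\<^esub> v n)"
    using l2_minus[OF \<sigma>[of k] dk] by (simp add: fun_eq_iff)
  then have vL: "v \<in> carrier (l2_sum H)" using L.M.minus_closed[OF \<sigma>[of k] dk] by simp
  have "\<exists>N. \<forall>k\<ge>N. hnorm (l2_sum H) (\<sigma> k \<ominus>\<^bsub>l2_sum H\<^esub> v) < e" if e: "e > 0" for e
  proof -
    obtain N where N: "\<And>k. k \<ge> N \<Longrightarrow> \<forall>M. (\<Sum>n<M. (hnorm (H n) (\<sigma> k n \<ominus>\<^bsub>H n\<^esub> v n))\<^sup>2) \<le> (e / 2)\<^sup>2"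
      using part[of "e / 2"] e by auto
    have "hnorm (l2_sum H) (\<sigma> k \<ominus>\<^bsub>l2_sum H\<^esub> v) < e" if "k \<ge> N" for k
    proof -
      have y: "\<sigma> k \<ominus>\<^bsub>l2_sum H\<^esub> v \<in> carrier (l2_sum H)" using \<sigma> vL by simp
      have "(hnorm (l2_sum H) (\<sigma> k \<ominus>\<^bsub>l2_sum H\<^esub> v))\<^sup>2 \<le> (e / 2)\<^sup>2"
        using bs(2)[OF N[OF that]] \<sigma> vL y by (simp add: L.hnorm_sq l2_norm_sq l2_minus)
      then have "hnorm (l2_sum H) (\<sigma> k \<ominus>\<^bsub>l2_sum H\<^esub> v) \<le> e / 2"
        by (rule power2_le_imp_le) (use e in simp)
      then show ?thesis using e by simp
    qed
    then show ?thesis by blast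
  qed
  then show "\<exists>v\<in>carrier (l2_sum H). \<forall>e>0. \<exists>N. \<forall>k\<ge>N. hnorm (l2_sum H) (\<sigma> k \<ominus>\<^bsub>l2_sum H\<^esub> v) < e"
    using vL by blast
qed

end

text \<open>The operator of \<open>a\<close> preserves square summability because one constant
  bounds it on all summands.\<close>

lemma (in ulf_metric_space) star_representation_l2_sum:
  fixes H :: "nat \<Rightarrow> 'h inner_module"
  assumes rep: "\<And>n. star_representation X d (H n) (\<pi> n)"
  shows "star_representation X d (l2_sum H) (\<lambda>a x n. \<pi> n a (x n))"
proof -
  interpret hilbert_family H
    by (rule hilbert_family.intro) (use rep in \<open>simp add: star_representation_def\<close>)
  note r = rep[unfolded star_representation_def]
  have lin: "clinear_map (H n) (H n) (\<pi> n a)" if "a \<in> carrier Cu" for n a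
    using r[of n] that by (simp add: bounded_operator_def)
  note lins = clinear_mapD[OF lin]
  have l2n: "x n \<in> carrier (H n)" if "x \<in> carrier (l2_sum H)" for x n
    using that by (simp add: l2_simps)
  have bd: "\<exists>C. \<forall>x\<in>carrier (l2_sum H). (\<lambda>n. \<pi> n a (x n)) \<in> carrier (l2_sum H) \<and>
      hnorm (l2_sum H) (\<lambda>n. \<pi> n a (x n)) \<le> C * hnorm (l2_sum H) x" if a: "a \<in> carrier Cu" for a
  proof -
    obtain C where C: "0 \<le> C" "\<And>(H :: 'h inner_module) \<pi> v. star_representation X d H \<pi> \<Longrightarrow> v \<in> carrier H \<Longrightarrow>
       hnorm H (\<pi> a v) \<le> C * hnorm H v"
      using star_representation_uniform_bound[OF a] by blast
    have "(\<lambda>n. \<pi> n a (x n)) \<in> carrier (l2_sum H) \<and>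
      hnorm (l2_sum H) (\<lambda>n. \<pi> n a (x n)) \<le> C * hnorm (l2_sum H) x" if x: "x \<in> carrier (l2_sum H)" for x
    proof -
      have le: "(hnorm (H n) (\<pi> n a (x n)))\<^sup>2 \<le> C\<^sup>2 * (hnorm (H n) (x n))\<^sup>2" for n
      proof -
        have "hnorm (H n) (\<pi> n a (x n)) \<le> C * hnorm (H n) (x n)" by (rule C(2)[OF rep l2n[OF x]])
        from power_mono[OF this, of 2] show ?thesis
          using lins(1)[OF a l2n[OF x]] by (simp add: power_mult_distrib)
      qed
      have s: "summable (\<lambda>n. C\<^sup>2 * (hnorm (H n) (x n))\<^sup>2)"
        using x by (simp add: l2_simps summable_mult)
      have s': "summable (\<lambda>n. (hnorm (H n) (\<pi> n a (x n)))\<^sup>2)"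
        by (rule summable_comparison_test'[OF s]) (use le in simp)
      then have y: "(\<lambda>n. \<pi> n a (x n)) \<in> carrier (l2_sum H)"
        using lins(1)[OF a l2n[OF x]] by (simp add: l2_simps)
      have "(hnorm (l2_sum H) (\<lambda>n. \<pi> n a (x n)))\<^sup>2 \<le> (\<Sum>n. C\<^sup>2 * (hnorm (H n) (x n))\<^sup>2)"
        using suminf_le[OF le s' s] y by (simp add: L.hnorm_sq l2_norm_sq)
      also have "\<dots> = (C * hnorm (l2_sum H) x)\<^sup>2"
        using suminf_mult[of "\<lambda>n. (hnorm (H n) (x n))\<^sup>2" "C\<^sup>2"] x
        by (simp add: power_mult_distrib L.hnorm_sq l2_norm_sq) (simp add: l2_simps)
      finally have "hnorm (l2_sum H) (\<lambda>n. \<pi> n a (x n)) \<le> C * hnorm (l2_sum H) x"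
        by (rule power2_le_imp_le) (use C(1) x in simp)
      then show ?thesis using y by blast
    qed
    then show ?thesis by blast
  qed
  show ?thesis
    unfolding star_representation_def
  proof (intro conjI ballI allI)
    show "hilbert_space (l2_sum H)" by (rule hilbert_space_l2_sum)
  next
    fix a assume a: "a \<in> carrier Cu"
    have "clinear_map (l2_sum H) (l2_sum H) (\<lambda>x n. \<pi> n a (x n))"
      unfolding clinear_map_def
    proof (intro conjI ballI allI)
      show "(\<lambda>x n. \<pi> n a (x n)) \<in> carrier (l2_sum H) \<rightarrow> carrier (l2_sum H)" using bd[OF a] by blast
    qed (use lins[OF a] l2n in \<open>simp_all add: l2_simps(3,4) fun_eq_iff\<close>)
    then show "bounded_operator (l2_sum H) (\<lambda>x n. \<pi> n a (x n))"
      unfolding bounded_operator_def using bd[OF a] by blast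
  next
    fix a b v assume *: "a \<in> carrier Cu" "b \<in> carrier Cu" "v \<in> carrier (l2_sum H)"
    show "(\<lambda>n. \<pi> n (a \<oplus>\<^bsub>Cu\<^esub> b) (v n)) = (\<lambda>n. \<pi> n a (v n)) \<oplus>\<^bsub>l2_sum H\<^esub> (\<lambda>n. \<pi> n b (v n))"
      using r * l2n by (simp add: l2_simps(3) fun_eq_iff)
    show "(\<lambda>n. \<pi> n (a \<otimes>\<^bsub>Cu\<^esub> b) (v n)) = (\<lambda>n. \<pi> n a (\<pi> n b (v n)))"
      using r * l2n by (simp add: fun_eq_iff)
  next
    fix c a v assume *: "a \<in> carrier Cu" "v \<in> carrier (l2_sum H)"
    show "(\<lambda>n. \<pi> n (c \<odot>\<^bsub>Cu\<^esub> a) (v n)) = c \<odot>\<^bsub>l2_sum H\<^esub> (\<lambda>n. \<pi> n a (v n))"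
      using r * l2n by (simp add: l2_simps(4) fun_eq_iff)
  next
    fix v assume *: "v \<in> carrier (l2_sum H)"
    show "(\<lambda>n. \<pi> n \<one>\<^bsub>Cu\<^esub> (v n)) = v"
      using r l2n[OF *] by (simp add: fun_eq_iff)
  next
    fix a v w assume *: "a \<in> carrier Cu" "v \<in> carrier (l2_sum H)" "w \<in> carrier (l2_sum H)"
    show "cinner (l2_sum H) (\<lambda>n. \<pi> n (adjoint_matrix a) (v n)) w = cinner (l2_sum H) v (\<lambda>n. \<pi> n a (w n))"
      using r * l2n by (simp add: l2_simps(5))
  qed
qed

section \<open>Cohomological property (T) implies geometric property (T)\<close>

context ulf_metric_space
begin

lemma sup_entry_ge:
  assumes a: "a \<in> carrier Cu" and "x \<in> X" "y \<in> X"
  shows "cmod (a x y) \<le> sup_entry X a"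
proof -
  obtain C where C: "\<And>x y. cmod (a x y) \<le> C" using a unfolding in_roe_iff by blast
  have "cmod (a x y) = (case (x, y) of (x, y) \<Rightarrow> cmod (a x y))" by simp
  also have "\<dots> \<le> sup_entry X a"
    unfolding sup_entry_def using assms C by (intro cSUP_upper bdd_aboveI[of _ C]) auto
  finally show ?thesis .
qed

lemma sup_entry_le:
  assumes "X \<noteq> {}" "\<And>x y. cmod (a x y) \<le> C"
  shows "sup_entry X a \<le> C"
  unfolding sup_entry_def using assms by (intro cSUP_least) auto

lemma diagonal_omega_ker: "a \<in> ker_omega X d \<Longrightarrow> a \<ominus>\<^bsub>Cu\<^esub> diagonal (omega a) = a"
proof -
  assume a: "a \<in> ker_omega X d"
  interpret abelian_group Cu by (rule abelian_group_roe)
  have "diagonal (omega a) = \<zero>\<^bsub>Cu\<^esub>" using a by (auto simp: ker_omega_def diagonal_def roe_simps fun_eq_iff)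
  then show ?thesis using a by (simp add: a_minus_def ker_omega_def)
qed

text \<open>If the spectral gaps of representations \<open>\<pi>\<^sub>n\<close> degenerate quickly along unit vectors \<open>v\<^sub>n\<close>, then
  \<open>a \<mapsto> (2\<^sup>n \<pi>\<^sub>n(a) v\<^sub>n)\<^sub>n\<close> is a cocycle with values in the direct sum which is not inner.\<close>

theorem cohomological_imp_geometric:
  assumes ne: "X \<noteq> {}" and T: "cohomological_T X d"
  shows "geometric_T X d"
proof (rule ccontr)
  assume not: "\<not> geometric_T X d"
  \<comment> \<open>The failing pairs of radius and constant are taken with radii tending to
    infinity and constants 4^-n, which decay faster than the weights 2^n below grow.\<close>
  have "\<exists>(H :: (nat \<Rightarrow> 'a cmatrix) inner_module) \<pi>. star_representation X d H \<pi> \<and> \<not> constant_gap X d (real (Suc n)) (1 / 4 ^ n) H \<pi>" for n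
  proof (rule ccontr)
    assume "\<not> ?thesis"
    then have "\<forall>(H :: (nat \<Rightarrow> 'a cmatrix) inner_module) \<pi>. star_representation X d H \<pi> \<longrightarrow>
        constant_gap X d (real (Suc n)) (1 / 4 ^ n) H \<pi>" by blast
    moreover have "(0::real) < real (Suc n)" "(0::real) < 1 / 4 ^ n" by simp_all
    ultimately show False using not unfolding geometric_T_def by blast
  qed
  then obtain H :: "nat \<Rightarrow> (nat \<Rightarrow> 'a cmatrix) inner_module" and \<pi> where
    rep: "\<And>n. star_representation X d (H n) (\<pi> n)"
    and gap: "\<And>n. \<not> constant_gap X d (real (Suc n)) (1 / 4 ^ n) (H n) (\<pi> n)" by metis
  interpret hilbert_family H
    by (rule hilbert_family.intro) (use rep in \<open>simp add: star_representation_def\<close>)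
  note r = rep[unfolded star_representation_def]
  have lin: "clinear_map (H n) (H n) (\<pi> n a)" if "a \<in> carrier Cu" for n a
    using r[of n] that by (simp add: bounded_operator_def)
  note lins = clinear_mapD[OF lin]
  have "\<exists>u. u \<in> orthogonal_complement (H n) (constant_vectors X d (H n) (\<pi> n)) \<and>
      hnorm (H n) u = 1 \<and> (\<forall>a\<in>ker_omega X d. a \<noteq> \<zero>\<^bsub>Cu\<^esub> \<longrightarrow> propagation d a \<le> ennreal (Suc n) \<longrightarrow>
        hnorm (H n) (\<pi> n a u) \<le> 1 / 4 ^ n * sup_entry X a)" for n
  proof -
    obtain v where v: "v \<in> orthogonal_complement (H n) (constant_vectors X d (H n) (\<pi> n))"
      "\<And>a. \<lbrakk>a \<in> carrier Cu; a \<noteq> \<zero>\<^bsub>Cu\<^esub>; propagation d a \<le> ennreal (real (Suc n))\<rbrakk> \<Longrightarrow>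
        hnorm (H n) (\<pi> n (a \<ominus>\<^bsub>Cu\<^esub> diagonal (omega a)) v) < 1 / 4 ^ n * hnorm (H n) v * sup_entry X a"
      using gap[of n] unfolding constant_gap_def by (meson not_le)
    have vH: "v \<in> carrier (H n)" using v(1) by (simp add: orthogonal_complement_def)
    have "hnorm (H n) v \<noteq> 0"
    proof
      assume 0: "hnorm (H n) v = 0"
      \<comment> \<open>Nonemptiness of \<open>X\<close> makes the unit a nonzero matrix of
        propagation 0. Tested on a vector of norm 0 it would yield a negative norm.\<close>
      obtain x where x: "x \<in> X" using ne by blast
      have "\<one>\<^bsub>Cu\<^esub> x x \<noteq> 0" using x by (simp add: roe_simps diagonal_def)
      then have "\<one>\<^bsub>Cu\<^esub> \<noteq> \<zero>\<^bsub>Cu\<^esub>" by (auto simp: roe_simps(3))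
      moreover have "propagation d \<one>\<^bsub>Cu\<^esub> \<le> ennreal (real (Suc n))"
        unfolding propagation_def by (rule Sup_least) (auto simp: roe_simps diagonal_def dist_self split: if_splits)
      ultimately have "hnorm (H n) (\<pi> n (\<one>\<^bsub>Cu\<^esub> \<ominus>\<^bsub>Cu\<^esub> diagonal (omega \<one>\<^bsub>Cu\<^esub>)) v) < 0"
        using v(2)[OF one_in_roe] 0 by simp
      moreover have "\<one>\<^bsub>Cu\<^esub> \<ominus>\<^bsub>Cu\<^esub> diagonal (omega \<one>\<^bsub>Cu\<^esub>) \<in> carrier Cu"
        using abelian_group.minus_closed[OF abelian_group_roe one_in_roe diagonal_omega_in_roe[OF one_in_roe]] .
      ultimately show False using S.hnorm_nonneg[OF lins(1)[OF _ vH]] by (meson not_le)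
    qed
    then have pos: "hnorm (H n) v > 0" using S.hnorm_nonneg[OF vH] by simp
    define c where "c = complex_of_real (1 / hnorm (H n) v)"
    have c: "cmod c = 1 / hnorm (H n) v" using pos by (simp add: c_def norm_divide)
    have cv: "c \<odot>\<^bsub>H n\<^esub> v \<in> carrier (H n)" using vH by (rule S.scale_closed)
    show ?thesis
    proof (intro exI[of _ "c \<odot>\<^bsub>H n\<^esub> v"] conjI ballI impI)
      show "c \<odot>\<^bsub>H n\<^esub> v \<in> orthogonal_complement (H n) (constant_vectors X d (H n) (\<pi> n))"
        using v(1) cv by (simp add: orthogonal_complement_def constant_vectors_def S.cinner_smult_left)
      show "hnorm (H n) (c \<odot>\<^bsub>H n\<^esub> v) = 1" using pos c vH by (simp add: S.hnorm_smult)
      fix a assume a: "a \<in> ker_omega X d" "a \<noteq> \<zero>\<^bsub>Cu\<^esub>" "propagation d a \<le> ennreal (real (Suc n))"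
      have aC: "a \<in> carrier Cu" using a by (simp add: ker_omega_def)
      have "hnorm (H n) (\<pi> n a v) < 1 / 4 ^ n * hnorm (H n) v * sup_entry X a"
        using v(2)[OF aC a(2,3)] by (simp add: diagonal_omega_ker[OF a(1)])
      then have "hnorm (H n) (\<pi> n a v) / hnorm (H n) v \<le> 1 / 4 ^ n * sup_entry X a"
        using pos by (simp only: pos_divide_le_eq) (simp add: mult_ac)
      then show "hnorm (H n) (\<pi> n a (c \<odot>\<^bsub>H n\<^esub> v)) \<le> 1 / 4 ^ n * sup_entry X a"
        using c lins(1)[OF aC vH] by (simp add: lins(3)[OF aC vH] S.hnorm_smult)
    qed
  qed
  then obtain u where u: "\<And>n. u n \<in> orthogonal_complement (H n) (constant_vectors X d (H n) (\<pi> n))"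
      "\<And>n. hnorm (H n) (u n) = 1"
      "\<And>n a. \<lbrakk>a \<in> ker_omega X d; a \<noteq> \<zero>\<^bsub>Cu\<^esub>; propagation d a \<le> ennreal (Suc n)\<rbrakk> \<Longrightarrow>
        hnorm (H n) (\<pi> n a (u n)) \<le> 1 / 4 ^ n * sup_entry X a" by metis
  have uH: "u n \<in> carrier (H n)" for n using u(1) by (simp add: orthogonal_complement_def)
  \<comment> \<open>The weights 2^n are unbounded, yet 2^n times the gap 4^-n is square
    summable.\<close>
  define w where "w n = complex_of_real (2 ^ n) \<odot>\<^bsub>H n\<^esub> u n" for n
  have wH: "w n \<in> carrier (H n)" for n using uH by (simp add: w_def S.scale_closed)
  define \<theta> where "\<theta> a = (\<lambda>n. \<pi> n a (w n))" for a
  have L: "a \<in> carrier Cu" if "a \<in> ker_omega X d" for a using that by (simp add: ker_omega_def)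
  have \<theta>c: "\<theta> a \<in> carrier (l2_sum H)" if a: "a \<in> ker_omega X d" for a
  proof -
    obtain r0 where r0: "0 \<le> r0" "propagation d a = ennreal r0"
      using L[OF a] by (cases "propagation d a") (auto simp: uniform_roe_def)
    \<comment> \<open>All but finitely many radii exceed the propagation of \<open>a\<close>, so
      from \<open>n0\<close> on the gap estimate applies.\<close>
    obtain n0 where n0: "r0 \<le> real n0" using real_arch_simple by blast
    obtain C where C: "0 \<le> C" "\<And>x y. cmod (a x y) \<le> C" using roe_bounded[OF L[OF a]] by blast
    have "summable (\<lambda>n. (hnorm (H n) (\<theta> a n))\<^sup>2)"
    proof (rule summable_comparison_test'[of _ n0])
      show "summable (\<lambda>n. C\<^sup>2 * (1 / 4) ^ n)"
        by (intro summable_mult summable_geometric) simp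
      fix n assume n: "n \<ge> n0"
      have "hnorm (H n) (\<pi> n a (u n)) \<le> 1 / 4 ^ n * C"
      proof (cases "a = \<zero>\<^bsub>Cu\<^esub>")
        case True
        then have "a = 0 \<odot>\<^bsub>Cu\<^esub> a" by (simp add: roe_simps)
        then have "\<pi> n a (u n) = 0 \<odot>\<^bsub>H n\<^esub> \<pi> n a (u n)" using r L[OF a] uH by metis
        then have "hnorm (H n) (\<pi> n a (u n)) = 0"
          using S.hnorm_smult[OF lins(1)[OF L[OF a] uH], of n 0] by simp
        then show ?thesis using C(1) by simp
      next
        case False
        have "propagation d a \<le> ennreal (Suc n)"
          unfolding r0(2) by (rule ennreal_leI) (use n0 n in simp)
        then have "hnorm (H n) (\<pi> n a (u n)) \<le> 1 / 4 ^ n * sup_entry X a" using u(3) a False by blast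
        also have "\<dots> \<le> 1 / 4 ^ n * C" using sup_entry_le[OF ne C(2)] by (intro mult_left_mono) simp_all
        finally show ?thesis .
      qed
      then have "2 ^ n * hnorm (H n) (\<pi> n a (u n)) \<le> 2 ^ n * (1 / 4 ^ n * C)"
        by (rule mult_left_mono) simp
      moreover have "hnorm (H n) (\<theta> a n) = 2 ^ n * hnorm (H n) (\<pi> n a (u n))"
        by (simp add: \<theta>_def w_def lins(3)[OF L[OF a] uH] S.hnorm_smult lins(1)[OF L[OF a] uH] norm_power)
      moreover have "2 ^ n * (1 / 4 ^ n * C) = (1 / 2) ^ n * C"
        using power_mult_distrib[of "2 :: real" 2 n] by (simp add: power_divide field_simps)
      ultimately have "hnorm (H n) (\<theta> a n) \<le> (1 / 2) ^ n * C" by simp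
      then have "(hnorm (H n) (\<theta> a n))\<^sup>2 \<le> ((1 / 2) ^ n * C)\<^sup>2"
        using lins(1)[OF L[OF a] wH] by (intro power_mono) (simp_all add: \<theta>_def)
      also have "\<dots> = C\<^sup>2 * (1 / 4) ^ n"
        using power_mult_distrib[of "1 / 2 :: real" "1 / 2" n] by (simp add: power_mult_distrib power2_eq_square)
      finally show "norm ((hnorm (H n) (\<theta> a n))\<^sup>2) \<le> C\<^sup>2 * (1 / 4) ^ n" by simp
    qed
    then show ?thesis using lins(1)[OF L[OF a] wH] by (simp add: l2_simps \<theta>_def)
  qed
  have "cocycle X d (l2_sum H) (\<lambda>a x n. \<pi> n a (x n)) \<theta>"
    unfolding cocycle_def clinear_map_def
  proof (intro conjI ballI allI)
    show "\<theta> \<in> carrier (Cu\<lparr>carrier := ker_omega X d\<rparr>) \<rightarrow> carrier (l2_sum H)" using \<theta>c by simp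
  next
    fix a b assume "a \<in> carrier (Cu\<lparr>carrier := ker_omega X d\<rparr>)" "b \<in> carrier (Cu\<lparr>carrier := ker_omega X d\<rparr>)"
    then have ab: "a \<in> carrier Cu" "b \<in> carrier Cu" using L by simp_all
    have "\<pi> n (a \<oplus>\<^bsub>Cu\<^esub> b) (w n) = \<pi> n a (w n) \<oplus>\<^bsub>H n\<^esub> \<pi> n b (w n)" for n using r ab wH by blast
    then show "\<theta> (a \<oplus>\<^bsub>Cu\<lparr>carrier := ker_omega X d\<rparr>\<^esub> b) = \<theta> a \<oplus>\<^bsub>l2_sum H\<^esub> \<theta> b"
      by (simp add: \<theta>_def l2_simps(3))
  next
    fix c a assume "a \<in> carrier (Cu\<lparr>carrier := ker_omega X d\<rparr>)"
    then have a: "a \<in> carrier Cu" using L by simp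
    have "\<pi> n (c \<odot>\<^bsub>Cu\<^esub> a) (w n) = c \<odot>\<^bsub>H n\<^esub> \<pi> n a (w n)" for n using r a wH by blast
    then show "\<theta> (c \<odot>\<^bsub>Cu\<lparr>carrier := ker_omega X d\<rparr>\<^esub> a) = c \<odot>\<^bsub>l2_sum H\<^esub> \<theta> a"
      by (simp add: \<theta>_def l2_simps(4))
  next
    fix a b assume a: "a \<in> carrier Cu" and "b \<in> ker_omega X d"
    then have b: "b \<in> carrier Cu" using L by blast
    have "\<pi> n (a \<otimes>\<^bsub>Cu\<^esub> b) (w n) = \<pi> n a (\<pi> n b (w n))" for n using r a b wH by blast
    then show "\<theta> (a \<otimes>\<^bsub>Cu\<^esub> b) = (\<lambda>n. \<pi> n a (\<theta> b n))" by (simp add: \<theta>_def)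
  qed
  from cohomological_T_D[OF T star_representation_l2_sum[OF rep] this]
  obtain z where z: "z \<in> carrier (l2_sum H)" "\<And>a. a \<in> ker_omega X d \<Longrightarrow> \<theta> a = (\<lambda>n. \<pi> n a (z n))"
    unfolding coboundary_def by blast
  have zH: "z n \<in> carrier (H n)" for n using z(1) by (simp add: l2_simps)
  have "2 ^ n \<le> hnorm (l2_sum H) z" for n
  proof -
    \<comment> \<open>In each component a solution \<open>z\<close> differs from \<open>w\<close> by
      a constant vector, and \<open>u n\<close> is orthogonal to constant vectors. So
      \<open>z n\<close> has the same inner product with the unit vector \<open>u n\<close> as
      \<open>w n\<close>, of modulus 2^n.\<close>
    have "w n \<ominus>\<^bsub>H n\<^esub> z n \<in> constant_vectors X d (H n) (\<pi> n)"
      unfolding constant_vectors_def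
    proof (intro CollectI conjI ballI)
      fix a assume a: "a \<in> ker_omega X d"
      have "\<pi> n a (w n) = \<pi> n a (z n)" using z(2)[OF a] by (simp add: \<theta>_def fun_eq_iff)
      then show "\<pi> n a (w n \<ominus>\<^bsub>H n\<^esub> z n) = \<zero>\<^bsub>H n\<^esub>"
        using S.clinear_map_diff[OF lin[OF L[OF a]] wH zH] S.diff_eq_zero lins(1)[OF L[OF a]] wH zH by metis
    qed (use wH zH in simp)
    then have "cinner (H n) (u n) (w n \<ominus>\<^bsub>H n\<^esub> z n) = 0" using u(1)[of n] by (simp add: orthogonal_complement_def)
    then have "cinner (H n) (u n) (z n) = cinner (H n) (u n) (w n)"
      using uH wH zH by (simp add: S.cinner_diff_right)
    also have "\<dots> = 2 ^ n" using uH u(2)[of n] by (simp add: w_def S.cinner_smult_right S.cinner_self)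
    finally have "2 ^ n = cmod (cinner (H n) (u n) (z n))" by (simp add: norm_power)
    also have "\<dots> \<le> hnorm (H n) (u n) * hnorm (H n) (z n)" by (rule S.norm_cinner_le[OF uH zH])
    also have "\<dots> \<le> hnorm (l2_sum H) z" using u(2)[of n] hnorm_component_le[OF z(1)] by simp
    finally show ?thesis .
  qed
  moreover obtain n where "hnorm (l2_sum H) z < 2 ^ n" using real_arch_pow[of 2] by auto
  ultimately show False by (meson not_le)
qed

end

section \<open>Schoenberg's theorem\<close>

text \<open>A real quadratic form sees only the symmetric part of a kernel, so symmetry is a
  separate clause. Complex coefficients are reached by \<open>psd_complex\<close>, which treats real
  and imaginary parts separately.\<close>

definition psd :: "'i set \<Rightarrow> ('i \<Rightarrow> 'i \<Rightarrow> real) \<Rightarrow> bool" where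
  "psd F k \<longleftrightarrow> (\<forall>x\<in>F. \<forall>y\<in>F. k x y = k y x) \<and> (\<forall>z. 0 \<le> (\<Sum>x\<in>F. \<Sum>y\<in>F. z x * z y * k x y))"

lemma psd_nonneg: "psd F k \<Longrightarrow> 0 \<le> (\<Sum>x\<in>F. \<Sum>y\<in>F. z x * z y * k x y)"
  by (simp add: psd_def)

lemma psd_sym: "psd F k \<Longrightarrow> x \<in> F \<Longrightarrow> y \<in> F \<Longrightarrow> k x y = k y x"
  by (simp add: psd_def)

lemma psd_subset:
  assumes k: "psd F k" and F: "finite F" "E \<subseteq> F"
  shows "psd E k"
  unfolding psd_def
proof (intro conjI ballI allI)
  fix z :: "'a \<Rightarrow> real"
  let ?z = "\<lambda>x. if x \<in> E then z x else 0"
  have "(\<Sum>x\<in>E. \<Sum>y\<in>E. z x * z y * k x y) = (\<Sum>x\<in>E. \<Sum>y\<in>E. ?z x * ?z y * k x y)"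
    by (intro sum.cong) auto
  also have "\<dots> = (\<Sum>x\<in>E. \<Sum>y\<in>F. ?z x * ?z y * k x y)"
    using F by (intro sum.cong[OF refl] sum.mono_neutral_left) auto
  also have "\<dots> = (\<Sum>x\<in>F. \<Sum>y\<in>F. ?z x * ?z y * k x y)"
    using F by (intro sum.mono_neutral_left) auto
  also have "0 \<le> \<dots>" by (rule psd_nonneg[OF k])
  finally show "0 \<le> (\<Sum>x\<in>E. \<Sum>y\<in>E. z x * z y * k x y)" .
qed (use k F in \<open>auto simp: psd_def\<close>)

lemma psd_cong:
  assumes "psd F k" "\<And>x y. x \<in> F \<Longrightarrow> y \<in> F \<Longrightarrow> k x y = k' x y"
  shows "psd F k'"
  using assms by (simp add: psd_def cong: sum.cong)

lemma psd_scale: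
  assumes "psd F k" shows "psd F (\<lambda>x y. f x * f y * k x y)"
  unfolding psd_def
proof (intro conjI ballI allI)
  fix z
  have "0 \<le> (\<Sum>x\<in>F. \<Sum>y\<in>F. (z x * f x) * (z y * f y) * k x y)" by (rule psd_nonneg[OF assms])
  then show "0 \<le> (\<Sum>x\<in>F. \<Sum>y\<in>F. z x * z y * (f x * f y * k x y))" by (simp add: mult_ac)
qed (use assms in \<open>simp add: psd_def mult_ac\<close>)

lemma psd_insert_expand:
  fixes k :: "'a \<Rightarrow> 'a \<Rightarrow> real"
  assumes F: "finite F" "e \<notin> F" and k: "\<And>x y. x \<in> insert e F \<Longrightarrow> y \<in> insert e F \<Longrightarrow> k x y = k y x"
  shows "(\<Sum>x\<in>insert e F. \<Sum>y\<in>insert e F. z x * z y * k x y) =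
    (z e)\<^sup>2 * k e e + 2 * z e * (\<Sum>y\<in>F. z y * k e y) + (\<Sum>x\<in>F. \<Sum>y\<in>F. z x * z y * k x y)"
proof -
  have "(\<Sum>x\<in>F. z x * z e * k x e) = z e * (\<Sum>y\<in>F. z y * k e y)"
    unfolding sum_distrib_left using k by (intro sum.cong) (auto simp: mult_ac)
  moreover have "(\<Sum>y\<in>F. z e * z y * k e y) = z e * (\<Sum>y\<in>F. z y * k e y)"
    by (simp add: sum_distrib_left mult_ac)
  ultimately show ?thesis using F by (simp add: sum.distrib power2_eq_square)
qed

text \<open>Schur's product theorem by elimination: subtracting a rank one kernel from \<open>g\<close> clears a row.\<close>

lemma schur_sum_nonneg:
  assumes "finite F" "psd F k" "psd F g"
  shows "0 \<le> (\<Sum>x\<in>F. \<Sum>y\<in>F. k x y * g x y)"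
  using assms
proof (induction F arbitrary: g rule: finite_induct)
  case (insert e F)
  have kF: "psd F k" and gF: "psd F g"
    using psd_subset[OF insert.prems(1)] psd_subset[OF insert.prems(2)] insert.hyps(1) by auto
  have gs: "g x y = g y x" if "x \<in> insert e F" "y \<in> insert e F" for x y
    using psd_sym[OF insert.prems(2) that] .
  have Q: "0 \<le> (z e)\<^sup>2 * g e e + 2 * z e * (\<Sum>y\<in>F. z y * g e y) + (\<Sum>x\<in>F. \<Sum>y\<in>F. z x * z y * g x y)" for z
    using psd_nonneg[OF insert.prems(2), of z] by (simp only: psd_insert_expand[OF insert.hyps gs])
  show ?case
  proof (cases "g e e = 0")
    case True
    have 0: "g e y = 0" if y: "y \<in> F" for y
    proof (rule ccontr)
      assume ne: "g e y \<noteq> 0"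
      \<comment> \<open>At this \<open>t\<close> the expression \<open>2 * t * g e y + g y y\<close>
        would be -1: a zero diagonal entry forces its row to vanish.\<close>
      define t where "t = - (g y y + 1) / (2 * g e y)"
      let ?z = "\<lambda>x. if x = e then t else if x = y then 1 else 0"
      have ye: "y \<noteq> e" using y insert.hyps by blast
      have pick: "(\<Sum>x\<in>F. ?z x * f x) = f y" for f :: "'a \<Rightarrow> real"
      proof -
        have "(\<Sum>x\<in>F. ?z x * f x) = (\<Sum>x\<in>F. if x = y then f x else 0)"
          using insert.hyps by (intro sum.cong) auto
        then show ?thesis using insert.hyps y by simp
      qed
      have "0 \<le> 2 * t * g e y + g y y"
        using Q[of ?z] unfolding mult.assoc sum_distrib_left[symmetric] pick by (simp add: True)
      then show False using ne by (simp add: t_def field_simps)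
    qed
    have "(\<Sum>x\<in>insert e F. \<Sum>y\<in>insert e F. k x y * g x y) = (\<Sum>x\<in>F. \<Sum>y\<in>F. k x y * g x y)"
      using insert.hyps 0 True gs by (simp add: sum.neutral)
    then show ?thesis using insert.IH[OF kF gF] by simp
  next
    case False
    have "0 \<le> g e e" using Q[of "\<lambda>x. if x = e then 1 else 0"] insert.hyps
      by (simp add: sum.neutral if_distrib cong: if_cong)
    with False have pos: "0 < g e e" by simp
    define h where "h x y = g x y - g x e * g y e / g e e" for x y
    have h0: "h e y = 0" "h y e = 0" if "y \<in> insert e F" for y
      using that gs[of e y] pos by (auto simp: h_def)
    have "psd F h"
      unfolding psd_def
    proof (intro conjI ballI allI)
      fix z :: "'a \<Rightarrow> real"
      define S where "S = (\<Sum>y\<in>F. z y * g e y)"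
      \<comment> \<open>The coefficient at \<open>e\<close> minimises the quadratic form of
        \<open>g\<close>; the minimum is the form of the Schur complement \<open>h\<close>.\<close>
      let ?z = "\<lambda>x. if x = e then - S / g e e else z x"
      have 1: "(\<Sum>y\<in>F. ?z y * g e y) = S" unfolding S_def
        using insert.hyps by (intro sum.cong) auto
      have 2: "(\<Sum>x\<in>F. \<Sum>y\<in>F. ?z x * ?z y * g x y) = (\<Sum>x\<in>F. \<Sum>y\<in>F. z x * z y * g x y)"
        using insert.hyps by (intro sum.cong) auto
      have SS: "S * S = (\<Sum>x\<in>F. \<Sum>y\<in>F. z x * z y * (g x e * g y e))"
        unfolding S_def sum_product using gs by (intro sum.cong) (auto simp: mult_ac)
      have "0 \<le> (\<Sum>x\<in>F. \<Sum>y\<in>F. z x * z y * g x y) - S * S / g e e"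
        using Q[of ?z] pos unfolding 1 2 by (simp add: power2_eq_square field_simps)
      also have "\<dots> = (\<Sum>x\<in>F. \<Sum>y\<in>F. z x * z y * h x y)"
        unfolding SS h_def by (simp add: sum_subtractf right_diff_distrib sum_divide_distrib)
      finally show "0 \<le> (\<Sum>x\<in>F. \<Sum>y\<in>F. z x * z y * h x y)" .
    qed (use gs in \<open>simp add: h_def mult.commute\<close>)
    then have "0 \<le> (\<Sum>x\<in>F. \<Sum>y\<in>F. k x y * h x y)" by (rule insert.IH[OF kF])
    also have "\<dots> = (\<Sum>x\<in>insert e F. \<Sum>y\<in>insert e F. k x y * h x y)"
      using insert.hyps h0 by (simp add: sum.neutral)
    finally have 1: "0 \<le> (\<Sum>x\<in>insert e F. \<Sum>y\<in>insert e F. k x y * h x y)" .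
    have "0 \<le> (\<Sum>x\<in>insert e F. \<Sum>y\<in>insert e F. g x e * g y e * k x y)"
      by (rule psd_nonneg[OF insert.prems(1)])
    then have 2: "0 \<le> (\<Sum>x\<in>insert e F. \<Sum>y\<in>insert e F. g x e * g y e * k x y) / g e e" using pos by simp
    \<comment> \<open>The rank one part removed from \<open>g\<close> contributes the form of
      \<open>k\<close> at the vector \<open>\<lambda>x. g x e\<close>, divided by
      \<open>g e e\<close>.\<close>
    have "(\<Sum>x\<in>insert e F. \<Sum>y\<in>insert e F. k x y * g x y) =
       (\<Sum>x\<in>insert e F. \<Sum>y\<in>insert e F. k x y * h x y + g x e * g y e * k x y / g e e)"
      by (intro sum.cong refl) (simp add: h_def algebra_simps)
    also have "\<dots> = (\<Sum>x\<in>insert e F. \<Sum>y\<in>insert e F. k x y * h x y) +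
       (\<Sum>x\<in>insert e F. \<Sum>y\<in>insert e F. g x e * g y e * k x y) / g e e"
      by (simp only: sum.distrib sum_divide_distrib)
    finally show ?thesis using 1 2 by linarith
  qed
qed simp

lemma psd_mult:
  assumes "finite F" "psd F k" "psd F g"
  shows "psd F (\<lambda>x y. k x y * g x y)"
  unfolding psd_def
proof (intro conjI ballI allI)
  fix z
  show "0 \<le> (\<Sum>x\<in>F. \<Sum>y\<in>F. z x * z y * (k x y * g x y))"
    using schur_sum_nonneg[OF assms(1) psd_scale[OF assms(2), of z] assms(3)] by (simp add: mult_ac)
qed (use assms in \<open>simp add: psd_def\<close>)

lemma psd_one: "psd F (\<lambda>x y. 1)"
proof -
  have "(\<Sum>x\<in>F. \<Sum>y\<in>F. z x * z y) = (\<Sum>x\<in>F. z x)\<^sup>2" for z :: "'a \<Rightarrow> real"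
    by (simp add: power2_eq_square sum_product)
  then show ?thesis by (simp add: psd_def)
qed

lemma psd_add:
  assumes "psd F k" "psd F g" shows "psd F (\<lambda>x y. k x y + g x y)"
  using assms by (simp add: psd_def distrib_left sum.distrib add_nonneg_nonneg)

lemma psd_cmult:
  assumes "psd F k" "0 \<le> (c::real)" shows "psd F (\<lambda>x y. c * k x y)"
proof (rule psd_cong[OF psd_scale[OF assms(1), of "\<lambda>_. sqrt c"]])
  fix x y show "sqrt c * sqrt c * k x y = c * k x y" using assms(2) by simp
qed

lemma psd_tendsto:
  assumes k: "\<And>n. psd F (k n)" and lim: "\<And>x y. x \<in> F \<Longrightarrow> y \<in> F \<Longrightarrow> ((\<lambda>n. k n x y) \<longlongrightarrow> l x y) U" and U: "U \<noteq> bot"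
  shows "psd F l"
  unfolding psd_def
proof (intro conjI ballI allI)
  fix x y assume xy: "x \<in> F" "y \<in> F"
  have "k n x y = k n y x" for n using psd_sym[OF k xy] .
  then have "((\<lambda>n. k n x y) \<longlongrightarrow> l y x) U" using lim[OF xy(2,1)] by simp
  with lim[OF xy] show "l x y = l y x" using tendsto_unique[OF U] by blast
next
  fix z
  have "((\<lambda>n. \<Sum>x\<in>F. \<Sum>y\<in>F. z x * z y * k n x y) \<longlongrightarrow> (\<Sum>x\<in>F. \<Sum>y\<in>F. z x * z y * l x y)) U"
    by (intro tendsto_sum tendsto_mult_left lim)
  then show "0 \<le> (\<Sum>x\<in>F. \<Sum>y\<in>F. z x * z y * l x y)"
    by (rule tendsto_lowerbound) (use k U in \<open>auto simp: psd_def\<close>)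
qed

text \<open>Powers are positive definite by Schur's theorem, and the exponential is a limit of
  nonnegative combinations of powers.\<close>

lemma psd_exp:
  assumes F: "finite F" and g: "psd F g"
  shows "psd F (\<lambda>x y. exp (g x y))"
proof (rule psd_tendsto)
  have pow: "psd F (\<lambda>x y. (g x y) ^ i)" for i
    by (induction i) (simp_all add: psd_one psd_mult[OF F g])
  show "psd F (\<lambda>x y. \<Sum>i<n. (g x y) ^ i /\<^sub>R fact i)" for n
  proof (induction n)
    case 0
    show ?case using psd_cmult[OF psd_one, of 0 F] by simp
  next
    case (Suc n)
    show ?case using psd_add[OF Suc psd_cmult[OF pow[of n], of "inverse (fact n)"]] by simp
  qed
  show "(\<lambda>n. \<Sum>i<n. (g x y) ^ i /\<^sub>R fact i) \<longlonglongrightarrow> exp (g x y)" for x y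
    using exp_converges[of "g x y"] by (simp add: sums_def)
qed simp

section \<open>Gram kernels and Gaussian kernels\<close>

context inner_product_space
begin

lemma finite_combination:
  fixes z :: "'i \<Rightarrow> real"
  assumes "finite F" "\<And>x. x \<in> F \<Longrightarrow> b x \<in> carrier H"
  shows "\<exists>v\<in>carrier H. \<forall>w\<in>carrier H. Re (cinner H v w) = (\<Sum>x\<in>F. z x * Re (cinner H (b x) w))"
  using assms
proof (induction F rule: finite_induct)
    case empty
    show ?case by (rule bexI[of _ \<zero>]) (simp_all add: cinner_zero_left)
  next
    case (insert e F)
    then obtain v where v: "v \<in> carrier H" "\<forall>w\<in>carrier H. Re (cinner H v w) = (\<Sum>x\<in>F. z x * Re (cinner H (b x) w))"
      by auto
    show ?case
      using v insert by (intro bexI[of _ "complex_of_real (z e) \<odot> b e \<oplus> v"])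
        (auto simp: cinner_add_left cinner_smult_left scale_closed)
  qed

lemma psd_gram:
  assumes F: "finite F" and b: "\<And>x. x \<in> F \<Longrightarrow> b x \<in> carrier H"
  shows "psd F (\<lambda>x y. Re (cinner H (b x) (b y)))"
  unfolding psd_def
proof (intro conjI ballI allI)
  show "Re (cinner H (b x) (b y)) = Re (cinner H (b y) (b x))" if "x \<in> F" "y \<in> F" for x y
    using cinner_commute[of "b x" "b y"] b that by simp
  fix z
  obtain v where v: "v \<in> carrier H" "\<And>w. w \<in> carrier H \<Longrightarrow> Re (cinner H v w) = (\<Sum>x\<in>F. z x * Re (cinner H (b x) w))"
    using finite_combination[of F b z] F b by blast
  have "(\<Sum>x\<in>F. \<Sum>y\<in>F. z x * z y * Re (cinner H (b x) (b y))) = (\<Sum>y\<in>F. z y * (\<Sum>x\<in>F. z x * Re (cinner H (b x) (b y))))"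
    by (subst sum.swap) (simp add: sum_distrib_left mult_ac)
  also have "\<dots> = (\<Sum>y\<in>F. z y * Re (cinner H (b y) v))"
    using v b cinner_commute[OF v(1)] by (intro sum.cong) auto
  also have "\<dots> = Re (cinner H v v)" using v by simp
  finally show "0 \<le> (\<Sum>x\<in>F. \<Sum>y\<in>F. z x * z y * Re (cinner H (b x) (b y)))"
    using cinner_nonneg[OF v(1)] by simp
qed

lemma hnorm_diff_sq:
  assumes "v \<in> carrier H" "w \<in> carrier H"
  shows "(hnorm H (v \<ominus> w))\<^sup>2 = (hnorm H v)\<^sup>2 + (hnorm H w)\<^sup>2 - 2 * Re (cinner H v w)"
  using assms cinner_commute[of v w] by (simp add: hnorm_sq cinner_diff_left cinner_diff_right)

text \<open>Expanding the squared distance splits the Gaussian into the exponential of a multiple of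
  the Gram kernel and a product of a function of \<open>x\<close> with the same function of
  \<open>y\<close>.\<close>

lemma psd_gaussian:
  assumes F: "finite F" and b: "\<And>x. x \<in> F \<Longrightarrow> b x \<in> carrier H" and t: "0 \<le> t"
  shows "psd F (\<lambda>x y. exp (- t * (hnorm H (b x \<ominus> b y))\<^sup>2))"
proof -
  have "psd F (\<lambda>x y. 2 * t * Re (cinner H (b x) (b y)))"
    using t by (intro psd_cmult psd_gram F b) simp_all
  from psd_scale[OF psd_exp[OF F this], of "\<lambda>x. exp (- t * (hnorm H (b x))\<^sup>2)"]
  show ?thesis
  proof (rule psd_cong)
    fix x y assume "x \<in> F" "y \<in> F"
    then show "exp (- t * (hnorm H (b x))\<^sup>2) * exp (- t * (hnorm H (b y))\<^sup>2) * exp (2 * t * Re (cinner H (b x) (b y)))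
        = exp (- t * (hnorm H (b x \<ominus> b y))\<^sup>2)"
      using b by (simp add: hnorm_diff_sq flip: exp_add) (simp add: algebra_simps)
  qed
qed

end

lemma psd_complex:
  fixes z :: "'i \<Rightarrow> complex"
  assumes k: "psd F k"
  shows "0 \<le> Re (\<Sum>x\<in>F. \<Sum>y\<in>F. z x * cnj (z y) * complex_of_real (k x y))"
proof -
  have "Re (\<Sum>x\<in>F. \<Sum>y\<in>F. z x * cnj (z y) * complex_of_real (k x y)) =
     (\<Sum>x\<in>F. \<Sum>y\<in>F. Re (z x) * Re (z y) * k x y) + (\<Sum>x\<in>F. \<Sum>y\<in>F. Im (z x) * Im (z y) * k x y)"
    by (simp add: sum.distrib distrib_right)
  then show ?thesis using psd_nonneg[OF k] by (simp only: add_nonneg_nonneg)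
qed

section \<open>Spectral gaps of unitary representations\<close>

text \<open>Banach's fixed point theorem on a closed subset. It inverts the Laplacian on the
  complement of the invariant vectors in \<open>laplacian_solve\<close>.\<close>

lemma (in hilbert_space) contraction_fixed_point:
  assumes W: "W \<subseteq> carrier H" "w0 \<in> W" "\<And>w. w \<in> W \<Longrightarrow> F w \<in> W"
    and closed: "\<And>\<sigma> v. \<lbrakk>\<And>n::nat. \<sigma> n \<in> W; v \<in> carrier H; (\<lambda>n. hnorm H (\<sigma> n \<ominus> v)) \<longlonglongrightarrow> 0\<rbrakk> \<Longrightarrow> v \<in> W"
    and F: "\<And>u v. \<lbrakk>u \<in> W; v \<in> W\<rbrakk> \<Longrightarrow> hnorm H (F u \<ominus> F v) \<le> \<rho> * hnorm H (u \<ominus> v)"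
    and \<rho>: "0 \<le> \<rho>" "\<rho> < 1"
  shows "\<exists>v\<in>W. F v = v"
proof -
  define s where "s n = (F ^^ n) w0" for n
  have sW: "s n \<in> W" for n by (induction n) (simp_all add: s_def W)
  have sH: "s n \<in> carrier H" for n using sW W by blast
  have tri: "hnorm H (u \<ominus> w) \<le> hnorm H (u \<ominus> v) + hnorm H (v \<ominus> w)"
    if "u \<in> carrier H" "v \<in> carrier H" "w \<in> carrier H" for u v w
    using triangle[of u v w] that by (simp add: hdist_def)
  define A where "A = hnorm H (s 0 \<ominus> s 1)"
  have A: "0 \<le> A" using sH by (simp add: A_def)
  have shift: "hnorm H (s n \<ominus> s (n + k)) \<le> \<rho> ^ n * hnorm H (s 0 \<ominus> s k)" for n k
  proof (induction n)
    case (Suc n)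
    have "hnorm H (s (Suc n) \<ominus> s (Suc n + k)) \<le> \<rho> * hnorm H (s n \<ominus> s (n + k))"
      using F[OF sW sW, of n "n + k"] by (simp add: s_def)
    also have "\<dots> \<le> \<rho> * (\<rho> ^ n * hnorm H (s 0 \<ominus> s k))" using Suc \<rho> by (intro mult_left_mono)
    finally show ?case by (simp add: mult_ac)
  qed simp
  have bd: "hnorm H (s 0 \<ominus> s k) \<le> A / (1 - \<rho>)" for k
  proof (induction k)
    case 0
    have "s 0 \<ominus> s 0 = \<zero>" using sH[of 0] by (simp add: diff_eq_zero)
    then show ?case using A \<rho> by (simp add: hnorm_zero)
  next
    case (Suc k)
    have "hnorm H (s 0 \<ominus> s (Suc k)) \<le> A + hnorm H (s 1 \<ominus> s (1 + k))"
      using tri[OF sH[of 0] sH[of 1] sH[of "1 + k"]] by (simp add: A_def)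
    also have "\<dots> \<le> A + \<rho> * (A / (1 - \<rho>))"
      using shift[of 1 k] mult_left_mono[OF Suc \<rho>(1)] by simp
    also have "\<dots> = A / (1 - \<rho>)" using \<rho> by (simp add: field_simps)
    finally show ?case .
  qed
  have geom: "hnorm H (s n \<ominus> s m) \<le> \<rho> ^ N * (A / (1 - \<rho>)) * 2" if "N \<le> n" "N \<le> m" for N n m
  proof -
    have le: "hnorm H (s N \<ominus> s n) \<le> \<rho> ^ N * (A / (1 - \<rho>))" if "N \<le> n" for n
    proof -
      have "hnorm H (s N \<ominus> s n) \<le> \<rho> ^ N * hnorm H (s 0 \<ominus> s (n - N))" using shift[of N "n - N"] that by simp
      also have "\<dots> \<le> \<rho> ^ N * (A / (1 - \<rho>))" using bd \<rho> by (intro mult_left_mono) simp_all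
      finally show ?thesis .
    qed
    have "hnorm H (s n \<ominus> s m) \<le> hnorm H (s n \<ominus> s N) + hnorm H (s N \<ominus> s m)" by (rule tri[OF sH sH sH])
    also have "hnorm H (s n \<ominus> s N) = hnorm H (s N \<ominus> s n)"
      using commute[of "s n" "s N"] sH by (simp add: hdist_def)
    finally have "hnorm H (s n \<ominus> s m) \<le> hnorm H (s N \<ominus> s n) + hnorm H (s N \<ominus> s m)" .
    from order_trans[OF this add_mono[OF le[OF that(1)] le[OF that(2)]]] show ?thesis
      by (simp only: mult_2_right)
  qed
  have "(\<lambda>N. \<rho> ^ N * (A / (1 - \<rho>)) * 2) \<longlonglongrightarrow> 0 * (A / (1 - \<rho>)) * 2"
    using \<rho> by (intro tendsto_mult tendsto_const LIMSEQ_realpow_zero)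
  then have lim0: "(\<lambda>N. \<rho> ^ N * (A / (1 - \<rho>)) * 2) \<longlonglongrightarrow> 0" by simp
  have small: "\<exists>N. \<rho> ^ N * (A / (1 - \<rho>)) * 2 < e" if "e > 0" for e
    using order_tendstoD(2)[OF lim0 that] unfolding eventually_sequentially by blast
  obtain v where v: "v \<in> carrier H" "(\<lambda>n. hnorm H (s n \<ominus> v)) \<longlonglongrightarrow> 0"
  proof (rule Cauchy_limit[OF sH])
    fix e :: real assume "e > 0"
    then obtain N where "\<rho> ^ N * (A / (1 - \<rho>)) * 2 < e" using small by blast
    then show "\<exists>N. \<forall>m\<ge>N. \<forall>n\<ge>N. hnorm H (s m \<ominus> s n) < e"
      using geom by (meson le_less_trans)
  qed blast
  have vW: "v \<in> W" by (rule closed[OF sW v])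
  have FvH: "F v \<in> carrier H" using W vW by blast
  have le: "hnorm H (F v \<ominus> v) \<le> \<rho> * hnorm H (s n \<ominus> v) + hnorm H (s (Suc n) \<ominus> v)" for n
  proof -
    have "hnorm H (F v \<ominus> v) \<le> hnorm H (F v \<ominus> s (Suc n)) + hnorm H (s (Suc n) \<ominus> v)" by (rule tri[OF FvH sH v(1)])
    moreover have "hnorm H (F v \<ominus> s (Suc n)) = hnorm H (F (s n) \<ominus> F v)"
      using commute[of "F v" "s (Suc n)"] sH[of "Suc n"] FvH by (simp add: hdist_def s_def)
    ultimately show ?thesis using F[OF sW[of n] vW] by simp
  qed
  have "(\<lambda>n. \<rho> * hnorm H (s n \<ominus> v) + hnorm H (s (Suc n) \<ominus> v)) \<longlonglongrightarrow> \<rho> * 0 + 0"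
    by (intro tendsto_add tendsto_mult_left v(2) LIMSEQ_Suc)
  from LIMSEQ_le_const[OF this] have "hnorm H (F v \<ominus> v) \<le> 0" using le by simp
  moreover have "0 \<le> hnorm H (F v \<ominus> v)" using FvH v(1) by (intro hnorm_nonneg) simp
  ultimately have "hnorm H (F v \<ominus> v) = 0" by linarith
  then have "F v = v" using FvH v(1) by (simp add: hnorm_eq_0 diff_eq_zero)
  then show ?thesis using vW by blast
qed

section \<open>Norms of formal linear combinations\<close>

lemma Re_sum_list: "Re (sum_list (map f xs)) = sum_list (map (\<lambda>x. Re (f x)) xs)"
  by (induction xs) auto

lemma cnj_sum_list: "cnj (sum_list (map f xs)) = sum_list (map (\<lambda>x. cnj (f x)) xs)"
  by (induction xs) auto

text \<open>The family passed to \<open>orbit_combination\<close> ignores its vector argument, so an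
  arbitrary map on the group, for instance a cocycle, can take the place of an orbit.\<close>

abbreviation lincomb :: "'h inner_module \<Rightarrow> ('g \<Rightarrow> 'h) \<Rightarrow> (complex \<times> 'g) list \<Rightarrow> 'h" where
  "lincomb H f l \<equiv> orbit_combination H (\<lambda>g _. f g) undefined l"

context inner_product_space
begin

lemma lincomb_closed: "(\<And>g. g \<in> snd ` set l \<Longrightarrow> f g \<in> carrier H) \<Longrightarrow> lincomb H f l \<in> carrier H"
  by (induction l) (auto simp: scale_closed)

lemma cinner_lincomb:
  assumes "\<And>g. g \<in> snd ` set l \<Longrightarrow> f g \<in> carrier H" "w \<in> carrier H"
  shows "cinner H (lincomb H f l) w = (\<Sum>(c, g)\<leftarrow>l. c * cinner H (f g) w)"
  using assms(1)
proof (induction l)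
  case (Cons a l)
  have "lincomb H f l \<in> carrier H" using Cons.prems by (intro lincomb_closed) auto
  then show ?case using Cons assms(2)
    by (cases a) (auto simp: cinner_add_left cinner_smult_left scale_closed)
qed (simp add: cinner_zero_left assms(2))

lemma cinner_ext:
  assumes "u \<in> carrier H" "v \<in> carrier H" "\<And>w. w \<in> carrier H \<Longrightarrow> cinner H u w = cinner H v w"
  shows "u = v"
proof -
  have "cinner H (u \<ominus> v) (u \<ominus> v) = 0"
    using assms by (simp add: cinner_diff_left)
  then have "hnorm H (u \<ominus> v) = 0" by (simp add: hnorm_def)
  then show ?thesis using assms by (simp add: hnorm_eq_0 diff_eq_zero)
qed

lemma hnorm_lincomb_sq:
  assumes f: "\<And>g. g \<in> snd ` set l \<Longrightarrow> f g \<in> carrier H" and real: "\<And>c. c \<in> fst ` set l \<Longrightarrow> Im c = 0"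
  shows "(hnorm H (lincomb H f l))\<^sup>2 = (\<Sum>x\<leftarrow>l. \<Sum>y\<leftarrow>l. Re (fst x) * Re (fst y) * Re (cinner H (f (snd x)) (f (snd y))))"
proof -
  let ?v = "lincomb H f l"
  have v: "?v \<in> carrier H" by (rule lincomb_closed[OF f])
  have Re_sum: "Re (\<Sum>(c, g)\<leftarrow>l. c * p g) = (\<Sum>x\<leftarrow>l. Re (fst x) * Re (p (snd x)))" for p
    using real by (induction l) auto
  have "Re (cinner H (f g) ?v) = (\<Sum>y\<leftarrow>l. Re (fst y) * Re (cinner H (f g) (f (snd y))))"
    if g: "g \<in> snd ` set l" for g
  proof -
    have "Re (cinner H (f g) ?v) = Re (cinner H ?v (f g))" using cinner_commute[OF v f[OF g]] by simp
    also have "\<dots> = (\<Sum>y\<leftarrow>l. Re (fst y) * Re (cinner H (f (snd y)) (f g)))"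
      using cinner_lincomb[of l f "f g"] f g Re_sum[of "\<lambda>h. cinner H (f h) (f g)"] by simp
    also have "\<dots> = (\<Sum>y\<leftarrow>l. Re (fst y) * Re (cinner H (f g) (f (snd y))))"
    proof (intro arg_cong[where f = sum_list] map_cong refl)
      fix y assume "y \<in> set l"
      then have "f (snd y) \<in> carrier H" using f by blast
      then show "Re (fst y) * Re (cinner H (f (snd y)) (f g)) = Re (fst y) * Re (cinner H (f g) (f (snd y)))"
        using cinner_commute[OF _ f[OF g], of "f (snd y)"] by simp
    qed
    finally show ?thesis .
  qed
  then have "(\<Sum>x\<leftarrow>l. Re (fst x) * Re (cinner H (f (snd x)) ?v)) =
      (\<Sum>x\<leftarrow>l. \<Sum>y\<leftarrow>l. Re (fst x) * Re (fst y) * Re (cinner H (f (snd x)) (f (snd y))))"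
    by (intro arg_cong[where f = sum_list] map_cong refl) (simp add: sum_list_const_mult[symmetric] mult.assoc)
  moreover have "(hnorm H ?v)\<^sup>2 = (\<Sum>x\<leftarrow>l. Re (fst x) * Re (cinner H (f (snd x)) ?v))"
    using hnorm_sq[OF v] cinner_lincomb[of l f ?v] f v Re_sum[of "\<lambda>h. cinner H (f h) ?v"] by simp
  ultimately show ?thesis by simp
qed

end

text \<open>The terms in \<open>q x\<close> or \<open>q y\<close> alone factor through the sum of
  all coefficients, which is zero.\<close>

lemma sum_list_polarization:
  fixes r q :: "'i \<Rightarrow> real"
  assumes "(\<Sum>x\<leftarrow>l. r x) = 0"
  shows "(\<Sum>x\<leftarrow>l. \<Sum>y\<leftarrow>l. r x * r y * (q x + q y - 2 * k x y)) = - 2 * (\<Sum>x\<leftarrow>l. \<Sum>y\<leftarrow>l. r x * r y * k x y)"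
proof -
  let ?I = "{0..<length l}" and ?r = "\<lambda>i. r (l ! i)" and ?q = "\<lambda>i. q (l ! i)" and ?k = "\<lambda>i j. k (l ! i) (l ! j)"
  have 0: "sum ?r ?I = 0" using assms by (simp add: sum_list_sum_nth)
  have "(\<Sum>i\<in>?I. \<Sum>j\<in>?I. ?r i * ?r j * (?q i + ?q j - 2 * ?k i j)) =
      (\<Sum>i\<in>?I. ?r i * ?q i * sum ?r ?I) + (\<Sum>i\<in>?I. ?r i * (\<Sum>j\<in>?I. ?r j * ?q j)) - 2 * (\<Sum>i\<in>?I. \<Sum>j\<in>?I. ?r i * ?r j * ?k i j)"
    unfolding sum_distrib_left sum.distrib[symmetric] sum_subtractf[symmetric]
    by (intro sum.cong refl) (simp add: algebra_simps)
  also have "\<dots> = - 2 * (\<Sum>i\<in>?I. \<Sum>j\<in>?I. ?r i * ?r j * ?k i j)"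
    unfolding 0 sum_distrib_right[symmetric] by simp
  finally show ?thesis by (simp add: sum_list_sum_nth)
qed

text \<open>For real coefficients with sum zero, the norm of a combination is determined by the mutual distances.\<close>

lemma (in inner_product_space) sum_squared_distances:
  assumes f: "\<And>g. g \<in> snd ` set l \<Longrightarrow> f g \<in> carrier H" and real: "\<And>c. c \<in> fst ` set l \<Longrightarrow> Im c = 0"
    and l: "(\<Sum>x\<leftarrow>l. Re (fst x)) = 0"
  shows "(\<Sum>x\<leftarrow>l. \<Sum>y\<leftarrow>l. Re (fst x) * Re (fst y) * (hnorm H (f (snd x) \<ominus> f (snd y)))\<^sup>2) =
    - 2 * (hnorm H (lincomb H f l))\<^sup>2"
proof -
  have "(\<Sum>x\<leftarrow>l. \<Sum>y\<leftarrow>l. Re (fst x) * Re (fst y) * (hnorm H (f (snd x) \<ominus> f (snd y)))\<^sup>2) =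
    (\<Sum>x\<leftarrow>l. \<Sum>y\<leftarrow>l. Re (fst x) * Re (fst y) * ((hnorm H (f (snd x)))\<^sup>2 + (hnorm H (f (snd y)))\<^sup>2
       - 2 * Re (cinner H (f (snd x)) (f (snd y)))))"
    using f by (intro arg_cong[where f = sum_list] map_cong refl) (simp add: hnorm_diff_sq)
  also have "\<dots> = - 2 * (\<Sum>x\<leftarrow>l. \<Sum>y\<leftarrow>l. Re (fst x) * Re (fst y) * Re (cinner H (f (snd x)) (f (snd y))))"
    by (rule sum_list_polarization[OF l])
  finally show ?thesis using hnorm_lincomb_sq[of l f] f real by simp
qed

section \<open>Unitary representations and their cocycles\<close>

text \<open>The group algebra element that sums 2 - s - s^-1, which is (s - 1)*(s - 1) in every
  unitary representation. It is kept as a formal combination so that it can be paired with orbits,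
  cocycles and kernels alike.\<close>

definition laplacian_list :: "('g, 'm) monoid_scheme \<Rightarrow> 'g list \<Rightarrow> (complex \<times> 'g) list" where
  "laplacian_list G S = concat (map (\<lambda>s. [(2, \<one>\<^bsub>G\<^esub>), (- 1, s), (- 1, inv\<^bsub>G\<^esub> s)]) S)"

lemma laplacian_list_real: "c \<in> fst ` set (laplacian_list G S) \<Longrightarrow> Im c = 0"
  by (induction S) (auto simp: laplacian_list_def)

lemma laplacian_list_sum: "(\<Sum>x\<leftarrow>laplacian_list G S. Re (fst x)) = 0"
  by (induction S) (auto simp: laplacian_list_def)

lemma laplacian_list_elements:
  "snd ` set (laplacian_list G S) \<subseteq> {\<one>\<^bsub>G\<^esub>} \<union> set S \<union> m_inv G ` set S"
  by (auto simp: laplacian_list_def)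

lemma laplacian_sum:
  "(\<Sum>(c, g)\<leftarrow>laplacian_list G S. c * f g) = (\<Sum>s\<leftarrow>S. 2 * f \<one>\<^bsub>G\<^esub> - f s - f (inv\<^bsub>G\<^esub> s))"
  by (induction S) (auto simp: laplacian_list_def)

locale unitary_rep = group G for G (structure) +
  fixes K :: "'h inner_module" and \<sigma> S
  assumes rep: "unitary_representation G K \<sigma>" and gens: "set S \<subseteq> carrier G"
begin

sublocale K: hilbert_space K using rep by (simp add: unitary_representation_def)

lemma rep_linear: "g \<in> carrier G \<Longrightarrow> clinear_map K K (\<sigma> g)"
  using rep by (simp add: unitary_representation_def unitary_operator_def)

lemmas rep_simps = clinear_mapD[OF rep_linear]

lemma rep_isometric:
  "\<lbrakk>g \<in> carrier G; v \<in> carrier K; w \<in> carrier K\<rbrakk> \<Longrightarrow> cinner K (\<sigma> g v) (\<sigma> g w) = cinner K v w"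
  using rep by (simp add: unitary_representation_def unitary_operator_def)

lemma rep_one: "v \<in> carrier K \<Longrightarrow> \<sigma> \<one> v = v"
  using rep by (simp add: unitary_representation_def)

lemma rep_mult: "\<lbrakk>g \<in> carrier G; h \<in> carrier G; v \<in> carrier K\<rbrakk> \<Longrightarrow> \<sigma> (g \<otimes> h) v = \<sigma> g (\<sigma> h v)"
  using rep by (simp add: unitary_representation_def)

lemma rep_adjoint:
  assumes g: "g \<in> carrier G" and "v \<in> carrier K" "w \<in> carrier K"
  shows "cinner K (\<sigma> (inv g) v) w = cinner K v (\<sigma> g w)"
  using rep_isometric[OF g rep_simps(1)[OF inv_closed[OF g] assms(2)] assms(3)]
    rep_mult[OF g inv_closed[OF g] assms(2)] assms by (simp add: rep_one)

lemma rep_diff: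
  "\<lbrakk>g \<in> carrier G; v \<in> carrier K; w \<in> carrier K\<rbrakk> \<Longrightarrow> \<sigma> g (v \<ominus>\<^bsub>K\<^esub> w) = \<sigma> g v \<ominus>\<^bsub>K\<^esub> \<sigma> g w"
  by (rule K.clinear_map_diff[OF rep_linear, symmetric])

lemma rep_norm: "\<lbrakk>g \<in> carrier G; v \<in> carrier K\<rbrakk> \<Longrightarrow> hnorm K (\<sigma> g v) = hnorm K v"
  by (simp add: hnorm_def rep_isometric)

definition invariants :: "'h set" where
  "invariants = {v \<in> carrier K. \<forall>g\<in>carrier G. \<sigma> g v = v}"

definition W :: "'h set" where "W = orthogonal_complement K invariants"

definition energy :: "'h \<Rightarrow> real" where
  "energy v = (\<Sum>s\<leftarrow>S. (hnorm K (\<sigma> s v \<ominus>\<^bsub>K\<^esub> v))\<^sup>2)"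

definition laplacian :: "'h \<Rightarrow> 'h" where
  "laplacian v = lincomb K (\<lambda>g. \<sigma> g v) (laplacian_list G S)"

text \<open>By \<open>cinner_laplacian_self\<close> the energy is the quadratic form of the
  Laplacian, so the Laplacian is at least \<nu> on the complement of the invariant vectors.\<close>

definition gap :: "real \<Rightarrow> bool" where
  "gap \<nu> \<longleftrightarrow> (\<forall>v\<in>W. \<nu> * (hnorm K v)\<^sup>2 \<le> energy v)"

lemma in_gens: "s \<in> set S \<Longrightarrow> s \<in> carrier G"
  using gens by blast

lemma list_elements: "g \<in> snd ` set (laplacian_list G S) \<Longrightarrow> g \<in> carrier G"
  using subsetD[OF laplacian_list_elements, of g G S] gens by auto

lemma laplacian_closed: "v \<in> carrier K \<Longrightarrow> laplacian v \<in> carrier K"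
  unfolding laplacian_def by (intro K.lincomb_closed rep_simps(1) list_elements)

lemma cinner_laplacian:
  assumes v: "v \<in> carrier K" and w: "w \<in> carrier K"
  shows "cinner K (laplacian v) w = (\<Sum>s\<leftarrow>S. cinner K (\<sigma> s v \<ominus>\<^bsub>K\<^esub> v) (\<sigma> s w \<ominus>\<^bsub>K\<^esub> w))"
proof -
  have "cinner K (laplacian v) w = (\<Sum>(c, g)\<leftarrow>laplacian_list G S. c * cinner K (\<sigma> g v) w)"
    unfolding laplacian_def using v w by (intro K.cinner_lincomb rep_simps(1) list_elements)
  also have "\<dots> = (\<Sum>s\<leftarrow>S. 2 * cinner K (\<sigma> \<one> v) w - cinner K (\<sigma> s v) w - cinner K (\<sigma> (inv s) v) w)"
    by (rule laplacian_sum)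
  also have "\<dots> = (\<Sum>s\<leftarrow>S. cinner K (\<sigma> s v \<ominus>\<^bsub>K\<^esub> v) (\<sigma> s w \<ominus>\<^bsub>K\<^esub> w))"
  proof (intro arg_cong[where f = sum_list] map_cong refl)
    fix s assume "s \<in> set S"
    then have s: "s \<in> carrier G" by (rule in_gens)
    show "2 * cinner K (\<sigma> \<one> v) w - cinner K (\<sigma> s v) w - cinner K (\<sigma> (inv s) v) w =
        cinner K (\<sigma> s v \<ominus>\<^bsub>K\<^esub> v) (\<sigma> s w \<ominus>\<^bsub>K\<^esub> w)"
      using s v w by (simp add: rep_one rep_adjoint rep_isometric rep_simps(1) K.cinner_diff_left K.cinner_diff_right)
  qed
  finally show ?thesis .
qed

lemma laplacian_symmetric:
  assumes v: "v \<in> carrier K" and w: "w \<in> carrier K"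
  shows "cinner K v (laplacian w) = cinner K (laplacian v) w"
proof -
  have "cinner K v (laplacian w) = cnj (cinner K (laplacian w) v)"
    by (rule K.cinner_commute[OF laplacian_closed[OF w] v])
  also have "\<dots> = (\<Sum>s\<leftarrow>S. cnj (cinner K (\<sigma> s w \<ominus>\<^bsub>K\<^esub> w) (\<sigma> s v \<ominus>\<^bsub>K\<^esub> v)))"
    unfolding cinner_laplacian[OF w v] by (rule cnj_sum_list)
  also have "\<dots> = cinner K (laplacian v) w"
    unfolding cinner_laplacian[OF v w]
  proof (intro arg_cong[where f = sum_list] map_cong refl)
    fix s assume "s \<in> set S"
    then show "cnj (cinner K (\<sigma> s w \<ominus>\<^bsub>K\<^esub> w) (\<sigma> s v \<ominus>\<^bsub>K\<^esub> v)) = cinner K (\<sigma> s v \<ominus>\<^bsub>K\<^esub> v) (\<sigma> s w \<ominus>\<^bsub>K\<^esub> w)"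
      using v w by (intro K.cinner_commute[symmetric]) (simp_all add: rep_simps(1) in_gens)
  qed
  finally show ?thesis .
qed

lemma laplacian_diff:
  assumes v: "v \<in> carrier K" and w: "w \<in> carrier K"
  shows "laplacian (v \<ominus>\<^bsub>K\<^esub> w) = laplacian v \<ominus>\<^bsub>K\<^esub> laplacian w"
proof (rule K.cinner_ext)
  fix u assume u: "u \<in> carrier K"
  have "cinner K (laplacian (v \<ominus>\<^bsub>K\<^esub> w)) u = cinner K (v \<ominus>\<^bsub>K\<^esub> w) (laplacian u)"
    using v w u by (intro laplacian_symmetric[symmetric]) simp_all
  also have "\<dots> = cinner K (laplacian v \<ominus>\<^bsub>K\<^esub> laplacian w) u"
    unfolding K.cinner_diff_left[OF v w laplacian_closed[OF u]] laplacian_symmetric[OF v u] laplacian_symmetric[OF w u]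
    by (rule K.cinner_diff_left[OF laplacian_closed[OF v] laplacian_closed[OF w] u, symmetric])
  finally show "cinner K (laplacian (v \<ominus>\<^bsub>K\<^esub> w)) u = cinner K (laplacian v \<ominus>\<^bsub>K\<^esub> laplacian w) u" .
qed (use v w in \<open>simp_all add: laplacian_closed\<close>)

lemma cinner_laplacian_self: "v \<in> carrier K \<Longrightarrow> Re (cinner K (laplacian v) v) = energy v"
proof -
  assume v: "v \<in> carrier K"
  have "Re (cinner K (laplacian v) v) = (\<Sum>s\<leftarrow>S. Re (cinner K (\<sigma> s v \<ominus>\<^bsub>K\<^esub> v) (\<sigma> s v \<ominus>\<^bsub>K\<^esub> v)))"
    unfolding cinner_laplacian[OF v v] by (rule Re_sum_list)
  also have "\<dots> = energy v"
    unfolding energy_def using v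
    by (intro arg_cong[where f = sum_list] map_cong refl) (simp add: K.hnorm_sq rep_simps(1) in_gens)
  finally show ?thesis .
qed

lemma energy_nonneg: "0 \<le> energy v"
  unfolding energy_def by (rule sum_list_nonneg) auto

text \<open>Up to the constant, the square of the Laplacian is dominated by the Laplacian itself, as
  for any bounded positive operator.\<close>

lemma hnorm_laplacian_le:
  assumes v: "v \<in> carrier K"
  shows "(hnorm K (laplacian v))\<^sup>2 \<le> 4 * (real (length S) + 1) * energy v"
proof -
  define N where "N = real (length S) + 1"
  have N: "N > 0" by (simp add: N_def)
  let ?w = "laplacian v"
  have w: "?w \<in> carrier K" by (rule laplacian_closed[OF v])
  have "(hnorm K ?w)\<^sup>2 = (\<Sum>s\<leftarrow>S. Re (cinner K (\<sigma> s v \<ominus>\<^bsub>K\<^esub> v) (\<sigma> s ?w \<ominus>\<^bsub>K\<^esub> ?w)))"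
    unfolding K.hnorm_sq[OF w] cinner_laplacian[OF v w] by (rule Re_sum_list)
  \<comment> \<open>Young's inequality, weighted so that the second terms add up to at most half of
    the left side. \<open>N\<close> exceeds the number of generators by one to stay positive for an
    empty list.\<close>
  also have "\<dots> \<le> (\<Sum>s\<leftarrow>S. 2 * N * (hnorm K (\<sigma> s v \<ominus>\<^bsub>K\<^esub> v))\<^sup>2 + (hnorm K ?w)\<^sup>2 / (2 * N))"
  proof (rule sum_list_mono)
    fix s assume "s \<in> set S"
    then have s: "s \<in> carrier G" by (rule in_gens)
    let ?p = "hnorm K (\<sigma> s v \<ominus>\<^bsub>K\<^esub> v)" and ?q = "hnorm K ?w"
    have "Re (cinner K (\<sigma> s v \<ominus>\<^bsub>K\<^esub> v) (\<sigma> s ?w \<ominus>\<^bsub>K\<^esub> ?w)) \<le> ?p * hnorm K (\<sigma> s ?w \<ominus>\<^bsub>K\<^esub> ?w)"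
      using s v w by (intro K.Cauchy_Schwarz_Re) (simp_all add: rep_simps(1))
    also have "\<dots> \<le> ?p * (2 * ?q)"
    proof (rule mult_left_mono)
      have "hnorm K (\<sigma> s ?w \<ominus>\<^bsub>K\<^esub> ?w) \<le> hnorm K (\<sigma> s ?w) + hnorm K (\<ominus>\<^bsub>K\<^esub> ?w)"
        unfolding a_minus_def using s w by (intro K.hnorm_triangle) (simp_all add: rep_simps(1))
      then show "hnorm K (\<sigma> s ?w \<ominus>\<^bsub>K\<^esub> ?w) \<le> 2 * ?q" using s w by (simp add: rep_norm K.hnorm_minus)
      show "0 \<le> ?p" using s v by (simp add: rep_simps(1))
    qed
    also have "\<dots> \<le> 2 * N * ?p\<^sup>2 + ?q\<^sup>2 / (2 * N)"
    proof -
      have "0 \<le> (2 * N * ?p - ?q)\<^sup>2 / (2 * N)" using N by simp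
      also have "\<dots> = 2 * N * ?p\<^sup>2 + ?q\<^sup>2 / (2 * N) - ?p * (2 * ?q)"
        using N by (simp add: power2_eq_square field_simps)
      finally show ?thesis by simp
    qed
    finally show "Re (cinner K (\<sigma> s v \<ominus>\<^bsub>K\<^esub> v) (\<sigma> s ?w \<ominus>\<^bsub>K\<^esub> ?w)) \<le> 2 * N * ?p\<^sup>2 + ?q\<^sup>2 / (2 * N)" .
  qed
  also have "\<dots> = 2 * N * energy v + real (length S) * ((hnorm K ?w)\<^sup>2 / (2 * N))"
    by (simp add: sum_list_addf sum_list_const_mult energy_def sum_list_triv)
  also have "real (length S) * ((hnorm K ?w)\<^sup>2 / (2 * N)) \<le> (hnorm K ?w)\<^sup>2 / 2"
  proof -
    have "real (length S) * ((hnorm K ?w)\<^sup>2 / (2 * N)) \<le> N * ((hnorm K ?w)\<^sup>2 / (2 * N))"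
      using N by (intro mult_right_mono) (simp_all add: N_def)
    then show ?thesis using N by simp
  qed
  finally have "(hnorm K ?w)\<^sup>2 \<le> 4 * N * energy v" by simp
  then show ?thesis by (simp only: N_def)
qed

lemma laplacian_in_W: "v \<in> carrier K \<Longrightarrow> laplacian v \<in> W"
proof -
  assume v: "v \<in> carrier K"
  have "cinner K (laplacian v) w = 0" if w: "w \<in> invariants" for w
  proof -
    have wK: "w \<in> carrier K" using w by (simp add: invariants_def)
    have "cinner K (\<sigma> s v \<ominus>\<^bsub>K\<^esub> v) (\<sigma> s w \<ominus>\<^bsub>K\<^esub> w) = 0" if "s \<in> set S" for s
    proof -
      have "\<sigma> s w = w" using w in_gens[OF that] by (simp add: invariants_def)
      then show ?thesis using in_gens[OF that] v wK by (simp add: rep_simps(1) K.cinner_diff_right)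
    qed
    then have "(\<Sum>s\<leftarrow>S. cinner K (\<sigma> s v \<ominus>\<^bsub>K\<^esub> v) (\<sigma> s w \<ominus>\<^bsub>K\<^esub> w)) = (\<Sum>s\<leftarrow>S. 0)"
      by (intro arg_cong[where f = sum_list] map_cong refl)
    then show ?thesis by (simp add: cinner_laplacian[OF v wK])
  qed
  then show ?thesis using laplacian_closed[OF v] by (simp add: W_def orthogonal_complement_def)
qed

lemma W_carrier: "v \<in> W \<Longrightarrow> v \<in> carrier K"
  by (simp add: W_def orthogonal_complement_def)

lemma W_linear:
  assumes v: "v \<in> W"
  shows "w \<in> W \<Longrightarrow> v \<ominus>\<^bsub>K\<^esub> w \<in> W" "w \<in> W \<Longrightarrow> v \<oplus>\<^bsub>K\<^esub> w \<in> W" "c \<odot>\<^bsub>K\<^esub> v \<in> W" "\<zero>\<^bsub>K\<^esub> \<in> W"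
  using v by (auto simp: W_def orthogonal_complement_def invariants_def K.cinner_diff_left K.cinner_add_left
      K.cinner_smult_left K.scale_closed K.cinner_zero_left)

lemma W_zero: "\<zero>\<^bsub>K\<^esub> \<in> W"
  by (auto simp: W_def orthogonal_complement_def invariants_def K.cinner_zero_left)

lemma W_closed:
  assumes \<tau>: "\<And>n::nat. \<tau> n \<in> W" and v: "v \<in> carrier K" and lim: "(\<lambda>n. hnorm K (\<tau> n \<ominus>\<^bsub>K\<^esub> v)) \<longlonglongrightarrow> 0"
  shows "v \<in> W"
proof -
  have "cinner K v w = 0" if w: "w \<in> invariants" for w
  proof -
    have wK: "w \<in> carrier K" using w by (simp add: invariants_def)
    have "cmod (cinner K v w) \<le> hnorm K (\<tau> n \<ominus>\<^bsub>K\<^esub> v) * hnorm K w" for n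
    proof -
      have "cinner K (\<tau> n) w = 0" using \<tau>[of n] w by (simp add: W_def orthogonal_complement_def)
      then have "cinner K (\<tau> n \<ominus>\<^bsub>K\<^esub> v) w = - cinner K v w"
        using W_carrier[OF \<tau>] v wK by (simp add: K.cinner_diff_left)
      then show ?thesis
        using K.norm_cinner_le[of "\<tau> n \<ominus>\<^bsub>K\<^esub> v" w] W_carrier[OF \<tau>] v wK by simp
    qed
    moreover have "(\<lambda>n. hnorm K (\<tau> n \<ominus>\<^bsub>K\<^esub> v) * hnorm K w) \<longlonglongrightarrow> 0" using tendsto_mult_left_zero[OF lim] .
    ultimately have "cmod (cinner K v w) \<le> 0" using LIMSEQ_le_const[of _ 0] by blast
    then show ?thesis by simp
  qed
  then show ?thesis using v by (simp add: W_def orthogonal_complement_def)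
qed

text \<open>The equation is a fixed point problem for a damped step \<open>F\<close> along the
  residual. On \<open>W\<close> the linear part of \<open>F\<close> contracts by the factor
  \<open>sqrt (1 - \<nu> / C)\<close>.\<close>

lemma laplacian_solve:
  assumes gap: "gap \<nu>" and \<nu>: "0 < \<nu>" and w: "w \<in> W"
  shows "\<exists>v\<in>W. laplacian v = w"
proof -
  define N where "N = 4 * (real (length S) + 1)"
  \<comment> \<open>As \<open>C\<close> is at least the constant of
    \<open>hnorm_laplacian_le\<close>, the quadratic term of the step costs at most one of the two
    energy terms gained. The other one yields the gap, and \<open>\<nu> \<le> C\<close> keeps the
    contraction factor real.\<close>
  define C where "C = N + \<nu>"
  have NC: "0 < N" "0 < C" "N \<le> C" "\<nu> \<le> C" "\<nu> / C < 1" using \<nu> by (auto simp: N_def C_def)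
  define F where "F v = v \<ominus>\<^bsub>K\<^esub> complex_of_real (1 / C) \<odot>\<^bsub>K\<^esub> (laplacian v \<ominus>\<^bsub>K\<^esub> w)" for v
  have FW: "F v \<in> W" if "v \<in> W" for v
    unfolding F_def using that w by (intro W_linear laplacian_in_W W_carrier)
  have contr: "hnorm K (u \<ominus>\<^bsub>K\<^esub> complex_of_real (1 / C) \<odot>\<^bsub>K\<^esub> laplacian u) \<le> sqrt (1 - \<nu> / C) * hnorm K u"
    if u: "u \<in> W" for u
  proof (rule power2_le_imp_le)
    have uK: "u \<in> carrier K" by (rule W_carrier[OF u])
    let ?D = "laplacian u" and ?c = "complex_of_real (1 / C)"
    have D: "?D \<in> carrier K" by (rule laplacian_closed[OF uK])
    have "Re (cinner K u (?c \<odot>\<^bsub>K\<^esub> ?D)) = energy u / C"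
      using uK D cinner_laplacian_self[OF uK] K.cinner_commute[OF D uK]
      by (simp add: K.cinner_smult_right K.scale_closed)
    then have "(hnorm K (u \<ominus>\<^bsub>K\<^esub> ?c \<odot>\<^bsub>K\<^esub> ?D))\<^sup>2 = (hnorm K u)\<^sup>2 + (hnorm K ?D)\<^sup>2 / C\<^sup>2 - 2 * (energy u / C)"
      using uK D NC by (simp add: K.hnorm_diff_sq K.scale_closed K.hnorm_smult power_divide norm_divide)
    also have "(hnorm K ?D)\<^sup>2 / C\<^sup>2 \<le> energy u / C"
    proof -
      have "(hnorm K ?D)\<^sup>2 \<le> C * energy u"
        using order_trans[OF hnorm_laplacian_le[OF uK] mult_right_mono[OF NC(3) energy_nonneg[of u], unfolded N_def]] .
      then show ?thesis using NC by (simp add: field_simps power2_eq_square)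
    qed
    also have "(hnorm K u)\<^sup>2 + energy u / C - 2 * (energy u / C) \<le> (1 - \<nu> / C) * (hnorm K u)\<^sup>2"
    proof -
      have "\<nu> * (hnorm K u)\<^sup>2 / C \<le> energy u / C"
        using gap u NC unfolding gap_def by (intro divide_right_mono) auto
      then show ?thesis by (simp add: algebra_simps)
    qed
    finally show "(hnorm K (u \<ominus>\<^bsub>K\<^esub> ?c \<odot>\<^bsub>K\<^esub> ?D))\<^sup>2 \<le> (sqrt (1 - \<nu> / C) * hnorm K u)\<^sup>2"
      using NC by (simp add: power_mult_distrib)
    show "0 \<le> sqrt (1 - \<nu> / C) * hnorm K u" using NC uK by simp
  qed
  have "\<exists>v\<in>W. F v = v"
  proof (rule K.contraction_fixed_point[OF _ W_zero FW W_closed])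
    show "W \<subseteq> carrier K" using W_carrier by blast
    show "0 \<le> sqrt (1 - \<nu> / C)" "sqrt (1 - \<nu> / C) < 1" using NC \<nu> by simp_all
    fix u v assume u: "u \<in> W" and v: "v \<in> W"
    let ?c = "complex_of_real (1 / C)"
    have K: "u \<in> carrier K" "v \<in> carrier K" "w \<in> carrier K" using u v w W_carrier by blast+
    note L = laplacian_closed[OF K(1)] laplacian_closed[OF K(2)]
    have "F u \<ominus>\<^bsub>K\<^esub> F v = (u \<ominus>\<^bsub>K\<^esub> v) \<ominus>\<^bsub>K\<^esub> ?c \<odot>\<^bsub>K\<^esub> laplacian (u \<ominus>\<^bsub>K\<^esub> v)"
      by (rule K.cinner_ext)
        (use K L in \<open>simp_all add: F_def laplacian_diff K.cinner_diff_left K.cinner_smult_left K.scale_closed algebra_simps\<close>)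
    then show "hnorm K (F u \<ominus>\<^bsub>K\<^esub> F v) \<le> sqrt (1 - \<nu> / C) * hnorm K (u \<ominus>\<^bsub>K\<^esub> v)"
      using contr[OF W_linear(1)[OF u v]] by simp
  qed blast+
  then obtain v where v: "v \<in> W" "F v = v" by blast
  have K: "v \<in> carrier K" "w \<in> carrier K" using v w W_carrier by blast+
  note L = laplacian_closed[OF K(1)]
  have "laplacian v = w"
  proof (rule K.cinner_ext[OF L K(2)])
    fix u assume u: "u \<in> carrier K"
    have "cinner K (F v) u = cinner K v u - complex_of_real (1 / C) * (cinner K (laplacian v) u - cinner K w u)"
      using K L u by (simp add: F_def K.cinner_diff_left K.cinner_smult_left K.scale_closed)
    then have "complex_of_real (1 / C) * (cinner K (laplacian v) u - cinner K w u) = 0" using v(2) by simp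
    then show "cinner K (laplacian v) u = cinner K w u" using NC by auto
  qed
  then show ?thesis using v(1) by blast
qed

text \<open>In operator terms, the square of the Laplacian is at least \<nu> times the Laplacian. A
  projection onto \<open>W\<close> is replaced by a vector \<open>u\<close> of \<open>W\<close> with
  the same Laplacian as \<open>v\<close>, which then has the same energy as well.\<close>

lemma energy_le_laplacian:
  assumes gap: "gap \<nu>" and \<nu>: "0 < \<nu>" and v: "v \<in> carrier K"
  shows "\<nu> * energy v \<le> (hnorm K (laplacian v))\<^sup>2"
proof -
  obtain u where u: "u \<in> W" "laplacian u = laplacian v"
    using laplacian_solve[OF gap \<nu> laplacian_in_W[OF v]] by blast
  have uK: "u \<in> carrier K" by (rule W_carrier[OF u(1)])
  have "energy v = Re (cinner K (laplacian u) v)" using cinner_laplacian_self[OF v] u by simp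
  also have "\<dots> = Re (cinner K u (laplacian u))" using laplacian_symmetric[OF uK v] u by simp
  also have "\<dots> = energy u" using cinner_laplacian_self[OF uK] laplacian_symmetric[OF uK uK] by simp
  finally have e: "energy v = energy u" .
  let ?e = "energy u" and ?d = "hnorm K (laplacian u)"
  have "?e \<le> ?d * hnorm K u"
    using K.Cauchy_Schwarz_Re[OF laplacian_closed[OF uK] uK] cinner_laplacian_self[OF uK] by simp
  then have "?e\<^sup>2 \<le> (?d * hnorm K u)\<^sup>2" using energy_nonneg by (intro power_mono)
  then have "\<nu> * (?e * ?e) \<le> ?d\<^sup>2 * (\<nu> * (hnorm K u)\<^sup>2)"
    using mult_left_mono[of "?e\<^sup>2" _ \<nu>] \<nu> by (simp add: power_mult_distrib power2_eq_square mult_ac)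
  also have "\<dots> \<le> ?d\<^sup>2 * ?e" using gap u(1) unfolding gap_def by (intro mult_left_mono) auto
  finally have "(\<nu> * ?e) * ?e \<le> ?d\<^sup>2 * ?e" by (simp add: mult_ac)
  then have "\<nu> * ?e \<le> ?d\<^sup>2"
    using energy_nonneg[of u] by (cases "?e = 0") auto
  then show ?thesis using e u(2) by simp
qed

end

section \<open>Delorme's theorem\<close>

definition group_cocycle ::
    "('g, 'm) monoid_scheme \<Rightarrow> 'h inner_module \<Rightarrow> ('g \<Rightarrow> 'h \<Rightarrow> 'h) \<Rightarrow> ('g \<Rightarrow> 'h) \<Rightarrow> bool" where
  "group_cocycle G K \<sigma> b \<longleftrightarrow> b \<in> carrier G \<rightarrow> carrier K \<and>
     (\<forall>g\<in>carrier G. \<forall>h\<in>carrier G. b (g \<otimes>\<^bsub>G\<^esub> h) = b g \<oplus>\<^bsub>K\<^esub> \<sigma> g (b h))"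

context unitary_rep
begin

lemma cocycle_closed: "group_cocycle G K \<sigma> b \<Longrightarrow> g \<in> carrier G \<Longrightarrow> b g \<in> carrier K"
  by (auto simp: group_cocycle_def)

lemma cocycle_mult:
  "\<lbrakk>group_cocycle G K \<sigma> b; g \<in> carrier G; h \<in> carrier G\<rbrakk> \<Longrightarrow> b (g \<otimes> h) = b g \<oplus>\<^bsub>K\<^esub> \<sigma> g (b h)"
  by (simp add: group_cocycle_def)

lemma cocycle_one: assumes b: "group_cocycle G K \<sigma> b" shows "b \<one> = \<zero>\<^bsub>K\<^esub>"
proof -
  have c: "b \<one> \<in> carrier K" by (rule cocycle_closed[OF b one_closed])
  have eq: "b \<one> = b \<one> \<oplus>\<^bsub>K\<^esub> b \<one>" using cocycle_mult[OF b one_closed one_closed] c by (simp add: rep_one)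
  show ?thesis
  proof (rule K.cinner_ext[OF c])
    fix w assume "w \<in> carrier K"
    then show "cinner K (b \<one>) w = cinner K \<zero>\<^bsub>K\<^esub> w"
      using arg_cong[OF eq, of "\<lambda>u. cinner K u w"] c by (simp add: K.cinner_add_left K.cinner_zero_left)
  qed simp
qed

lemma cocycle_inv:
  assumes b: "group_cocycle G K \<sigma> b" and g: "g \<in> carrier G"
  shows "b (inv g) = \<ominus>\<^bsub>K\<^esub> \<sigma> (inv g) (b g)"
proof -
  have c: "b (inv g) \<in> carrier K" "\<sigma> (inv g) (b g) \<in> carrier K"
    using cocycle_closed[OF b] g by (simp_all add: rep_simps(1))
  have "b (inv g) \<oplus>\<^bsub>K\<^esub> \<sigma> (inv g) (b g) = \<zero>\<^bsub>K\<^esub>"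
    using cocycle_mult[OF b inv_closed[OF g] g] g by (simp add: cocycle_one[OF b])
  then show ?thesis using c by (metis K.M.minus_equality)
qed

lemma cocycle_diff:
  assumes b: "group_cocycle G K \<sigma> b" and gh: "g \<in> carrier G" "h \<in> carrier G" "k \<in> carrier G"
  shows "hnorm K (b (k \<otimes> g) \<ominus>\<^bsub>K\<^esub> b (k \<otimes> h)) = hnorm K (b g \<ominus>\<^bsub>K\<^esub> b h)"
proof -
  note c = cocycle_closed[OF b gh(1)] cocycle_closed[OF b gh(2)] cocycle_closed[OF b gh(3)]
  have "b (k \<otimes> g) \<ominus>\<^bsub>K\<^esub> b (k \<otimes> h) = \<sigma> k (b g \<ominus>\<^bsub>K\<^esub> b h)"
    by (rule K.cinner_ext) (use c gh in
      \<open>simp_all add: cocycle_mult[OF b] rep_diff rep_simps(1) K.cinner_diff_left K.cinner_add_left\<close>)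
  then show ?thesis using c gh by (simp add: rep_norm)
qed

lemma coboundary_cocycle:
  assumes v: "v \<in> carrier K"
  shows "group_cocycle G K \<sigma> (\<lambda>g. \<sigma> g v \<ominus>\<^bsub>K\<^esub> v)"
  unfolding group_cocycle_def
proof (intro conjI ballI)
  fix g h assume gh: "g \<in> carrier G" "h \<in> carrier G"
  show "\<sigma> (g \<otimes> h) v \<ominus>\<^bsub>K\<^esub> v = (\<sigma> g v \<ominus>\<^bsub>K\<^esub> v) \<oplus>\<^bsub>K\<^esub> \<sigma> g (\<sigma> h v \<ominus>\<^bsub>K\<^esub> v)"
    by (rule K.cinner_ext) (use v gh in
      \<open>simp_all add: rep_mult rep_diff rep_simps(1) K.cinner_diff_left K.cinner_add_left\<close>)
qed (use v in \<open>simp add: rep_simps(1)\<close>)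

lemma cocycle_minus:
  assumes b: "group_cocycle G K \<sigma> b" and b': "group_cocycle G K \<sigma> b'"
  shows "group_cocycle G K \<sigma> (\<lambda>g. b g \<ominus>\<^bsub>K\<^esub> b' g)"
  unfolding group_cocycle_def
proof (intro conjI ballI)
  fix g h assume gh: "g \<in> carrier G" "h \<in> carrier G"
  note c = cocycle_closed[OF b] cocycle_closed[OF b']
  show "b (g \<otimes> h) \<ominus>\<^bsub>K\<^esub> b' (g \<otimes> h) = (b g \<ominus>\<^bsub>K\<^esub> b' g) \<oplus>\<^bsub>K\<^esub> \<sigma> g (b h \<ominus>\<^bsub>K\<^esub> b' h)"
    by (rule K.cinner_ext) (use c gh in
      \<open>simp_all add: cocycle_mult[OF b] cocycle_mult[OF b'] rep_diff rep_simps(1) K.cinner_diff_left K.cinner_add_left\<close>)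
qed (use cocycle_closed[OF b] cocycle_closed[OF b'] in simp)

text \<open>Against an invariant vector, \<open>b (inv s)\<close> pairs to the negative of
  \<open>b s\<close>, so the Laplacian of \<open>b\<close> lies in \<open>W\<close>. There it is the
  Laplacian of some \<open>v\<close>, and subtracting the coboundary of \<open>v\<close> cancels
  it.\<close>

lemma harmonic_representative:
  assumes gap: "gap \<nu>" "0 < \<nu>" and b: "group_cocycle G K \<sigma> b"
  shows "\<exists>v\<in>carrier K. lincomb K (\<lambda>g. b g \<ominus>\<^bsub>K\<^esub> (\<sigma> g v \<ominus>\<^bsub>K\<^esub> v)) (laplacian_list G S) = \<zero>\<^bsub>K\<^esub>"
proof -
  let ?l = "laplacian_list G S"
  note c = cocycle_closed[OF b]
  define w where "w = lincomb K b ?l"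
  have wK: "w \<in> carrier K" unfolding w_def by (intro K.lincomb_closed c list_elements)
  have w: "cinner K w u = (\<Sum>s\<leftarrow>S. 2 * cinner K (b \<one>) u - cinner K (b s) u - cinner K (b (inv s)) u)"
    if "u \<in> carrier K" for u
  proof -
    have "cinner K w u = (\<Sum>(c, g)\<leftarrow>?l. c * cinner K (b g) u)"
      unfolding w_def using that by (intro K.cinner_lincomb c list_elements)
    then show ?thesis by (simp only: laplacian_sum)
  qed
  have "cinner K w u = 0" if u: "u \<in> invariants" for u
  proof -
    have uK: "u \<in> carrier K" using u by (simp add: invariants_def)
    have "2 * cinner K (b \<one>) u - cinner K (b s) u - cinner K (b (inv s)) u = 0" if "s \<in> set S" for s
    proof -
      have s: "s \<in> carrier G" using in_gens[OF that] .
      have "cinner K (b (inv s)) u = - cinner K (\<sigma> (inv s) (b s)) u"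
        using s c uK by (simp add: cocycle_inv[OF b] K.minus_eq_smult rep_simps(1) K.cinner_smult_left)
      also have "cinner K (\<sigma> (inv s) (b s)) u = cinner K (b s) u"
        using rep_adjoint[OF s c[OF s] uK] u s by (simp add: invariants_def)
      finally show ?thesis using uK by (simp add: cocycle_one[OF b] K.cinner_zero_left)
    qed
    then have "(\<Sum>s\<leftarrow>S. 2 * cinner K (b \<one>) u - cinner K (b s) u - cinner K (b (inv s)) u) = (\<Sum>s\<leftarrow>S. 0)"
      by (intro arg_cong[where f = sum_list] map_cong refl)
    then show ?thesis using w[OF uK] by simp
  qed
  then have "w \<in> W" using wK by (simp add: W_def orthogonal_complement_def)
  then obtain v where v: "v \<in> W" "laplacian v = w" using laplacian_solve[OF gap] by blast
  have vK: "v \<in> carrier K" by (rule W_carrier[OF v(1)])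
  let ?b = "\<lambda>g. b g \<ominus>\<^bsub>K\<^esub> (\<sigma> g v \<ominus>\<^bsub>K\<^esub> v)"
  have bK: "?b g \<in> carrier K" if "g \<in> carrier G" for g using c[OF that] vK that by (simp add: rep_simps(1))
  have "lincomb K ?b ?l = \<zero>\<^bsub>K\<^esub>"
  proof (rule K.cinner_ext)
    show "lincomb K ?b ?l \<in> carrier K" by (intro K.lincomb_closed bK list_elements)
    fix u assume u: "u \<in> carrier K"
    have "cinner K (lincomb K ?b ?l) u = (\<Sum>(c, g)\<leftarrow>?l. c * cinner K (?b g) u)"
      using u by (intro K.cinner_lincomb bK list_elements)
    also have "\<dots> = (\<Sum>s\<leftarrow>S. 2 * cinner K (?b \<one>) u - cinner K (?b s) u - cinner K (?b (inv s)) u)"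
      by (rule laplacian_sum)
    also have "\<dots> = (\<Sum>s\<leftarrow>S. (2 * cinner K (b \<one>) u - cinner K (b s) u - cinner K (b (inv s)) u) -
        (2 * cinner K (\<sigma> \<one> v) u - cinner K (\<sigma> s v) u - cinner K (\<sigma> (inv s) v) u))"
      using u vK c in_gens by (intro arg_cong[where f = sum_list] map_cong refl)
        (simp add: K.cinner_diff_left rep_simps(1))
    also have "\<dots> = cinner K w u - cinner K (laplacian v) u"
    proof -
      have "cinner K (laplacian v) u = (\<Sum>(c, g)\<leftarrow>?l. c * cinner K (\<sigma> g v) u)"
        unfolding laplacian_def using u vK by (intro K.cinner_lincomb rep_simps(1) list_elements)
      then show ?thesis unfolding w[OF u] laplacian_sum by (simp add: sum_list_subtractf)
    qed
    finally show "cinner K (lincomb K ?b ?l) u = cinner K \<zero>\<^bsub>K\<^esub> u" using u v(2) by (simp add: K.cinner_zero_left)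
  qed simp
  then show ?thesis using vK by blast
qed

end

text \<open>The constant comes from a word for \<open>g\<close>, so it is independent of the
  representation and of the cocycle. This uniformity is what produces gaps common to all
  representations.\<close>

lemma group_cocycle_bound:
  assumes "g \<in> generate G (set S)"
  shows "\<exists>M\<ge>0. \<forall>(K :: 'h inner_module) \<sigma> b. unitary_rep G K \<sigma> S \<longrightarrow> group_cocycle G K \<sigma> b \<longrightarrow>
     hnorm K (b g) \<le> M * (\<Sum>s\<leftarrow>S. hnorm K (b s))"
  using assms
proof (induction rule: generate.induct)
  case one
  have "hnorm K (b \<one>\<^bsub>G\<^esub>) \<le> 0 * (\<Sum>s\<leftarrow>S. hnorm K (b s))" if "unitary_rep G K \<sigma> S" "group_cocycle G K \<sigma> b"
    for K :: "'h inner_module" and \<sigma> b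
  proof -
    interpret unitary_rep G K \<sigma> S by fact
    show ?thesis by (simp add: cocycle_one[OF that(2)] K.hnorm_zero)
  qed
  then show ?case by blast
next
  case (incl s)
  have "hnorm K (b s) \<le> 1 * (\<Sum>s\<leftarrow>S. hnorm K (b s))" if "unitary_rep G K \<sigma> S" "group_cocycle G K \<sigma> b"
    for K :: "'h inner_module" and \<sigma> b
  proof -
    interpret unitary_rep G K \<sigma> S by fact
    have "hnorm K (b s) \<le> (\<Sum>s\<leftarrow>S. hnorm K (b s))"
      using incl cocycle_closed[OF that(2)] in_gens
      by (intro member_le_sum_list) auto
    then show ?thesis by simp
  qed
  then show ?case using zero_le_one[where 'a = real] by blast
next
  case (inv s)
  have "hnorm K (b (inv\<^bsub>G\<^esub> s)) \<le> 1 * (\<Sum>s\<leftarrow>S. hnorm K (b s))" if "unitary_rep G K \<sigma> S" "group_cocycle G K \<sigma> b"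
    for K :: "'h inner_module" and \<sigma> b
  proof -
    interpret unitary_rep G K \<sigma> S by fact
    have s: "s \<in> carrier G" using in_gens[OF inv] .
    have "hnorm K (b s) \<le> (\<Sum>s\<leftarrow>S. hnorm K (b s))"
      using inv cocycle_closed[OF that(2)] in_gens
      by (intro member_le_sum_list) auto
    moreover have "hnorm K (b (inv\<^bsub>G\<^esub> s)) = hnorm K (b s)"
      using s cocycle_closed[OF that(2)] by (simp add: cocycle_inv[OF that(2)] K.hnorm_minus rep_simps(1) rep_norm)
    ultimately show ?thesis by simp
  qed
  then show ?case using zero_le_one[where 'a = real] by blast
next
  case (eng g h)
  obtain M where M: "M \<ge> 0" "\<And>(K :: 'h inner_module) \<sigma> b. unitary_rep G K \<sigma> S \<Longrightarrow> group_cocycle G K \<sigma> b \<Longrightarrow>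
     hnorm K (b g) \<le> M * (\<Sum>s\<leftarrow>S. hnorm K (b s))" using eng.IH(1) by blast
  obtain M' where M': "M' \<ge> 0" "\<And>(K :: 'h inner_module) \<sigma> b. unitary_rep G K \<sigma> S \<Longrightarrow> group_cocycle G K \<sigma> b \<Longrightarrow>
     hnorm K (b h) \<le> M' * (\<Sum>s\<leftarrow>S. hnorm K (b s))" using eng.IH(2) by blast
  have "hnorm K (b (g \<otimes>\<^bsub>G\<^esub> h)) \<le> (M + M') * (\<Sum>s\<leftarrow>S. hnorm K (b s))" if "unitary_rep G K \<sigma> S" "group_cocycle G K \<sigma> b"
    for K :: "'h inner_module" and \<sigma> b
  proof -
    interpret unitary_rep G K \<sigma> S by fact
    have gh: "g \<in> carrier G" "h \<in> carrier G"
      using eng.hyps generate_in_carrier[OF gens] by blast+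
    have "hnorm K (b (g \<otimes>\<^bsub>G\<^esub> h)) \<le> hnorm K (b g) + hnorm K (\<sigma> g (b h))"
      unfolding cocycle_mult[OF that(2) gh]
      using gh cocycle_closed[OF that(2)] by (intro K.hnorm_triangle rep_simps(1))
    also have "\<dots> \<le> M * (\<Sum>s\<leftarrow>S. hnorm K (b s)) + M' * (\<Sum>s\<leftarrow>S. hnorm K (b s))"
      using gh cocycle_closed[OF that(2)] M(2)[OF that] M'(2)[OF that] by (simp add: rep_norm add_mono)
    finally show ?thesis by (simp add: distrib_right)
  qed
  then show ?case using M(1) M'(1) by (intro exI[of _ "M + M'"]) auto
qed

lemma group_cocycle_bound_finite:
  assumes "finite Q" "Q \<subseteq> generate G (set S)"
  obtains M where "M \<ge> 0" "\<And>(K :: 'h inner_module) \<sigma> b g. unitary_rep G K \<sigma> S \<Longrightarrow> group_cocycle G K \<sigma> b \<Longrightarrow> g \<in> Q \<Longrightarrow>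
     hnorm K (b g) \<le> M * (\<Sum>s\<leftarrow>S. hnorm K (b s))"
proof -
  have "\<forall>g\<in>Q. \<exists>M\<ge>0. \<forall>(K :: 'h inner_module) \<sigma> b. unitary_rep G K \<sigma> S \<longrightarrow> group_cocycle G K \<sigma> b \<longrightarrow>
     hnorm K (b g) \<le> M * (\<Sum>s\<leftarrow>S. hnorm K (b s))"
    by (rule ballI, rule group_cocycle_bound, rule subsetD[OF assms(2)])
  from bchoice[OF this] obtain m where "\<forall>g\<in>Q. 0 \<le> m g \<and> (\<forall>(K :: 'h inner_module) \<sigma> b. unitary_rep G K \<sigma> S \<longrightarrow>
     group_cocycle G K \<sigma> b \<longrightarrow> hnorm K (b g) \<le> m g * (\<Sum>s\<leftarrow>S. hnorm K (b s)))"
    ..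
  then have m: "\<And>g. g \<in> Q \<Longrightarrow> m g \<ge> 0" "\<And>(K :: 'h inner_module) \<sigma> b g. g \<in> Q \<Longrightarrow> unitary_rep G K \<sigma> S \<Longrightarrow> group_cocycle G K \<sigma> b \<Longrightarrow>
     hnorm K (b g) \<le> m g * (\<Sum>s\<leftarrow>S. hnorm K (b s))" by blast+
  show thesis
  proof (rule that[of "\<Sum>g\<in>Q. m g"])
    show "0 \<le> (\<Sum>g\<in>Q. m g)" using m(1) by (rule sum_nonneg)
    fix K :: "'h inner_module" and \<sigma> b g
    assume *: "unitary_rep G K \<sigma> S" "group_cocycle G K \<sigma> b" "g \<in> Q"
    interpret unitary_rep G K \<sigma> S by fact
    have "0 \<le> (\<Sum>s\<leftarrow>S. hnorm K (b s))"
      using cocycle_closed[OF *(2)] in_gens by (intro sum_list_nonneg) auto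
    moreover have "m g \<le> (\<Sum>g\<in>Q. m g)" using assms(1) *(3) m(1) by (intro member_le_sum) auto
    ultimately have "m g * (\<Sum>s\<leftarrow>S. hnorm K (b s)) \<le> (\<Sum>g\<in>Q. m g) * (\<Sum>s\<leftarrow>S. hnorm K (b s))"
      by (intro mult_right_mono)
    then show "hnorm K (b g) \<le> (\<Sum>g\<in>Q. m g) * (\<Sum>s\<leftarrow>S. hnorm K (b s))" using m(2)[OF *(3,1,2)] by simp
  qed
qed

section \<open>Restriction to the complement of the invariant vectors\<close>

context unitary_rep
begin

text \<open>Property (T) yields an invariant vector somewhere in the space of a representation.
  Restricted to \<open>W\<close>, which contains no nonzero invariant vector, this becomes a
  contradiction.\<close>

abbreviation KW where "KW \<equiv> K\<lparr>carrier := W\<rparr>"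

lemma inner_product_space_KW: "inner_product_space KW"
proof (intro inner_product_space.intro moduleI inner_product_space_axioms.intro cring_complex_ring)
  show "abelian_group KW"
  proof (rule abelian_groupI)
    fix x assume "x \<in> carrier KW"
    then have x: "x \<in> W" by simp
    have "(- 1) \<odot>\<^bsub>K\<^esub> x \<oplus>\<^bsub>K\<^esub> x = \<zero>\<^bsub>K\<^esub>"
      using W_carrier[OF x] by (simp add: K.minus_eq_smult[symmetric] K.M.l_neg)
    then show "\<exists>y\<in>carrier KW. y \<oplus>\<^bsub>KW\<^esub> x = \<zero>\<^bsub>KW\<^esub>"
      using W_linear(3)[OF x, of "- 1"] by auto
  qed (use W_linear W_zero W_carrier in \<open>auto simp: K.M.a_ac\<close>)
qed (use W_linear(3) W_carrier K.smult_l_distr K.smult_r_distr K.smult_assoc1 K.smult_one in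
    \<open>auto simp: K.cinner_add_left K.cinner_smult_left intro: K.cinner_commute K.cinner_pos\<close>)

lemma KW_minus: "\<lbrakk>u \<in> W; v \<in> W\<rbrakk> \<Longrightarrow> u \<ominus>\<^bsub>KW\<^esub> v = u \<ominus>\<^bsub>K\<^esub> v"
  using inner_product_space.minus_eq_smult[OF inner_product_space_KW, of v] W_carrier
  by (simp add: a_minus_def K.minus_eq_smult)

lemma KW_norm: "hnorm KW v = hnorm K v"
  by (simp add: hnorm_def)

lemma hilbert_space_KW: "hilbert_space KW"
proof (rule inner_product_space.hilbert_spaceI[OF inner_product_space_KW])
  fix \<tau> :: "nat \<Rightarrow> 'h" assume \<tau>: "\<And>n. \<tau> n \<in> carrier KW"
    and C: "\<And>e. e > 0 \<Longrightarrow> \<exists>N. \<forall>m\<ge>N. \<forall>n\<ge>N. hnorm KW (\<tau> m \<ominus>\<^bsub>KW\<^esub> \<tau> n) < e"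
  have \<tau>W: "\<tau> n \<in> W" for n using \<tau> by simp
  have "\<exists>N. \<forall>m\<ge>N. \<forall>n\<ge>N. hnorm K (\<tau> m \<ominus>\<^bsub>K\<^esub> \<tau> n) < e" if "e > 0" for e
    using C[OF that] by (simp add: KW_minus \<tau>W KW_norm)
  with W_carrier[OF \<tau>W] obtain v where v: "v \<in> carrier K" "(\<lambda>n. hnorm K (\<tau> n \<ominus>\<^bsub>K\<^esub> v)) \<longlonglongrightarrow> 0"
    using K.Cauchy_limit[of \<tau>] by blast
  have vW: "v \<in> W" by (rule W_closed[OF \<tau>W v])
  have "\<exists>N. \<forall>n\<ge>N. hnorm KW (\<tau> n \<ominus>\<^bsub>KW\<^esub> v) < e" if "e > 0" for e
    using order_tendstoD(2)[OF v(2) that] by (simp add: eventually_sequentially KW_minus \<tau>W vW KW_norm)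
  then show "\<exists>v\<in>carrier KW. \<forall>e>0. \<exists>N. \<forall>n\<ge>N. hnorm KW (\<tau> n \<ominus>\<^bsub>KW\<^esub> v) < e" using vW by auto
qed

lemma rep_W: "g \<in> carrier G \<Longrightarrow> v \<in> W \<Longrightarrow> \<sigma> g v \<in> W"
proof -
  assume g: "g \<in> carrier G" and v: "v \<in> W"
  have vK: "v \<in> carrier K" by (rule W_carrier[OF v])
  have "cinner K (\<sigma> g v) w = 0" if w: "w \<in> invariants" for w
  proof -
    have wK: "w \<in> carrier K" "\<sigma> g w = w" using w g by (simp_all add: invariants_def)
    then have "cinner K (\<sigma> g v) w = cinner K v w" using rep_isometric[OF g vK wK(1)] by simp
    then show ?thesis using v w by (simp add: W_def orthogonal_complement_def)
  qed
  then show ?thesis using rep_simps(1)[OF g vK] by (simp add: W_def orthogonal_complement_def)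
qed

lemma unitary_representation_KW: "unitary_representation G KW \<sigma>"
  unfolding unitary_representation_def unitary_operator_def clinear_map_def
proof (intro conjI ballI allI hilbert_space_KW)
  fix g assume g: "g \<in> carrier G"
  show "\<sigma> g \<in> carrier KW \<rightarrow> carrier KW" using rep_W[OF g] by simp
  show "\<sigma> g ` carrier KW = carrier KW"
  proof
    show "\<sigma> g ` carrier KW \<subseteq> carrier KW" using rep_W[OF g] by auto
    show "carrier KW \<subseteq> \<sigma> g ` carrier KW"
    proof
      fix w assume "w \<in> carrier KW"
      then have w: "w \<in> W" by simp
      have "w = \<sigma> g (\<sigma> (inv g) w)"
        using rep_mult[OF g inv_closed[OF g] W_carrier[OF w]] g W_carrier[OF w] by (simp add: rep_one)
      then show "w \<in> \<sigma> g ` carrier KW" using rep_W[OF inv_closed[OF g] w] by auto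
    qed
  qed
qed (use W_carrier in \<open>auto simp: rep_simps rep_isometric rep_one rep_mult\<close>)

end

lemma property_T_gap:
  fixes G :: "('g, 'm) monoid_scheme"
  assumes G: "group G" and T: "property_T G" and S: "set S \<subseteq> carrier G" "generate G (set S) = carrier G"
  obtains \<nu> where "0 < \<nu>"
    "\<And>(K :: 'h inner_module) \<sigma>. unitary_rep G K \<sigma> S \<Longrightarrow> unitary_rep.gap G K \<sigma> S \<nu>"
proof -
  obtain Q \<epsilon> where Q: "finite Q" "Q \<subseteq> carrier G" "0 < \<epsilon>"
    and QT: "\<And>(H :: 'h inner_module) \<pi> v. \<lbrakk>unitary_representation G H \<pi>; almost_invariant_vector H \<pi> Q \<epsilon> v\<rbrakk> \<Longrightarrow>
       has_invariant_vector G H \<pi>"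
    using property_T_D[OF G T] by metis
  obtain M where M: "M \<ge> 0" "\<And>(K :: 'h inner_module) \<sigma> b g. unitary_rep G K \<sigma> S \<Longrightarrow> group_cocycle G K \<sigma> b \<Longrightarrow> g \<in> Q \<Longrightarrow>
     hnorm K (b g) \<le> M * (\<Sum>s\<leftarrow>S. hnorm K (b s))"
    using group_cocycle_bound_finite[OF Q(1), of G S] Q(2) S(2) by metis
  \<comment> \<open>The added 1 keeps the denominator positive and makes the final estimate
    strict.\<close>
  define \<delta> where "\<delta> = \<epsilon> / (M * length S + 1)"
  have den: "0 < M * length S + 1" using M(1) by (simp add: add_nonneg_pos)
  have \<delta>: "0 < \<delta>" using Q(3) den by (simp add: \<delta>_def)
  have "unitary_rep.gap G K \<sigma> S (\<delta>\<^sup>2)" if "unitary_rep G K \<sigma> S" for K :: "'h inner_module" and \<sigma>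
  proof -
    interpret unitary_rep G K \<sigma> S by fact
    show ?thesis
      unfolding gap_def
    proof (rule ballI, rule ccontr)
      fix v assume v: "v \<in> W" and less: "\<not> \<delta>\<^sup>2 * (hnorm K v)\<^sup>2 \<le> energy v"
      have vK: "v \<in> carrier K" by (rule W_carrier[OF v])
      have pos: "0 < hnorm K v"
        using less energy_nonneg[of v] K.hnorm_nonneg[OF vK] by (cases "hnorm K v = 0") auto
      let ?b = "\<lambda>g. \<sigma> g v \<ominus>\<^bsub>K\<^esub> v"
      have "hnorm K (?b s) \<le> \<delta> * hnorm K v" if "s \<in> set S" for s
      proof (rule power2_le_imp_le)
        have "(hnorm K (?b s))\<^sup>2 \<le> energy v"
          unfolding energy_def using that by (intro member_le_sum_list) auto
        then show "(hnorm K (?b s))\<^sup>2 \<le> (\<delta> * hnorm K v)\<^sup>2" using less by (simp add: power_mult_distrib)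
        show "0 \<le> \<delta> * hnorm K v" using \<delta> pos by simp
      qed
      then have "(\<Sum>s\<leftarrow>S. hnorm K (?b s)) \<le> (\<Sum>s\<leftarrow>S. \<delta> * hnorm K v)" by (rule sum_list_mono)
      then have sum: "(\<Sum>s\<leftarrow>S. hnorm K (?b s)) \<le> length S * (\<delta> * hnorm K v)" by (simp add: sum_list_triv)
      have "hnorm K (?b g) < \<epsilon> * hnorm K v" if g: "g \<in> Q" for g
      proof -
        have "hnorm K (?b g) \<le> M * (\<Sum>s\<leftarrow>S. hnorm K (?b s))"
          by (rule M(2)[OF unitary_rep_axioms coboundary_cocycle[OF vK] g])
        also have "\<dots> \<le> M * (length S * (\<delta> * hnorm K v))" by (rule mult_left_mono[OF sum M(1)])
        also have "\<dots> = (M * length S) * (\<delta> * hnorm K v)" by simp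
        also have "\<dots> < (M * length S + 1) * (\<delta> * hnorm K v)"
          using \<delta> pos by (intro mult_strict_right_mono) simp_all
        also have "\<dots> = \<epsilon> * hnorm K v" using den by (simp add: \<delta>_def)
        finally show ?thesis .
      qed
      then have "almost_invariant_vector KW \<sigma> Q \<epsilon> v"
        unfolding almost_invariant_vector_def
        using v pos K.hnorm_zero Q(2) rep_W by (auto simp: KW_minus KW_norm subset_iff)
      from QT[OF unitary_representation_KW this]
      obtain w where w: "w \<in> W" "w \<noteq> \<zero>\<^bsub>K\<^esub>" "\<And>g. g \<in> carrier G \<Longrightarrow> \<sigma> g w = w"
        by (auto simp: has_invariant_vector_def)
      then have "w \<in> invariants" using W_carrier by (simp add: invariants_def)
      then have "cinner K w w = 0" using w(1) by (simp add: W_def orthogonal_complement_def)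
      then show False using K.cinner_pos[OF W_carrier[OF w(1)] w(2)] by simp
    qed
  qed
  moreover have "0 < \<delta>\<^sup>2" using \<delta> by simp
  ultimately show thesis using that by blast
qed

section \<open>The unitary representation of an invariant positive definite kernel\<close>

lemma sum_list_swap:
  fixes f :: "'i \<Rightarrow> 'j \<Rightarrow> 'k::comm_monoid_add"
  shows "(\<Sum>x\<leftarrow>xs. \<Sum>y\<leftarrow>ys. f x y) = (\<Sum>y\<leftarrow>ys. \<Sum>x\<leftarrow>xs. f x y)"
  by (induction xs) (simp_all add: sum_list_addf)

text \<open>Families indexed by natural numbers are used because a vector is a list in which a group
  element may occur several times; the indices are its positions.\<close>

locale group_kernel = group G for G (structure) +
  fixes k :: "'g \<Rightarrow> 'g \<Rightarrow> real"
  assumes psd: "\<And>(F :: nat set) g. finite F \<Longrightarrow> (\<And>i. i \<in> F \<Longrightarrow> g i \<in> carrier G) \<Longrightarrow> psd F (\<lambda>i j. k (g i) (g j))"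
    and invariant: "\<lbrakk>h \<in> carrier G; g \<in> carrier G; g' \<in> carrier G\<rbrakk> \<Longrightarrow> k (h \<otimes> g) (h \<otimes> g') = k g g'"
begin

text \<open>Finitely supported functions on the group as lists of coefficients and elements, as in
  the GNS construction. Concatenation is not a commutative group operation, but the form cannot
  tell.\<close>

definition V :: "(complex \<times> 'g) list inner_module" where
  "V = \<lparr>carrier = {l. snd ` set l \<subseteq> carrier G}, mult = undefined, one = undefined, zero = [],
     add = (@), smult = (\<lambda>c l. map (\<lambda>x. (c * fst x, snd x)) l),
     cinner = (\<lambda>l m. \<Sum>x\<leftarrow>l. \<Sum>y\<leftarrow>m. fst x * cnj (fst y) * complex_of_real (k (snd x) (snd y)))\<rparr>"

lemma V_simps:
  "carrier V = {l. snd ` set l \<subseteq> carrier G}" "add V = (@)"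
  "smult V = (\<lambda>c l. map (\<lambda>x. (c * fst x, snd x)) l)"
  "cinner V = (\<lambda>l m. \<Sum>x\<leftarrow>l. \<Sum>y\<leftarrow>m. fst x * cnj (fst y) * complex_of_real (k (snd x) (snd y)))"
  by (simp_all add: V_def)

lemma kernel_sym: "\<lbrakk>g \<in> carrier G; h \<in> carrier G\<rbrakk> \<Longrightarrow> k g h = k h g"
  using psd_sym[OF psd[of "{0, 1}" "\<lambda>i. if i = 0 then g else h"], of 0 1] by simp

sublocale V: semi_inner_product V
proof
  show "carrier V \<noteq> {}" by (auto simp: V_simps(1) intro: exI[of _ "[]"])
next
  fix u v assume "u \<in> carrier V" "v \<in> carrier V"
  then show "u \<oplus>\<^bsub>V\<^esub> v \<in> carrier V" by (auto simp: V_simps(1,2))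
next
  fix v c assume "v \<in> carrier V"
  then show "c \<odot>\<^bsub>V\<^esub> v \<in> carrier V" by (auto simp: V_simps(1,3))
next
  fix u v w
  show "cinner V (u \<oplus>\<^bsub>V\<^esub> v) w = cinner V u w + cinner V v w" by (simp add: V_simps)
next
  fix v w c
  show "cinner V (c \<odot>\<^bsub>V\<^esub> v) w = c * cinner V v w"
    by (simp add: V_simps o_def sum_list_const_mult[symmetric] mult.assoc)
next
  fix v w assume "v \<in> carrier V" "w \<in> carrier V"
  then have vw: "\<And>x. x \<in> set v \<Longrightarrow> snd x \<in> carrier G" "\<And>x. x \<in> set w \<Longrightarrow> snd x \<in> carrier G"
    by (auto simp: V_simps(1))
  have "cnj (cinner V v w) = (\<Sum>x\<leftarrow>v. \<Sum>y\<leftarrow>w. cnj (fst x) * fst y * complex_of_real (k (snd x) (snd y)))"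
    by (simp add: V_simps(4) cnj_sum_list)
  also have "\<dots> = (\<Sum>x\<leftarrow>v. \<Sum>y\<leftarrow>w. fst y * cnj (fst x) * complex_of_real (k (snd y) (snd x)))"
    using vw by (intro arg_cong[where f = sum_list] map_cong refl) (simp add: kernel_sym)
  also have "\<dots> = cinner V w v"
    unfolding V_simps(4) by (rule sum_list_swap)
  finally show "cinner V w v = cnj (cinner V v w)" by simp
next
  fix v assume v: "v \<in> carrier V"
  let ?I = "{0..<length v}"
  have "psd ?I (\<lambda>i j. k (snd (v ! i)) (snd (v ! j)))"
    by (rule psd) (use v in \<open>auto simp: V_simps(1)\<close>)
  from psd_complex[OF this, of "\<lambda>i. fst (v ! i)"]
  show "0 \<le> Re (cinner V v v)" by (simp add: V_simps(4) sum_list_sum_nth)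
qed

definition shift :: "'g \<Rightarrow> (complex \<times> 'g) list \<Rightarrow> (complex \<times> 'g) list" where
  "shift h l = map (\<lambda>x. (fst x, h \<otimes> snd x)) l"

lemma shift_closed: "h \<in> carrier G \<Longrightarrow> l \<in> carrier V \<Longrightarrow> shift h l \<in> carrier V"
  by (auto simp: V_simps(1) shift_def)

lemma shift_shift:
  assumes "g \<in> carrier G" "h \<in> carrier G" "l \<in> carrier V"
  shows "shift g (shift h l) = shift (g \<otimes> h) l"
  using assms by (auto simp: V_simps(1) shift_def m_assoc)

lemma shift_one: "l \<in> carrier V \<Longrightarrow> shift \<one> l = l"
  by (induction l) (auto simp: V_simps(1) shift_def)

lemma shift_isometric:
  assumes h: "h \<in> carrier G" and l: "l \<in> carrier V" and m: "m \<in> carrier V"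
  shows "cinner V (shift h l) (shift h m) = cinner V l m"
proof -
  have "k (h \<otimes> snd x) (h \<otimes> snd y) = k (snd x) (snd y)" if "x \<in> set l" "y \<in> set m" for x y
    by (intro invariant h) (use l m that in \<open>simp_all add: V_simps(1) image_subset_iff\<close>)
  then show ?thesis
    unfolding V_simps(4) shift_def map_map o_def
    by (intro arg_cong[where f = sum_list] map_cong refl) simp
qed

lemma shift_adjoint:
  assumes h: "h \<in> carrier G" and l: "l \<in> carrier V" and m: "m \<in> carrier V"
  shows "cinner V (shift h l) m = cinner V l (shift (inv h) m)"
proof -
  have "cinner V (shift h l) m = cinner V (shift h l) (shift h (shift (inv h) m))"
    using h m by (simp add: shift_shift shift_one)
  then show ?thesis using shift_isometric[OF h l shift_closed[OF inv_closed[OF h] m]] by simp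
qed

lemma adjoint_pair_shift: assumes h: "h \<in> carrier G" shows "V.adjoint_pair (shift h) (shift (inv h))"
proof -
  have n: "\<exists>C. \<forall>u\<in>carrier V. hnorm V (shift g u) \<le> C * hnorm V u" if "g \<in> carrier G" for g
    using that by (intro exI[of _ 1]) (simp add: hnorm_def shift_isometric)
  show ?thesis unfolding V.adjoint_pair_def
    using h shift_closed shift_adjoint n by auto
qed

lemma unitary_representation_gns:
  "unitary_representation G V.completion (\<lambda>h. V.lift (shift (inv h)))"
proof -
  have mult: "V.lift (shift (inv (g \<otimes> h))) l = V.lift (shift (inv g)) (V.lift (shift (inv h)) l)"
    if "g \<in> carrier G" "h \<in> carrier G" for g h l
    using that by (auto simp: V.lift_def fun_eq_iff shift_closed shift_shift inv_mult_group)
  have one: "V.lift (shift (inv \<one>)) l = l" if "l \<in> carrier V.completion" for l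
    using that by (auto simp: V.lift_def fun_eq_iff shift_one V.completion_simps(1) V.completion_set_def)
  show ?thesis
    unfolding unitary_representation_def unitary_operator_def
  proof (intro conjI ballI V.hilbert_space_completion)
    fix h assume h: "h \<in> carrier G"
    note T = adjoint_pair_shift[OF h]
    show "clinear_map V.completion V.completion (V.lift (shift (inv h)))" by (rule V.clinear_map_lift[OF T])
    show "V.lift (shift (inv h)) ` carrier V.completion = carrier V.completion"
    proof
      show "V.lift (shift (inv h)) ` carrier V.completion \<subseteq> carrier V.completion"
        using V.lift_in_completion[OF T] by blast
      show "carrier V.completion \<subseteq> V.lift (shift (inv h)) ` carrier V.completion"
      proof
        fix l assume l: "l \<in> carrier V.completion"
        have "V.lift (shift (inv h)) (V.lift (shift (inv (inv h))) l) = l"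
          using mult[OF h inv_closed[OF h], of l] one[OF l] h by simp
        then show "l \<in> V.lift (shift (inv h)) ` carrier V.completion"
          using V.lift_in_completion[OF adjoint_pair_shift[OF inv_closed[OF h]] l] by (metis imageI)
      qed
    qed
    fix l m assume l: "l \<in> carrier V.completion" and m: "m \<in> carrier V.completion"
    have "cinner V.completion (V.lift (shift (inv h)) l) (V.lift (shift (inv h)) m) =
        cinner V.completion l (V.lift (shift h) (V.lift (shift (inv h)) m))"
      by (rule V.cinner_lift[OF T l V.lift_in_completion[OF T m]])
    also have "V.lift (shift h) (V.lift (shift (inv h)) m) = m"
      using mult[OF inv_closed[OF h] h, of m] one[OF m] h by simp
    finally show "cinner V.completion (V.lift (shift (inv h)) l) (V.lift (shift (inv h)) m) = cinner V.completion l m" .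
  next
    fix l assume "l \<in> carrier V.completion"
    then show "V.lift (shift (inv \<one>)) l = l" by (rule one)
  next
    fix g h l assume "g \<in> carrier G" "h \<in> carrier G"
    then show "V.lift (shift (inv (g \<otimes> h))) l = V.lift (shift (inv g)) (V.lift (shift (inv h)) l)" by (rule mult)
  qed
qed

lemma gns_vector:
  assumes "g \<in> carrier G" "h \<in> carrier G"
  shows "cinner V.completion (V.lift (shift (inv g)) (V.embed [(1, \<one>)])) (V.lift (shift (inv h)) (V.embed [(1, \<one>)]))
    = complex_of_real (k g h)"
proof -
  have e: "[(1, \<one>)] \<in> carrier V" by (simp add: V_simps(1))
  have "V.lift (shift (inv g)) (V.embed [(1, \<one>)]) = V.embed [(1, g)]" if "g \<in> carrier G" for g
    using that V.lift_embed[OF adjoint_pair_shift[OF that] e] by (simp add: shift_def)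
  then show ?thesis using assms by (simp add: V.cinner_embed) (simp add: V.cinner_embed V_simps)
qed

end

text \<open>The spectral gap inequality for the vectors of the representation with kernel \<open>exp (- t N)\<close> is
  an equality at \<open>t = 0\<close>; the conclusion is its derivative there.\<close>

lemma harmonic_kernel_zero:
  fixes G :: "('g, 'm) monoid_scheme" and S :: "'g list" and N :: "'g \<Rightarrow> 'g \<Rightarrow> real"
  defines "E \<equiv> {\<one>\<^bsub>G\<^esub>} \<union> set S \<union> m_inv G ` set S"
  assumes \<nu>: "0 < \<nu>" and N0: "\<And>g. g \<in> E \<Longrightarrow> N g g = 0"
    and rep: "\<And>t. 0 < t \<Longrightarrow> \<exists>(K :: 'h inner_module) \<sigma> \<xi>. unitary_rep G K \<sigma> S \<and> unitary_rep.gap G K \<sigma> S \<nu> \<and>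
       \<xi> \<in> carrier K \<and> (\<forall>g\<in>E. \<forall>h\<in>E. cinner K (\<sigma> g \<xi>) (\<sigma> h \<xi>) = complex_of_real (exp (- t * N g h)))"
    and harmonic: "(\<Sum>x\<leftarrow>laplacian_list G S. \<Sum>y\<leftarrow>laplacian_list G S. Re (fst x) * Re (fst y) * N (snd x) (snd y)) = 0"
  shows "(\<Sum>s\<leftarrow>S. N s \<one>\<^bsub>G\<^esub>) \<le> 0"
proof (rule ccontr)
  let ?l = "laplacian_list G S"
  assume pos: "\<not> (\<Sum>s\<leftarrow>S. N s \<one>\<^bsub>G\<^esub>) \<le> 0"
  \<comment> \<open>This is the defect of \<open>energy_le_laplacian\<close> for a unit vector whose
    translates have inner products \<open>exp (- t * N g h)\<close>: the squared norm of its
    Laplacian minus \<nu> times its energy.\<close>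
  define f where "f t = (\<Sum>x\<leftarrow>?l. \<Sum>y\<leftarrow>?l. Re (fst x) * Re (fst y) * exp (- t * N (snd x) (snd y)))
    - \<nu> * (\<Sum>s\<leftarrow>S. 2 - 2 * exp (- t * N s \<one>\<^bsub>G\<^esub>))" for t
  have f0: "f 0 = 0"
  proof -
    have "(\<Sum>x\<leftarrow>?l. \<Sum>y\<leftarrow>?l. Re (fst x) * Re (fst y)) = (\<Sum>x\<leftarrow>?l. Re (fst x)) * (\<Sum>y\<leftarrow>?l. Re (fst y))"
      by (simp add: sum_list_mult_const sum_list_const_mult)
    then show ?thesis by (simp add: f_def laplacian_list_sum)
  qed
  have fpos: "0 \<le> f t" if t: "0 < t" for t
  proof -
    obtain K :: "'h inner_module" and \<sigma> \<xi> where K: "unitary_rep G K \<sigma> S" "unitary_rep.gap G K \<sigma> S \<nu>"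
      "\<xi> \<in> carrier K" "\<And>g h. g \<in> E \<Longrightarrow> h \<in> E \<Longrightarrow> cinner K (\<sigma> g \<xi>) (\<sigma> h \<xi>) = complex_of_real (exp (- t * N g h))"
      using rep[OF t] by blast
    interpret unitary_rep G K \<sigma> S by fact
    have E: "snd ` set ?l \<subseteq> E" "set S \<subseteq> E" "\<one>\<^bsub>G\<^esub> \<in> E" using laplacian_list_elements[of G S] by (auto simp: E_def)
    have "energy \<xi> = (\<Sum>s\<leftarrow>S. 2 - 2 * exp (- t * N s \<one>\<^bsub>G\<^esub>))"
      unfolding energy_def
    proof (intro arg_cong[where f = sum_list] map_cong refl)
      fix s assume "s \<in> set S"
      then have s: "s \<in> carrier G" "s \<in> E" using in_gens E(2) by auto
      have 1: "hnorm K (\<sigma> s \<xi>) = 1" "hnorm K \<xi> = 1"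
        using K(4)[OF s(2) s(2)] K(4)[OF E(3) E(3)] N0[OF s(2)] N0[OF E(3)] K(3) by (simp_all add: hnorm_def rep_one)
      have "Re (cinner K (\<sigma> s \<xi>) \<xi>) = exp (- t * N s \<one>\<^bsub>G\<^esub>)"
        using K(4)[OF s(2) E(3)] K(3) by (simp add: rep_one)
      then show "(hnorm K (\<sigma> s \<xi> \<ominus>\<^bsub>K\<^esub> \<xi>))\<^sup>2 = 2 - 2 * exp (- t * N s \<one>\<^bsub>G\<^esub>)"
        using s(1) K(3) 1 by (simp add: K.hnorm_diff_sq rep_simps(1))
    qed
    moreover have "(hnorm K (laplacian \<xi>))\<^sup>2 = (\<Sum>x\<leftarrow>?l. \<Sum>y\<leftarrow>?l. Re (fst x) * Re (fst y) * exp (- t * N (snd x) (snd y)))"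
    proof -
      have "(hnorm K (laplacian \<xi>))\<^sup>2 = (\<Sum>x\<leftarrow>?l. \<Sum>y\<leftarrow>?l. Re (fst x) * Re (fst y) * Re (cinner K (\<sigma> (snd x) \<xi>) (\<sigma> (snd y) \<xi>)))"
        unfolding laplacian_def
        by (rule K.hnorm_lincomb_sq[of ?l "\<lambda>g. \<sigma> g \<xi>"]) (simp_all only: rep_simps(1)[OF list_elements K(3)] laplacian_list_real)
      also have "\<dots> = (\<Sum>x\<leftarrow>?l. \<Sum>y\<leftarrow>?l. Re (fst x) * Re (fst y) * exp (- t * N (snd x) (snd y)))"
        using E(1) by (intro arg_cong[where f = sum_list] map_cong refl) (simp add: K(4) image_subset_iff)
      finally show ?thesis .
    qed
    ultimately show ?thesis using energy_le_laplacian[OF K(2) \<nu> K(3)] by (simp add: f_def)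
  qed
  have DERIV_sum_list: "((\<lambda>t. \<Sum>x\<leftarrow>xs. p x t) has_real_derivative (\<Sum>x\<leftarrow>xs. p' x)) (at (0::real))"
    if "\<And>x. ((\<lambda>t. p x t) has_real_derivative p' x) (at 0)" for p p' and xs :: "'i list"
    using that by (induction xs) (auto intro!: derivative_eq_intros)
  have "(f has_real_derivative ((\<Sum>x\<leftarrow>?l. \<Sum>y\<leftarrow>?l. Re (fst x) * Re (fst y) * (- N (snd x) (snd y)))
      - \<nu> * (\<Sum>s\<leftarrow>S. 2 * N s \<one>\<^bsub>G\<^esub>))) (at 0)"
    unfolding f_def
    by (intro DERIV_diff DERIV_cmult DERIV_sum_list) (auto intro!: derivative_eq_intros)
  moreover have "(\<Sum>x\<leftarrow>?l. \<Sum>y\<leftarrow>?l. Re (fst x) * Re (fst y) * (- N (snd x) (snd y))) = 0"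
    using harmonic by (simp add: uminus_sum_list_map[unfolded o_def, symmetric])
  moreover have "(\<Sum>s\<leftarrow>S. 2 * N s \<one>\<^bsub>G\<^esub>) = 2 * (\<Sum>s\<leftarrow>S. N s \<one>\<^bsub>G\<^esub>)" by (rule sum_list_const_mult)
  ultimately have "(f has_real_derivative (- \<nu> * (2 * (\<Sum>s\<leftarrow>S. N s \<one>\<^bsub>G\<^esub>)))) (at 0)" by simp
  moreover have "- \<nu> * (2 * (\<Sum>s\<leftarrow>S. N s \<one>\<^bsub>G\<^esub>)) < 0" using \<nu> pos by (simp add: mult_pos_pos)
  ultimately obtain e where e: "0 < e" "\<And>h. \<lbrakk>0 < h; h < e\<rbrakk> \<Longrightarrow> f (0 + h) < f 0"
    using DERIV_neg_dec_right by blast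
  have "f (0 + e / 2) < f 0" using e by simp
  then show False using fpos[of "e / 2"] e(1) f0 by simp
qed

theorem delorme:
  fixes G :: "('g, 'm) monoid_scheme" and K :: "'h inner_module"
  assumes T: "property_T G" and S: "generate G (set S) = carrier G"
    and rep: "unitary_rep G K \<sigma> S" and b: "group_cocycle G K \<sigma> b"
  shows "\<exists>v\<in>carrier K. \<forall>g\<in>carrier G. b g = \<sigma> g v \<ominus>\<^bsub>K\<^esub> v"
proof -
  interpret unitary_rep G K \<sigma> S by fact
  obtain \<nu> where \<nu>: "0 < \<nu>" "gap \<nu>"
    using property_T_gap[OF group_axioms T gens S] unitary_rep_axioms by metis
  \<comment> \<open>A second gap: the first concerns the given space and produces the harmonic
    cocycle, this one concerns the spaces built from the kernels, which have another type.\<close>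
  obtain \<mu> where \<mu>: "0 < \<mu>"
    "\<And>(K' :: ((complex \<times> 'g) list \<Rightarrow> complex) inner_module) \<sigma>. unitary_rep G K' \<sigma> S \<Longrightarrow> unitary_rep.gap G K' \<sigma> S \<mu>"
    using property_T_gap[OF group_axioms T gens S] by metis
  obtain v where v: "v \<in> carrier K"
    and harm: "lincomb K (\<lambda>g. b g \<ominus>\<^bsub>K\<^esub> (\<sigma> g v \<ominus>\<^bsub>K\<^esub> v)) (laplacian_list G S) = \<zero>\<^bsub>K\<^esub>"
    using harmonic_representative[OF \<nu>(2,1) b] by blast
  define b' where "b' g = b g \<ominus>\<^bsub>K\<^esub> (\<sigma> g v \<ominus>\<^bsub>K\<^esub> v)" for g
  have b': "group_cocycle G K \<sigma> b'"
    unfolding b'_def by (rule cocycle_minus[OF b coboundary_cocycle[OF v]])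
  note c = cocycle_closed[OF b']
  define N where "N g h = (hnorm K (b' g \<ominus>\<^bsub>K\<^esub> b' h))\<^sup>2" for g h
  have "(\<Sum>s\<leftarrow>S. N s \<one>\<^bsub>G\<^esub>) \<le> 0"
  proof (rule harmonic_kernel_zero[OF \<mu>(1)])
    fix g assume "g \<in> {\<one>\<^bsub>G\<^esub>} \<union> set S \<union> m_inv G ` set S"
    then have "g \<in> carrier G" using in_gens by auto
    then show "N g g = 0" using c[of g] by (simp add: N_def K.diff_eq_zero[THEN iffD2] K.hnorm_zero)
  next
    fix t :: real assume t: "0 < t"
    interpret k: group_kernel G "\<lambda>g h. exp (- t * N g h)"
    proof
      fix F :: "nat set" and g assume "finite F" "\<And>i. i \<in> F \<Longrightarrow> g i \<in> carrier G"
      then show "psd F (\<lambda>i j. exp (- t * N (g i) (g j)))"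
        unfolding N_def using t c by (intro K.psd_gaussian) auto
    next
      fix h g g' assume "h \<in> carrier G" "g \<in> carrier G" "g' \<in> carrier G"
      then show "exp (- t * N (h \<otimes>\<^bsub>G\<^esub> g) (h \<otimes>\<^bsub>G\<^esub> g')) = exp (- t * N g g')"
        by (simp add: N_def cocycle_diff[OF b'])
    qed
    let ?\<sigma> = "\<lambda>h. k.V.lift (k.shift (inv\<^bsub>G\<^esub> h))" and ?\<xi> = "k.V.embed [(1, \<one>\<^bsub>G\<^esub>)]"
    have r: "unitary_rep G k.V.completion ?\<sigma> S"
      by (intro unitary_rep.intro unitary_rep_axioms.intro group_axioms gens k.unitary_representation_gns)
    have "?\<xi> \<in> carrier k.V.completion"
      unfolding k.V.completion_simps(1) by (rule k.V.embed_in_completion) (simp only: k.V_simps(1), simp)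
    moreover have "\<forall>g\<in>{\<one>\<^bsub>G\<^esub>} \<union> set S \<union> m_inv G ` set S. \<forall>h\<in>{\<one>\<^bsub>G\<^esub>} \<union> set S \<union> m_inv G ` set S.
        cinner k.V.completion (?\<sigma> g ?\<xi>) (?\<sigma> h ?\<xi>) = complex_of_real (exp (- t * N g h))"
      using in_gens by (intro ballI k.gns_vector) auto
    ultimately show "\<exists>(K :: ((complex \<times> 'g) list \<Rightarrow> complex) inner_module) \<sigma> \<xi>. unitary_rep G K \<sigma> S \<and> unitary_rep.gap G K \<sigma> S \<mu> \<and>
       \<xi> \<in> carrier K \<and> (\<forall>g\<in>{\<one>\<^bsub>G\<^esub>} \<union> set S \<union> m_inv G ` set S. \<forall>h\<in>{\<one>\<^bsub>G\<^esub>} \<union> set S \<union> m_inv G ` set S.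
         cinner K (\<sigma> g \<xi>) (\<sigma> h \<xi>) = complex_of_real (exp (- t * N g h)))"
      using r \<mu>(2)[OF r] by blast
  next
    have "(\<Sum>x\<leftarrow>laplacian_list G S. \<Sum>y\<leftarrow>laplacian_list G S. Re (fst x) * Re (fst y) * N (snd x) (snd y)) =
        - 2 * (hnorm K (lincomb K b' (laplacian_list G S)))\<^sup>2"
      unfolding N_def by (rule K.sum_squared_distances) (auto intro!: c list_elements laplacian_list_real laplacian_list_sum)
    then show "(\<Sum>x\<leftarrow>laplacian_list G S. \<Sum>y\<leftarrow>laplacian_list G S. Re (fst x) * Re (fst y) * N (snd x) (snd y)) = 0"
      using harm by (simp add: b'_def K.hnorm_zero)
  qed
  moreover have "hnorm K (b' s) = 0" if sum: "(\<Sum>s\<leftarrow>S. N s \<one>\<^bsub>G\<^esub>) \<le> 0" and s: "s \<in> set S" for s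
  proof -
    have "N s \<one>\<^bsub>G\<^esub> \<le> (\<Sum>s\<leftarrow>S. N s \<one>\<^bsub>G\<^esub>)"
      using s by (intro member_le_sum_list) (auto simp: N_def)
    from order_trans[OF this sum] have "N s \<one>\<^bsub>G\<^esub> \<le> 0" .
    moreover have "b' s \<ominus>\<^bsub>K\<^esub> b' \<one>\<^bsub>G\<^esub> = b' s"
      using c[OF in_gens[OF s]] by (simp add: cocycle_one[OF b'] a_minus_def)
    ultimately show ?thesis by (simp add: N_def)
  qed
  ultimately have "(\<Sum>s\<leftarrow>S. hnorm K (b' s)) = (\<Sum>s\<leftarrow>S. 0)"
    by (intro arg_cong[where f = sum_list] map_cong refl)
  then have sum0: "(\<Sum>s\<leftarrow>S. hnorm K (b' s)) = 0" by simp
  have "b g = \<sigma> g v \<ominus>\<^bsub>K\<^esub> v" if g: "g \<in> carrier G" for g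
  proof -
    \<comment> \<open>A cocycle that vanishes on the generators vanishes on the whole group.\<close>
    obtain M where "hnorm K (b' g) \<le> M * (\<Sum>s\<leftarrow>S. hnorm K (b' s))"
      using group_cocycle_bound[of g G S] g S unitary_rep_axioms b' by blast
    then have "hnorm K (b' g) = 0" using sum0 K.hnorm_nonneg[OF c[OF g]] by simp
    then have "b' g = \<zero>\<^bsub>K\<^esub>" using c[OF g] by (simp add: K.hnorm_eq_0)
    then show ?thesis unfolding b'_def using cocycle_closed[OF b g] v g by (simp add: K.diff_eq_zero rep_simps(1))
  qed
  then show ?thesis using v by blast
qed

section \<open>Group actions that induce the coarse structure\<close>

locale roe_action = ulf_metric_space X d + group G + group_action G X \<phi>
  for X :: "'a set" and d and G :: "('g, 'm) monoid_scheme" (structure) and \<phi> +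
  fixes S :: "'g list"
  assumes gens: "set S \<subseteq> carrier G" and generate: "generate G (set S) = carrier G"
    and controlled: "controlled d {(x, \<phi> g x) |x g. x \<in> X \<and> g \<in> set S}"
    and generating: "generating X d {(x, \<phi> g x) |x g. x \<in> X \<and> g \<in> set S}"
begin

lemma act_closed: "g \<in> carrier G \<Longrightarrow> x \<in> X \<Longrightarrow> \<phi> g x \<in> X"
  using element_image by blast

lemma act_one: "x \<in> X \<Longrightarrow> \<phi> \<one> x = x"
  using id_eq_one by (metis restrict_apply')

lemma act_mult: "\<lbrakk>g \<in> carrier G; h \<in> carrier G; x \<in> X\<rbrakk> \<Longrightarrow> \<phi> (g \<otimes> h) x = \<phi> g (\<phi> h x)"
  using composition_rule by blast

lemma act_inv: "\<lbrakk>g \<in> carrier G; x \<in> X; y \<in> X\<rbrakk> \<Longrightarrow> x = \<phi> g y \<longleftrightarrow> y = \<phi> (inv g) x"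
  using act_mult[of g "inv g" x] act_mult[of "inv g" g y] act_one[of x] act_one[of y] by auto

definition u :: "'g \<Rightarrow> 'a cmatrix" where
  "u g = (\<lambda>x y. if y \<in> X \<and> x = \<phi> g y then 1 else 0)"

lemma u_one: "u \<one> = \<one>\<^bsub>Cu\<^esub>"
  by (auto simp: u_def roe_simps diagonal_def fun_eq_iff act_one)

lemma adjoint_u: "g \<in> carrier G \<Longrightarrow> adjoint_matrix (u g) = u (inv g)"
  using act_inv[of g] act_closed by (auto simp: u_def adjoint_matrix_def fun_eq_iff)

lemma mult_u:
  assumes g: "g \<in> carrier G" and ug: "u g \<in> carrier Cu"
  shows "u g \<otimes>\<^bsub>Cu\<^esub> a = (\<lambda>x z. if x \<in> X then a (\<phi> (inv g) x) z else 0)"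
proof (intro ext)
  fix x z
  show "(u g \<otimes>\<^bsub>Cu\<^esub> a) x z = (if x \<in> X then a (\<phi> (inv g) x) z else 0)"
  proof (cases "x \<in> X")
    case True
    have "(u g \<otimes>\<^bsub>Cu\<^esub> a) x z = (\<Sum>y\<in>{\<phi> (inv g) x}. u g x y * a y z)"
      by (rule mult_eq_sum[OF _ _ ug]) (use act_inv[OF g True] in \<open>auto simp: u_def split: if_splits\<close>)
    then show ?thesis using True act_inv[OF g True act_closed[OF inv_closed[OF g] True]]
      act_closed[OF inv_closed[OF g] True] by (simp add: u_def)
  next
    case False
    have "(u g \<otimes>\<^bsub>Cu\<^esub> a) x z = (\<Sum>y\<in>{}. u g x y * a y z)"
      by (rule mult_eq_sum[OF _ _ ug]) (use False act_closed[OF g] in \<open>auto simp: u_def split: if_splits\<close>)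
    then show ?thesis using False by simp
  qed
qed

lemma u_mult:
  assumes g: "g \<in> carrier G" and h: "h \<in> carrier G" and ug: "u g \<in> carrier Cu"
  shows "u g \<otimes>\<^bsub>Cu\<^esub> u h = u (g \<otimes> h)"
proof (intro ext)
  fix x z
  have "(x \<in> X \<and> z \<in> X \<and> \<phi> (inv g) x = \<phi> h z) \<longleftrightarrow> z \<in> X \<and> x = \<phi> (g \<otimes> h) z"
    using act_inv[OF g, of x "\<phi> h z"] act_closed[OF h, of z] act_mult[OF g h, of z]
      act_closed[of "g \<otimes> h" z] g h by auto
  then show "(u g \<otimes>\<^bsub>Cu\<^esub> u h) x z = u (g \<otimes> h) x z"
    unfolding mult_u[OF g ug] by (auto simp: u_def)
qed

lemma u_generator_in_roe:
  assumes s: "s \<in> set S" shows "u s \<in> carrier Cu"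
proof -
  let ?E = "{(x, \<phi> g x) |x g. x \<in> X \<and> g \<in> set S}"
  obtain r where r: "0 \<le> r" "(SUP (x, y)\<in>?E. d x y) = ennreal r"
    using controlled unfolding controlled_def by (cases "SUP (x, y)\<in>?E. d x y") auto
  have sG: "s \<in> carrier G" using s gens by blast
  have "d x y \<le> ennreal (r + 1)" if "u s x y \<noteq> 0" for x y
  proof -
    have y: "y \<in> X" "x = \<phi> s y" using that by (auto simp: u_def split: if_splits)
    have "d x y = d y x" using y act_closed[OF sG] by (intro dist_commute) auto
    also have "\<dots> = (case (y, x) of (x, y) \<Rightarrow> d x y)" by simp
    also have "\<dots> \<le> (SUP (x, y)\<in>?E. d x y)" by (rule SUP_upper) (use y s in blast)
    also have "\<dots> \<le> ennreal (r + 1)" unfolding r(2) by (rule ennreal_leI) simp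
    finally show ?thesis .
  qed
  moreover have "\<forall>x y. cmod (u s x y) \<le> 1" by (simp add: u_def)
  moreover have "x \<in> X \<and> y \<in> X" if "u s x y \<noteq> 0" for x y
    using that act_closed[OF sG] by (auto simp: u_def split: if_splits)
  moreover have "0 < r + 1" using r by simp
  ultimately show ?thesis unfolding in_roe_iff by blast
qed

lemma u_in_roe: assumes "g \<in> carrier G" shows "u g \<in> carrier Cu"
proof -
  have "g \<in> generate G (set S)" using assms generate by simp
  then show ?thesis
  proof (induction rule: generate.induct)
    case one
    show ?case using u_one one_in_roe by simp
  next
    case (incl s)
    show ?case by (rule u_generator_in_roe[OF incl])
  next
    case (inv s)
    then show ?case using adjoint_in_roe[OF u_generator_in_roe[OF inv]] adjoint_u gens by auto
  next
    case (eng g h)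
    then have "g \<in> carrier G" "h \<in> carrier G" using generate by auto
    then show ?case using mult_in_roe[OF eng.IH] u_mult eng.IH(1) by simp
  qed
qed

section \<open>Decomposition of matrices along the group\<close>

definition delta :: "'g \<Rightarrow> 'a cmatrix" where
  "delta g = u g \<oplus>\<^bsub>Cu\<^esub> (- 1) \<odot>\<^bsub>Cu\<^esub> \<one>\<^bsub>Cu\<^esub>"

lemma delta_in_roe: "g \<in> carrier G \<Longrightarrow> delta g \<in> carrier Cu"
  unfolding delta_def by (intro add_in_roe smult_in_roe one_in_roe u_in_roe)

lemma delta_ker: assumes g: "g \<in> carrier G" shows "delta g \<in> ker_omega X d"
proof -
  have "omega (delta g) x = 0" for x
  proof (cases "x \<in> X")
    case True
    let ?F = "{\<phi> (inv g) x, x}"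
    have y: "\<phi> (inv g) x \<in> X" using act_closed[OF inv_closed[OF g] True] .
    have "omega (delta g) x = sum (delta g x) ?F"
      by (rule omega_eq_sum) (use act_inv[OF g True] True in \<open>auto simp: delta_def roe_simps u_def diagonal_def split: if_splits\<close>)
    also have "\<dots> = 0"
      using act_inv[OF g True] True y
      by (cases "\<phi> (inv g) x = x") (auto simp: delta_def roe_simps u_def diagonal_def)
    finally show ?thesis .
  next
    case False
    have "omega (delta g) x = sum (delta g x) {}"
      by (rule omega_eq_sum) (use False act_closed[OF g] in \<open>auto simp: delta_def roe_simps u_def diagonal_def split: if_splits\<close>)
    then show ?thesis by simp
  qed
  then show ?thesis using delta_in_roe[OF g] by (simp add: ker_omega_def fun_eq_iff)
qed

text \<open>The map \<open>delta\<close> is itself a cocycle, with values in the left ideal and the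
  group acting by left multiplication. So the composition with an equivariant map on the ideal is a
  group cocycle.\<close>

lemma delta_mult:
  assumes g: "g \<in> carrier G" and h: "h \<in> carrier G"
  shows "delta (g \<otimes> h) = delta g \<oplus>\<^bsub>Cu\<^esub> u g \<otimes>\<^bsub>Cu\<^esub> delta h"
proof -
  have "u g \<otimes>\<^bsub>Cu\<^esub> delta h = u (g \<otimes> h) \<oplus>\<^bsub>Cu\<^esub> (- 1) \<odot>\<^bsub>Cu\<^esub> u g"
  proof -
    have "u g \<otimes>\<^bsub>Cu\<^esub> delta h = (\<lambda>x z. (u g \<otimes>\<^bsub>Cu\<^esub> u h) x z - (u g \<otimes>\<^bsub>Cu\<^esub> u \<one>) x z)"
      unfolding mult_u[OF g u_in_roe[OF g]] by (auto simp: delta_def roe_simps u_one fun_eq_iff)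
    also have "u g \<otimes>\<^bsub>Cu\<^esub> u h = u (g \<otimes> h)" by (rule u_mult[OF g h u_in_roe[OF g]])
    also have "u g \<otimes>\<^bsub>Cu\<^esub> u \<one> = u g" using u_mult[OF g one_closed u_in_roe[OF g]] g by simp
    finally show ?thesis by (simp add: roe_simps)
  qed
  then show ?thesis by (simp add: delta_def roe_simps fun_eq_iff)
qed

text \<open>A chain of i steps is the action of a word of i letters, and there are finitely many
  such words.\<close>

lemma finite_chain:
  "\<exists>F. finite F \<and> F \<subseteq> carrier G \<and> (\<forall>x\<in>X. \<forall>y\<in>X.
     (x, y) \<in> ({(x, \<phi> g x) |x g. x \<in> X \<and> g \<in> set S} \<union> {(x, \<phi> g x) |x g. x \<in> X \<and> g \<in> set S}\<inverse>) ^^ i \<longrightarrow> (\<exists>g\<in>F. x = \<phi> g y))"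
proof (induction i)
  case 0
  show ?case by (intro exI[of _ "{\<one>}"]) (auto simp: act_one)
next
  case (Suc i)
  let ?E = "{(x, \<phi> g x) |x g. x \<in> X \<and> g \<in> set S} \<union> {(x, \<phi> g x) |x g. x \<in> X \<and> g \<in> set S}\<inverse>"
  obtain F where F: "finite F" "F \<subseteq> carrier G" "\<And>x y. \<lbrakk>x \<in> X; y \<in> X; (x, y) \<in> ?E ^^ i\<rbrakk> \<Longrightarrow> \<exists>g\<in>F. x = \<phi> g y"
    using Suc.IH by blast
  define F' where "F' = (\<lambda>(g, s). g \<otimes> s) ` (F \<times> (set S \<union> m_inv G ` set S))"
  have "\<exists>g\<in>F'. x = \<phi> g y" if x: "x \<in> X" and y: "y \<in> X" and xy: "(x, y) \<in> ?E ^^ Suc i" for x y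
  proof -
    obtain z where z: "(x, z) \<in> ?E ^^ i" "(z, y) \<in> ?E" using xy by auto
    have "z \<in> X" using z(2) gens act_closed y by auto
    moreover have "\<exists>s\<in>set S \<union> m_inv G ` set S. z = \<phi> s y"
      using z(2)
    proof
      assume "(z, y) \<in> {(x, \<phi> g x) |x g. x \<in> X \<and> g \<in> set S}"
      then obtain s where s: "y = \<phi> s z" "s \<in> set S" "z \<in> X" by blast
      then have "z = \<phi> (inv s) y" using act_inv[of s y z] y gens by auto
      then show ?thesis using s by blast
    qed blast
    ultimately obtain g s where gs: "g \<in> F" "s \<in> set S \<union> m_inv G ` set S" "x = \<phi> g z" "z = \<phi> s y"
      using F(3)[OF x _ z(1)] by blast
    then have "g \<in> carrier G" "s \<in> carrier G" using F(2) gens by auto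
    then have "x = \<phi> (g \<otimes> s) y" using gs act_mult y by simp
    then show ?thesis using gs(1,2) unfolding F'_def by force
  qed
  moreover have "finite F'" "F' \<subseteq> carrier G" using F(1,2) gens by (auto simp: F'_def)
  ultimately show ?case by blast
qed

text \<open>This is how the generating condition enters: pairs at bounded distance are joined by
  chains of bounded length, hence by the action of a finite set of group elements.\<close>

lemma finite_displacement:
  assumes R: "0 < R"
  obtains F where "finite F" "F \<subseteq> carrier G" "\<And>x y. \<lbrakk>x \<in> X; y \<in> X; d x y \<le> ennreal R\<rbrakk> \<Longrightarrow> \<exists>g\<in>F. x = \<phi> g y"
proof -
  let ?E = "{(x, \<phi> g x) |x g. x \<in> X \<and> g \<in> set S} \<union> {(x, \<phi> g x) |x g. x \<in> X \<and> g \<in> set S}\<inverse>"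
  from generating[unfolded generating_def, THEN spec, THEN mp, OF R]
  obtain n where n: "\<forall>x\<in>X. \<forall>y\<in>X. d x y \<le> ennreal R \<longrightarrow> (\<exists>i\<le>n. (x, y) \<in> ?E ^^ i)" ..
  have "\<forall>i. \<exists>F. finite F \<and> F \<subseteq> carrier G \<and> (\<forall>x\<in>X. \<forall>y\<in>X. (x, y) \<in> ?E ^^ i \<longrightarrow> (\<exists>g\<in>F. x = \<phi> g y))"
    by (intro allI finite_chain)
  from choice[OF this] obtain F where F:
    "\<forall>i. finite (F i) \<and> F i \<subseteq> carrier G \<and> (\<forall>x\<in>X. \<forall>y\<in>X. (x, y) \<in> ?E ^^ i \<longrightarrow> (\<exists>g\<in>F i. x = \<phi> g y))" ..
  show thesis
  proof (rule that[of "\<Union>i\<le>n. F i"])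
    fix x y assume xy: "x \<in> X" "y \<in> X" "d x y \<le> ennreal R"
    then obtain i where i: "i \<le> n" "(x, y) \<in> ?E ^^ i" using n by blast
    then have "\<exists>g\<in>F i. x = \<phi> g y" using F[rule_format, of i] xy by simp
    then show "\<exists>g\<in>\<Union>i\<le>n. F i. x = \<phi> g y" using i(1) by blast
  qed (use F in auto)
qed

text \<open>Each nonzero entry is assigned to one group element that realises it. This writes
  \<open>a\<close> as a sum of terms \<open>f g * u g\<close>, so that \<open>omega a\<close> is the
  sum of the functions \<open>f g\<close>, and the difference consists of multiples of
  \<open>delta g\<close>.\<close>

lemma displacement_decomposition:
  assumes F: "finite F" "F \<subseteq> carrier G" and a: "a \<in> carrier Cu"
    and cover: "\<And>x y. a x y \<noteq> 0 \<Longrightarrow> \<exists>g\<in>F. x = \<phi> g y" and C: "\<And>x y. cmod (a x y) \<le> C"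
  obtains f where "\<And>g x. cmod (f g x) \<le> C" "\<And>g x. x \<notin> X \<Longrightarrow> f g x = 0"
    "a \<ominus>\<^bsub>Cu\<^esub> diagonal (omega a) = (\<lambda>x y. \<Sum>g\<in>F. (diagonal (f g) \<otimes>\<^bsub>Cu\<^esub> delta g) x y)"
proof -
  have C0: "0 \<le> C" using C[of undefined undefined] norm_ge_zero order_trans by blast
  define sel where "sel x y = (SOME g. g \<in> F \<and> x = \<phi> g y)" for x y
  have sel: "sel x y \<in> F" "x = \<phi> (sel x y) y" if "a x y \<noteq> 0" for x y
    using someI_ex[of "\<lambda>g. g \<in> F \<and> x = \<phi> g y"] cover[OF that] unfolding sel_def by blast+
  \<comment> \<open>In row \<open>x\<close> the element \<open>g\<close> determines the column; the
    condition on \<open>sel\<close> counts each entry once and keeps the bound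
    \<open>C\<close>.\<close>
  define f where "f g x = (if x \<in> X \<and> sel x (\<phi> (inv g) x) = g then a x (\<phi> (inv g) x) else 0)" for g x
  have fC: "cmod (f g x) \<le> C" for g x using C C0 by (simp add: f_def)
  have fX: "f g x = 0" if "x \<notin> X" for g x using that by (simp add: f_def)
  have fin: "diagonal (f g) \<in> carrier Cu" for g by (rule diagonal_in_roe[OF fC fX])
  have dec: "a x y = (\<Sum>g\<in>F. f g x * u g x y)" for x y
  proof (cases "a x y = 0")
    case True
    have "f g x * u g x y = 0" if g: "g \<in> F" for g
    proof (cases "y \<in> X \<and> x = \<phi> g y")
      case yes: True
      then have "x \<in> X" "y = \<phi> (inv g) x" using act_closed act_inv[of g x y] g F(2) by auto
      then show ?thesis using True by (auto simp: f_def)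
    qed (auto simp: u_def)
    then have "(\<Sum>g\<in>F. f g x * u g x y) = 0" by (rule sum.neutral[OF ballI])
    then show ?thesis using True by simp
  next
    case False
    have xy: "x \<in> X" "y \<in> X" using roe_entry_in[OF a False] by auto
    have "f g x * u g x y = (if g = sel x y then a x y else 0)" if g: "g \<in> F" for g
    proof (cases "x = \<phi> g y")
      case True
      then have "y = \<phi> (inv g) x" using act_inv[of g x y] g F(2) xy by auto
      then show ?thesis using xy True by (auto simp: f_def u_def)
    next
      case f: False
      then show ?thesis using sel(2)[OF False] by (auto simp: u_def)
    qed
    then have "(\<Sum>g\<in>F. f g x * u g x y) = (\<Sum>g\<in>F. if g = sel x y then a x y else 0)" by simp
    then show ?thesis using F(1) sel(1)[OF False] by simp
  qed
  have om: "omega a x = (\<Sum>g\<in>F. f g x)" for x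
  proof (cases "x \<in> X")
    case False
    then show ?thesis using roe_entry_in[OF a] by (auto simp: fX omega_def intro!: sum.neutral)
  next
    case x: True
    let ?Y = "(\<lambda>g. \<phi> (inv g) x) ` F"
    have Y: "finite ?Y" using F by simp
    have "{y. a x y \<noteq> 0} \<subseteq> ?Y"
    proof
      fix y assume "y \<in> {y. a x y \<noteq> 0}"
      then have y: "a x y \<noteq> 0" by simp
      then have "y = \<phi> (inv (sel x y)) x"
        using act_inv[of "sel x y" x y] sel[OF y] roe_entry_in[OF a y] F(2) by blast
      then show "y \<in> ?Y" using sel(1)[OF y] by blast
    qed
    then have "omega a x = (\<Sum>y\<in>?Y. a x y)" by (rule omega_eq_sum[OF Y])
    also have "\<dots> = (\<Sum>y\<in>?Y. \<Sum>g\<in>F. f g x * u g x y)" by (simp only: dec)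
    also have "\<dots> = (\<Sum>g\<in>F. \<Sum>y\<in>?Y. f g x * u g x y)" by (rule sum.swap)
    also have "\<dots> = (\<Sum>g\<in>F. f g x)"
    proof (intro sum.cong refl)
      fix g assume g: "g \<in> F"
      then have gG: "g \<in> carrier G" using F(2) by blast
      have ueq: "u g x y = (if y = \<phi> (inv g) x then 1 else 0)" for y
        using act_inv[OF gG x, of y] act_closed[OF inv_closed[OF gG] x] by (auto simp: u_def)
      then show "(\<Sum>y\<in>?Y. f g x * u g x y) = f g x"
        unfolding ueq using Y g by (simp add: if_distrib cong: if_cong)
    qed
    finally show ?thesis .
  qed
  have "a \<ominus>\<^bsub>Cu\<^esub> diagonal (omega a) = (\<lambda>x y. a x y - diagonal (omega a) x y)"
  proof -
    interpret A: abelian_group Cu by (rule abelian_group_roe)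
    have "\<ominus>\<^bsub>Cu\<^esub> diagonal (omega a) = (\<lambda>x y. - diagonal (omega a) x y)"
    proof (rule A.minus_equality)
      show "(\<lambda>x y. - diagonal (omega a) x y) \<in> carrier Cu"
        using smult_in_roe[OF diagonal_omega_in_roe[OF a], of "- 1"] by (simp add: roe_simps)
    qed (use diagonal_omega_in_roe[OF a] in \<open>auto simp: roe_simps\<close>)
    then show ?thesis by (simp add: a_minus_def roe_simps)
  qed
  also have "\<dots> = (\<lambda>x y. \<Sum>g\<in>F. (diagonal (f g) \<otimes>\<^bsub>Cu\<^esub> delta g) x y)"
  proof (intro ext)
    fix x y
    have "diagonal (omega a) x y = (\<Sum>g\<in>F. f g x * \<one>\<^bsub>Cu\<^esub> x y)"
      using fX by (simp add: diagonal_def roe_simps om sum_distrib_right)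
    then show "a x y - diagonal (omega a) x y = (\<Sum>g\<in>F. (diagonal (f g) \<otimes>\<^bsub>Cu\<^esub> delta g) x y)"
      unfolding dec[of x y] diagonal_mult[OF fin] by (simp add: delta_def roe_simps sum_subtractf right_diff_distrib)
  qed
  finally show thesis using that fC fX by blast
qed

lemma sum_in_roe:
  assumes "finite F" "\<And>g. g \<in> F \<Longrightarrow> m g \<in> carrier Cu"
  shows "(\<lambda>x y. \<Sum>g\<in>F. m g x y) \<in> carrier Cu"
  using assms
proof (induction F rule: finite_induct)
  case empty
  show ?case using ker_omega_zero by (simp add: ker_omega_def)
next
  case (insert g F)
  then have "m g \<oplus>\<^bsub>Cu\<^esub> (\<lambda>x y. \<Sum>g\<in>F. m g x y) \<in> carrier Cu" by (intro add_in_roe) auto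
  then show ?case using insert.hyps by (simp add: roe_simps)
qed

lemma sum_in_ker:
  assumes "finite F" "\<And>g. g \<in> F \<Longrightarrow> m g \<in> ker_omega X d"
  shows "(\<lambda>x y. \<Sum>g\<in>F. m g x y) \<in> ker_omega X d"
  using assms
proof (induction F rule: finite_induct)
  case empty
  show ?case using ker_omega_zero by simp
next
  case (insert g F)
  then have "m g \<oplus>\<^bsub>Cu\<^esub> (\<lambda>x y. \<Sum>g\<in>F. m g x y) \<in> ker_omega X d" by (intro ker_omega_add) auto
  then show ?case using insert.hyps by (simp add: roe_simps)
qed

end

section \<open>Cocycles of the algebra and cocycles of the group\<close>

locale roe_action_rep = roe_action X d G \<phi> S
  for X :: "'a set" and d and G :: "('g, 'm) monoid_scheme" (structure) and \<phi> S +
  fixes H :: "'h inner_module" and \<pi>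
  assumes star_rep: "star_representation X d H \<pi>"
begin

lemma pi_simps:
  assumes "a \<in> carrier Cu" "v \<in> carrier H"
  shows "\<pi> a v \<in> carrier H"
    "b \<in> carrier Cu \<Longrightarrow> \<pi> (a \<oplus>\<^bsub>Cu\<^esub> b) v = \<pi> a v \<oplus>\<^bsub>H\<^esub> \<pi> b v"
    "b \<in> carrier Cu \<Longrightarrow> \<pi> (a \<otimes>\<^bsub>Cu\<^esub> b) v = \<pi> a (\<pi> b v)"
    "\<pi> (c \<odot>\<^bsub>Cu\<^esub> a) v = c \<odot>\<^bsub>H\<^esub> \<pi> a v"
    "\<pi> \<one>\<^bsub>Cu\<^esub> v = v"
    "w \<in> carrier H \<Longrightarrow> cinner H (\<pi> (adjoint_matrix a) v) w = cinner H v (\<pi> a w)"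
  using star_rep assms unfolding star_representation_def bounded_operator_def clinear_map_def by blast+

lemma pi_linear: "a \<in> carrier Cu \<Longrightarrow> clinear_map H H (\<pi> a)"
  using star_rep unfolding star_representation_def bounded_operator_def by blast

sublocale H: hilbert_space H using star_rep by (simp add: star_representation_def)

abbreviation \<sigma> where "\<sigma> g \<equiv> \<pi> (u g)"

lemma unitary_representation_u: "unitary_representation G H \<sigma>"
proof -
  have mult: "\<sigma> (g \<otimes> h) v = \<sigma> g (\<sigma> h v)" if "g \<in> carrier G" "h \<in> carrier G" "v \<in> carrier H" for g h v
    using pi_simps(3)[OF u_in_roe[OF that(1)] that(3) u_in_roe[OF that(2)]] u_mult[OF that(1,2) u_in_roe[OF that(1)]] by simp
  have one: "\<sigma> \<one> v = v" if "v \<in> carrier H" for v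
    using pi_simps(5)[OF one_in_roe that] by (simp add: u_one)
  show ?thesis
    unfolding unitary_representation_def unitary_operator_def
  proof (intro conjI ballI H.hilbert_space_axioms)
    fix g assume g: "g \<in> carrier G"
    note ug = u_in_roe[OF g] and ug' = u_in_roe[OF inv_closed[OF g]]
    show "clinear_map H H (\<sigma> g)" by (rule pi_linear[OF ug])
    show "\<sigma> g ` carrier H = carrier H"
    proof
      show "\<sigma> g ` carrier H \<subseteq> carrier H" using pi_simps(1)[OF ug] by blast
      show "carrier H \<subseteq> \<sigma> g ` carrier H"
      proof
        fix v assume v: "v \<in> carrier H"
        have "v = \<sigma> g (\<sigma> (inv g) v)" using mult[OF g inv_closed[OF g] v] one[OF v] g by simp
        then show "v \<in> \<sigma> g ` carrier H" using pi_simps(1)[OF ug' v] by blast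
      qed
    qed
    fix v w assume v: "v \<in> carrier H" and w: "w \<in> carrier H"
    have "cinner H (\<sigma> g v) (\<sigma> g w) = cinner H (\<sigma> (inv g) (\<sigma> g v)) w"
      using pi_simps(6)[OF ug pi_simps(1)[OF ug v] w] adjoint_u[OF g] by simp
    also have "\<sigma> (inv g) (\<sigma> g v) = v" using mult[OF inv_closed[OF g] g v] one[OF v] g by simp
    finally show "cinner H (\<sigma> g v) (\<sigma> g w) = cinner H v w" .
  qed (use one mult in auto)
qed

sublocale U: unitary_rep G H \<sigma> S
  by unfold_locales (use unitary_representation_u gens in auto)

lemma pi_delta: "g \<in> carrier G \<Longrightarrow> v \<in> carrier H \<Longrightarrow> \<pi> (delta g) v = \<sigma> g v \<ominus>\<^bsub>H\<^esub> v"
  unfolding delta_def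
  by (simp add: pi_simps(2)[OF u_in_roe _ smult_in_roe[OF one_in_roe]] pi_simps(4,5)[OF one_in_roe]
      a_minus_def H.minus_eq_smult)

lemma hnorm_pi_sum_le:
  assumes "finite F" "\<And>g. g \<in> F \<Longrightarrow> m g \<in> carrier Cu" "v \<in> carrier H"
  shows "hnorm H (\<pi> (\<lambda>x y. \<Sum>g\<in>F. m g x y) v) \<le> (\<Sum>g\<in>F. hnorm H (\<pi> (m g) v))"
  using assms
proof (induction F rule: finite_induct)
  case empty
  have z: "(\<lambda>x y. 0) \<in> carrier Cu" using ker_omega_zero by (simp add: ker_omega_def)
  have "\<pi> (0 \<odot>\<^bsub>Cu\<^esub> (\<lambda>x y. 0)) v = 0 \<odot>\<^bsub>H\<^esub> \<pi> (\<lambda>x y. 0) v" by (rule pi_simps(4)[OF z empty(2)])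
  then have "\<pi> (\<lambda>x y. 0) v = \<zero>\<^bsub>H\<^esub>" using pi_simps(1)[OF z empty(2)] by (simp add: roe_simps H.smult_zero)
  then show ?case by (simp add: H.hnorm_zero)
next
  case (insert g F)
  have s: "(\<lambda>x y. \<Sum>g\<in>F. m g x y) \<in> carrier Cu" using insert by (intro sum_in_roe) auto
  have g: "m g \<in> carrier Cu" using insert by auto
  have "(\<lambda>x y. \<Sum>g\<in>insert g F. m g x y) = m g \<oplus>\<^bsub>Cu\<^esub> (\<lambda>x y. \<Sum>g\<in>F. m g x y)"
    using insert.hyps by (simp add: roe_simps)
  then have "hnorm H (\<pi> (\<lambda>x y. \<Sum>g\<in>insert g F. m g x y) v) \<le> hnorm H (\<pi> (m g) v) + hnorm H (\<pi> (\<lambda>x y. \<Sum>g\<in>F. m g x y) v)"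
    using pi_simps(2)[OF g insert.prems(2) s] H.hnorm_triangle[OF pi_simps(1)[OF g insert.prems(2)] pi_simps(1)[OF s insert.prems(2)]]
    by simp
  then show ?case using insert by simp
qed

lemma roe_controlled:
  assumes "a \<in> carrier Cu"
  obtains F where "finite F" "F \<subseteq> carrier G" "\<And>x y. a x y \<noteq> 0 \<Longrightarrow> \<exists>g\<in>F. x = \<phi> g y"
proof -
  obtain R where R: "R > 0" "\<And>x y. a x y \<noteq> 0 \<Longrightarrow> x \<in> X \<and> y \<in> X \<and> d x y \<le> ennreal R"
    using assms unfolding in_roe_iff by blast
  obtain F where F: "finite F" "F \<subseteq> carrier G" "\<And>x y. \<lbrakk>x \<in> X; y \<in> X; d x y \<le> ennreal R\<rbrakk> \<Longrightarrow> \<exists>g\<in>F. x = \<phi> g y"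
    using finite_displacement[OF R(1)] by blast
  show thesis
  proof (rule that[OF F(1,2)])
    fix x y assume "a x y \<noteq> 0"
    then show "\<exists>g\<in>F. x = \<phi> g y" using R(2) F(3) by blast
  qed
qed

text \<open>An element of the ideal is a sum of diagonal multiples of the elements
  \<open>delta g\<close>, so it annihilates every invariant vector. This identifies the orthogonal
  complements in \<open>constant_gap\<close> and in \<open>gap\<close>.\<close>

lemma constant_vectors_eq: "constant_vectors X d H \<pi> = U.invariants"
proof
  show "constant_vectors X d H \<pi> \<subseteq> U.invariants"
  proof
    fix v assume v: "v \<in> constant_vectors X d H \<pi>"
    then have vH: "v \<in> carrier H" by (simp add: constant_vectors_def)
    have "\<sigma> g v = v" if g: "g \<in> carrier G" for g
    proof -
      have "\<sigma> g v \<ominus>\<^bsub>H\<^esub> v = \<zero>\<^bsub>H\<^esub>"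
        using v delta_ker[OF g] unfolding pi_delta[OF g vH, symmetric] constant_vectors_def by blast
      then show ?thesis using pi_simps(1)[OF u_in_roe[OF g] vH] vH by (simp add: H.diff_eq_zero)
    qed
    then show "v \<in> U.invariants" using vH by (simp add: U.invariants_def)
  qed
  show "U.invariants \<subseteq> constant_vectors X d H \<pi>"
  proof
    fix v assume v: "v \<in> U.invariants"
    then have vH: "v \<in> carrier H" by (simp add: U.invariants_def)
    have "\<pi> a v = \<zero>\<^bsub>H\<^esub>" if a: "a \<in> ker_omega X d" for a
    proof -
      have aC: "a \<in> carrier Cu" using a by (simp add: ker_omega_def)
      obtain C where C: "0 \<le> C" "\<And>x y. cmod (a x y) \<le> C" using roe_bounded[OF aC] by blast
      obtain F where F: "finite F" "F \<subseteq> carrier G" "\<And>x y. a x y \<noteq> 0 \<Longrightarrow> \<exists>g\<in>F. x = \<phi> g y"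
        using roe_controlled[OF aC] by blast
      obtain f where f: "\<And>g x. cmod (f g x) \<le> C" "\<And>g x. x \<notin> X \<Longrightarrow> f g x = 0"
        "a \<ominus>\<^bsub>Cu\<^esub> diagonal (omega a) = (\<lambda>x y. \<Sum>g\<in>F. (diagonal (f g) \<otimes>\<^bsub>Cu\<^esub> delta g) x y)"
        using displacement_decomposition[OF F(1,2) aC F(3) C(2)] by blast
      have fin: "diagonal (f g) \<in> carrier Cu" for g by (rule diagonal_in_roe[OF f(1,2)])
      have m: "diagonal (f g) \<otimes>\<^bsub>Cu\<^esub> delta g \<in> carrier Cu" if "g \<in> F" for g
        using that F(2) by (intro mult_in_roe fin delta_in_roe) auto
      have "hnorm H (\<pi> (diagonal (f g) \<otimes>\<^bsub>Cu\<^esub> delta g) v) = 0" if g: "g \<in> F" for g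
      proof -
        have gG: "g \<in> carrier G" using g F(2) by blast
        have "\<pi> (delta g) v = \<zero>\<^bsub>H\<^esub>" using v gG vH by (simp add: pi_delta U.invariants_def H.diff_eq_zero)
        then have "\<pi> (diagonal (f g) \<otimes>\<^bsub>Cu\<^esub> delta g) v = \<pi> (diagonal (f g)) \<zero>\<^bsub>H\<^esub>"
          by (simp add: pi_simps(3)[OF fin vH delta_in_roe[OF gG]])
        also have "hnorm H \<dots> \<le> C * hnorm H \<zero>\<^bsub>H\<^esub>"
          by (rule star_representation_diagonal_le[OF star_rep _ f(1,2)]) simp
        finally show ?thesis using H.hnorm_nonneg[OF pi_simps(1)[OF m[OF g] vH]] by (simp add: H.hnorm_zero)
      qed
      then have "hnorm H (\<pi> a v) \<le> 0"
        using hnorm_pi_sum_le[OF F(1) m vH] f(3) diagonal_omega_ker[OF a] by simp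
      then show ?thesis using H.hnorm_nonneg[OF pi_simps(1)[OF aC vH]] H.hnorm_eq_0[OF pi_simps(1)[OF aC vH]] by simp
    qed
    then show "v \<in> constant_vectors X d H \<pi>" using vH by (simp add: constant_vectors_def)
  qed
qed

lemma cocycle_of_roe_cocycle:
  assumes \<theta>: "cocycle X d H \<pi> \<theta>"
  shows "group_cocycle G H \<sigma> (\<lambda>g. \<theta> (delta g))"
proof -
  have cl: "\<theta> a \<in> carrier H" "b \<in> ker_omega X d \<Longrightarrow> \<theta> (a \<oplus>\<^bsub>Cu\<^esub> b) = \<theta> a \<oplus>\<^bsub>H\<^esub> \<theta> b" if "a \<in> ker_omega X d" for a b
    using \<theta> that by (auto simp: cocycle_def clinear_map_def)
  show ?thesis
    unfolding group_cocycle_def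
  proof (intro conjI ballI)
    show "(\<lambda>g. \<theta> (delta g)) \<in> carrier G \<rightarrow> carrier H" using cl(1) delta_ker by blast
    fix g h assume g: "g \<in> carrier G" and h: "h \<in> carrier G"
    have "\<theta> (u g \<otimes>\<^bsub>Cu\<^esub> delta h) = \<sigma> g (\<theta> (delta h))"
      using \<theta> u_in_roe[OF g] delta_ker[OF h] by (simp add: cocycle_def)
    then show "\<theta> (delta (g \<otimes> h)) = \<theta> (delta g) \<oplus>\<^bsub>H\<^esub> \<sigma> g (\<theta> (delta h))"
      using delta_mult[OF g h] cl(2)[OF delta_ker[OF g] ker_omega_mult[OF u_in_roe[OF g] delta_ker[OF h]]] by simp
  qed
qed

text \<open>Both sides are additive and compatible with multiplication by diagonal matrices, so
  agreement on the generators \<open>delta g\<close> of the ideal suffices.\<close>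

lemma coboundary_of_group_coboundary:
  assumes \<theta>: "cocycle X d H \<pi> \<theta>" and v: "v \<in> carrier H"
    and eq: "\<And>g. g \<in> carrier G \<Longrightarrow> \<theta> (delta g) = \<sigma> g v \<ominus>\<^bsub>H\<^esub> v"
  shows "coboundary X d H \<pi> \<theta>"
proof -
  have th: "\<theta> a \<in> carrier H" "b \<in> ker_omega X d \<Longrightarrow> \<theta> (a \<oplus>\<^bsub>Cu\<^esub> b) = \<theta> a \<oplus>\<^bsub>H\<^esub> \<theta> b"
    "\<theta> (c \<odot>\<^bsub>Cu\<^esub> a) = c \<odot>\<^bsub>H\<^esub> \<theta> a" "e \<in> carrier Cu \<Longrightarrow> \<theta> (e \<otimes>\<^bsub>Cu\<^esub> a) = \<pi> e (\<theta> a)" if "a \<in> ker_omega X d" for a b c e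
    using \<theta> that by (auto simp: cocycle_def clinear_map_def)
  have zero: "\<theta> (\<lambda>x y. 0) = \<pi> (\<lambda>x y. 0) v"
  proof -
    have z: "(\<lambda>x y. 0) \<in> carrier Cu" using ker_omega_zero by (simp add: ker_omega_def)
    have "\<theta> (0 \<odot>\<^bsub>Cu\<^esub> (\<lambda>x y. 0)) = 0 \<odot>\<^bsub>H\<^esub> \<theta> (\<lambda>x y. 0)" by (rule th(3)[OF ker_omega_zero])
    moreover have "\<pi> (0 \<odot>\<^bsub>Cu\<^esub> (\<lambda>x y. 0)) v = 0 \<odot>\<^bsub>H\<^esub> \<pi> (\<lambda>x y. 0) v" by (rule pi_simps(4)[OF z v])
    ultimately show ?thesis
      using pi_simps(1)[OF z v] th(1)[OF ker_omega_zero] by (simp add: roe_simps H.smult_zero)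
  qed
  have sum: "\<theta> (\<lambda>x y. \<Sum>g\<in>F. m g x y) = \<pi> (\<lambda>x y. \<Sum>g\<in>F. m g x y) v"
    if "finite F" "\<And>g. g \<in> F \<Longrightarrow> m g \<in> ker_omega X d \<and> \<theta> (m g) = \<pi> (m g) v" for F and m :: "'g \<Rightarrow> 'a cmatrix"
    using that
  proof (induction F rule: finite_induct)
    case empty
    show ?case using zero by simp
  next
    case (insert g F)
    have s: "(\<lambda>x y. \<Sum>g\<in>F. m g x y) \<in> ker_omega X d" using insert by (intro sum_in_ker) auto
    have g: "m g \<in> ker_omega X d" "\<theta> (m g) = \<pi> (m g) v" using insert by auto
    have "(\<lambda>x y. \<Sum>g\<in>insert g F. m g x y) = m g \<oplus>\<^bsub>Cu\<^esub> (\<lambda>x y. \<Sum>g\<in>F. m g x y)"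
      using insert.hyps by (simp add: roe_simps)
    moreover have "m g \<in> carrier Cu" "(\<lambda>x y. \<Sum>g\<in>F. m g x y) \<in> carrier Cu" using s g by (simp_all add: ker_omega_def)
    ultimately show ?case using th(2)[OF g(1) s] g(2) insert pi_simps(2) v by simp
  qed
  have "\<theta> a = \<pi> a v" if a: "a \<in> ker_omega X d" for a
  proof -
    have aC: "a \<in> carrier Cu" using a by (simp add: ker_omega_def)
    obtain C where C: "0 \<le> C" "\<And>x y. cmod (a x y) \<le> C" using roe_bounded[OF aC] by blast
    obtain F where F: "finite F" "F \<subseteq> carrier G" "\<And>x y. a x y \<noteq> 0 \<Longrightarrow> \<exists>g\<in>F. x = \<phi> g y"
      using roe_controlled[OF aC] by blast
    obtain f where f: "\<And>g x. cmod (f g x) \<le> C" "\<And>g x. x \<notin> X \<Longrightarrow> f g x = 0"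
      "a \<ominus>\<^bsub>Cu\<^esub> diagonal (omega a) = (\<lambda>x y. \<Sum>g\<in>F. (diagonal (f g) \<otimes>\<^bsub>Cu\<^esub> delta g) x y)"
      using displacement_decomposition[OF F(1,2) aC F(3) C(2)] by blast
    have fin: "diagonal (f g) \<in> carrier Cu" for g by (rule diagonal_in_roe[OF f(1,2)])
    have "diagonal (f g) \<otimes>\<^bsub>Cu\<^esub> delta g \<in> ker_omega X d \<and>
        \<theta> (diagonal (f g) \<otimes>\<^bsub>Cu\<^esub> delta g) = \<pi> (diagonal (f g) \<otimes>\<^bsub>Cu\<^esub> delta g) v" if g: "g \<in> F" for g
    proof -
      have gG: "g \<in> carrier G" using g F(2) by blast
      have "\<theta> (diagonal (f g) \<otimes>\<^bsub>Cu\<^esub> delta g) = \<pi> (diagonal (f g)) (\<pi> (delta g) v)"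
        using th(4)[OF delta_ker[OF gG] fin] eq[OF gG] pi_delta[OF gG v] by simp
      then show ?thesis using ker_omega_mult[OF fin delta_ker[OF gG]] pi_simps(3)[OF fin v delta_in_roe[OF gG]] by simp
    qed
    from sum[OF F(1) this] show ?thesis using f(3) diagonal_omega_ker[OF a] by simp
  qed
  then show ?thesis unfolding coboundary_def using v by blast
qed

end

lemma (in roe_action) property_T_imp_cohomological:
  assumes T: "property_T G"
  shows "cohomological_T X d"
  unfolding cohomological_T_def
proof (intro allI impI, elim conjE)
  fix H :: "(nat \<Rightarrow> 'a cmatrix) inner_module" and \<pi> \<theta>
  assume rep: "star_representation X d H \<pi>" and \<theta>: "cocycle X d H \<pi> \<theta>"
  interpret roe_action_rep X d G \<phi> S H \<pi> by unfold_locales (rule rep)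
  show "coboundary X d H \<pi> \<theta>"
    using delorme[OF T generate U.unitary_rep_axioms cocycle_of_roe_cocycle[OF \<theta>]]
      coboundary_of_group_coboundary[OF \<theta>] by blast
qed

section \<open>From the gap over constant vectors to the gap of the Laplacian\<close>

lemma sum_list_square_le: "(sum_list (map p xs))\<^sup>2 \<le> length xs * (\<Sum>x\<leftarrow>xs. (p x)\<^sup>2)" for p :: "'i \<Rightarrow> real"
  using Cauchy_Schwarz_ineq_sum[of "\<lambda>i. 1" "\<lambda>i. p (xs ! i)" "{0..<length xs}"]
  by (simp add: sum_list_sum_nth)

text \<open>The matrix that witnesses the gap may vary with the vector, but its propagation is
  bounded, so it decomposes along one finite set \<open>F\<close>. Its effect on \<open>v\<close> is
  thus bounded by the displacements of \<open>v\<close> under the generators, and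
  \<open>sup_entry X a\<close> cancels.\<close>

lemma (in roe_action) gap_of_constant_gap:
  assumes R: "0 < R" and c: "0 < c"
  obtains \<nu> where "0 < \<nu>" "\<And>(H :: 'h inner_module) \<pi>. star_representation X d H \<pi> \<Longrightarrow> constant_gap X d R c H \<pi> \<Longrightarrow>
     unitary_rep.gap G H (\<lambda>g. \<pi> (u g)) S \<nu>"
proof -
  obtain F where F: "finite F" "F \<subseteq> carrier G" "\<And>x y. \<lbrakk>x \<in> X; y \<in> X; d x y \<le> ennreal R\<rbrakk> \<Longrightarrow> \<exists>g\<in>F. x = \<phi> g y"
    using finite_displacement[OF R] by blast
  obtain M where M: "M \<ge> 0" "\<And>(K :: 'h inner_module) \<sigma> b g. unitary_rep G K \<sigma> S \<Longrightarrow> group_cocycle G K \<sigma> b \<Longrightarrow> g \<in> F \<Longrightarrow>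
     hnorm K (b g) \<le> M * (\<Sum>s\<leftarrow>S. hnorm K (b s))"
    using group_cocycle_bound_finite[OF F(1), of G S] F(2) generate by metis
  \<comment> \<open>The factor \<open>length S\<close> comes from the Cauchy-Schwarz inequality
    between the sum of the displacements and the energy; the added 1 allows the division.\<close>
  define B where "B = (card F * M)\<^sup>2 * length S + 1"
  have B: "0 < B" by (simp add: B_def add_nonneg_pos)
  have "unitary_rep.gap G H (\<lambda>g. \<pi> (u g)) S (c\<^sup>2 / B)"
    if rep: "star_representation X d H \<pi>" and gap: "constant_gap X d R c H \<pi>" for H :: "'h inner_module" and \<pi>
  proof -
    interpret roe_action_rep X d G \<phi> S H \<pi> by unfold_locales (rule rep)
    show ?thesis
      unfolding U.gap_def
    proof
      fix v assume v: "v \<in> U.W"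
      have vH: "v \<in> carrier H" by (rule U.W_carrier[OF v])
      have "v \<in> orthogonal_complement H (constant_vectors X d H \<pi>)" using v by (simp add: U.W_def constant_vectors_eq)
      then obtain a where a: "a \<in> carrier Cu" "a \<noteq> \<zero>\<^bsub>Cu\<^esub>" "propagation d a \<le> ennreal R"
        "hnorm H (\<pi> (a \<ominus>\<^bsub>Cu\<^esub> diagonal (omega a)) v) \<ge> c * hnorm H v * sup_entry X a"
        using gap unfolding constant_gap_def by blast
      obtain x y where xy: "a x y \<noteq> 0" using a(2) by (auto simp: roe_simps fun_eq_iff)
      have pos: "0 < sup_entry X a"
        using sup_entry_ge[OF a(1), of x y] roe_entry_in[OF a(1) xy] xy
        by (meson less_le_trans zero_less_norm_iff)
      have bd: "cmod (a x y) \<le> sup_entry X a" for x y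
        using sup_entry_ge[OF a(1), of x y] roe_entry_in[OF a(1), of x y] pos by (cases "a x y = 0") auto
      have "\<exists>g\<in>F. x = \<phi> g y" if "a x y \<noteq> 0" for x y
      proof (rule F(3))
        show "x \<in> X" "y \<in> X" using roe_entry_in[OF a(1) that] by auto
        have "d x y \<le> propagation d a" unfolding propagation_def by (rule Sup_upper) (use that in blast)
        then show "d x y \<le> ennreal R" using a(3) by (rule order_trans)
      qed
      from displacement_decomposition[OF F(1,2) a(1) this bd]
      obtain f where f: "\<And>g x. cmod (f g x) \<le> sup_entry X a" "\<And>g x. x \<notin> X \<Longrightarrow> f g x = 0"
        "a \<ominus>\<^bsub>Cu\<^esub> diagonal (omega a) = (\<lambda>x y. \<Sum>g\<in>F. (diagonal (f g) \<otimes>\<^bsub>Cu\<^esub> delta g) x y)" by blast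
      have fin: "diagonal (f g) \<in> carrier Cu" for g by (rule diagonal_in_roe[OF f(1,2)])
      let ?p = "\<Sum>s\<leftarrow>S. hnorm H (\<sigma> s v \<ominus>\<^bsub>H\<^esub> v)"
      have "c * hnorm H v * sup_entry X a \<le> (\<Sum>g\<in>F. hnorm H (\<pi> (diagonal (f g) \<otimes>\<^bsub>Cu\<^esub> delta g) v))"
        using a(4) hnorm_pi_sum_le[OF F(1) _ vH, of "\<lambda>g. diagonal (f g) \<otimes>\<^bsub>Cu\<^esub> delta g"] F(2) fin
        unfolding f(3) by (force intro: mult_in_roe delta_in_roe)
      also have "\<dots> \<le> (\<Sum>g\<in>F. sup_entry X a * (M * ?p))"
      proof (rule sum_mono)
        fix g assume g: "g \<in> F"
        then have gG: "g \<in> carrier G" using F(2) by blast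
        have "hnorm H (\<pi> (diagonal (f g) \<otimes>\<^bsub>Cu\<^esub> delta g) v) \<le> sup_entry X a * hnorm H (\<pi> (delta g) v)"
          unfolding pi_simps(3)[OF fin vH delta_in_roe[OF gG]]
          by (rule star_representation_diagonal_le[OF star_rep pi_simps(1)[OF delta_in_roe[OF gG] vH] f(1,2)])
        also have "\<dots> \<le> sup_entry X a * (M * ?p)"
          using M(2)[OF U.unitary_rep_axioms U.coboundary_cocycle[OF vH] g] pos
          by (intro mult_left_mono) (simp_all add: pi_delta[OF gG vH])
        finally show "hnorm H (\<pi> (diagonal (f g) \<otimes>\<^bsub>Cu\<^esub> delta g) v) \<le> sup_entry X a * (M * ?p)" .
      qed
      also have "\<dots> = (card F * M * ?p) * sup_entry X a" by simp
      finally have "c * hnorm H v \<le> card F * M * ?p" using pos by simp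
      then have "(c * hnorm H v)\<^sup>2 \<le> (card F * M * ?p)\<^sup>2"
        using c vH by (intro power_mono) simp_all
      also have "\<dots> = (card F * M)\<^sup>2 * ?p\<^sup>2" by (rule power_mult_distrib)
      also have "\<dots> \<le> (card F * M)\<^sup>2 * (length S * U.energy v)"
        unfolding U.energy_def by (intro mult_left_mono sum_list_square_le) simp
      also have "\<dots> \<le> B * U.energy v"
        using U.energy_nonneg[of v] by (simp add: B_def algebra_simps)
      finally show "c\<^sup>2 / B * (hnorm H v)\<^sup>2 \<le> U.energy v"
        using B by (simp add: power_mult_distrib divide_le_eq mult.commute)
    qed
  qed
  moreover have "0 < c\<^sup>2 / B" using c B by simp
  ultimately show thesis using that by blast
qed

section \<open>Actions with finite invariant blocks\<close>

text \<open>Limits along an ultrafilter, with a suitable finer filter in its place. By Tychonoff's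
  theorem the family, seen as a map into a product of balls, has a cluster point.\<close>

lemma bounded_family_limits:
  fixes f :: "'i \<Rightarrow> 'n \<Rightarrow> 'c::{heine_borel, real_normed_vector}"
  assumes U: "U \<noteq> bot" and C: "\<And>i n. norm (f i n) \<le> C i"
  obtains U' where "U' \<noteq> bot" "U' \<le> U" "\<And>i. \<exists>l. (f i \<longlongrightarrow> l) U'"
proof -
  let ?S = "PiE UNIV (\<lambda>i. cball 0 (C i)) :: ('i \<Rightarrow> 'c) set" and ?F = "\<lambda>n i. f i n"
  have "compactin (product_topology (\<lambda>i. euclidean) UNIV) ?S"
    unfolding compactin_PiE by simp
  then have S: "compact ?S" by (simp add: euclidean_product_topology)
  have "filtermap ?F U \<noteq> bot" using U by (simp add: filtermap_bot_iff)
  moreover have "eventually (\<lambda>x. x \<in> ?S) (filtermap ?F U)"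
    using C by (simp add: eventually_filtermap PiE_iff)
  ultimately obtain L where L: "inf (nhds L) (filtermap ?F U) \<noteq> bot"
    using S[unfolded compact_filter, rule_format, of "filtermap ?F U"] by blast
  \<comment> \<open>The neighbourhoods of the cluster point are pulled back to the index set, which
    forces convergence to it in every coordinate.\<close>
  let ?U = "inf (filtercomap ?F (nhds L)) U"
  have "?U \<noteq> bot"
  proof
    assume "?U = bot"
    then have "eventually (\<lambda>_. False) ?U" by simp
    then obtain P Q where PQ: "eventually P (filtercomap ?F (nhds L))" "eventually Q U" "\<And>n. \<not> (P n \<and> Q n)"
      unfolding eventually_inf by blast
    obtain P' where P': "eventually P' (nhds L)" "\<And>n. P' (?F n) \<Longrightarrow> P n"
      using PQ(1) unfolding eventually_filtercomap by blast
    have "eventually (\<lambda>n. \<not> P' (?F n)) U"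
      using PQ(2) by (rule eventually_mono) (use PQ(3) P'(2) in blast)
    then have "eventually (\<lambda>y. \<not> P' y) (filtermap ?F U)" by (simp add: eventually_filtermap)
    then have "eventually (\<lambda>_. False) (inf (nhds L) (filtermap ?F U))"
      unfolding eventually_inf using P'(1) by blast
    then show False using L by (simp add: eventually_False)
  qed
  moreover have "?U \<le> U" by simp
  moreover have "(f i \<longlongrightarrow> L i) ?U" for i
  proof -
    have "filterlim ?F (nhds L) ?U"
      by (rule filterlim_mono[OF filterlim_filtercomap order_refl]) simp
    moreover have "continuous_on UNIV (\<lambda>x :: 'i \<Rightarrow> 'c. x i)" by simp
    then have "((\<lambda>x. x i) \<longlongrightarrow> L i) (nhds L)"
      by (intro tendsto_at_iff_tendsto_nhds[THEN iffD1, of "\<lambda>x. x i" L]) (simp add: continuous_on_def)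
    ultimately show ?thesis by (rule filterlim_compose[rotated])
  qed
  ultimately show thesis using that by blast
qed

text \<open>Models a disjoint union of Cayley graphs of finite groups, the blocks being the
  components. The last assumption says that on each block the group acts through a freely acting
  quotient: elements that agree at one point of a block agree on the block.\<close>

locale block_action = roe_action X d G \<phi> S
  for X :: "'a set" and d and G :: "('g, 'm) monoid_scheme" (structure) and \<phi> S +
  fixes blk :: "'a \<Rightarrow> 'i"
  assumes finite_block: "finite {x \<in> X. blk x = m}"
    and blk_act: "\<lbrakk>g \<in> carrier G; x \<in> X\<rbrakk> \<Longrightarrow> blk (\<phi> g x) = blk x"
    and regular: "\<lbrakk>g \<in> carrier G; h \<in> carrier G; x \<in> X; y \<in> X; blk x = blk y; \<phi> g x = \<phi> h x\<rbrakk> \<Longrightarrow> \<phi> g y = \<phi> h y"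
begin

definition Y :: "'i \<Rightarrow> 'a set" where "Y m = {x \<in> X. blk x = m}"

definition T0 :: "'g set" where "T0 = {\<one>} \<union> set S \<union> m_inv G ` set S"

text \<open>The radius \<open>Suc n\<close> is positive also for n = 0, as
  \<open>finite_displacement\<close> requires.\<close>

definition cover :: "nat \<Rightarrow> 'g set" where
  "cover n = (SOME F. finite F \<and> F \<subseteq> carrier G \<and> (\<forall>x\<in>X. \<forall>y\<in>X. d x y \<le> ennreal (Suc n) \<longrightarrow> (\<exists>g\<in>F. x = \<phi> g y)))"

lemma cover:
  "finite (cover n)" "cover n \<subseteq> carrier G"
  "\<lbrakk>x \<in> X; y \<in> X; d x y \<le> ennreal (Suc n)\<rbrakk> \<Longrightarrow> \<exists>g\<in>cover n. x = \<phi> g y"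
proof -
  obtain F where "finite F" "F \<subseteq> carrier G" "\<And>x y. \<lbrakk>x \<in> X; y \<in> X; d x y \<le> ennreal (real (Suc n))\<rbrakk> \<Longrightarrow> \<exists>g\<in>F. x = \<phi> g y"
    using finite_displacement[of "real (Suc n)"] by auto
  then have "\<exists>F. finite F \<and> F \<subseteq> carrier G \<and> (\<forall>x\<in>X. \<forall>y\<in>X. d x y \<le> ennreal (Suc n) \<longrightarrow> (\<exists>g\<in>F. x = \<phi> g y))"
    by blast
  note c = someI_ex[OF this, folded cover_def]
  show "finite (cover n)" "cover n \<subseteq> carrier G" using c by blast+
  show "\<lbrakk>x \<in> X; y \<in> X; d x y \<le> ennreal (Suc n)\<rbrakk> \<Longrightarrow> \<exists>g\<in>cover n. x = \<phi> g y" using c by blast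
qed

definition D :: "nat \<Rightarrow> 'g set" where "D n = (\<Union>i\<le>n. cover i)"

text \<open>The elements whose action is to be compared at stage n. Products of two displacements
  are included because a change of base point in \<open>kernel_block\<close> replaces
  \<open>sel x y\<close> by \<open>sel x z \<otimes> sel z y\<close>.\<close>

definition A :: "nat \<Rightarrow> 'g set" where "A n = T0 \<union> D n \<union> (\<lambda>(g, h). g \<otimes> h) ` (D n \<times> D n)"

lemma T0_carrier: "T0 \<subseteq> carrier G"
  using gens by (auto simp: T0_def)

lemma D_carrier: "D n \<subseteq> carrier G"
  using cover(2) by (auto simp: D_def)

lemma D_mono: "m \<le> n \<Longrightarrow> D m \<subseteq> D n"
  unfolding D_def by (intro UN_mono) auto

lemma A_carrier: "A n \<subseteq> carrier G"
  using T0_carrier D_carrier by (fastforce simp: A_def)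

lemma finite_A: "finite (A n)"
  using cover(1) by (simp add: A_def T0_def D_def)

lemma A_mono: "m \<le> n \<Longrightarrow> A m \<subseteq> A n"
  using D_mono[of m n] by (auto simp: A_def)

text \<open>Taking the least admissible radius makes the selected element independent of the radius
  under consideration, while it lies in \<open>D n\<close> for every admissible n.\<close>

definition sel :: "'a \<Rightarrow> 'a \<Rightarrow> 'g" where
  "sel x y = (SOME g. g \<in> cover (LEAST n. d x y \<le> ennreal (Suc n)) \<and> x = \<phi> g y)"

lemma sel:
  assumes "x \<in> X" "y \<in> X" "d x y \<le> ennreal (Suc n)"
  shows "sel x y \<in> D n" "x = \<phi> (sel x y) y"
proof -
  define k where "k = (LEAST n. d x y \<le> ennreal (Suc n))"
  have k: "d x y \<le> ennreal (Suc k)" "k \<le> n"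
    unfolding k_def using LeastI[of "\<lambda>n. d x y \<le> ennreal (Suc n)" n] Least_le[of "\<lambda>n. d x y \<le> ennreal (Suc n)" n] assms(3) by auto
  have "\<exists>g. g \<in> cover k \<and> x = \<phi> g y" using cover(3)[OF assms(1,2) k(1)] by blast
  from someI_ex[OF this] have "sel x y \<in> cover k \<and> x = \<phi> (sel x y) y" by (simp add: sel_def k_def)
  then show "sel x y \<in> D n" "x = \<phi> (sel x y) y" using k(2) by (auto simp: D_def)
qed

lemma roe_radius:
  assumes "a \<in> carrier Cu"
  obtains r where "\<And>x y. a x y \<noteq> 0 \<Longrightarrow> x \<in> X \<and> y \<in> X \<and> d x y \<le> ennreal (Suc r)"
proof -
  obtain R where R: "\<And>x y. a x y \<noteq> 0 \<Longrightarrow> x \<in> X \<and> y \<in> X \<and> d x y \<le> ennreal R"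
    using assms unfolding in_roe_iff by blast
  obtain r where "R \<le> real r" using real_arch_simple by blast
  then have "ennreal R \<le> ennreal (Suc r)" by (intro ennreal_leI) simp
  then show thesis using that R order_trans by blast
qed

text \<open>Finite propagation keeps a matrix inside the blocks, since each entry is realised by the
  action of a group element.\<close>

lemma roe_block: assumes "a \<in> carrier Cu" "a x y \<noteq> 0" shows "blk x = blk y"
proof -
  obtain r where r: "\<And>x y. a x y \<noteq> 0 \<Longrightarrow> x \<in> X \<and> y \<in> X \<and> d x y \<le> ennreal (Suc r)"
    using roe_radius[OF assms(1)] by blast
  have "sel x y \<in> D r" "x = \<phi> (sel x y) y" using sel[of x y r] r[OF assms(2)] by blast+
  then show ?thesis using blk_act[of "sel x y" y] D_carrier r[OF assms(2)] by auto
qed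

end

text \<open>The kernel \<open>k\<close> need not factor through the action on a block, but by \<open>coherent\<close> it does so for
  elements of any given length on all blocks \<open>mm n\<close> with \<open>n\<close> large.\<close>

locale block_kernel = block_action X d G \<phi> S blk
  for X :: "'a set" and d and G :: "('g, 'm) monoid_scheme" (structure) and \<phi> S and blk :: "'a \<Rightarrow> 'i" +
  fixes k :: "'g \<Rightarrow> 'g \<Rightarrow> real" and mm :: "nat \<Rightarrow> 'i" and U :: "nat filter"
  assumes k_bound: "\<lbrakk>g \<in> carrier G; h \<in> carrier G\<rbrakk> \<Longrightarrow> \<bar>k g h\<bar> \<le> 1"
    and k_inv: "\<lbrakk>l \<in> carrier G; g \<in> carrier G; h \<in> carrier G\<rbrakk> \<Longrightarrow> k (l \<otimes> g) (l \<otimes> h) = k g h"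
    and k_psd: "\<And>(F :: 'a set) g. finite F \<Longrightarrow> (\<And>i. i \<in> F \<Longrightarrow> g i \<in> carrier G) \<Longrightarrow> psd F (\<lambda>i j. k (g i) (g j))"
    and k_sym: "\<lbrakk>g \<in> carrier G; h \<in> carrier G\<rbrakk> \<Longrightarrow> k g h = k h g"
    and Y_nonempty: "Y (mm n) \<noteq> {}"
    and coherent: "\<lbrakk>g \<in> A r; g' \<in> A r; r \<le> n; x \<in> Y (mm n); \<phi> g x = \<phi> g' x; h \<in> carrier G\<rbrakk> \<Longrightarrow> k g h = k g' h"
    and U: "U \<noteq> bot" "U \<le> sequentially"
begin

text \<open>Row \<open>z\<close> of a matrix is read as the combination of the group elements
  \<open>sel z y\<close> with coefficients \<open>a z y\<close>; the form is the average over
  \<open>z\<close> of the inner products of rows. Where the kernel value depends on \<open>y\<close>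
  and \<open>y'\<close> but not on the base point \<open>z\<close>, this is a linear functional of
  b* a, so left multiplication by c* is adjoint to that by c.\<close>

definition form :: "'a cmatrix \<Rightarrow> 'a cmatrix \<Rightarrow> nat \<Rightarrow> complex" where
  "form a b n = (\<Sum>z\<in>Y (mm n). \<Sum>y\<in>Y (mm n). \<Sum>y'\<in>Y (mm n).
     a z y * cnj (b z y') * complex_of_real (k (sel z y) (sel z y'))) / card (Y (mm n))"

lemma Y_finite: "finite (Y m)"
  using finite_block by (simp add: Y_def)

lemma Y_card: "card (Y (mm n)) > 0"
  using Y_nonempty[of n] Y_finite by (simp add: card_gt_0_iff)

lemma roe_Y: "a \<in> carrier Cu \<Longrightarrow> a x y \<noteq> 0 \<Longrightarrow> x \<in> Y m \<longleftrightarrow> y \<in> Y m"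
  using roe_block[of a x y] roe_entry_in[of a x y] by (auto simp: Y_def)

lemma sel_carrier: "a \<in> carrier Cu \<Longrightarrow> a x y \<noteq> 0 \<Longrightarrow> sel x y \<in> carrier G"
  using roe_radius[of a] sel(1)[of x y] D_carrier by (metis subsetD)

lemma form_bounded:
  assumes a: "a \<in> carrier Cu" and b: "b \<in> carrier Cu"
  shows "\<exists>C. \<forall>n. cmod (form a b n) \<le> C"
proof -
  obtain Ca where Ca: "0 \<le> Ca" "\<And>x y. cmod (a x y) \<le> Ca" using roe_bounded[OF a] by blast
  obtain Cb where Cb: "0 \<le> Cb" "\<And>x y. cmod (b x y) \<le> Cb" using roe_bounded[OF b] by blast
  obtain na where na: "\<And>x. finite {y. a x y \<noteq> 0}" "\<And>x. card {y. a x y \<noteq> 0} \<le> na" using finite_rows[OF a] by blast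
  obtain nb where nb: "\<And>x. finite {y. b x y \<noteq> 0}" "\<And>x. card {y. b x y \<noteq> 0} \<le> nb" using finite_rows[OF b] by blast
  define C where "C = (na * Ca) * (nb * Cb)"
  have row: "(\<Sum>y\<in>Y m. cmod (c x y)) \<le> n * E"
    if "\<And>x. finite {y. c x y \<noteq> 0}" "\<And>x. card {y. c x y \<noteq> 0} \<le> n" "0 \<le> E" "\<And>x y. cmod (c x y) \<le> E"
    for c :: "'a cmatrix" and n E m x
  proof -
    have "(\<Sum>y\<in>Y m. cmod (c x y)) = (\<Sum>y\<in>Y m \<inter> {y. c x y \<noteq> 0}. cmod (c x y))"
      using Y_finite by (intro sum.mono_neutral_right) auto
    also have "\<dots> \<le> (\<Sum>y\<in>{y. c x y \<noteq> 0}. cmod (c x y))"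
      using that(1) by (intro sum_mono2) auto
    also have "\<dots> \<le> card {y. c x y \<noteq> 0} * E" using that(4) by (intro sum_bounded_above) auto
    also have "\<dots> \<le> n * E" using that(2)[of x] that(3) by (intro mult_right_mono) auto
    finally show ?thesis .
  qed
  have "cmod (form a b n) \<le> C" for n
  proof -
    have "cmod (\<Sum>z\<in>Y (mm n). \<Sum>y\<in>Y (mm n). \<Sum>y'\<in>Y (mm n).
       a z y * cnj (b z y') * complex_of_real (k (sel z y) (sel z y'))) \<le> (\<Sum>z\<in>Y (mm n). C)"
    proof (rule sum_norm_le)
      fix z
      have "cmod (\<Sum>y\<in>Y (mm n). \<Sum>y'\<in>Y (mm n). a z y * cnj (b z y') * complex_of_real (k (sel z y) (sel z y')))
         \<le> (\<Sum>y\<in>Y (mm n). \<Sum>y'\<in>Y (mm n). cmod (a z y) * cmod (b z y'))"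
      proof (intro sum_norm_le)
        fix y y'
        show "cmod (a z y * cnj (b z y') * complex_of_real (k (sel z y) (sel z y'))) \<le> cmod (a z y) * cmod (b z y')"
        proof (cases "a z y = 0 \<or> b z y' = 0")
          case False
          then have "\<bar>k (sel z y) (sel z y')\<bar> \<le> 1" using sel_carrier[OF a] sel_carrier[OF b] by (intro k_bound) auto
          then show ?thesis by (simp add: norm_mult mult_left_le)
        qed auto
      qed
      also have "\<dots> = (\<Sum>y\<in>Y (mm n). cmod (a z y)) * (\<Sum>y'\<in>Y (mm n). cmod (b z y'))" by (simp add: sum_product)
      also have "\<dots> \<le> C" unfolding C_def
        by (intro mult_mono row na nb Ca Cb sum_nonneg) (use Ca(1) in simp_all)
      finally show "cmod (\<Sum>y\<in>Y (mm n). \<Sum>y'\<in>Y (mm n). a z y * cnj (b z y') * complex_of_real (k (sel z y) (sel z y'))) \<le> C" .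
    qed
    then show ?thesis using Y_card[of n] by (simp add: form_def norm_divide divide_le_eq mult.commute)
  qed
  then show ?thesis by blast
qed

lemma form_add: "form (a \<oplus>\<^bsub>Cu\<^esub> b) c n = form a c n + form b c n"
  by (simp add: form_def roe_simps distrib_right sum.distrib add_divide_distrib)

lemma form_scale: "form (e \<odot>\<^bsub>Cu\<^esub> a) c n = e * form a c n"
  by (simp add: form_def roe_simps sum_distrib_left mult.assoc)

lemma form_commute:
  assumes a: "a \<in> carrier Cu" and b: "b \<in> carrier Cu"
  shows "form b a n = cnj (form a b n)"
proof -
  have "b z y * cnj (a z y') * complex_of_real (k (sel z y) (sel z y')) =
      cnj (a z y' * cnj (b z y) * complex_of_real (k (sel z y') (sel z y)))" for z y y'
    using k_sym[of "sel z y" "sel z y'"] sel_carrier[OF a, of z y'] sel_carrier[OF b, of z y]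
    by (cases "a z y' = 0 \<or> b z y = 0") auto
  then have "form b a n = (\<Sum>z\<in>Y (mm n). \<Sum>y\<in>Y (mm n). \<Sum>y'\<in>Y (mm n).
     cnj (a z y' * cnj (b z y) * complex_of_real (k (sel z y') (sel z y)))) / card (Y (mm n))"
    by (simp only: form_def)
  also have "\<dots> = (\<Sum>z\<in>Y (mm n). \<Sum>y'\<in>Y (mm n). \<Sum>y\<in>Y (mm n).
     cnj (a z y' * cnj (b z y) * complex_of_real (k (sel z y') (sel z y)))) / card (Y (mm n))"
  proof -
    have "(\<Sum>y\<in>Y (mm n). \<Sum>y'\<in>Y (mm n). cnj (a z y' * cnj (b z y) * complex_of_real (k (sel z y') (sel z y)))) =
      (\<Sum>y'\<in>Y (mm n). \<Sum>y\<in>Y (mm n). cnj (a z y' * cnj (b z y) * complex_of_real (k (sel z y') (sel z y))))" for z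
      by (rule sum.swap)
    then show ?thesis by (simp only:)
  qed
  finally show ?thesis by (simp add: form_def)
qed

lemma form_nonneg: assumes a: "a \<in> carrier Cu" shows "0 \<le> Re (form a a n)"
proof -
  have "0 \<le> Re (\<Sum>y\<in>Y (mm n). \<Sum>y'\<in>Y (mm n). a z y * cnj (a z y') * complex_of_real (k (sel z y) (sel z y')))" for z
  proof -
    let ?F = "{y \<in> Y (mm n). a z y \<noteq> 0}"
    have "psd ?F (\<lambda>y y'. k (sel z y) (sel z y'))"
      using Y_finite sel_carrier[OF a] by (intro k_psd) auto
    from psd_complex[OF this, of "a z"]
    have "0 \<le> Re (\<Sum>y\<in>?F. \<Sum>y'\<in>?F. a z y * cnj (a z y') * complex_of_real (k (sel z y) (sel z y')))" .
    also have "(\<Sum>y\<in>?F. \<Sum>y'\<in>?F. a z y * cnj (a z y') * complex_of_real (k (sel z y) (sel z y'))) =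
      (\<Sum>y\<in>?F. \<Sum>y'\<in>Y (mm n). a z y * cnj (a z y') * complex_of_real (k (sel z y) (sel z y')))"
      using Y_finite by (intro sum.cong[OF refl] sum.mono_neutral_left) auto
    also have "\<dots> = (\<Sum>y\<in>Y (mm n). \<Sum>y'\<in>Y (mm n). a z y * cnj (a z y') * complex_of_real (k (sel z y) (sel z y')))"
      using Y_finite by (intro sum.mono_neutral_left) auto
    finally show ?thesis .
  qed
  then have "0 \<le> (\<Sum>z\<in>Y (mm n). Re (\<Sum>y\<in>Y (mm n). \<Sum>y'\<in>Y (mm n). a z y * cnj (a z y') * complex_of_real (k (sel z y) (sel z y'))))"
    by (rule sum_nonneg)
  then show ?thesis by (simp add: form_def)
qed

text \<open>Translating both arguments by \<open>sel x z\<close> leaves \<open>k\<close> unchanged.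
  The translated elements act at \<open>y\<close> and \<open>y'\<close> as those selected for the
  base point \<open>x\<close> do, and \<open>coherent\<close> exchanges them one argument at a
  time.\<close>

lemma kernel_block:
  assumes n: "r \<le> n" and z: "x \<in> X" "z \<in> X" "y \<in> Y (mm n)" "y' \<in> Y (mm n)"
    and d: "d x z \<le> ennreal (Suc r)" "d x y \<le> ennreal (Suc r)" "d z y \<le> ennreal (Suc r)"
      "d x y' \<le> ennreal (Suc r)" "d z y' \<le> ennreal (Suc r)"
  shows "k (sel z y) (sel z y') = k (sel x y) (sel x y')"
proof -
  have X: "y \<in> X" "y' \<in> X" using z by (auto simp: Y_def)
  let ?l = "sel x z"
  have D: "?l \<in> D r" "sel z y \<in> D r" "sel z y' \<in> D r" "sel x y \<in> D r" "sel x y' \<in> D r"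
    using sel(1) z X d by blast+
  then have G: "?l \<in> carrier G" "sel z y \<in> carrier G" "sel z y' \<in> carrier G" "sel x y \<in> carrier G" "sel x y' \<in> carrier G"
    using D_carrier by blast+
  have act: "\<phi> (?l \<otimes> sel z y) y = \<phi> (sel x y) y" "\<phi> (?l \<otimes> sel z y') y' = \<phi> (sel x y') y'"
    using act_mult G X sel(2)[OF z(1,2) d(1)] sel(2)[OF z(2) X(1) d(3)] sel(2)[OF z(1) X(1) d(2)]
      sel(2)[OF z(2) X(2) d(5)] sel(2)[OF z(1) X(2) d(4)] by metis+
  have A: "?l \<otimes> sel z y \<in> A r" "?l \<otimes> sel z y' \<in> A r" "sel x y \<in> A r" "sel x y' \<in> A r"
    using D by (auto simp: A_def)
  have "k (sel z y) (sel z y') = k (?l \<otimes> sel z y) (?l \<otimes> sel z y')" using G by (simp add: k_inv)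
  also have "\<dots> = k (sel x y) (?l \<otimes> sel z y')"
    by (rule coherent[OF A(1,3) n z(3) act(1)]) (use G in simp)
  also have "\<dots> = k (?l \<otimes> sel z y') (sel x y)" using G by (simp add: k_sym)
  also have "\<dots> = k (sel x y') (sel x y)" by (rule coherent[OF A(2,4) n z(4) act(2) G(4)])
  finally show ?thesis using G by (simp add: k_sym)
qed

text \<open>After expansion both sides run over the same quadruples of points and differ only in the
  base point of the kernel, \<open>z\<close> on the left and \<open>x\<close> on the right. The
  equality holds for large \<open>n\<close>, once coherence covers the radii of the three
  matrices.\<close>

lemma form_adjoint:
  assumes c: "c \<in> carrier Cu" and a: "a \<in> carrier Cu" and b: "b \<in> carrier Cu"
  shows "\<forall>\<^sub>F n in sequentially. form (adjoint_matrix c \<otimes>\<^bsub>Cu\<^esub> a) b n = form a (c \<otimes>\<^bsub>Cu\<^esub> b) n"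
proof -
  obtain rc where rc: "\<And>x y. c x y \<noteq> 0 \<Longrightarrow> x \<in> X \<and> y \<in> X \<and> d x y \<le> ennreal (Suc rc)" using roe_radius[OF c] by blast
  obtain ra where ra: "\<And>x y. a x y \<noteq> 0 \<Longrightarrow> x \<in> X \<and> y \<in> X \<and> d x y \<le> ennreal (Suc ra)" using roe_radius[OF a] by blast
  obtain rb where rb: "\<And>x y. b x y \<noteq> 0 \<Longrightarrow> x \<in> X \<and> y \<in> X \<and> d x y \<le> ennreal (Suc rb)" using roe_radius[OF b] by blast
  \<comment> \<open>Steps of radius i + 1 and j + 1 combine to i + j + 2, which is
    \<open>Suc (i + j + 1)\<close>; hence the extra 1.\<close>
  define r where "r = rc + ra + rb + 1"
  have mono: "t \<le> ennreal (Suc r)" if "t \<le> ennreal (Suc q)" "q \<le> r" for t q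
    using that by (meson ennreal_leI of_nat_le_iff Suc_le_mono order_trans)
  have mono2: "d p w \<le> ennreal (Suc r)"
    if "d p q \<le> ennreal (Suc i)" "d q w \<le> ennreal (Suc j)" "i + j + 1 \<le> r" "p \<in> X" "q \<in> X" "w \<in> X" for p q w i j
  proof -
    have "d p w \<le> ennreal (Suc i) + ennreal (Suc j)"
      using dist_triangle[OF that(4,5,6)] that(1,2) by (meson add_mono order_trans)
    also have "\<dots> = ennreal (Suc (i + j + 1))" by (simp flip: ennreal_plus)
    finally show ?thesis by (rule mono) (use that in simp)
  qed
  have "form (adjoint_matrix c \<otimes>\<^bsub>Cu\<^esub> a) b n = form a (c \<otimes>\<^bsub>Cu\<^esub> b) n" if n: "r \<le> n" for n
  proof -
    let ?Y = "Y (mm n)"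
    have l: "(adjoint_matrix c \<otimes>\<^bsub>Cu\<^esub> a) z y = (\<Sum>x\<in>?Y. cnj (c x z) * a x y)" if z: "z \<in> ?Y" for z y
    proof -
      have "(adjoint_matrix c \<otimes>\<^bsub>Cu\<^esub> a) z y = (\<Sum>x\<in>?Y. adjoint_matrix c z x * a x y)"
        by (rule mult_eq_sum[OF Y_finite _ adjoint_in_roe[OF c]]) (use roe_Y[OF c] z in \<open>auto simp: adjoint_matrix_def\<close>)
      then show ?thesis by (simp add: adjoint_matrix_def)
    qed
    have rr: "(c \<otimes>\<^bsub>Cu\<^esub> b) x y = (\<Sum>z\<in>?Y. c x z * b z y)" if x: "x \<in> ?Y" for x y
      by (rule mult_eq_sum[OF Y_finite _ c]) (use roe_Y[OF c] x in auto)
    have key: "cnj (c x z) * a x y * cnj (b z y') * complex_of_real (k (sel z y) (sel z y')) =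
       a x y * cnj (c x z * b z y') * complex_of_real (k (sel x y) (sel x y'))"
      if Y: "x \<in> ?Y" "z \<in> ?Y" "y \<in> ?Y" "y' \<in> ?Y" for x y z y'
    proof (cases "c x z = 0 \<or> a x y = 0 \<or> b z y' = 0")
      case False
      then have nz: "c x z \<noteq> 0" "a x y \<noteq> 0" "b z y' \<noteq> 0" by auto
      note X = rc[OF nz(1)] ra[OF nz(2)] rb[OF nz(3)]
      have zx: "d z x \<le> ennreal (Suc rc)" using X(1) dist_commute[of x z] by simp
      have "k (sel z y) (sel z y') = k (sel x y) (sel x y')"
      proof (rule kernel_block[OF n _ _ Y(3,4)])
        show "x \<in> X" "z \<in> X" using X by auto
        show "d x z \<le> ennreal (Suc r)" using mono[of "d x z" rc] X by (simp add: r_def)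
        show "d x y \<le> ennreal (Suc r)" using mono[of "d x y" ra] X by (simp add: r_def)
        show "d z y' \<le> ennreal (Suc r)" using mono[of "d z y'" rb] X by (simp add: r_def)
        show "d z y \<le> ennreal (Suc r)" using mono2[of z x rc y ra] zx X by (simp add: r_def)
        show "d x y' \<le> ennreal (Suc r)" using mono2[of x z rc y' rb] X by (simp add: r_def)
      qed
      then show ?thesis by simp
    qed auto
    have "(\<Sum>z\<in>?Y. \<Sum>y\<in>?Y. \<Sum>y'\<in>?Y. (adjoint_matrix c \<otimes>\<^bsub>Cu\<^esub> a) z y * cnj (b z y') * complex_of_real (k (sel z y) (sel z y')))
      = (\<Sum>z\<in>?Y. \<Sum>y\<in>?Y. \<Sum>y'\<in>?Y. \<Sum>x\<in>?Y. cnj (c x z) * a x y * cnj (b z y') * complex_of_real (k (sel z y) (sel z y')))"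
      by (intro sum.cong refl) (simp only: l sum_distrib_right)
    also have "\<dots> = (\<Sum>z\<in>?Y. \<Sum>y\<in>?Y. \<Sum>y'\<in>?Y. \<Sum>x\<in>?Y. a x y * cnj (c x z * b z y') * complex_of_real (k (sel x y) (sel x y')))"
      by (intro sum.cong refl) (rule key)
    also have "\<dots> = (\<Sum>x\<in>?Y. \<Sum>y\<in>?Y. \<Sum>y'\<in>?Y. \<Sum>z\<in>?Y. a x y * cnj (c x z * b z y') * complex_of_real (k (sel x y) (sel x y')))"
    proof -
      have "(\<Sum>z\<in>?Y. \<Sum>y\<in>?Y. \<Sum>y'\<in>?Y. \<Sum>x\<in>?Y. f x z y y') = (\<Sum>x\<in>?Y. \<Sum>y\<in>?Y. \<Sum>y'\<in>?Y. \<Sum>z\<in>?Y. f x z y y')"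
        for f :: "'a \<Rightarrow> 'a \<Rightarrow> 'a \<Rightarrow> 'a \<Rightarrow> complex"
      proof -
        have s1: "(\<Sum>y'\<in>?Y. \<Sum>x\<in>?Y. f x z y y') = (\<Sum>x\<in>?Y. \<Sum>y'\<in>?Y. f x z y y')" for z y by (rule sum.swap)
        have s2: "(\<Sum>y\<in>?Y. \<Sum>x\<in>?Y. \<Sum>y'\<in>?Y. f x z y y') = (\<Sum>x\<in>?Y. \<Sum>y\<in>?Y. \<Sum>y'\<in>?Y. f x z y y')" for z by (rule sum.swap)
        have s3: "(\<Sum>z\<in>?Y. \<Sum>y\<in>?Y. \<Sum>y'\<in>?Y. f x z y y') = (\<Sum>y\<in>?Y. \<Sum>z\<in>?Y. \<Sum>y'\<in>?Y. f x z y y')" for x by (rule sum.swap)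
        have s4: "(\<Sum>z\<in>?Y. \<Sum>y'\<in>?Y. f x z y y') = (\<Sum>y'\<in>?Y. \<Sum>z\<in>?Y. f x z y y')" for x y by (rule sum.swap)
        have "(\<Sum>z\<in>?Y. \<Sum>y\<in>?Y. \<Sum>y'\<in>?Y. \<Sum>x\<in>?Y. f x z y y') = (\<Sum>z\<in>?Y. \<Sum>x\<in>?Y. \<Sum>y\<in>?Y. \<Sum>y'\<in>?Y. f x z y y')"
          by (simp only: s1 s2)
        also have "\<dots> = (\<Sum>x\<in>?Y. \<Sum>z\<in>?Y. \<Sum>y\<in>?Y. \<Sum>y'\<in>?Y. f x z y y')" by (rule sum.swap)
        also have "\<dots> = (\<Sum>x\<in>?Y. \<Sum>y\<in>?Y. \<Sum>y'\<in>?Y. \<Sum>z\<in>?Y. f x z y y')"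
          by (simp only: s3 s4)
        finally show ?thesis .
      qed
      then show ?thesis .
    qed
    also have "\<dots> = (\<Sum>x\<in>?Y. \<Sum>y\<in>?Y. \<Sum>y'\<in>?Y. a x y * cnj ((c \<otimes>\<^bsub>Cu\<^esub> b) x y') * complex_of_real (k (sel x y) (sel x y')))"
      by (intro sum.cong refl) (simp only: rr cnj_sum sum_distrib_left sum_distrib_right)
    finally show ?thesis unfolding form_def by (rule arg_cong)
  qed
  then show ?thesis by (auto simp: eventually_sequentially)
qed

text \<open>Row \<open>z\<close> of \<open>u g\<close> has a single entry, at
  \<open>\<phi> (inv g) z\<close>. The element selected for it acts there as \<open>g\<close> does,
  so coherence turns the kernel value into \<open>k g h\<close> for every \<open>z\<close>.\<close>

lemma form_u:
  assumes g: "g \<in> T0" and h: "h \<in> T0"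
  shows "\<forall>\<^sub>F n in sequentially. form (u g) (u h) n = complex_of_real (k g h)"
proof -
  have gh: "g \<in> carrier G" "h \<in> carrier G" using g h T0_carrier by auto
  obtain rg where rg: "\<And>x y. u g x y \<noteq> 0 \<Longrightarrow> x \<in> X \<and> y \<in> X \<and> d x y \<le> ennreal (Suc rg)" using roe_radius[OF u_in_roe[OF gh(1)]] by blast
  obtain rh where rh: "\<And>x y. u h x y \<noteq> 0 \<Longrightarrow> x \<in> X \<and> y \<in> X \<and> d x y \<le> ennreal (Suc rh)" using roe_radius[OF u_in_roe[OF gh(2)]] by blast
  define r where "r = max rg rh"
  have row: "u g z y = (if y = \<phi> (inv g) z then 1 else 0)" "\<phi> (inv g) z \<in> Y m"
    if "z \<in> Y m" "g \<in> carrier G" for g z y m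
    using that act_inv[of g z y] act_closed[of "inv g" z] blk_act[of "inv g" z] by (auto simp: Y_def u_def)
  have "form (u g) (u h) n = complex_of_real (k g h)" if n: "r \<le> n" for n
  proof -
    let ?Y = "Y (mm n)"
    have "(\<Sum>y\<in>?Y. \<Sum>y'\<in>?Y. u g z y * cnj (u h z y') * complex_of_real (k (sel z y) (sel z y'))) = complex_of_real (k g h)"
      if z: "z \<in> ?Y" for z
    proof -
      let ?y = "\<phi> (inv g) z" and ?y' = "\<phi> (inv h) z"
      have Yy: "?y \<in> ?Y" "?y' \<in> ?Y" using row(2)[OF z] gh by auto
      have X: "z \<in> X" "?y \<in> X" "?y' \<in> X" using z Yy by (auto simp: Y_def)
      have "u g z ?y \<noteq> 0" "u h z ?y' \<noteq> 0" using row(1)[OF z gh(1)] row(1)[OF z gh(2)] by simp_all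
      then have s: "sel z ?y \<in> D rg" "z = \<phi> (sel z ?y) ?y" "sel z ?y' \<in> D rh" "z = \<phi> (sel z ?y') ?y'"
        using rg rh sel X by blast+
      have A: "sel z ?y \<in> A r" "sel z ?y' \<in> A r" "g \<in> A r" "h \<in> A r"
        using s g h D_mono[of rg r] D_mono[of rh r] by (auto simp: A_def r_def)
      have act: "\<phi> (sel z ?y) ?y = \<phi> g ?y" "\<phi> (sel z ?y') ?y' = \<phi> h ?y'"
        using s act_inv[OF gh(1) X(1,2)] act_inv[OF gh(2) X(1,3)] by simp_all
      have sG: "sel z ?y \<in> carrier G" "sel z ?y' \<in> carrier G" using A A_carrier by blast+
      have "k (sel z ?y) (sel z ?y') = k g (sel z ?y')" by (rule coherent[OF A(1,3) n Yy(1) act(1) sG(2)])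
      also have "\<dots> = k (sel z ?y') g" by (rule k_sym[OF gh(1) sG(2)])
      also have "\<dots> = k h g" by (rule coherent[OF A(2,4) n Yy(2) act(2) gh(1)])
      finally have kk: "k (sel z ?y) (sel z ?y') = k g h" using k_sym[OF gh] by simp
      have "(\<Sum>y\<in>?Y. \<Sum>y'\<in>?Y. u g z y * cnj (u h z y') * complex_of_real (k (sel z y) (sel z y'))) =
        (\<Sum>y\<in>?Y. if y = ?y then (\<Sum>y'\<in>?Y. if y' = ?y' then complex_of_real (k (sel z y) (sel z y')) else 0) else 0)"
        unfolding row(1)[OF z gh(1)] row(1)[OF z gh(2)] by (intro sum.cong refl) (auto intro!: sum.cong)
      also have "\<dots> = complex_of_real (k (sel z ?y) (sel z ?y'))" using Yy Y_finite by simp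
      finally show ?thesis by (simp only: kk)
    qed
    then show ?thesis using Y_card[of n] by (simp add: form_def)
  qed
  then show ?thesis by (auto simp: eventually_sequentially)
qed

text \<open>The forms converge along a finer filter to a form on the algebra, for which the adjoint
  relation holds exactly. The representation is left multiplication, and the vector is the class of
  the unit.\<close>

lemma kernel_representation:
  "\<exists>(K :: ('a cmatrix \<Rightarrow> complex) inner_module) \<pi> \<xi>. star_representation X d K \<pi> \<and> \<xi> \<in> carrier K \<and>
     (\<forall>g\<in>T0. \<forall>h\<in>T0. cinner K (\<pi> (u g) \<xi>) (\<pi> (u h) \<xi>) = complex_of_real (k g h))"
proof -
  \<comment> \<open>The value 0 off the algebra makes the family bounded at every index, as the
    compactness argument requires.\<close>
  define F where "F p n = (if fst p \<in> carrier Cu \<and> snd p \<in> carrier Cu then form (fst p) (snd p) n else 0)" for p n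
  have "\<exists>C. \<forall>n. cmod (F p n) \<le> C" for p
    using form_bounded[of "fst p" "snd p"] by (cases "fst p \<in> carrier Cu \<and> snd p \<in> carrier Cu") (auto simp: F_def)
  then obtain C where C: "\<And>p n. norm (F p n) \<le> C p" by metis
  obtain U' where U': "U' \<noteq> bot" "U' \<le> U" "\<And>p. \<exists>l. (F p \<longlongrightarrow> l) U'"
    using bounded_family_limits[of U F C] U(1) C by blast
  define B where "B a b = Lim U' (F (a, b))" for a b
  have lim: "(form a b \<longlongrightarrow> B a b) U'" if "a \<in> carrier Cu" "b \<in> carrier Cu" for a b
  proof -
    obtain l where l: "(F (a, b) \<longlongrightarrow> l) U'" using U'(3) by blast
    then have "B a b = l" unfolding B_def using U'(1) by (intro tendsto_Lim) simp_all
    moreover have "F (a, b) = form a b" using that by (simp add: F_def fun_eq_iff)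
    ultimately show ?thesis using l by simp
  qed
  have ev: "B a b = B a' b'" if "a \<in> carrier Cu" "b \<in> carrier Cu" "a' \<in> carrier Cu" "b' \<in> carrier Cu"
    "\<forall>\<^sub>F n in sequentially. form a b n = form a' b' n" for a b a' b'
  proof (rule tendsto_unique[OF U'(1)])
    show "(form a' b' \<longlongrightarrow> B a' b') U'" by (rule lim[OF that(3,4)])
    have "\<forall>\<^sub>F n in U'. form a b n = form a' b' n"
      \<comment> \<open>The finer filter refines \<open>sequentially\<close>, so identities that
        hold for large \<open>n\<close> pass to the limit form.\<close>
      using that(5) U'(2) U(2) by (meson filter_leD order_trans)
    then show "(form a' b' \<longlongrightarrow> B a b) U'" using lim[OF that(1,2)] by (simp add: tendsto_cong)
  qed
  have B_add: "B (a \<oplus>\<^bsub>Cu\<^esub> b) c = B a c + B b c" if "a \<in> carrier Cu" "b \<in> carrier Cu" "c \<in> carrier Cu" for a b c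
  proof (rule tendsto_unique[OF U'(1) lim[OF add_in_roe[OF that(1,2)] that(3)]])
    have "form (a \<oplus>\<^bsub>Cu\<^esub> b) c = (\<lambda>n. form a c n + form b c n)" by (simp add: fun_eq_iff form_add)
    then show "(form (a \<oplus>\<^bsub>Cu\<^esub> b) c \<longlongrightarrow> B a c + B b c) U'"
      using tendsto_add[OF lim[OF that(1,3)] lim[OF that(2,3)]] by simp
  qed
  have B_scale: "B (e \<odot>\<^bsub>Cu\<^esub> a) c = e * B a c" if "a \<in> carrier Cu" "c \<in> carrier Cu" for a c e
  proof (rule tendsto_unique[OF U'(1) lim[OF smult_in_roe[OF that(1)] that(2)]])
    have "form (e \<odot>\<^bsub>Cu\<^esub> a) c = (\<lambda>n. e * form a c n)" by (simp add: fun_eq_iff form_scale)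
    then show "(form (e \<odot>\<^bsub>Cu\<^esub> a) c \<longlongrightarrow> e * B a c) U'" using tendsto_mult_left[OF lim[OF that]] by simp
  qed
  have B_commute: "B b a = cnj (B a b)" if "a \<in> carrier Cu" "b \<in> carrier Cu" for a b
  proof (rule tendsto_unique[OF U'(1) lim[OF that(2,1)]])
    have "form b a = (\<lambda>n. cnj (form a b n))" by (simp add: fun_eq_iff form_commute[OF that])
    then show "(form b a \<longlongrightarrow> cnj (B a b)) U'" using tendsto_cnj[OF lim[OF that]] by simp
  qed
  have B_nonneg: "0 \<le> Re (B a a)" if "a \<in> carrier Cu" for a
    by (rule tendsto_lowerbound[OF tendsto_Re[OF lim[OF that that]]]) (use form_nonneg[OF that] U'(1) in auto)
  define V :: "'a cmatrix inner_module" where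
    "V = \<lparr>carrier = carrier Cu, mult = mult Cu, one = one Cu, zero = zero Cu, add = add Cu, smult = smult Cu, cinner = B\<rparr>"
  have V: "carrier V = carrier Cu" "add V = add Cu" "smult V = smult Cu" "cinner V = B"
    by (simp_all add: V_def)
  interpret V: semi_inner_product V
    by unfold_locales (use one_in_roe in \<open>auto simp: V add_in_roe smult_in_roe B_add B_scale B_nonneg intro: B_commute\<close>)
  have dist1: "(a \<oplus>\<^bsub>Cu\<^esub> b) \<otimes>\<^bsub>Cu\<^esub> v = (a \<otimes>\<^bsub>Cu\<^esub> v) \<oplus>\<^bsub>Cu\<^esub> (b \<otimes>\<^bsub>Cu\<^esub> v)"
    if ab: "a \<in> carrier Cu" "b \<in> carrier Cu" for a b v
  proof (intro ext)
    fix x z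
    let ?F = "{y. a x y \<noteq> 0} \<union> {y. b x y \<noteq> 0}"
    have F: "finite ?F" using finite_row ab by blast
    have "((a \<oplus>\<^bsub>Cu\<^esub> b) \<otimes>\<^bsub>Cu\<^esub> v) x z = (\<Sum>y\<in>?F. (a \<oplus>\<^bsub>Cu\<^esub> b) x y * v y z)"
      by (rule mult_eq_sum[OF F _ add_in_roe[OF ab]]) (auto simp: roe_simps)
    moreover have "(a \<otimes>\<^bsub>Cu\<^esub> v) x z = (\<Sum>y\<in>?F. a x y * v y z)" by (rule mult_eq_sum[OF F _ ab(1)]) auto
    moreover have "(b \<otimes>\<^bsub>Cu\<^esub> v) x z = (\<Sum>y\<in>?F. b x y * v y z)" by (rule mult_eq_sum[OF F _ ab(2)]) auto
    ultimately show "((a \<oplus>\<^bsub>Cu\<^esub> b) \<otimes>\<^bsub>Cu\<^esub> v) x z = ((a \<otimes>\<^bsub>Cu\<^esub> v) \<oplus>\<^bsub>Cu\<^esub> (b \<otimes>\<^bsub>Cu\<^esub> v)) x z"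
      by (simp add: roe_simps distrib_right sum.distrib)
  qed
  have dist2: "(e \<odot>\<^bsub>Cu\<^esub> a) \<otimes>\<^bsub>Cu\<^esub> v = e \<odot>\<^bsub>Cu\<^esub> (a \<otimes>\<^bsub>Cu\<^esub> v)" if a: "a \<in> carrier Cu" for a v e
  proof (intro ext)
    fix x z
    have "((e \<odot>\<^bsub>Cu\<^esub> a) \<otimes>\<^bsub>Cu\<^esub> v) x z = (\<Sum>y | a x y \<noteq> 0. (e \<odot>\<^bsub>Cu\<^esub> a) x y * v y z)"
      by (rule mult_eq_sum[OF finite_row[OF a] _ smult_in_roe[OF a]]) (auto simp: roe_simps)
    then show "((e \<odot>\<^bsub>Cu\<^esub> a) \<otimes>\<^bsub>Cu\<^esub> v) x z = (e \<odot>\<^bsub>Cu\<^esub> (a \<otimes>\<^bsub>Cu\<^esub> v)) x z"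
      by (simp add: roe_simps sum_distrib_left mult.assoc)
  qed
  have assoc: "(a \<otimes>\<^bsub>Cu\<^esub> b) \<otimes>\<^bsub>Cu\<^esub> v = a \<otimes>\<^bsub>Cu\<^esub> (b \<otimes>\<^bsub>Cu\<^esub> v)"
    if ab: "a \<in> carrier Cu" "b \<in> carrier Cu" for a b v
  proof (intro ext)
    fix x z
    let ?F = "{y. a x y \<noteq> 0}" and ?E = "\<Union>y\<in>{y. a x y \<noteq> 0}. {w. b y w \<noteq> 0}"
    have F: "finite ?F" "finite ?E" using finite_row ab by blast+
    have ab_eq: "(a \<otimes>\<^bsub>Cu\<^esub> b) x w = (\<Sum>y\<in>?F. a x y * b y w)" for w by (simp add: roe_simps)
    have "((a \<otimes>\<^bsub>Cu\<^esub> b) \<otimes>\<^bsub>Cu\<^esub> v) x z = (\<Sum>w\<in>?E. (a \<otimes>\<^bsub>Cu\<^esub> b) x w * v w z)"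
    proof (rule mult_eq_sum[OF F(2) _ mult_in_roe[OF ab]])
      fix w assume "(a \<otimes>\<^bsub>Cu\<^esub> b) x w \<noteq> 0"
      from sum.not_neutral_contains_not_neutral[OF this[unfolded ab_eq]] show "w \<in> ?E" by auto
    qed
    also have "\<dots> = (\<Sum>y\<in>?F. a x y * (\<Sum>w\<in>?E. b y w * v w z))"
      unfolding ab_eq sum_distrib_right sum_distrib_left by (subst sum.swap) (simp add: mult.assoc)
    also have "\<dots> = (\<Sum>y\<in>?F. a x y * (b \<otimes>\<^bsub>Cu\<^esub> v) y z)"
      by (intro sum.cong refl arg_cong2[where f = "(*)"] mult_eq_sum[OF F(2) _ ab(2), symmetric]) auto
    also have "\<dots> = (a \<otimes>\<^bsub>Cu\<^esub> (b \<otimes>\<^bsub>Cu\<^esub> v)) x z" by (simp add: roe_simps(1))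
    finally show "((a \<otimes>\<^bsub>Cu\<^esub> b) \<otimes>\<^bsub>Cu\<^esub> v) x z = (a \<otimes>\<^bsub>Cu\<^esub> (b \<otimes>\<^bsub>Cu\<^esub> v)) x z" .
  qed
  have one1: "\<one>\<^bsub>Cu\<^esub> \<otimes>\<^bsub>Cu\<^esub> v = v" if "v \<in> carrier Cu" for v
  proof (intro ext)
    fix x z
    have "v x z = 0" if "x \<notin> X" using roe_entry_in[OF \<open>v \<in> carrier Cu\<close>] that by blast
    then show "(\<one>\<^bsub>Cu\<^esub> \<otimes>\<^bsub>Cu\<^esub> v) x z = v x z"
      using mult_u[OF one_closed, of v] one_in_roe by (simp add: u_one act_one)
  qed
  have one2: "u g \<otimes>\<^bsub>Cu\<^esub> \<one>\<^bsub>Cu\<^esub> = u g" if "g \<in> carrier G" for g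
    using u_mult[OF that one_closed u_in_roe[OF that]] that by (simp add: u_one)
  interpret P: pre_representation X d V "\<lambda>a v. a \<otimes>\<^bsub>Cu\<^esub> v"
  proof (intro pre_representation.intro pre_representation_axioms.intro ulf_metric_space_axioms V.semi_inner_product_axioms)
    fix a v w assume "a \<in> carrier Cu" "v \<in> carrier V" "w \<in> carrier V"
    then show "cinner V (adjoint_matrix a \<otimes>\<^bsub>Cu\<^esub> v) w = cinner V v (a \<otimes>\<^bsub>Cu\<^esub> w)"
      unfolding V by (intro ev mult_in_roe adjoint_in_roe form_adjoint)
  qed (simp_all add: V mult_in_roe dist1 dist2 assoc one1 B_add B_scale)
  let ?\<pi> = "\<lambda>a. V.lift ((\<otimes>\<^bsub>Cu\<^esub>) (adjoint_matrix a))"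
  have "?\<pi> (u g) (V.embed \<one>\<^bsub>Cu\<^esub>) = V.embed (u g)" if g: "g \<in> carrier G" for g
    using V.lift_embed[OF P.adjoint_pair_T[OF u_in_roe[OF g]], of "\<one>\<^bsub>Cu\<^esub>"] one_in_roe by (simp add: V one2[OF g])
  moreover have "cinner V.completion (V.embed (u g)) (V.embed (u h)) = complex_of_real (k g h)"
    if g: "g \<in> T0" and h: "h \<in> T0" for g h
  proof -
    have gh: "u g \<in> carrier Cu" "u h \<in> carrier Cu" using g h T0_carrier u_in_roe by blast+
    have "B (u g) (u h) = complex_of_real (k g h)"
    proof (rule tendsto_unique[OF U'(1) lim[OF gh]])
      have "\<forall>\<^sub>F n in U'. form (u g) (u h) n = complex_of_real (k g h)"
        using form_u[OF g h] U'(2) U(2) by (meson filter_leD order_trans)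
      then show "(form (u g) (u h) \<longlongrightarrow> complex_of_real (k g h)) U'" by (simp add: tendsto_eventually)
    qed
    then show ?thesis using gh by (simp add: V.cinner_embed V)
  qed
  moreover have "V.embed \<one>\<^bsub>Cu\<^esub> \<in> carrier V.completion"
    unfolding V.completion_simps(1) by (rule V.embed_in_completion) (simp add: V one_in_roe)
  ultimately show ?thesis
    using P.star_representation_completion T0_carrier
    by (intro exI[of _ V.completion] exI[of _ ?\<pi>] exI[of _ "V.embed \<one>\<^bsub>Cu\<^esub>"]) (simp add: subset_iff)
qed

end

section \<open>Localisation of a cocycle to sets of blocks\<close>

locale block_action_rep = block_action X d G \<phi> S blk + roe_action_rep X d G \<phi> S H \<pi>
  for X :: "'a set" and d and G :: "('g, 'm) monoid_scheme" (structure) and \<phi> S and blk :: "'a \<Rightarrow> 'i"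
    and H :: "'h inner_module" and \<pi>
begin

definition ind :: "'i set \<Rightarrow> 'a cmatrix" where
  "ind J = diagonal (\<lambda>x. if x \<in> X \<and> blk x \<in> J then 1 else 0)"

abbreviation P where "P J \<equiv> \<pi> (ind J)"

lemma ind_in_roe: "ind J \<in> carrier Cu"
  unfolding ind_def by (rule diagonal_in_roe[of _ 1]) auto

lemma ind_mult: "ind J \<otimes>\<^bsub>Cu\<^esub> a = (\<lambda>x y. (if x \<in> X \<and> blk x \<in> J then 1 else 0) * a x y)"
  using diagonal_mult[OF ind_in_roe[unfolded ind_def]] by (simp add: ind_def)

lemma P_closed: "w \<in> carrier H \<Longrightarrow> P J w \<in> carrier H"
  by (rule pi_simps(1)[OF ind_in_roe])

lemma P_linear: "clinear_map H H (P J)"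
  by (rule pi_linear[OF ind_in_roe])

text \<open>Blocks are invariant under the group, so the indicator matrices commute with its
  permutation matrices. Hence the projections carry cocycles to cocycles.\<close>

lemma P_commute: assumes g: "g \<in> carrier G" and w: "w \<in> carrier H" shows "P J (\<sigma> g w) = \<sigma> g (P J w)"
proof -
  have "ind J \<otimes>\<^bsub>Cu\<^esub> u g = u g \<otimes>\<^bsub>Cu\<^esub> ind J"
  proof (intro ext)
    fix x z
    show "(ind J \<otimes>\<^bsub>Cu\<^esub> u g) x z = (u g \<otimes>\<^bsub>Cu\<^esub> ind J) x z"
      using act_inv[OF g, of x z] act_closed[OF inv_closed[OF g], of x] blk_act[OF inv_closed[OF g], of x]
      by (auto simp: ind_mult mult_u[OF g u_in_roe[OF g]]) (auto simp: ind_def diagonal_def u_def)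
  qed
  then show ?thesis
    using pi_simps(3)[OF ind_in_roe w u_in_roe[OF g], of J] pi_simps(3)[OF u_in_roe[OF g] w ind_in_roe, of J] by simp
qed

lemma P_split: "w \<in> carrier H \<Longrightarrow> P J w = P (J \<inter> Q) w \<oplus>\<^bsub>H\<^esub> P (J - Q) w"
proof -
  assume w: "w \<in> carrier H"
  have "ind J = ind (J \<inter> Q) \<oplus>\<^bsub>Cu\<^esub> ind (J - Q)"
    by (auto simp: ind_def diagonal_def roe_simps fun_eq_iff)
  then show ?thesis using pi_simps(2)[OF ind_in_roe w ind_in_roe, of "J \<inter> Q" "J - Q"] by simp
qed

lemma P_UNIV: "w \<in> carrier H \<Longrightarrow> P UNIV w = w"
  using pi_simps(5)[OF one_in_roe] by (simp add: ind_def roe_simps)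

lemma P_empty: assumes w: "w \<in> carrier H" and e: "\<And>m. m \<in> J \<Longrightarrow> Y m = {}" shows "P J w = \<zero>\<^bsub>H\<^esub>"
proof -
  have "ind J = 0 \<odot>\<^bsub>Cu\<^esub> ind J" using e by (auto simp: ind_def diagonal_def roe_simps Y_def fun_eq_iff)
  then have "P J w = 0 \<odot>\<^bsub>H\<^esub> P J w" using pi_simps(4)[OF ind_in_roe w, of 0 J] by simp
  then show ?thesis using P_closed[OF w] by (simp add: H.smult_zero)
qed

lemma P_cocycle:
  assumes b: "group_cocycle G H \<sigma> b" shows "group_cocycle G H \<sigma> (\<lambda>g. P J (b g))"
  unfolding group_cocycle_def
proof (intro conjI ballI)
  fix g h assume gh: "g \<in> carrier G" "h \<in> carrier G"
  note c = U.cocycle_closed[OF b]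
  show "P J (b (g \<otimes> h)) = P J (b g) \<oplus>\<^bsub>H\<^esub> \<sigma> g (P J (b h))"
    using gh c U.cocycle_mult[OF b gh] clinear_mapD(2)[OF P_linear, of "b g" "\<sigma> g (b h)" J] P_commute[OF gh(1), of "b h" J]
    by (simp add: U.rep_simps(1))
qed (use U.cocycle_closed[OF b] P_closed in blast)

end

locale harmonic_block_cocycle = block_action_rep X d G \<phi> S blk H \<pi>
  for X :: "'a set" and d and G :: "('g, 'm) monoid_scheme" (structure) and \<phi> S and blk :: "'a \<Rightarrow> 'i"
    and H :: "'h inner_module" and \<pi> +
  fixes b :: "'g \<Rightarrow> 'h"
  assumes b: "group_cocycle G H \<sigma> b"
    and harmonic: "lincomb H b (laplacian_list G S) = \<zero>\<^bsub>H\<^esub>"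
    and agree: "\<lbrakk>g \<in> carrier G; h \<in> carrier G; \<And>x. x \<in> X \<Longrightarrow> blk x \<in> J \<Longrightarrow> \<phi> g x = \<phi> h x\<rbrakk> \<Longrightarrow> P J (b g) = P J (b h)"
begin

lemma b_closed: "g \<in> carrier G \<Longrightarrow> b g \<in> carrier H"
  by (rule U.cocycle_closed[OF b])

text \<open>The energy that the cocycle carries on the blocks in \<open>J\<close>. It may be zero on
  every single block although it is positive on the whole, which is why sets of blocks are
  followed.\<close>

definition mu :: "'i set \<Rightarrow> real" where
  "mu J = (\<Sum>s\<leftarrow>S. (hnorm H (P J (b s)))\<^sup>2)"

lemma mu_nonneg: "0 \<le> mu J"
  unfolding mu_def by (rule sum_list_nonneg) auto

lemma mu_zero: "mu J = 0 \<longleftrightarrow> (\<forall>s\<in>set S. P J (b s) = \<zero>\<^bsub>H\<^esub>)"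
proof
  assume 0: "mu J = 0"
  show "\<forall>s\<in>set S. P J (b s) = \<zero>\<^bsub>H\<^esub>"
  proof
    fix s assume s: "s \<in> set S"
    have "(hnorm H (P J (b s)))\<^sup>2 \<le> mu J" unfolding mu_def using s by (intro member_le_sum_list) auto
    then have "hnorm H (P J (b s)) = 0" using 0 by simp
    then show "P J (b s) = \<zero>\<^bsub>H\<^esub>" using P_closed[OF b_closed[OF U.in_gens[OF s]]] by (simp add: H.hnorm_eq_0)
  qed
next
  assume "\<forall>s\<in>set S. P J (b s) = \<zero>\<^bsub>H\<^esub>"
  then have "mu J = (\<Sum>s\<leftarrow>S. 0)"
    unfolding mu_def by (intro arg_cong[where f = sum_list] map_cong refl) (simp add: H.hnorm_zero)
  then show "mu J = 0" by simp
qed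

lemma mu_split:
  assumes "0 < mu J" shows "0 < mu (J \<inter> Q) \<or> 0 < mu (J - Q)"
proof (rule ccontr)
  assume "\<not> ?thesis"
  then have "mu (J \<inter> Q) = 0" "mu (J - Q) = 0" using mu_nonneg[of "J \<inter> Q"] mu_nonneg[of "J - Q"] by auto
  then have z: "P (J \<inter> Q) (b s) = \<zero>\<^bsub>H\<^esub>" "P (J - Q) (b s) = \<zero>\<^bsub>H\<^esub>" if "s \<in> set S" for s
    using that unfolding mu_zero by blast+
  have "P J (b s) = \<zero>\<^bsub>H\<^esub>" if s: "s \<in> set S" for s
    unfolding P_split[OF b_closed[OF U.in_gens[OF s]], of J Q] z[OF s] by simp
  then have "mu J = 0" unfolding mu_zero by blast
  then show False using assms by simp
qed

text \<open>Each set \<open>Q\<close> cuts the current set of blocks in two, and at least one of the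
  pieces keeps positive energy.\<close>

lemma decide:
  assumes "finite \<Q>" "0 < mu J"
  shows "\<exists>J'\<subseteq>J. 0 < mu J' \<and> (\<forall>Q\<in>\<Q>. J' \<subseteq> Q \<or> J' \<inter> Q = {})"
  using assms
proof (induction \<Q> rule: finite_induct)
  case empty
  then show ?case by blast
next
  case (insert Q \<Q>)
  then obtain J' where J': "J' \<subseteq> J" "0 < mu J'" "\<And>Q. Q \<in> \<Q> \<Longrightarrow> J' \<subseteq> Q \<or> J' \<inter> Q = {}" by blast
  from mu_split[OF J'(2), of Q] show ?case
  proof
    assume "0 < mu (J' \<inter> Q)"
    then show ?thesis using J' by (intro exI[of _ "J' \<inter> Q"]) blast
  next
    assume "0 < mu (J' - Q)"
    then show ?thesis using J' by (intro exI[of _ "J' - Q"]) blast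
  qed
qed

text \<open>Each member records the blocks on which two given elements of \<open>A n\<close> act
  alike; there are finitely many, so \<open>decide\<close> applies.\<close>

definition agreement :: "nat \<Rightarrow> 'i set set" where
  "agreement n = (\<lambda>(g, h). {m. \<forall>x\<in>Y m. \<phi> g x = \<phi> h x}) ` (A n \<times> A n)"

lemma block_sequence:
  assumes pos: "0 < mu UNIV"
  obtains J where "\<And>n. 0 < mu (J n)" "\<And>n. J (Suc n) \<subseteq> J n"
    "\<And>n Q. Q \<in> agreement n \<Longrightarrow> J n \<subseteq> Q \<or> J n \<inter> Q = {}"
proof -
  have fin: "finite (agreement n)" for n using finite_A by (simp add: agreement_def)
  have "\<exists>J. \<forall>n. (0 < mu (J n) \<and> (\<forall>Q\<in>agreement n. J n \<subseteq> Q \<or> J n \<inter> Q = {})) \<and> J (Suc n) \<subseteq> J n"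
  proof (rule dependent_nat_choice)
    show "\<exists>J. 0 < mu J \<and> (\<forall>Q\<in>agreement 0. J \<subseteq> Q \<or> J \<inter> Q = {})"
      using decide[OF fin pos] by blast
    fix J n assume "0 < mu J \<and> (\<forall>Q\<in>agreement n. J \<subseteq> Q \<or> J \<inter> Q = {})"
    then show "\<exists>J'. (0 < mu J' \<and> (\<forall>Q\<in>agreement (Suc n). J' \<subseteq> Q \<or> J' \<inter> Q = {})) \<and> J' \<subseteq> J"
      using decide[OF fin, of J "Suc n"] by blast
  qed
  then show thesis using that by blast
qed

text \<open>If \<open>b\<close> were nonzero, the kernels of the cocycles \<open>P (J n) (b g)\<close>, normalised by \<open>mu\<close>, would accumulate at
  a harmonic kernel on the group with \<open>(\<Sum>s\<leftarrow>S. N s \<one>) = 1\<close>. The conditions on \<open>J\<close> turn the limit into a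
  representation of the algebra of the space, where the spectral gap is available.\<close>

lemma harmonic_cocycle_zero:
  assumes \<nu>: "0 < \<nu>"
    and gap: "\<And>(K :: ('a cmatrix \<Rightarrow> complex) inner_module) \<rho>. star_representation X d K \<rho> \<Longrightarrow>
       unitary_rep.gap G K (\<lambda>g. \<rho> (u g)) S \<nu>"
  shows "\<forall>s\<in>set S. b s = \<zero>\<^bsub>H\<^esub>"
proof (rule ccontr)
  assume "\<not> ?thesis"
  then have "mu UNIV \<noteq> 0" unfolding mu_zero using P_UNIV[OF b_closed[OF U.in_gens]] by auto
  then have "0 < mu UNIV" using mu_nonneg[of UNIV] by simp
  then obtain J where J: "\<And>n. 0 < mu (J n)" "\<And>n. J (Suc n) \<subseteq> J n"
    "\<And>n Q. Q \<in> agreement n \<Longrightarrow> J n \<subseteq> Q \<or> J n \<inter> Q = {}"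
    using block_sequence by blast
  have J_mono: "J n \<subseteq> J m" if "m \<le> n" for m n using lift_Suc_antimono_le[of J, OF J(2) that] .
  \<comment> \<open>A set of empty blocks carries no energy, so a nonempty block can be picked as a
    place for the form.\<close>
  have "\<exists>m. m \<in> J n \<and> Y m \<noteq> {}" for n
  proof (rule ccontr)
    assume "\<not> ?thesis"
    then have "P (J n) (b s) = \<zero>\<^bsub>H\<^esub>" if "s \<in> set S" for s
      using that by (intro P_empty b_closed U.in_gens) auto
    then have "mu (J n) = 0" unfolding mu_zero by blast
    then show False using J(1)[of n] by simp
  qed
  then obtain mm where mm: "\<And>n. mm n \<in> J n" "\<And>n. Y (mm n) \<noteq> {}" by metis
  \<comment> \<open>The energies \<open>mu (J n)\<close> may tend to 0; dividing by them keeps the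
    limit kernel nonzero on the generators.\<close>
  define N' where "N' n g h = (hnorm H (P (J n) (b g) \<ominus>\<^bsub>H\<^esub> P (J n) (b h)))\<^sup>2 / mu (J n)" for n g h
  have coc: "group_cocycle G H \<sigma> (\<lambda>g. P (J n) (b g))" for n by (rule P_cocycle[OF b])
  note Pb = P_closed[OF b_closed]
  \<comment> \<open>At a fixed element the localised cocycle is bounded by a constant times its
    values on the generators, whose squares add up to \<open>mu (J n)\<close>. So the normalised
    kernels are bounded in n at each pair.\<close>
  have bound: "\<exists>C. \<forall>n. \<bar>N' n g h\<bar> \<le> C" if gh: "g \<in> carrier G" "h \<in> carrier G" for g h
  proof -
    have "{g, h} \<subseteq> generate G (set S)" using gh generate by simp
    then obtain M where M: "M \<ge> 0" "\<And>(K :: 'h inner_module) \<sigma> b x. unitary_rep G K \<sigma> S \<Longrightarrow> group_cocycle G K \<sigma> b \<Longrightarrow> x \<in> {g, h} \<Longrightarrow>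
       hnorm K (b x) \<le> M * (\<Sum>s\<leftarrow>S. hnorm K (b s))"
      using group_cocycle_bound_finite[of "{g, h}" G S] by blast
    have "\<bar>N' n g h\<bar> \<le> (2 * M)\<^sup>2 * length S" for n
    proof -
      let ?p = "\<Sum>s\<leftarrow>S. hnorm H (P (J n) (b s))"
      have "hnorm H (P (J n) (b g) \<ominus>\<^bsub>H\<^esub> P (J n) (b h)) \<le> hnorm H (P (J n) (b g)) + hnorm H (P (J n) (b h))"
        using H.hnorm_triangle[OF Pb[OF gh(1)] H.M.a_inv_closed[OF Pb[OF gh(2)]], of "J n" "J n"] Pb gh
        by (simp add: a_minus_def H.hnorm_minus)
      also have "\<dots> \<le> M * ?p + M * ?p"
        using M(2)[OF U.unitary_rep_axioms coc] by (intro add_mono) auto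
      finally have "hnorm H (P (J n) (b g) \<ominus>\<^bsub>H\<^esub> P (J n) (b h)) \<le> 2 * M * ?p" by simp
      then have "(hnorm H (P (J n) (b g) \<ominus>\<^bsub>H\<^esub> P (J n) (b h)))\<^sup>2 \<le> (2 * M * ?p)\<^sup>2"
        using Pb gh by (intro power_mono) simp_all
      also have "\<dots> = (2 * M)\<^sup>2 * ?p\<^sup>2" by (rule power_mult_distrib)
      also have "\<dots> \<le> (2 * M)\<^sup>2 * (length S * mu (J n))"
        unfolding mu_def by (intro mult_left_mono sum_list_square_le) simp
      finally show ?thesis using J(1)[of n] by (simp add: N'_def divide_le_eq mult.assoc)
    qed
    then show ?thesis by blast
  qed
  \<comment> \<open>Again 0 off the group, so that every index of the family is bounded.\<close>
  define F where "F p n = (if fst p \<in> carrier G \<and> snd p \<in> carrier G then N' n (fst p) (snd p) else 0)" for p n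
  have "\<exists>C. \<forall>n. norm (F p n) \<le> C" for p
    using bound[of "fst p" "snd p"] by (cases "fst p \<in> carrier G \<and> snd p \<in> carrier G") (auto simp: F_def)
  then obtain C where C: "\<And>p n. norm (F p n) \<le> C p" by metis
  obtain U where U: "U \<noteq> bot" "U \<le> sequentially" "\<And>p. \<exists>l. (F p \<longlongrightarrow> l) U"
    using bounded_family_limits[of sequentially F C] C by (metis trivial_limit_sequentially)
  define N where "N g h = Lim U (F (g, h))" for g h
  have lim: "((\<lambda>n. N' n g h) \<longlongrightarrow> N g h) U" if "g \<in> carrier G" "h \<in> carrier G" for g h
  proof -
    obtain l where l: "(F (g, h) \<longlongrightarrow> l) U" using U(3) by blast
    then have "N g h = l" unfolding N_def using U(1) by (intro tendsto_Lim) simp_all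
    moreover have "F (g, h) = (\<lambda>n. N' n g h)" using that by (simp add: F_def fun_eq_iff)
    ultimately show ?thesis using l by simp
  qed
  have N_eqI: "N g h = l" if "g \<in> carrier G" "h \<in> carrier G" "((\<lambda>n. N' n g h) \<longlongrightarrow> l) U" for g h l
    using tendsto_unique[OF U(1) lim[OF that(1,2)] that(3)] .
  have N_nonneg: "0 \<le> N g h" if "g \<in> carrier G" "h \<in> carrier G" for g h
    by (rule tendsto_lowerbound[OF lim[OF that]]) (use U(1) J(1) in \<open>auto simp: N'_def less_imp_le\<close>)
  have N_self: "N g g = 0" if g: "g \<in> carrier G" for g
  proof (rule N_eqI[OF g g])
    have "N' n g g = 0" for n using Pb[OF g] by (simp add: N'_def H.diff_eq_zero[THEN iffD2] H.hnorm_zero)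
    then show "((\<lambda>n. N' n g g) \<longlongrightarrow> 0) U" by simp
  qed
  have N_inv: "N (l \<otimes> g) (l \<otimes> h) = N g h" if "l \<in> carrier G" "g \<in> carrier G" "h \<in> carrier G" for l g h
  proof (rule N_eqI)
    have "N' n (l \<otimes> g) (l \<otimes> h) = N' n g h" for n
      using U.cocycle_diff[OF coc that(2,3,1)] by (simp add: N'_def)
    then show "((\<lambda>n. N' n (l \<otimes> g) (l \<otimes> h)) \<longlongrightarrow> N g h) U" using lim[OF that(2,3)] by simp
  qed (use that in auto)
  have N_sym: "N g h = N h g" if "g \<in> carrier G" "h \<in> carrier G" for g h
  proof (rule N_eqI[OF that])
    have "N' n g h = N' n h g" for n
      using H.hnorm_minus[of "P (J n) (b g) \<ominus>\<^bsub>H\<^esub> P (J n) (b h)"] Pb that by (simp add: N'_def H.minus_diff)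
    then show "((\<lambda>n. N' n g h) \<longlongrightarrow> N h g) U" using lim[OF that(2,1)] by simp
  qed
  have psd: "psd E (\<lambda>i j. exp (- t * N (g i) (g j)))"
    if "0 < t" "finite E" "\<And>i. i \<in> E \<Longrightarrow> g i \<in> carrier G" for t and E :: "'j set" and g
  proof (rule psd_tendsto[OF _ _ U(1)])
    show "psd E (\<lambda>i j. exp (- t * N' n (g i) (g j)))" for n
    proof -
      have "psd E (\<lambda>i j. exp (- (t / mu (J n)) * (hnorm H (P (J n) (b (g i)) \<ominus>\<^bsub>H\<^esub> P (J n) (b (g j))))\<^sup>2))"
        using that J(1)[of n] by (intro H.psd_gaussian Pb) (auto simp: less_imp_le)
      then show ?thesis by (simp add: N'_def)
    qed
    show "((\<lambda>n. exp (- t * N' n (g i) (g j))) \<longlongrightarrow> exp (- t * N (g i) (g j))) U" if "i \<in> E" "j \<in> E" for i j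
      using that \<open>\<And>i. i \<in> E \<Longrightarrow> g i \<in> carrier G\<close> by (intro tendsto_exp tendsto_mult_left lim) auto
  qed
  \<comment> \<open>Agreement at one point of the block \<open>mm n\<close> spreads over that block
    by \<open>regular\<close>. This block lies in \<open>J n\<close>, and \<open>J n\<close> does
    not split the agreement set, so the two elements act alike on all of \<open>J n\<close> and of
    the later sets. From \<open>n\<close> on the localised cocycles therefore take equal values at
    both.\<close>
  have coherent: "N g h = N g' h"
    if g: "g \<in> A r" "g' \<in> A r" and n: "r \<le> n" and x: "x \<in> Y (mm n)" "\<phi> g x = \<phi> g' x" and h: "h \<in> carrier G"
    for g g' r n x h
  proof -
    have gG: "g \<in> carrier G" "g' \<in> carrier G" using g A_carrier by blast+
    let ?Q = "{m. \<forall>x\<in>Y m. \<phi> g x = \<phi> g' x}"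
    have "?Q \<in> agreement n" using g A_mono[OF n] unfolding agreement_def by force
    moreover have "mm n \<in> ?Q"
    proof (intro CollectI ballI)
      fix y assume "y \<in> Y (mm n)"
      then show "\<phi> g y = \<phi> g' y" using regular[OF gG _ _ _ x(2)] x(1) by (auto simp: Y_def)
    qed
    ultimately have JQ: "J n \<subseteq> ?Q" using J(3) mm(1)[of n] by blast
    have eq: "N' n' g h = N' n' g' h" if "n \<le> n'" for n'
    proof -
      have "P (J n') (b g) = P (J n') (b g')"
        using JQ J_mono[OF that] by (intro agree gG) (auto simp: Y_def)
      then show ?thesis by (simp add: N'_def)
    qed
    show ?thesis
    proof (rule N_eqI[OF gG(1) h])
      have "\<forall>\<^sub>F n' in sequentially. N' n' g h = N' n' g' h" using eq by (auto simp: eventually_sequentially)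
      then have "\<forall>\<^sub>F n' in U. N' n' g h = N' n' g' h" using U(2) by (rule filter_leD[rotated])
      then show "((\<lambda>n. N' n g h) \<longlongrightarrow> N g' h) U" using lim[OF gG(2) h] by (simp add: tendsto_cong)
    qed
  qed
  have "(\<Sum>s\<leftarrow>S. N s \<one>) \<le> 0"
  proof (rule harmonic_kernel_zero[OF \<nu>])
    fix g assume "g \<in> {\<one>} \<union> set S \<union> m_inv G ` set S"
    then show "N g g = 0" using N_self T0_carrier unfolding T0_def by blast
  next
    fix t :: real assume t: "0 < t"
    interpret k: block_kernel X d G \<phi> S blk "\<lambda>g h. exp (- t * N g h)" mm U
    proof
      fix g h assume gh: "g \<in> carrier G" "h \<in> carrier G"
      show "\<bar>exp (- t * N g h)\<bar> \<le> 1" using N_nonneg[OF gh] t by simp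
      show "exp (- t * N g h) = exp (- t * N h g)" using N_sym[OF gh] by simp
    next
      fix l g h assume "l \<in> carrier G" "g \<in> carrier G" "h \<in> carrier G"
      then show "exp (- t * N (l \<otimes> g) (l \<otimes> h)) = exp (- t * N g h)" by (simp add: N_inv)
    next
      fix E :: "'a set" and g assume "finite E" "\<And>i. i \<in> E \<Longrightarrow> g i \<in> carrier G"
      then show "psd E (\<lambda>i j. exp (- t * N (g i) (g j)))" by (intro psd t)
    next
      fix g r g' n x h assume "g \<in> A r" "g' \<in> A r" "r \<le> n" "x \<in> Y (mm n)" "\<phi> g x = \<phi> g' x" "h \<in> carrier G"
      then have "N g h = N g' h" by (rule coherent)
      then show "exp (- t * N g h) = exp (- t * N g' h)" by (rule arg_cong)
    next
      show "Y (mm n) \<noteq> {}" for n by (rule mm(2))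
      show "U \<noteq> bot" by (rule U(1))
      show "U \<le> sequentially" by (rule U(2))
    qed
    \<comment> \<open>The limit kernel is realised in a representation of the algebra, to which the
      gap hypothesis applies.\<close>
    obtain K :: "('a cmatrix \<Rightarrow> complex) inner_module" and \<rho> \<xi> where K: "star_representation X d K \<rho>" "\<xi> \<in> carrier K"
      "\<forall>g\<in>T0. \<forall>h\<in>T0. cinner K (\<rho> (u g) \<xi>) (\<rho> (u h) \<xi>) = complex_of_real (exp (- t * N g h))"
      using k.kernel_representation by blast
    interpret R: roe_action_rep X d G \<phi> S K \<rho> by unfold_locales (rule K(1))
    show "\<exists>(K :: ('a cmatrix \<Rightarrow> complex) inner_module) \<sigma> \<xi>. unitary_rep G K \<sigma> S \<and> unitary_rep.gap G K \<sigma> S \<nu> \<and>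
       \<xi> \<in> carrier K \<and> (\<forall>g\<in>{\<one>} \<union> set S \<union> m_inv G ` set S. \<forall>h\<in>{\<one>} \<union> set S \<union> m_inv G ` set S.
         cinner K (\<sigma> g \<xi>) (\<sigma> h \<xi>) = complex_of_real (exp (- t * N g h)))"
      using R.U.unitary_rep_axioms gap[OF K(1)] K(2,3) unfolding T0_def by blast
  next
    let ?l = "laplacian_list G S"
    \<comment> \<open>Harmonicity survives localisation because \<open>P (J n)\<close> is
      linear.\<close>
    have lin: "lincomb H (\<lambda>g. P (J n) (b g)) ?l = \<zero>\<^bsub>H\<^esub>" for n
    proof -
      have P0: "P (J n) \<zero>\<^bsub>H\<^esub> = \<zero>\<^bsub>H\<^esub>"
        using clinear_mapD(3)[OF P_linear, of "\<zero>\<^bsub>H\<^esub>" "J n" 0] P_closed[of "\<zero>\<^bsub>H\<^esub>" "J n"] by (simp add: H.smult_zero)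
      have "lincomb H (\<lambda>g. P (J n) (b g)) l = P (J n) (lincomb H b l)" if "snd ` set l \<subseteq> carrier G" for l
        using that
      proof (induction l)
        case (Cons a l)
        have "lincomb H b l \<in> carrier H" using Cons.prems by (intro H.lincomb_closed b_closed) auto
        then show ?case using Cons b_closed
          by (auto simp: clinear_mapD[OF P_linear] H.scale_closed)
      qed (simp add: P0)
      from this[of ?l] show ?thesis using U.list_elements harmonic P0 by auto
    qed
    have "(\<Sum>x\<leftarrow>?l. \<Sum>y\<leftarrow>?l. Re (fst x) * Re (fst y) * N' n (snd x) (snd y)) = 0" for n
    proof -
      have "(\<Sum>x\<leftarrow>?l. \<Sum>y\<leftarrow>?l. Re (fst x) * Re (fst y) * (hnorm H (P (J n) (b (snd x)) \<ominus>\<^bsub>H\<^esub> P (J n) (b (snd y))))\<^sup>2) =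
          - 2 * (hnorm H (lincomb H (\<lambda>g. P (J n) (b g)) ?l))\<^sup>2"
        by (rule H.sum_squared_distances) (auto intro!: Pb U.list_elements laplacian_list_real laplacian_list_sum)
      then have "(\<Sum>x\<leftarrow>?l. \<Sum>y\<leftarrow>?l. Re (fst x) * Re (fst y) * (hnorm H (P (J n) (b (snd x)) \<ominus>\<^bsub>H\<^esub> P (J n) (b (snd y))))\<^sup>2) / mu (J n) = 0"
        by (simp add: lin H.hnorm_zero)
      moreover have "(\<Sum>x\<leftarrow>l. \<Sum>y\<leftarrow>l'. f x y) / c = (\<Sum>x\<leftarrow>l. \<Sum>y\<leftarrow>l'. f x y / c)"
        for f :: "complex \<times> 'g \<Rightarrow> complex \<times> 'g \<Rightarrow> real" and c l l'
      proof -
        have "(\<Sum>y\<leftarrow>l'. f x y) / c = (\<Sum>y\<leftarrow>l'. f x y / c)" for x by (induction l') (auto simp: add_divide_distrib)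
        then show ?thesis by (induction l) (auto simp: add_divide_distrib)
      qed
      ultimately show ?thesis by (simp add: N'_def)
    qed
    moreover have "((\<lambda>n. \<Sum>x\<leftarrow>l. \<Sum>y\<leftarrow>l'. Re (fst x) * Re (fst y) * N' n (snd x) (snd y)) \<longlongrightarrow>
        (\<Sum>x\<leftarrow>l. \<Sum>y\<leftarrow>l'. Re (fst x) * Re (fst y) * N (snd x) (snd y))) U"
      if l: "snd ` set l \<subseteq> carrier G" "snd ` set l' \<subseteq> carrier G" for l l' :: "(complex \<times> 'g) list"
    proof -
      have "((\<lambda>n. \<Sum>y\<leftarrow>l'. Re (fst x) * Re (fst y) * N' n (snd x) (snd y)) \<longlongrightarrow>
        (\<Sum>y\<leftarrow>l'. Re (fst x) * Re (fst y) * N (snd x) (snd y))) U" if "snd x \<in> carrier G" for x :: "complex \<times> 'g"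
        using l(2) that by (induction l') (auto intro!: tendsto_add tendsto_mult_left lim)
      then show ?thesis using l(1) by (induction l) (auto intro!: tendsto_add)
    qed
    from this[of ?l ?l] have "((\<lambda>n. \<Sum>x\<leftarrow>?l. \<Sum>y\<leftarrow>?l. Re (fst x) * Re (fst y) * N' n (snd x) (snd y)) \<longlongrightarrow>
        (\<Sum>x\<leftarrow>?l. \<Sum>y\<leftarrow>?l. Re (fst x) * Re (fst y) * N (snd x) (snd y))) U"
      using U.list_elements by blast
    ultimately have "((\<lambda>n. 0) \<longlongrightarrow> (\<Sum>x\<leftarrow>?l. \<Sum>y\<leftarrow>?l. Re (fst x) * Re (fst y) * N (snd x) (snd y))) U" by simp
    then show "(\<Sum>x\<leftarrow>?l. \<Sum>y\<leftarrow>?l. Re (fst x) * Re (fst y) * N (snd x) (snd y)) = 0"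
      by (rule tendsto_unique[OF U(1) _ tendsto_const])
  qed
  \<comment> \<open>The normalisation passes to the limit and contradicts the vanishing forced by
    the gap.\<close>
  moreover have "(\<Sum>s\<leftarrow>S. N s \<one>) = 1"
  proof (rule tendsto_unique[OF U(1)])
    have "((\<lambda>n. \<Sum>s\<leftarrow>l. N' n s \<one>) \<longlongrightarrow> (\<Sum>s\<leftarrow>l. N s \<one>)) U" if "set l \<subseteq> carrier G" for l
      using that by (induction l) (auto intro!: tendsto_add lim)
    then show "((\<lambda>n. \<Sum>s\<leftarrow>S. N' n s \<one>) \<longlongrightarrow> (\<Sum>s\<leftarrow>S. N s \<one>)) U" using gens by blast
    have "(\<Sum>s\<leftarrow>S. N' n s \<one>) = 1" for n
    proof -
      have "N' n s \<one> = (1 / mu (J n)) * (hnorm H (P (J n) (b s)))\<^sup>2" if "s \<in> set S" for s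
      proof -
        have "P (J n) (b s) \<ominus>\<^bsub>H\<^esub> \<zero>\<^bsub>H\<^esub> = P (J n) (b s)"
          using Pb[OF U.in_gens[OF that], of "J n"] H.smult_r_null[of "- 1"]
          by (simp add: a_minus_def H.minus_eq_smult)
        then show ?thesis using U.cocycle_one[OF coc, of n] by (simp add: N'_def)
      qed
      then have "(\<Sum>s\<leftarrow>S. N' n s \<one>) = (\<Sum>s\<leftarrow>S. (1 / mu (J n)) * (hnorm H (P (J n) (b s)))\<^sup>2)"
        by (intro arg_cong[where f = sum_list] map_cong refl)
      also have "\<dots> = (1 / mu (J n)) * mu (J n)" unfolding mu_def by (rule sum_list_const_mult)
      finally show ?thesis using J(1)[of n] by simp
    qed
    then show "((\<lambda>n. \<Sum>s\<leftarrow>S. N' n s \<one>) \<longlongrightarrow> 1) U" by simp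
  qed
  ultimately show False by simp
qed

end

text \<open>Same scheme as \<open>delorme\<close>, with the spectral gaps supplied by
  \<open>gap_of_constant_gap\<close> and the vanishing of the harmonic cocycle by
  \<open>harmonic_cocycle_zero\<close>.\<close>

lemma (in block_action) geometric_imp_cohomological:
  assumes T: "geometric_T X d"
  shows "cohomological_T X d"
  unfolding cohomological_T_def
proof (intro allI impI, elim conjE)
  fix H :: "(nat \<Rightarrow> 'a cmatrix) inner_module" and \<pi> \<theta>
  assume rep: "star_representation X d H \<pi>" and \<theta>: "cocycle X d H \<pi> \<theta>"
  interpret block_action_rep X d G \<phi> S blk H \<pi> by unfold_locales (rule rep)
  obtain \<nu> where \<nu>: "0 < \<nu>" "U.gap \<nu>"
  proof -
    obtain R c where Rc: "R > 0" "c > 0"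
      "\<And>(H :: (nat \<Rightarrow> 'a cmatrix) inner_module) \<pi>. star_representation X d H \<pi> \<Longrightarrow> constant_gap X d R c H \<pi>"
      using geometric_T_D[OF T] by metis
    show thesis using gap_of_constant_gap[OF Rc(1,2)] that Rc(3)[OF rep] rep by metis
  qed
  \<comment> \<open>The first gap, on \<open>H\<close>, yields a harmonic cocycle; this one serves
    the representations obtained by completing the algebra.\<close>
  obtain \<mu> where \<mu>: "0 < \<mu>" "\<And>(K :: ('a cmatrix \<Rightarrow> complex) inner_module) \<rho>. star_representation X d K \<rho> \<Longrightarrow>
       unitary_rep.gap G K (\<lambda>g. \<rho> (u g)) S \<mu>"
  proof -
    obtain R c where Rc: "R > 0" "c > 0"
      "\<And>(K :: ('a cmatrix \<Rightarrow> complex) inner_module) \<rho>. star_representation X d K \<rho> \<Longrightarrow> constant_gap X d R c K \<rho>"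
      using geometric_T_D[OF T] by metis
    show thesis using gap_of_constant_gap[OF Rc(1,2)] that Rc(3) by metis
  qed
  define b where "b g = \<theta> (delta g)" for g
  have coc: "group_cocycle G H \<sigma> b" unfolding b_def by (rule cocycle_of_roe_cocycle[OF \<theta>])
  obtain v where v: "v \<in> carrier H"
    and harm: "lincomb H (\<lambda>g. b g \<ominus>\<^bsub>H\<^esub> (\<sigma> g v \<ominus>\<^bsub>H\<^esub> v)) (laplacian_list G S) = \<zero>\<^bsub>H\<^esub>"
    using U.harmonic_representative[OF \<nu>(2,1) coc] by blast
  define b' where "b' g = b g \<ominus>\<^bsub>H\<^esub> (\<sigma> g v \<ominus>\<^bsub>H\<^esub> v)" for g
  have b': "group_cocycle G H \<sigma> b'"
    unfolding b'_def by (rule U.cocycle_minus[OF coc U.coboundary_cocycle[OF v]])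
  interpret harmonic_block_cocycle X d G \<phi> S blk H \<pi> b'
  proof
    show "group_cocycle G H \<sigma> b'" by (rule b')
    show "lincomb H b' (laplacian_list G S) = \<zero>\<^bsub>H\<^esub>" unfolding b'_def by (rule harm)
    fix g h J assume g: "g \<in> carrier G" and h: "h \<in> carrier G"
      and eq: "\<And>x. x \<in> X \<Longrightarrow> blk x \<in> J \<Longrightarrow> \<phi> g x = \<phi> h x"
    \<comment> \<open>Left multiplication by \<open>ind J\<close> keeps the rows in the blocks of
      \<open>J\<close>, and there \<open>u g\<close> and \<open>u h\<close> coincide.\<close>
    have "ind J \<otimes>\<^bsub>Cu\<^esub> delta g = ind J \<otimes>\<^bsub>Cu\<^esub> delta h"
    proof (intro ext)
      fix x z
      have "u g x z = u h x z" if "x \<in> X" "blk x \<in> J"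
        using that eq[of z] blk_act[OF g, of z] blk_act[OF h, of z] by (auto simp: u_def)
      then show "(ind J \<otimes>\<^bsub>Cu\<^esub> delta g) x z = (ind J \<otimes>\<^bsub>Cu\<^esub> delta h) x z"
        unfolding ind_mult by (simp add: delta_def roe_simps(4,5))
    qed
    moreover have "P J (b' g) = \<theta> (ind J \<otimes>\<^bsub>Cu\<^esub> delta g) \<ominus>\<^bsub>H\<^esub> \<pi> (ind J \<otimes>\<^bsub>Cu\<^esub> delta g) v" if g: "g \<in> carrier G" for g
    proof -
      have "b' g = \<theta> (delta g) \<ominus>\<^bsub>H\<^esub> \<pi> (delta g) v" by (simp add: b'_def b_def pi_delta[OF g v])
      moreover have "\<theta> (delta g) \<in> carrier H" using U.cocycle_closed[OF coc g] by (simp add: b_def)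
      moreover have "\<theta> (ind J \<otimes>\<^bsub>Cu\<^esub> delta g) = P J (\<theta> (delta g))"
        using \<theta> ind_in_roe delta_ker[OF g] by (simp add: cocycle_def)
      ultimately show ?thesis
        using H.clinear_map_diff[OF P_linear, of "\<theta> (delta g)" "\<pi> (delta g) v" J] pi_simps(1)[OF delta_in_roe[OF g] v]
          pi_simps(3)[OF ind_in_roe v delta_in_roe[OF g]] by simp
    qed
    ultimately show "P J (b' g) = P J (b' h)" using g h by simp
  qed
  have "b' s = \<zero>\<^bsub>H\<^esub>" if "s \<in> set S" for s using harmonic_cocycle_zero[OF \<mu>] that by blast
  then have "(\<Sum>s\<leftarrow>S. hnorm H (b' s)) = (\<Sum>s\<leftarrow>S. 0)"
    by (intro arg_cong[where f = sum_list] map_cong refl) (simp add: H.hnorm_zero)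
  then have sum0: "(\<Sum>s\<leftarrow>S. hnorm H (b' s)) = 0" by simp
  have "\<theta> (delta g) = \<sigma> g v \<ominus>\<^bsub>H\<^esub> v" if g: "g \<in> carrier G" for g
  proof -
    obtain M where "hnorm H (b' g) \<le> M * (\<Sum>s\<leftarrow>S. hnorm H (b' s))"
      using group_cocycle_bound[of g G S] g generate U.unitary_rep_axioms b' by blast
    then have "hnorm H (b' g) = 0" using sum0 H.hnorm_nonneg[OF U.cocycle_closed[OF b' g]] by simp
    then have "b' g = \<zero>\<^bsub>H\<^esub>" using U.cocycle_closed[OF b' g] by (simp add: H.hnorm_eq_0)
    then show ?thesis
      using U.cocycle_closed[OF coc g] v g unfolding b'_def b_def by (simp add: H.diff_eq_zero U.rep_simps(1))
  qed
  then show "coboundary X d H \<pi> \<theta>" by (rule coboundary_of_group_coboundary[OF \<theta> v])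
qed

section \<open>Disjoint unions of finite Cayley graphs\<close>

lemma (in monoid) foldr_mult_closed: "set w \<subseteq> carrier G \<Longrightarrow> foldr (\<otimes>) w \<one> \<in> carrier G"
  by (induction w) auto

lemma (in monoid) foldr_mult_append:
  "\<lbrakk>set v \<subseteq> carrier G; set w \<subseteq> carrier G\<rbrakk> \<Longrightarrow> foldr (\<otimes>) (v @ w) \<one> = foldr (\<otimes>) v \<one> \<otimes> foldr (\<otimes>) w \<one>"
  using foldr_mult_closed by (induction v) (simp_all add: m_assoc)

lemma (in group) generate_imp_word:
  assumes "S \<subseteq> carrier G" "g \<in> generate G S"
  shows "\<exists>w. set w \<subseteq> S \<union> m_inv G ` S \<and> foldr (\<otimes>) w \<one> = g"
  using assms(2)
proof induction
  case one
  show ?case by (rule exI[of _ "[]"]) simp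
next
  case (incl h)
  then show ?case using assms(1) by (intro exI[of _ "[h]"]) auto
next
  case (inv h)
  then show ?case using assms(1) by (intro exI[of _ "[inv h]"]) auto
next
  case (eng g h)
  then obtain v w where vw: "set v \<subseteq> S \<union> m_inv G ` S" "foldr (\<otimes>) v \<one> = g"
    "set w \<subseteq> S \<union> m_inv G ` S" "foldr (\<otimes>) w \<one> = h" by blast
  have "S \<union> m_inv G ` S \<subseteq> carrier G" using assms(1) by auto
  then have "foldr (\<otimes>) (v @ w) \<one> = g \<otimes> h" using vw by (subst foldr_mult_append) auto
  then show ?case using vw by (intro exI[of _ "v @ w"]) simp
qed

lemma word_length_word:
  assumes "marked_group k G s" "g \<in> carrier G"
  obtains w where "length w = word_length G s g" "set w \<subseteq> set s \<union> m_inv G ` set s"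
    "foldr (\<otimes>\<^bsub>G\<^esub>) w \<one>\<^bsub>G\<^esub> = g"
proof -
  have "\<exists>n w. length w = n \<and> set w \<subseteq> set s \<union> m_inv G ` set s \<and> foldr (\<otimes>\<^bsub>G\<^esub>) w \<one>\<^bsub>G\<^esub> = g"
    using assms group.generate_imp_word[of G "set s" g] unfolding marked_group_def by auto
  from LeastI_ex[OF this] show ?thesis using that unfolding word_length_def by blast
qed

lemma word_length_le:
  "\<lbrakk>set w \<subseteq> set s \<union> m_inv G ` set s; foldr (\<otimes>\<^bsub>G\<^esub>) w \<one>\<^bsub>G\<^esub> = g\<rbrakk> \<Longrightarrow> word_length G s g \<le> length w"
  unfolding word_length_def by (rule Least_le) blast

lemma group_actionI:
  assumes G: "group G"
    and closed: "\<And>g x. \<lbrakk>g \<in> carrier G; x \<in> E\<rbrakk> \<Longrightarrow> \<phi> g x \<in> E"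
    and one: "\<And>x. x \<in> E \<Longrightarrow> \<phi> \<one>\<^bsub>G\<^esub> x = x"
    and mult: "\<And>g h x. \<lbrakk>g \<in> carrier G; h \<in> carrier G; x \<in> E\<rbrakk> \<Longrightarrow> \<phi> (g \<otimes>\<^bsub>G\<^esub> h) x = \<phi> g (\<phi> h x)"
    and ext: "\<And>g. g \<in> carrier G \<Longrightarrow> \<phi> g \<in> extensional E"
  shows "group_action G E \<phi>"
proof -
  interpret group G by fact
  have inv: "\<phi> (inv\<^bsub>G\<^esub> g) (\<phi> g x) = x" "\<phi> g (\<phi> (inv\<^bsub>G\<^esub> g) x) = x" if "g \<in> carrier G" "x \<in> E" for g x
    using that mult[of "inv\<^bsub>G\<^esub> g" g x] mult[of g "inv\<^bsub>G\<^esub> g" x] one by simp_all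
  have Bij: "\<phi> g \<in> Bij E" if "g \<in> carrier G" for g
    using that ext closed inv unfolding Bij_def
    by (auto intro!: bij_betw_byWitness[where f' = "\<phi> (inv\<^bsub>G\<^esub> g)"])
  show ?thesis
  proof (unfold group_action_def group_hom_def group_hom_axioms_def, intro conjI G group_BijGroup homI)
    show "\<phi> g \<in> carrier (BijGroup E)" if "g \<in> carrier G" for g using Bij[OF that] by (simp add: BijGroup_def)
    fix g h assume gh: "g \<in> carrier G" "h \<in> carrier G"
    have "\<phi> (g \<otimes>\<^bsub>G\<^esub> h) = compose E (\<phi> g) (\<phi> h)"
      using gh mult ext[of "g \<otimes>\<^bsub>G\<^esub> h"] by (intro extensionalityI[of _ E]) (auto simp: compose_def)
    then show "\<phi> (g \<otimes>\<^bsub>G\<^esub> h) = \<phi> g \<otimes>\<^bsub>BijGroup E\<^esub> \<phi> h" using Bij gh by (simp add: BijGroup_def)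
  qed
qed

text \<open>All components carry an action of the subgroup of the product group generated by the
  tuples of corresponding generators.\<close>

lemma (in ulf_metric_space) Cayley_union_block_action:
  fixes I :: "'i set" and G :: "'i \<Rightarrow> 'b monoid"
  assumes marked: "\<And>m. m \<in> I \<Longrightarrow> marked_group k (G m) (s m)"
    and fin: "\<And>m. m \<in> I \<Longrightarrow> finite (carrier (G m))"
    and union: "Cayley_union X d I G s"
  obtains \<Gamma> :: "('i \<Rightarrow> 'b) monoid" and \<phi> S and blk :: "'a \<Rightarrow> 'i" where "block_action X d \<Gamma> \<phi> S blk"
proof -
  obtain f where f: "bij_betw f X (SIGMA m:I. carrier (G m))"
    and iso: "\<And>x y. \<lbrakk>x \<in> X; y \<in> X\<rbrakk> \<Longrightarrow> d x y = Cayley_union_dist G s (f x) (f y)"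
    using union unfolding Cayley_union_def by blast
  have grp: "group (G m)" and len: "length (s m) = k" and sG: "set (s m) \<subseteq> carrier (G m)" if "m \<in> I" for m
    using marked[OF that] by (auto simp: marked_group_def)
  define P where "P = product_group I G"
  define S where "S = map (\<lambda>j. \<lambda>m\<in>I. s m ! j) [0..<k]"
  \<comment> \<open>The subgroup replaces the full product because the locale requires a group
    generated by the finitely many tuples.\<close>
  define \<Gamma> where "\<Gamma> = subgroup_generated P (set S)"
  define blk where "blk x = fst (f x)" for x
  define \<phi> where "\<phi> \<gamma> = (\<lambda>x\<in>X. inv_into X f (blk x, \<gamma> (blk x) \<otimes>\<^bsub>G (blk x)\<^esub> snd (f x)))" for \<gamma>
  interpret P: group P unfolding P_def using grp by simp
  have P: "\<gamma> m \<in> carrier (G m)" if "\<gamma> \<in> carrier P" "m \<in> I" for \<gamma> m using that by (auto simp: P_def)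
  have S: "set S \<subseteq> carrier P" using sG len by (fastforce simp: S_def P_def)
  have set_S: "(\<lambda>\<gamma>. \<gamma> m) ` set S = set (s m)" if "m \<in> I" for m
    using that len[OF that] by (auto simp: S_def image_image in_set_conv_nth)
  have \<Gamma>: "group \<Gamma>" "carrier \<Gamma> \<subseteq> carrier P" "set S \<subseteq> carrier \<Gamma>"
    using P.carrier_subgroup_generated_subset P.subgroup_generated_subset_carrier_subset[OF S]
    by (auto simp: \<Gamma>_def)
  have fX: "blk x \<in> I" "snd (f x) \<in> carrier (G (blk x))" if "x \<in> X" for x
    using bij_betwE[OF f] that by (auto simp: blk_def)
  have f_inj: "x = y" if "x \<in> X" "y \<in> X" "blk x = blk y" "snd (f x) = snd (f y)" for x y
    using that bij_betw_imp_inj_on[OF f] by (auto simp: inj_on_def blk_def prod_eq_iff)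
  have act: "\<phi> \<gamma> x \<in> X" "blk (\<phi> \<gamma> x) = blk x" "snd (f (\<phi> \<gamma> x)) = \<gamma> (blk x) \<otimes>\<^bsub>G (blk x)\<^esub> snd (f x)"
    if "\<gamma> \<in> carrier P" "x \<in> X" for \<gamma> x
  proof -
    interpret group "G (blk x)" by (rule grp[OF fX(1)[OF that(2)]])
    have "(blk x, \<gamma> (blk x) \<otimes>\<^bsub>G (blk x)\<^esub> snd (f x)) \<in> f ` X"
      using P[OF that(1)] fX[OF that(2)] f by (simp add: bij_betw_def)
    then show "\<phi> \<gamma> x \<in> X" "blk (\<phi> \<gamma> x) = blk x" "snd (f (\<phi> \<gamma> x)) = \<gamma> (blk x) \<otimes>\<^bsub>G (blk x)\<^esub> snd (f x)"
      using that(2) by (simp_all add: \<phi>_def inv_into_into f_inv_into_f blk_def[of "inv_into _ _ _"])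
  qed
  have action: "group_action \<Gamma> X \<phi>"
  proof (rule group_actionI[OF \<Gamma>(1)])
    show "\<phi> \<gamma> x \<in> X" if "\<gamma> \<in> carrier \<Gamma>" "x \<in> X" for \<gamma> x using that act(1) \<Gamma>(2) by blast
    show "\<phi> \<gamma> \<in> extensional X" for \<gamma> by (simp add: \<phi>_def)
    show "\<phi> \<one>\<^bsub>\<Gamma>\<^esub> x = x" if x: "x \<in> X" for x
    proof -
      interpret group "G (blk x)" by (rule grp[OF fX(1)[OF x]])
      show ?thesis
        using act[OF P.one_closed x] fX[OF x] x by (intro f_inj) (simp_all add: \<Gamma>_def P_def)
    qed
    show "\<phi> (\<gamma> \<otimes>\<^bsub>\<Gamma>\<^esub> \<delta>) x = \<phi> \<gamma> (\<phi> \<delta> x)" if "\<gamma> \<in> carrier \<Gamma>" "\<delta> \<in> carrier \<Gamma>" and x: "x \<in> X" for \<gamma> \<delta> x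
    proof -
      interpret group "G (blk x)" by (rule grp[OF fX(1)[OF x]])
      have \<gamma>\<delta>: "\<gamma> \<in> carrier P" "\<delta> \<in> carrier P" using that \<Gamma>(2) by blast+
      have "(\<gamma> \<otimes>\<^bsub>P\<^esub> \<delta>) (blk x) = \<gamma> (blk x) \<otimes>\<^bsub>G (blk x)\<^esub> \<delta> (blk x)" using fX(1)[OF x] by (simp add: P_def)
      then show ?thesis
        using act[OF P.m_closed[OF \<gamma>\<delta>] x] act[OF \<gamma>\<delta>(2) x] act[OF \<gamma>\<delta>(1) act(1)[OF \<gamma>\<delta>(2) x]]
          fX[OF x] P[OF \<gamma>\<delta>(1)] P[OF \<gamma>\<delta>(2)]
        by (intro f_inj) (simp_all add: \<Gamma>_def m_assoc)
    qed
  qed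
  let ?E = "{(x, \<phi> \<gamma> x) |x \<gamma>. x \<in> X \<and> \<gamma> \<in> set S}"
  have controlled: "controlled d ?E"
  proof -
    have "d x (\<phi> \<gamma> x) \<le> 1" if x: "x \<in> X" and \<gamma>: "\<gamma> \<in> set S" for x \<gamma>
    proof -
      interpret group "G (blk x)" by (rule grp[OF fX(1)[OF x]])
      have \<gamma>P: "\<gamma> \<in> carrier P" using \<gamma> S by blast
      note \<gamma>x = P[OF \<gamma>P fX(1)[OF x]] and a = act[OF \<gamma>P x]
      have "\<gamma> (blk x) \<in> set (s (blk x))" using set_S[OF fX(1)[OF x]] \<gamma> by blast
      \<comment> \<open>The distance is the word length of g h^-1, so a left translation by a
        generator moves every point by at most one step.\<close>
      moreover have "snd (f x) \<otimes>\<^bsub>G (blk x)\<^esub> inv\<^bsub>G (blk x)\<^esub> (\<gamma> (blk x) \<otimes>\<^bsub>G (blk x)\<^esub> snd (f x)) = inv\<^bsub>G (blk x)\<^esub> \<gamma> (blk x)"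
        using \<gamma>x fX(2)[OF x] by (simp add: inv_mult_group m_assoc[symmetric])
      ultimately have "word_length (G (blk x)) (s (blk x)) (snd (f x) \<otimes>\<^bsub>G (blk x)\<^esub> inv\<^bsub>G (blk x)\<^esub> snd (f (\<phi> \<gamma> x))) \<le> length [inv\<^bsub>G (blk x)\<^esub> \<gamma> (blk x)]"
        using \<gamma>x a(3) by (intro word_length_le) auto
      then have "word_length (G (blk x)) (s (blk x)) (snd (f x) \<otimes>\<^bsub>G (blk x)\<^esub> inv\<^bsub>G (blk x)\<^esub> snd (f (\<phi> \<gamma> x))) \<le> 1" by simp
      then show ?thesis
        using iso[OF x a(1)] a(2) by (auto simp: Cayley_union_dist_def blk_def split: prod.splits)
    qed
    then have "(SUP (x, y)\<in>?E. d x y) \<le> 1" by (intro SUP_least) auto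
    then show ?thesis unfolding controlled_def by (rule le_less_trans) simp
  qed
  \<comment> \<open>A word is followed letter by letter. A generator is a pair of \<open>?E\<close>
    read backwards, the inverse of a generator is one read forwards.\<close>
  have chain: "(x, y) \<in> (?E \<union> ?E\<inverse>) ^^ length w"
    if "x \<in> X" "y \<in> X" "blk x = blk y" "set w \<subseteq> set (s (blk y)) \<union> m_inv (G (blk y)) ` set (s (blk y))"
      "snd (f x) = foldr (\<otimes>\<^bsub>G (blk y)\<^esub>) w \<one>\<^bsub>G (blk y)\<^esub> \<otimes>\<^bsub>G (blk y)\<^esub> snd (f y)" for x y w
    using that
  proof (induction w arbitrary: x)
    case Nil
    interpret group "G (blk y)" by (rule grp[OF fX(1)[OF Nil(2)]])
    show ?case using Nil fX(2)[OF Nil(2)] f_inj[of x y] by simp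
  next
    case (Cons a w)
    interpret group "G (blk y)" by (rule grp[OF fX(1)[OF \<open>y \<in> X\<close>]])
    note y = fX[OF \<open>y \<in> X\<close>]
    have sy: "set (s (blk y)) \<subseteq> carrier (G (blk y))" by (rule sG[OF y(1)])
    let ?p = "foldr (\<otimes>\<^bsub>G (blk y)\<^esub>) w \<one>\<^bsub>G (blk y)\<^esub>"
    have p: "?p \<in> carrier (G (blk y))" using Cons.prems(4) sy by (intro foldr_mult_closed) auto
    have a: "a \<in> carrier (G (blk y))" using Cons.prems(4) sy by auto
    have fx: "snd (f x) = a \<otimes>\<^bsub>G (blk y)\<^esub> (?p \<otimes>\<^bsub>G (blk y)\<^esub> snd (f y))"
      using Cons.prems(5) a p y by (simp add: m_assoc)
    obtain z where z: "z \<in> X" "f z = (blk y, ?p \<otimes>\<^bsub>G (blk y)\<^esub> snd (f y))"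
      using bij_betw_imp_surj_on[OF f] p y by (metis (no_types, lifting) SigmaI imageE m_closed)
    have bz: "blk z = blk y" using z by (simp add: blk_def)
    have "(x, z) \<in> ?E \<union> ?E\<inverse>"
    proof (cases "a \<in> set (s (blk y))")
      case True
      then obtain \<gamma> where \<gamma>: "\<gamma> \<in> set S" "\<gamma> (blk y) = a"
        using True unfolding set_S[OF y(1), symmetric] by blast
      have a\<gamma>: "\<phi> \<gamma> z \<in> X" "blk (\<phi> \<gamma> z) = blk z" "snd (f (\<phi> \<gamma> z)) = \<gamma> (blk z) \<otimes>\<^bsub>G (blk z)\<^esub> snd (f z)"
        using act[OF subsetD[OF S \<gamma>(1)] z(1)] .
      have "x = \<phi> \<gamma> z"
        using a\<gamma> \<gamma>(2) z(2) bz fx Cons.prems(3) by (intro f_inj Cons.prems(1)) simp_all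
      then show ?thesis using \<gamma> z by blast
    next
      case False
      then obtain b where b: "b \<in> set (s (blk y))" "a = inv\<^bsub>G (blk y)\<^esub> b" using Cons.prems(4) by auto
      then obtain \<gamma> where \<gamma>: "\<gamma> \<in> set S" "\<gamma> (blk y) = b"
        unfolding set_S[OF y(1), symmetric] by blast
      have bG: "b \<in> carrier (G (blk y))" using b sy by blast
      have "b \<otimes>\<^bsub>G (blk y)\<^esub> snd (f x) = ?p \<otimes>\<^bsub>G (blk y)\<^esub> snd (f y)"
        unfolding fx b(2) using bG p y by (simp add: m_assoc[symmetric])
      then have "z = \<phi> \<gamma> x"
        using act[OF subsetD[OF S \<gamma>(1)] Cons.prems(1)] \<gamma>(2) z bz Cons.prems(3) by (intro f_inj z(1)) simp_all
      then show ?thesis using \<gamma> Cons.prems(1) by blast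
    qed
    moreover have "(z, y) \<in> (?E \<union> ?E\<inverse>) ^^ length w"
      using Cons.prems z bz by (intro Cons.IH) auto
    ultimately show ?case by (simp add: relpow_Suc_I2 del: relpow.simps)
  qed
  have generating: "generating X d ?E"
    unfolding generating_def
  proof (intro allI impI)
    fix R :: real assume R: "0 < R"
    show "\<exists>n. \<forall>x\<in>X. \<forall>y\<in>X. d x y \<le> ennreal R \<longrightarrow> (\<exists>i\<le>n. (x, y) \<in> (?E \<union> ?E\<inverse>) ^^ i)"
    proof (rule exI[of _ "nat \<lceil>R\<rceil>"], intro ballI impI)
      fix x y assume x: "x \<in> X" and y: "y \<in> X" and le: "d x y \<le> ennreal R"
      let ?m = "blk y" and ?g = "snd (f x) \<otimes>\<^bsub>G (blk y)\<^esub> inv\<^bsub>G (blk y)\<^esub> snd (f y)"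
      interpret group "G ?m" by (rule grp[OF fX(1)[OF y]])
      have "Cayley_union_dist G s (f x) (f y) \<le> ennreal R" using le iso[OF x y] by simp
      then have bxy: "blk x = ?m" and wl: "of_nat (word_length (G ?m) (s ?m) ?g) \<le> ennreal R"
        by (auto simp: Cayley_union_dist_def blk_def top_unique split: prod.splits if_splits)
      note cl = fX(2)[OF x, unfolded bxy] fX(2)[OF y]
      have g: "?g \<in> carrier (G ?m)" using cl by simp
      obtain w where w: "length w = word_length (G ?m) (s ?m) ?g"
        "set w \<subseteq> set (s ?m) \<union> m_inv (G ?m) ` set (s ?m)" "foldr (\<otimes>\<^bsub>G ?m\<^esub>) w \<one>\<^bsub>G ?m\<^esub> = ?g"
        using word_length_word[OF marked[OF fX(1)[OF y]] g] .
      have "ennreal (real (length w)) \<le> ennreal R" using wl w(1) by (simp add: ennreal_of_nat_eq_real_of_nat)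
      then have "length w \<le> nat \<lceil>R\<rceil>" using R by (simp add: le_nat_iff) linarith
      moreover have "(x, y) \<in> (?E \<union> ?E\<inverse>) ^^ length w"
        using w cl by (intro chain x y bxy) (simp_all add: m_assoc)
      ultimately show "\<exists>i\<le>nat \<lceil>R\<rceil>. (x, y) \<in> (?E \<union> ?E\<inverse>) ^^ i" by blast
    qed
  qed
  have "block_action X d \<Gamma> \<phi> S blk"
  proof (intro block_action.intro roe_action.intro roe_action_axioms.intro block_action_axioms.intro
      ulf_metric_space_axioms \<Gamma>(1) action \<Gamma>(3) controlled generating)
    show "generate \<Gamma> (set S) = carrier \<Gamma>"
      using P.generate_consistent[OF subsetI[OF generate.incl] P.generate_is_subgroup[OF S]] S
      by (simp add: \<Gamma>_def subgroup_generated_def Int_absorb1)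
    show "finite {x \<in> X. blk x = m}" for m
    proof (cases "m \<in> I")
      case True
      have "(\<lambda>x. snd (f x)) ` {x \<in> X. blk x = m} \<subseteq> carrier (G m)" using fX(2) by auto
      moreover have "inj_on (\<lambda>x. snd (f x)) {x \<in> X. blk x = m}"
        by (rule inj_onI) (simp add: f_inj)
      ultimately show ?thesis using finite_subset[OF _ fin[OF True]] finite_imageD by blast
    next
      case False
      then have "{x \<in> X. blk x = m} = {}" using fX by blast
      then show ?thesis by (metis finite.emptyI)
    qed
    fix \<gamma> x assume \<gamma>: "\<gamma> \<in> carrier \<Gamma>" and x: "x \<in> X"
    show "blk (\<phi> \<gamma> x) = blk x" using \<gamma> x act(2) \<Gamma>(2) by blast
    fix \<delta> y assume \<delta>: "\<delta> \<in> carrier \<Gamma>" and y: "y \<in> X" and xy: "blk x = blk y" and eq: "\<phi> \<gamma> x = \<phi> \<delta> x"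
    interpret group "G (blk y)" by (rule grp[OF fX(1)[OF y]])
    have P': "\<gamma> \<in> carrier P" "\<delta> \<in> carrier P" using \<gamma> \<delta> \<Gamma>(2) by blast+
    \<comment> \<open>The action on a component is left translation by one coordinate, so
      cancellation recovers that coordinate from a single point.\<close>
    have "\<gamma> (blk y) = \<delta> (blk y)"
      using act(3)[OF P'(1) x] act(3)[OF P'(2) x] eq xy fX[OF x] P[OF P'(1)] P[OF P'(2)] by simp
    then show "\<phi> \<gamma> y = \<phi> \<delta> y" by (simp add: \<phi>_def y)
  qed
  then show thesis by (rule that)
qed

text \<open>Nonemptiness excludes a degenerate case: over the empty space the algebra is zero, so
  \<open>geometric_T\<close> fails for want of a nonzero matrix, while
  \<open>cohomological_T\<close> holds.\<close>

theorem theorem6p7: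
  fixes X :: "'a set" and d :: "'a \<Rightarrow> 'a \<Rightarrow> ennreal"
  assumes "ulf_metric_space X d" and "X \<noteq> {}"
  shows
    "(cohomological_T X d \<longrightarrow> geometric_T X d) \<and>
     (\<forall>(G :: 'g monoid) S \<phi>.
        group G \<and> property_T G \<and> finite S \<and> S \<subseteq> carrier G \<and> generate G S = carrier G \<and>
        group_action G X \<phi> \<and>
        controlled d {(x, \<phi> g x) |x g. x \<in> X \<and> g \<in> S} \<and>
        generating X d {(x, \<phi> g x) |x g. x \<in> X \<and> g \<in> S} \<longrightarrow>
        cohomological_T X d) \<and>
     (\<forall>k (I :: 'i set) (G :: 'i \<Rightarrow> 'b monoid) s.
        (\<forall>m\<in>I. marked_group k (G m) (s m) \<and> finite (carrier (G m))) \<and>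
        Cayley_union X d I G s \<longrightarrow>
        (cohomological_T X d \<longleftrightarrow> geometric_T X d))"
proof -
  interpret ulf_metric_space X d by fact
  have 1: "cohomological_T X d \<Longrightarrow> geometric_T X d" by (rule cohomological_imp_geometric[OF assms(2)])
  have 2: "cohomological_T X d"
    if "group G" "property_T G" "finite S" "S \<subseteq> carrier G" "generate G S = carrier G" "group_action G X \<phi>"
      "controlled d {(x, \<phi> g x) |x g. x \<in> X \<and> g \<in> S}" "generating X d {(x, \<phi> g x) |x g. x \<in> X \<and> g \<in> S}"
    for G :: "'g monoid" and S \<phi>
  proof -
    obtain l where "set l = S" using finite_list[OF \<open>finite S\<close>] by blast
    then have "roe_action X d G \<phi> l"
      using that ulf_metric_space_axioms by (simp add: roe_action_def roe_action_axioms_def)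
    then show ?thesis by (rule roe_action.property_T_imp_cohomological) fact
  qed
  have 3: "cohomological_T X d"
    if "\<And>m. m \<in> I \<Longrightarrow> marked_group k (G m) (s m)" "\<And>m. m \<in> I \<Longrightarrow> finite (carrier (G m))"
      "Cayley_union X d I G s" "geometric_T X d" for k and I :: "'i set" and G :: "'i \<Rightarrow> 'b monoid" and s
    using Cayley_union_block_action[OF that(1-3)] block_action.geometric_imp_cohomological[OF _ that(4)] by metis
  show ?thesis
  proof (intro conjI allI impI)
    show "geometric_T X d" if "cohomological_T X d" using that by (rule 1)
  next
    fix G :: "'g monoid" and S \<phi>
    assume "group G \<and> property_T G \<and> finite S \<and> S \<subseteq> carrier G \<and> generate G S = carrier G \<and>
        group_action G X \<phi> \<and> controlled d {(x, \<phi> g x) |x g. x \<in> X \<and> g \<in> S} \<and>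
        generating X d {(x, \<phi> g x) |x g. x \<in> X \<and> g \<in> S}"
    then show "cohomological_T X d" by (elim conjE) (rule 2)
  next
    fix k and I :: "'i set" and G :: "'i \<Rightarrow> 'b monoid" and s
    assume "(\<forall>m\<in>I. marked_group k (G m) (s m) \<and> finite (carrier (G m))) \<and> Cayley_union X d I G s"
    then show "cohomological_T X d \<longleftrightarrow> geometric_T X d" using 1 3[of I k G s] by blast
  qed
qed

end
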